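(* Let $\tau\in\mathbb{H}$ and $\alpha,\beta,\gamma\in\mathbb{C}$, and put $c_1=2\alpha$, $c_2=2\gamma-2\alpha$, $c_3=-2\beta$, $c_4=2\beta-2\gamma$; assume $c_1,c_2,c_3,c_4\notin\mathbb{Z}$. Then the cohomology intersection matrix $C=(\langle[\phi_i],[\phi_j]\rangle_{\mathrm{ch}})_{i,j=1,\dots,4}$ (with $[\phi_i]\in H^1(M;\mathcal{L})$ and $[\phi_j]\in H^1(M;\mathcal{L}^\vee)$) is $$C=2\pi\sqrt{-1}\begin{pmatrix}0&\frac{1}{c_1+1}&0&0\\ \frac{1}{c_1-1}&C_{22}&0&0\\ 0&0&\frac{c_1+c_2}{c_1c_2}&\frac1{c_1}\\ 0&0&\frac1{c_1}&\frac{c_1+c_3}{c_1c_3}\end{pmatrix},$$ where $$C_{22}=\frac{1}{\pi^2\vartheta_3(0)^4(c_1-1)(c_1+1)}\Big(-c_1\frac{\vartheta_1'''(0)}{\vartheta_1'(0)}-c_2\frac{\vartheta_2''(0)}{\vartheta_2(0)}-c_3\frac{\vartheta_3''(0)}{\vartheta_3(0)}+(2c_1-c_4)\frac{\vartheta_4''(0)}{\vartheta_4(0)}\Big),$$ and moreover, writing $\alpha=a+\frac12$, $\beta=b-\frac12$, $\gamma=c$, $$C_{22}=\frac{(a-b+1)\lambda(\tau)+c}{2a(a+1)}.$$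
   Context: Theta functions: with $\mathbf{e}(x)=e^{2\pi\sqrt{-1}x}$ and fixed $\tau\in\mathbb{H}$ (upper half plane), $\vartheta_1(u)=-\sum_{m\in\mathbb{Z}}\mathbf{e}(\frac12(m+\frac12)^2\tau+(m+\frac12)(u+\frac12))$, $\vartheta_2(u)=\sum_{m}\mathbf{e}(\frac12(m+\frac12)^2\tau+(m+\frac12)u)$, $\vartheta_3(u)=\sum_m\mathbf{e}(\frac12m^2\tau+mu)$, $\vartheta_4(u)=\sum_m\mathbf{e}(\frac12m^2\tau+m(u+\frac12))$; primes denote derivatives in $u$. $\lambda(\tau)=\vartheta_2(0)^4/\vartheta_3(0)^4$. Space and local systems: $E=\mathbb{C}/(\mathbb{Z}+\mathbb{Z}\tau)$, $D=\{0,\frac12,\frac{1+\tau}2,\frac\tau2\}\subset E$, $M=E\setminus D$. $T(u)=\vartheta_1(u)^{2\alpha}\vartheta_2(u)^{2\gamma-2\alpha}\vartheta_3(u)^{-2\beta}\vartheta_4(u)^{2\beta-2\gamma}$ is a multivalued function whose exponents at $t_1=0$, $t_2=\frac12$, $t_3=\frac{1+\tau}2$, $t_4=\frac\tau2$ are $c_1,c_2,c_3,c_4$. $\omega=d\log T(u)$ is a meromorphic $1$-form on $E$. $\mathcal{L}=\mathbb{C}T(u)^{-1}$ and $\mathcal{L}^\vee=\mathbb{C}T(u)$ are the local systems on $M$ defined by $T^{-1}$ and $T$. Twisted cohomology: let $\mathcal{O}_E( *D)(E)$ and $\Omega^1_E( *D)(E)$ be the spaces of functions, resp. $1$-forms,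 meromorphic on $E$ and holomorphic on $M$. Put $\nabla f=df+f\omega$, $\nabla^\vee f=df-f\omega$. One identifies $H^1(M;\mathcal{L})=\Omega^1_E( *D)(E)/\nabla(\mathcal{O}_E( *D)(E))$ and $H^1(M;\mathcal{L}^\vee)=\Omega^1_E( *D)(E)/\nabla^\vee(\mathcal{O}_E( *D)(E))$ (both are 4-dimensional). Cohomology intersection form: the bilinear form $\langle\cdot,\cdot\rangle_{\mathrm{ch}}:H^1(M;\mathcal{L})\times H^1(M;\mathcal{L}^\vee)\to\mathbb{C}$, $\langle[\varphi],[\psi]\rangle_{\mathrm{ch}}=\int_M\varphi_{\mathrm c}\wedge\psi$, where $\varphi_{\mathrm c}$ is a smooth compactly supported $\nabla$-closed form representing the image of $[\varphi]$ under the inverse of the natural isomorphism $H^1_{\mathrm c}(M;\mathcal{L})\to H^1(M;\mathcal{L})$. Equivalently, $\langle[\varphi],[\psi]\rangle_{\mathrm{ch}}=2\pi\sqrt{-1}\sum_{p\in D}\operatorname{Res}_p(f_p\psi)$, where $f_p$ is the unique germ of meromorphic function at $p$ with $\nabla f_p=\varphi$ near $p$. Cocycles: $\phi_1=\pi\vartheta_3(0)^2du$, $\phi_2=\pi\vartheta_2(0)^2\frac{\vartheta_4(u)^2}{\vartheta_1(u)^2}du$, $\phi_3=\pi\vartheta_2(0)^2\frac{\vartheta_3(u)\vartheta_4(u)}{\vartheta_1(u)\vartheta_2(u)}du=d\log\frac{\vartheta_2(u)}{\vartheta_1(u)}$, $\phi_4=\pi\vartheta_3(0)^2\frac{\vartheta_2(u)\vartheta_4(u)}{\vartheta_1(u)\vartheta_3(u)}du=d\log\frac{\vartheta_3(u)}{\vartheta_1(u)}$.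 Each $\phi_j$ defines a class in both $H^1(M;\mathcal{L})$ and $H^1(M;\mathcal{L}^\vee)$. *)

theory Defs
  imports "HOL-Complex_Analysis.Complex_Analysis"
begin

definition ee :: "complex \<Rightarrow> complex" where
  "ee x = exp (2 * of_real pi * \<i> * x)"

definition theta1 :: "complex \<Rightarrow> complex \<Rightarrow> complex" where
  "theta1 \<tau> u = - (\<Sum>\<^sub>\<infinity>m\<in>(UNIV :: int set).
     ee (1/2 * (of_int m + 1/2)\<^sup>2 * \<tau> + (of_int m + 1/2) * (u + 1/2)))"

definition theta2 :: "complex \<Rightarrow> complex \<Rightarrow> complex" where
  "theta2 \<tau> u = (\<Sum>\<^sub>\<infinity>m\<in>(UNIV :: int set).
     ee (1/2 * (of_int m + 1/2)\<^sup>2 * \<tau> + (of_int m + 1/2) * u))"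

definition theta3 :: "complex \<Rightarrow> complex \<Rightarrow> complex" where
  "theta3 \<tau> u = (\<Sum>\<^sub>\<infinity>m\<in>(UNIV :: int set).
     ee (1/2 * (of_int m)\<^sup>2 * \<tau> + of_int m * u))"

definition theta4 :: "complex \<Rightarrow> complex \<Rightarrow> complex" where
  "theta4 \<tau> u = (\<Sum>\<^sub>\<infinity>m\<in>(UNIV :: int set).
     ee (1/2 * (of_int m)\<^sup>2 * \<tau> + of_int m * (u + 1/2)))"

definition modular_lambda :: "complex \<Rightarrow> complex" where
  "modular_lambda \<tau> = theta2 \<tau> 0 ^ 4 / theta3 \<tau> 0 ^ 4"

text \<open>
  Functions and forms on \<open>M = E - D\<close>, where \<open>E = C / (Z + Z\<tau>)\<close>, are represented by their
  pullbacks to \<open>C\<close>: they are periodic on the preimage \<open>M\<^sub>C \<tau>\<close> of \<open>M\<close>, and their values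
  outside \<open>M\<^sub>C \<tau>\<close> are irrelevant.
\<close>

definition lattice :: "complex \<Rightarrow> complex set" where
  "lattice \<tau> = {of_int m + of_int n * \<tau> | m n :: int. True}"

definition M\<^sub>C :: "complex \<Rightarrow> complex set" where
  "M\<^sub>C \<tau> = - {p + l | p l. p \<in> {0, 1/2, (1 + \<tau>)/2, \<tau>/2} \<and> l \<in> lattice \<tau>}"

definition periodic_on_M :: "complex \<Rightarrow> (complex \<Rightarrow> 'a) \<Rightarrow> bool" where
  "periodic_on_M \<tau> f \<longleftrightarrow> (\<forall>u\<in>M\<^sub>C \<tau>. \<forall>l\<in>lattice \<tau>. f (u + l) = f u)"

definition fund_parallelogram :: "complex \<Rightarrow> complex set" where
  "fund_parallelogram \<tau> = {of_real s + of_real t * \<tau> | s t :: real. 0 \<le> s \<and> s < 1 \<and> 0 \<le> t \<and> t < 1}"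

text \<open>
  A complex-valued 1-form \<open>\<phi>\<close> sends a point \<open>u\<close> and a tangent vector \<open>v\<close> to \<open>\<phi> u v\<close>, so that
  \<open>\<phi> = \<phi>(1) dx + \<phi>(\<i>) dy\<close> where \<open>u = x + \<i>y\<close>.  A 2-form is represented by its coefficient with
  respect to \<open>dx \<and> dy\<close>, the standard orientation.
\<close>

type_synonym form1 = "complex \<Rightarrow> complex \<Rightarrow> complex"

definition times_du :: "(complex \<Rightarrow> complex) \<Rightarrow> form1" where
  "times_du g = (\<lambda>u v. g u * v)"

definition d0 :: "(complex \<Rightarrow> complex) \<Rightarrow> form1" where
  "d0 f = (\<lambda>u. frechet_derivative f (at u))"

definition d1 :: "form1 \<Rightarrow> complex \<Rightarrow> complex" where
  "d1 \<phi> = (\<lambda>u. frechet_derivative (\<lambda>z. \<phi> z \<i>) (at u) 1 - frechet_derivative (\<lambda>z. \<phi> z 1) (at u) \<i>)"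

definition wedge :: "form1 \<Rightarrow> form1 \<Rightarrow> complex \<Rightarrow> complex" where
  "wedge \<phi> \<psi> = (\<lambda>u. \<phi> u 1 * \<psi> u \<i> - \<phi> u \<i> * \<psi> u 1)"

text \<open>\<open>\<nabla>f = df + f \<eta>\<close> on functions and \<open>\<nabla>\<phi> = d\<phi> + \<eta> \<and> \<phi>\<close> on 1-forms, for a connection form \<open>\<eta>\<close>.\<close>

definition nabla0 :: "form1 \<Rightarrow> (complex \<Rightarrow> complex) \<Rightarrow> form1" where
  "nabla0 \<eta> f = (\<lambda>u v. d0 f u v + f u * \<eta> u v)"

definition nabla1 :: "form1 \<Rightarrow> form1 \<Rightarrow> complex \<Rightarrow> complex" where
  "nabla1 \<eta> \<phi> = (\<lambda>u. d1 \<phi> u + wedge \<eta> \<phi> u)"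

text \<open>
  \<open>f\<close> is infinitely differentiable on an open set \<open>S\<close>; \<open>F m n\<close> is the partial derivative of order
  \<open>m\<close> in \<open>x\<close> and \<open>n\<close> in \<open>y\<close>.
\<close>

definition smooth_on :: "complex set \<Rightarrow> (complex \<Rightarrow> complex) \<Rightarrow> bool" where
  "smooth_on S f \<longleftrightarrow> (\<exists>F :: nat \<Rightarrow> nat \<Rightarrow> complex \<Rightarrow> complex.
     (\<forall>z\<in>S. F 0 0 z = f z) \<and>
     (\<forall>m n. \<forall>z\<in>S. (F m n has_derivative
        (\<lambda>h. of_real (Re h) * F (Suc m) n z + of_real (Im h) * F m (Suc n) z)) (at z)))"

definition smooth_functions :: "complex \<Rightarrow> (complex \<Rightarrow> complex) set" where
  "smooth_functions \<tau> = {h. periodic_on_M \<tau> h \<and> smooth_on (M\<^sub>C \<tau>) h}"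

definition smooth_forms :: "complex \<Rightarrow> form1 set" where
  "smooth_forms \<tau> = {\<phi>. periodic_on_M \<tau> \<phi> \<and> (\<forall>u\<in>M\<^sub>C \<tau>. linear (\<phi> u)) \<and>
     smooth_on (M\<^sub>C \<tau>) (\<lambda>u. \<phi> u 1) \<and> smooth_on (M\<^sub>C \<tau>) (\<lambda>u. \<phi> u \<i>)}"

definition compact_support_in_M :: "complex \<Rightarrow> form1 \<Rightarrow> bool" where
  "compact_support_in_M \<tau> \<phi> \<longleftrightarrow> (\<exists>K. compact K \<and> K \<subseteq> M\<^sub>C \<tau> \<and>
     (\<forall>u\<in>M\<^sub>C \<tau>. \<phi> u \<noteq> (\<lambda>v. 0) \<longrightarrow> (\<exists>l\<in>lattice \<tau>. u + l \<in> K)))"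

text \<open>
  \<open>omega \<tau> \<alpha> \<beta> \<gamma>\<close> is \<open>d log T\<close>, where \<open>T\<close> is the multivalued function
  \<open>\<vartheta>\<^sub>1(u)^(2\<alpha>) \<vartheta>\<^sub>2(u)^(2\<gamma>-2\<alpha>) \<vartheta>\<^sub>3(u)^(-2\<beta>) \<vartheta>\<^sub>4(u)^(2\<beta>-2\<gamma>)\<close>; the logarithmic differential of a product
  of complex powers does not depend on the branches.
\<close>

definition omega :: "complex \<Rightarrow> complex \<Rightarrow> complex \<Rightarrow> complex \<Rightarrow> form1" where
  "omega \<tau> \<alpha> \<beta> \<gamma> = times_du (\<lambda>u.
       2*\<alpha>           * (deriv (theta1 \<tau>) u / theta1 \<tau> u)
     + (2*\<gamma> - 2*\<alpha>)   * (deriv (theta2 \<tau>) u / theta2 \<tau> u)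
     + (- 2*\<beta>)       * (deriv (theta3 \<tau>) u / theta3 \<tau> u)
     + (2*\<beta> - 2*\<gamma>)   * (deriv (theta4 \<tau>) u / theta4 \<tau> u))"

definition mero_functions :: "complex \<Rightarrow> (complex \<Rightarrow> complex) set" where
  "mero_functions \<tau> = {f. periodic_on_M \<tau> f \<and> f holomorphic_on M\<^sub>C \<tau> \<and> f meromorphic_on UNIV}"

text \<open>As \<open>du\<close> is a nowhere vanishing holomorphic form on \<open>E\<close>, the meromorphic forms are \<open>g du\<close>.\<close>

definition mero_forms :: "complex \<Rightarrow> form1 set" where
  "mero_forms \<tau> = {\<phi>. \<exists>g\<in>mero_functions \<tau>. \<forall>u\<in>M\<^sub>C \<tau>. \<phi> u = times_du g u}"

definition cohomologous :: "complex \<Rightarrow> form1 \<Rightarrow> (form1 \<times> form1) set" where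
  "cohomologous \<tau> \<eta> = {(\<phi>, \<phi>'). \<phi> \<in> mero_forms \<tau> \<and> \<phi>' \<in> mero_forms \<tau> \<and>
     (\<exists>f\<in>mero_functions \<tau>. \<forall>u\<in>M\<^sub>C \<tau>. \<forall>v. \<phi>' u v - \<phi> u v = nabla0 \<eta> f u v)}"

text \<open>
  \<open>H1 \<tau> \<eta>\<close> is the quotient of the meromorphic forms by \<open>\<nabla>\<close>-exact ones; it is \<open>H\<^sup>1(M; L)\<close> for
  \<open>\<eta> = \<omega>\<close> and \<open>H\<^sup>1(M; L\<^sup>\<vee>)\<close> for \<open>\<eta> = - \<omega>\<close>, since the flat sections of \<open>d + \<omega>\<close> are multiples of
  \<open>1/T\<close>, those of \<open>d - \<omega>\<close> are multiples of \<open>T\<close>.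
\<close>

definition H1 :: "complex \<Rightarrow> form1 \<Rightarrow> form1 set set" where
  "H1 \<tau> \<eta> = mero_forms \<tau> // cohomologous \<tau> \<eta>"

definition coh_class :: "complex \<Rightarrow> form1 \<Rightarrow> form1 \<Rightarrow> form1 set" where
  "coh_class \<tau> \<eta> \<phi> = cohomologous \<tau> \<eta> `` {\<phi>}"

definition neg_form :: "form1 \<Rightarrow> form1" where
  "neg_form \<eta> = (\<lambda>u v. - \<eta> u v)"

text \<open>
  \<open>\<phi>c\<close> is a smooth compactly supported \<open>\<nabla>\<close>-closed form whose class in \<open>H\<^sup>1\<^sub>c(M; L)\<close> is sent
  to the class of \<open>\<phi>\<close> by the natural map, that is, \<open>\<phi>c\<close> and \<open>\<phi>\<close> differ by \<open>\<nabla>h\<close> for a smooth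
  function \<open>h\<close> on \<open>M\<close> (with no condition on its support).
\<close>

definition compact_rep :: "complex \<Rightarrow> form1 \<Rightarrow> form1 \<Rightarrow> form1 \<Rightarrow> bool" where
  "compact_rep \<tau> \<eta> \<phi> \<phi>c \<longleftrightarrow>
     \<phi>c \<in> smooth_forms \<tau> \<and> compact_support_in_M \<tau> \<phi>c \<and> (\<forall>u\<in>M\<^sub>C \<tau>. nabla1 \<eta> \<phi>c u = 0) \<and>
     (\<exists>h\<in>smooth_functions \<tau>. \<forall>u\<in>M\<^sub>C \<tau>. \<forall>v. \<phi>c u v = \<phi> u v + nabla0 \<eta> h u v)"

definition integral_M :: "complex \<Rightarrow> (complex \<Rightarrow> complex) \<Rightarrow> complex" where
  "integral_M \<tau> F = (LINT u : fund_parallelogram \<tau> \<inter> M\<^sub>C \<tau> | lborel. F u)"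

text \<open>
  The value of \<open>\<integral>\<^sub>M \<phi>c \<and> \<psi>\<close> for any choice of representatives; the definite description includes
  that it does not depend on the choices.
\<close>

definition intersection_ch :: "complex \<Rightarrow> form1 \<Rightarrow> form1 set \<Rightarrow> form1 set \<Rightarrow> complex" where
  "intersection_ch \<tau> \<eta> X Y = (THE s. \<exists>\<phi>\<in>X. \<exists>\<psi>\<in>Y. \<exists>\<phi>c.
     compact_rep \<tau> \<eta> \<phi> \<phi>c \<and> s = integral_M \<tau> (wedge \<phi>c \<psi>))"

text \<open>
  The fourth cocycle is the one with index \<open>4\<close>, which equals \<open>0\<close> in the type \<open>4\<close>.  With the sign of
  \<open>\<vartheta>\<^sub>1\<close> fixed above, the third and fourth cocycles are \<open>d log (\<vartheta>\<^sub>1/\<vartheta>\<^sub>2)\<close> and \<open>d log (\<vartheta>\<^sub>1/\<vartheta>\<^sub>3)\<close>.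
  Replacing both by their negatives does not change the intersection matrix.
\<close>

definition phi :: "complex \<Rightarrow> 4 \<Rightarrow> form1" where
  "phi \<tau> j = times_du (\<lambda>u.
     if j = 1 then of_real pi * theta3 \<tau> 0 ^ 2
     else if j = 2 then of_real pi * theta2 \<tau> 0 ^ 2 * (theta4 \<tau> u ^ 2 / theta1 \<tau> u ^ 2)
     else if j = 3 then of_real pi * theta2 \<tau> 0 ^ 2 * (theta3 \<tau> u * theta4 \<tau> u / (theta1 \<tau> u * theta2 \<tau> u))
     else of_real pi * theta3 \<tau> 0 ^ 2 * (theta2 \<tau> u * theta4 \<tau> u / (theta1 \<tau> u * theta3 \<tau> u)))"

definition intersection_matrix :: "complex \<Rightarrow> complex \<Rightarrow> complex \<Rightarrow> complex \<Rightarrow> complex ^ 4 ^ 4" where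
  "intersection_matrix \<tau> \<alpha> \<beta> \<gamma> = (let \<omega> = omega \<tau> \<alpha> \<beta> \<gamma> in
     \<chi> i j. intersection_ch \<tau> \<omega> (coh_class \<tau> \<omega> (phi \<tau> i)) (coh_class \<tau> (neg_form \<omega>) (phi \<tau> j)))"

end

theory Submission
  imports Defs "HOL-Real_Asymp.Real_Asymp"
begin

text \<open>
  Write every meromorphic form on \<open>E\<close> as \<open>g du\<close> with \<open>g\<close> doubly periodic, and let \<open>\<omega> = (c/z + v(z)) dz\<close>
  in the coordinate \<open>z = u - p\<close> at a point \<open>p\<close> of the half lattice, which is the preimage of \<open>D\<close>.

  \<^bold>\<open>From integrals to residues.\<close> Since \<open>c\<close> is not an integer, the equation \<open>\<nabla>f = \<phi>\<close> has exactly one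
  single-valued solution \<open>f_p\<close> in a punctured neighbourhood of \<open>p\<close>: the recursion for its Laurent coefficients
  never divides by zero (\<open>local_solution\<close>), and a solution of \<open>\<nabla>k = 0\<close> is multiplied by a number other
  than \<open>1\<close> along a loop around \<open>p\<close> (\<open>local_homogeneous_solution_0\<close>). Let \<open>\<chi>\<close> be a radial cutoff function
  and \<open>\<chi>f\<close> the function that is \<open>\<chi> f_p\<close> near each \<open>p\<close>. Then \<open>\<phi> - \<nabla>(\<chi>f)\<close> is a compactly supported
  representative of \<open>\<phi>\<close> (\<open>exists_representative\<close>). Conversely, if \<open>\<phi>c = \<phi> + \<nabla>h\<close> is any compactly supported
  representative, then \<open>h = - f_p\<close> near \<open>p\<close> by uniqueness, so that \<open>k = h + \<chi>f\<close> vanishes near \<open>D\<close>. As forms of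
  type \<open>(1,0)\<close> have wedge product zero, for \<open>\<psi> = g2 du\<close>
  one has \<open>\<phi>c \<and> \<psi> = dh \<and> \<psi> = d(k \<psi>) - d(\<chi>f) \<and> \<psi>\<close>, where \<open>d(\<chi>f) \<and> \<psi> = d\<chi> \<and> f_p \<psi>\<close> near \<open>p\<close>;
  and with \<open>f_p \<psi> = dG_p + R_p dz/z\<close>, where \<open>R_p\<close> is the residue,
  \<open>d\<chi> \<and> f_p \<psi> = - d(G_p d\<chi>) + R_p d\<chi> \<and> dz/z\<close>. By Stokes' theorem only the integral of
  \<open>- R_p d\<chi> \<and> dz/z\<close> remains, which is \<open>2\<pi>\<i> R_p\<close> by integration in \<open>|z|\<^sup>2\<close>. If \<open>\<psi>\<close> is changed by
  \<open>\<nabla>\<^sup>\<vee>g\<close>, the wedge product changes by \<open>- d(g \<phi>c)\<close>, because \<open>\<phi>c\<close> is \<open>\<nabla>\<close>-closed. Hence the integral is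
  \<open>2\<pi>\<i>\<close> times the sum of the \<open>R_p\<close> for all choices (\<open>integral_of_representative\<close>,
  \<open>intersection_ch_eq\<close>), and \<open>intersection_formula\<close> expresses it by the first Laurent coefficients of
  \<open>\<omega>\<close>, \<open>\<phi>\<close> and \<open>\<psi>\<close>.

  \<^bold>\<open>The Laurent coefficients.\<close> The form \<open>\<phi>\<^sub>1\<close> is constant; \<open>\<phi>\<^sub>3\<close> and \<open>\<phi>\<^sub>4\<close> have simple poles with residues
  \<open>1\<close> and \<open>-1\<close>, the value \<open>1\<close> being Jacobi's formula \<open>\<vartheta>\<^sub>1'(0) = \<pi> \<vartheta>\<^sub>2(0) \<vartheta>\<^sub>3(0) \<vartheta>\<^sub>4(0)\<close>; and \<open>\<phi>\<^sub>2\<close> has one double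
  pole, at \<open>0\<close>, with zero residue. Its constant term comes from
  \<open>\<vartheta>\<^sub>1'\<^sup>2 - \<vartheta>\<^sub>1 \<vartheta>\<^sub>1'' = C \<vartheta>\<^sub>4\<^sup>2 - (\<vartheta>\<^sub>4''(0)/\<vartheta>\<^sub>4(0)) \<vartheta>\<^sub>1\<^sup>2\<close> (\<open>hirota_theta1\<close>), which says that
  \<open>\<vartheta>\<^sub>4\<^sup>2/\<vartheta>\<^sub>1\<^sup>2\<close> is a multiple of the Weierstrass function minus its value at \<open>\<tau>/2\<close>. The
  slope of the regular part of \<open>\<omega>\<close> at \<open>0\<close> enters through the products with \<open>\<phi>\<^sub>2\<close>; this gives \<open>C22\<close> in terms of
  \<open>\<vartheta>\<^sub>1'''(0)/\<vartheta>\<^sub>1'(0)\<close> and the \<open>\<vartheta>\<^sub>i''(0)/\<vartheta>\<^sub>i(0)\<close>. The formula with \<open>\<lambda>\<close> follows because the differences of the latter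
  are \<open>\<pi>\<^sup>2 \<vartheta>\<^sub>3(0)^4\<close> and \<open>\<pi>\<^sup>2 \<vartheta>\<^sub>2(0)^4\<close> (\<open>second_ratio_differences\<close>) and their sum is the former
  (\<open>third_ratio_sum\<close>).

  \<^bold>\<open>The theta functions.\<close> Two entire functions with the same factors of quasi-periodicity are proportional if the
  zeros of the second form a translate of the lattice and are cancelled by those of the first (\<open>quasi_periodic_quotient_constant\<close>, an application of Liouville's
  theorem). This yields the zeros of \<open>\<vartheta>\<^sub>3\<close> by comparison with an infinite product, then \<open>hirota_theta1\<close> and the
  duplication formula for \<open>\<vartheta>\<^sub>1\<close>, from which the sum is read off. Jacobi's formula is obtained by observing
  that \<open>\<vartheta>\<^sub>1'(0) / (\<vartheta>\<^sub>2(0) \<vartheta>\<^sub>3(0) \<vartheta>\<^sub>4(0))\<close> does not change when \<open>\<tau>\<close> is doubled (\<open>jacobi_ratio_double\<close>) and tends to \<open>\<pi>\<close>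
  as \<open>Im \<tau>\<close> tends to infinity.
\<close>

section \<open>Partial derivatives and smoothness\<close>

text \<open>
  Smoothness is treated through the two real partial derivatives. They are total functions, which makes iteration
  simple; differentiability is required separately in the definition of \<open>Ck\<close>.
\<close>

definition px :: "(complex \<Rightarrow> complex) \<Rightarrow> complex \<Rightarrow> complex" where
  "px f z = frechet_derivative f (at z) 1"
definition py :: "(complex \<Rightarrow> complex) \<Rightarrow> complex \<Rightarrow> complex" where
  "py f z = frechet_derivative f (at z) \<i>"

lemma linear_complex_expand:
  assumes "linear D"
  shows "D h = of_real (Re h) * D 1 + of_real (Im h) * (D \<i> :: complex)"
proof -
  have "h = Re h *\<^sub>R 1 + Im h *\<^sub>R \<i>"
    by (simp add: complex_eq_iff)
  then have "D h = D (Re h *\<^sub>R 1 + Im h *\<^sub>R \<i>)" by simp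
  also have "\<dots> = Re h *\<^sub>R D 1 + Im h *\<^sub>R D \<i>"
    using assms by (simp add: linear_add linear_scale)
  finally show ?thesis by (simp add: scaleR_conv_of_real)
qed

lemma px_py_eqI:
  assumes "(f has_derivative D) (at z)"
  shows "px f z = D 1" "py f z = D \<i>"
  using frechet_derivative_at[OF assms] by (simp_all add: px_def py_def)

lemma has_derivative_px_py:
  assumes "f differentiable (at z)"
  shows "(f has_derivative (\<lambda>h. of_real (Re h) * px f z + of_real (Im h) * py f z)) (at z)"
proof -
  have *: "(f has_derivative frechet_derivative f (at z)) (at z)"
    using assms frechet_derivative_works by blast
  have "frechet_derivative f (at z) = (\<lambda>h. of_real (Re h) * px f z + of_real (Im h) * py f z)"
    using linear_complex_expand[of "frechet_derivative f (at z)"] has_derivative_linear[OF *]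
    unfolding px_def py_def by blast
  with * show ?thesis by simp
qed

text \<open>
  Partial derivatives are local; this transfers them to functions that are defined piecewise or extended by zero.
\<close>

lemma px_py_cong:
  assumes "open S" "z \<in> S" "\<And>w. w \<in> S \<Longrightarrow> f w = g w" "f differentiable (at z)"
  shows "g differentiable (at z)" "px g z = px f z" "py g z = py f z"
proof -
  have "(g has_derivative (\<lambda>h. of_real (Re h) * px f z + of_real (Im h) * py f z)) (at z)"
    using has_derivative_transform_within_open[OF has_derivative_px_py[OF assms(4)] assms(1,2)] assms(3) by blast
  then show "g differentiable (at z)" "px g z = px f z" "py g z = py f z"
    using px_py_eqI[of g _ z] differentiableI by force+
qed

lemma px_py_mult:
  assumes "f differentiable (at z)" "g differentiable (at z)"
  shows "px (\<lambda>w. f w * g w) z = px f z * g z + f z * px g z"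
    "py (\<lambda>w. f w * g w) z = py f z * g z + f z * py g z"
    "(\<lambda>w. f w * g w) differentiable (at z)"
  using px_py_eqI[OF has_derivative_mult[OF assms[THEN has_derivative_px_py]]]
  by (auto intro: differentiable_mult assms)

lemma px_py_add:
  assumes "f differentiable (at z)" "g differentiable (at z)"
  shows "px (\<lambda>w. f w + g w) z = px f z + px g z"
    "py (\<lambda>w. f w + g w) z = py f z + py g z"
    "(\<lambda>w. f w + g w) differentiable (at z)"
  using px_py_eqI[OF has_derivative_add[OF assms[THEN has_derivative_px_py]]]
  by (auto intro: differentiable_add assms)

lemma px_py_field:
  assumes "(f has_field_derivative d) (at z)"
  shows "px f z = d" "py f z = \<i> * d" "f differentiable (at z)"
  using px_py_eqI[OF assms[unfolded has_field_derivative_def]] assms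
  by (auto simp: has_field_derivative_def intro: differentiableI)

text \<open>
  This recursion is convenient for induction on the order: sums, products and compositions only need the product and
  chain rules for first derivatives.
\<close>

fun Ck :: "nat \<Rightarrow> complex set \<Rightarrow> (complex \<Rightarrow> complex) \<Rightarrow> bool" where
  "Ck 0 S f \<longleftrightarrow> continuous_on S f"
| "Ck (Suc k) S f \<longleftrightarrow> (\<forall>z\<in>S. f differentiable (at z)) \<and> Ck k S (px f) \<and> Ck k S (py f)"

lemma Ck_cong:
  assumes "open S"
  shows "Ck k S f \<Longrightarrow> (\<And>z. z \<in> S \<Longrightarrow> f z = g z) \<Longrightarrow> Ck k S g"
proof (induction k arbitrary: f g)
  case 0
  then show ?case using continuous_on_cong by force
next
  case (Suc k)
  have "g differentiable (at z)" "px g z = px f z" "py g z = py f z" if "z \<in> S" for z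
    using px_py_cong[OF assms that, of f g] Suc.prems that by auto
  then show ?case
    using Suc.IH[of "px f" "px g"] Suc.IH[of "py f" "py g"] Suc.prems by auto
qed

lemma Ck_continuous:
  assumes "Ck k S f"
  shows "continuous_on S f"
proof (cases k)
  case (Suc n)
  then have "\<And>z. z \<in> S \<Longrightarrow> isCont f z"
    using assms differentiable_imp_continuous_within by auto
  then show ?thesis by (intro continuous_at_imp_continuous_on) blast
qed (use assms in auto)

lemma Ck_SucI:
  assumes "open S" and "Ck k S a" "Ck k S b"
    and d: "\<And>z. z \<in> S \<Longrightarrow> (f has_derivative (\<lambda>h. of_real (Re h) * a z + of_real (Im h) * b z)) (at z)"
  shows "Ck (Suc k) S f"
  using Ck_cong[OF assms(1,2), of "px f"] Ck_cong[OF assms(1,3), of "py f"] px_py_eqI[OF d] d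
  by (auto intro: differentiableI)

lemma Ck_SucD: "Ck (Suc k) S f \<Longrightarrow> Ck k S f"
proof (induction k arbitrary: f)
  case 0
  from Ck_continuous[OF 0] show ?case by simp
next
  case (Suc k)
  then show ?case by (metis Ck.simps(2))
qed

lemma Ck_add:
  assumes "open S"
  shows "Ck k S f \<Longrightarrow> Ck k S g \<Longrightarrow> Ck k S (\<lambda>z. f z + g z)"
proof (induction k arbitrary: f g)
  case 0
  then show ?case by (auto intro: continuous_intros)
next
  case (Suc k)
  then have "Ck k S (\<lambda>z. px f z + px g z)" "Ck k S (\<lambda>z. py f z + py g z)" by auto
  then show ?case
    using has_derivative_add[OF has_derivative_px_py has_derivative_px_py] Suc.prems
    by (elim Ck_SucI[OF assms]) (auto simp: algebra_simps)
qed

lemma Ck_mult: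
  assumes "open S"
  shows "Ck k S f \<Longrightarrow> Ck k S g \<Longrightarrow> Ck k S (\<lambda>z. f z * g z)"
proof (induction k arbitrary: f g)
  case 0
  then show ?case by (auto intro: continuous_intros)
next
  case (Suc k)
  then have "Ck k S (\<lambda>z. px f z * g z + f z * px g z)" "Ck k S (\<lambda>z. py f z * g z + f z * py g z)"
    using Ck_SucD[of k S f] Ck_SucD[of k S g] by (auto intro!: Ck_add[OF assms])
  then show ?case
    using has_derivative_mult[OF has_derivative_px_py has_derivative_px_py] Suc.prems
    by (elim Ck_SucI[OF assms]) (auto simp: algebra_simps)
qed

lemma Ck_holomorphic:
  assumes "open S"
  shows "f holomorphic_on S \<Longrightarrow> Ck k S f"
proof (induction k arbitrary: f)
  case 0
  then show ?case by (auto intro: holomorphic_on_imp_continuous_on)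
next
  case (Suc k)
  have d: "(f has_field_derivative deriv f z) (at z)" if "z \<in> S" for z
    using Suc.prems assms that holomorphic_derivI by blast
  have "Ck k S (deriv f)" "Ck k S (\<lambda>z. \<i> * deriv f z)"
    using Suc.prems assms by (auto intro!: Suc.IH holomorphic_intros)
  then show ?case
    using has_derivative_px_py[OF px_py_field(3)[OF d]] px_py_field[OF d]
    by (elim Ck_SucI[OF assms]) auto
qed

lemma Ck_subset: "Ck k S f \<Longrightarrow> T \<subseteq> S \<Longrightarrow> Ck k T f"
proof (induction k arbitrary: f)
  case 0
  then show ?case using continuous_on_subset by auto
qed auto

lemma Ck_local:
  assumes "\<And>z. z \<in> S \<Longrightarrow> \<exists>U. open U \<and> z \<in> U \<and> Ck k U f"
  shows "Ck k S f"
  using assms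
proof (induction k arbitrary: f)
  case 0
  have "continuous (at z within S) f" if z: "z \<in> S" for z
  proof -
    obtain U where U: "open U" "z \<in> U" "Ck 0 U f"
      using 0 z by blast
    then have "isCont f z" by (simp add: continuous_on_eq_continuous_at)
    then show ?thesis using continuous_at_imp_continuous_at_within by blast
  qed
  then show ?case by (simp add: continuous_on_eq_continuous_within)
next
  case (Suc k)
  have "Ck k S (px f)" "Ck k S (py f)"
    by (rule Suc.IH; use Suc.prems in fastforce)+
  moreover have "f differentiable (at z)" if "z \<in> S" for z
    using Suc.prems that by force
  ultimately show ?case by simp
qed

lemma has_derivative_shift_iff:
  fixes f :: "complex \<Rightarrow> complex"
  shows "((\<lambda>w. f (w + l)) has_derivative D) (at z) \<longleftrightarrow> (f has_derivative D) (at (z + l))"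
proof
  assume *: "(f has_derivative D) (at (z + l))"
  have "((\<lambda>w. w + l) has_derivative (\<lambda>h. h)) (at z)"
    by (auto intro!: derivative_eq_intros)
  from has_derivative_compose[OF this *] show "((\<lambda>w. f (w + l)) has_derivative D) (at z)" by simp
next
  assume *: "((\<lambda>w. f (w + l)) has_derivative D) (at z)"
  have "((\<lambda>w. w - l) has_derivative (\<lambda>h. h)) (at (z + l))"
    by (auto intro!: derivative_eq_intros)
  from has_derivative_compose[OF this, of "\<lambda>w. f (w + l)" D] * show "(f has_derivative D) (at (z + l))" by simp
qed

lemma px_py_shift:
  "px (\<lambda>w. f (w + l)) z = px f (z + l)" "py (\<lambda>w. f (w + l)) z = py f (z + l)"
  "(\<lambda>w. f (w + l)) differentiable (at z) \<longleftrightarrow> f differentiable (at (z + l))"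
  unfolding px_def py_def frechet_derivative_def differentiable_def has_derivative_shift_iff by simp_all

lemma Ck_shift: "Ck k S f \<Longrightarrow> (\<And>z. z \<in> T \<Longrightarrow> z + l \<in> S) \<Longrightarrow> Ck k T (\<lambda>z. f (z + l))"
proof (induction k arbitrary: f)
  case 0
  then have c: "continuous_on S f" by simp
  show ?case
    using 0 by (auto intro!: continuous_on_compose2[OF c] continuous_intros)
next
  case (Suc k)
  have "px (\<lambda>z. f (z + l)) = (\<lambda>z. px f (z + l))" "py (\<lambda>z. f (z + l)) = (\<lambda>z. py f (z + l))"
    by (auto simp: px_py_shift)
  then show ?case using Suc by (auto simp: px_py_shift)
qed

text \<open>
  The chain rule takes \<open>r n\<close> to \<open>r (Suc n)\<close>, so the induction on the order runs over all the derivatives \<open>r n\<close> of the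
  outer function at once.
\<close>

lemma Ck_compose_real:
  fixes r :: "nat \<Rightarrow> real \<Rightarrow> real" and u :: "complex \<Rightarrow> real"
  assumes S: "open S"
    and r: "\<And>n x. (r n has_real_derivative r (Suc n) x) (at x)"
    and u: "\<And>k. Ck k S (\<lambda>z. of_real (u z))"
  shows "Ck k S (\<lambda>z. of_real (r n (u z)))"
proof (induction k arbitrary: n)
  case 0
  have "continuous_on S (\<lambda>z. Re (complex_of_real (u z)))"
    by (rule continuous_on_Re[OF u[of 0, unfolded Ck.simps(1)]])
  then have cu: "continuous_on S u" by simp
  have cr: "continuous_on UNIV (r n)"
    using r DERIV_isCont by (intro continuous_at_imp_continuous_on) blast
  show ?case
  proof -
    have "continuous_on S (\<lambda>z. r n (u z))"
      by (rule continuous_on_compose2[OF cr cu]) simp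
    then show ?thesis by (simp add: continuous_on_of_real)
  qed
next
  case (Suc k)
  let ?u = "\<lambda>z. complex_of_real (u z)"
  have *: "((\<lambda>z. complex_of_real (r n (u z))) has_derivative
      (\<lambda>h. of_real (r (Suc n) (u z)) * (of_real (Re h) * px ?u z + of_real (Im h) * py ?u z))) (at z)"
    if "z \<in> S" for z
  proof -
    have d: "(?u has_derivative (\<lambda>h. of_real (Re h) * px ?u z + of_real (Im h) * py ?u z)) (at z)"
      using u[of "Suc 0", unfolded Ck.simps(2)] that by (intro has_derivative_px_py) blast
    have "((\<lambda>z. Re (?u z)) has_derivative (\<lambda>h. Re (of_real (Re h) * px ?u z + of_real (Im h) * py ?u z))) (at z)"
      by (rule has_derivative_Re[OF d])
    then have dr: "(u has_derivative (\<lambda>h. Re (of_real (Re h) * px ?u z + of_real (Im h) * py ?u z))) (at z)"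
      by simp
    from has_derivative_of_real[OF this]
    have "(?u has_derivative (\<lambda>h. of_real (Re (of_real (Re h) * px ?u z + of_real (Im h) * py ?u z)))) (at z)" .
    note eq = fun_cong[OF has_derivative_unique[OF this d]]
    have e: "complex_of_real (Re (of_real (Re h) * px ?u z + of_real (Im h) * py ?u z)) = of_real (Re h) * px ?u z + of_real (Im h) * py ?u z" for h
      by (rule eq)
    have "(r n has_derivative (\<lambda>x. r (Suc n) (u z) * x)) (at (u z))"
      using r[of n "u z"] by (simp add: has_field_derivative_def)
    from has_derivative_compose[OF dr this]
    have "((\<lambda>z. complex_of_real (r n (u z))) has_derivative (\<lambda>h. complex_of_real (r (Suc n) (u z) *
        Re (of_real (Re h) * px ?u z + of_real (Im h) * py ?u z)))) (at z)"
      by (rule has_derivative_of_real)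
    then show ?thesis by (simp only: of_real_mult e)
  qed
  have "Ck k S (\<lambda>z. of_real (r (Suc n) (u z)) * px ?u z)" "Ck k S (\<lambda>z. of_real (r (Suc n) (u z)) * py ?u z)"
    using Ck_mult[OF S Suc.IH] u[of "Suc k", unfolded Ck.simps(2)] by blast+
  then show ?case
  proof (rule Ck_SucI[OF S])
    fix z assume "z \<in> S"
    from *[OF this] show "((\<lambda>z. complex_of_real (r n (u z))) has_derivative
      (\<lambda>h. of_real (Re h) * (of_real (r (Suc n) (u z)) * px ?u z) + of_real (Im h) * (of_real (r (Suc n) (u z)) * py ?u z))) (at z)"
      by (simp add: distrib_left mult.left_commute)
  qed
qed

text \<open>
  Integrate \<open>py f\<close> along a vertical segment, differentiate in \<open>x\<close> under the integral sign, and then differentiate with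
  respect to the upper end point.
\<close>

lemma px_py_commute:
  assumes S: "open S" and f: "Ck 2 S f" and z: "z \<in> S"
  shows "px (py f) z = py (px f) z"
proof -
  have f2: "\<forall>z\<in>S. f differentiable (at z)" "Ck 1 S (px f)" "Ck 1 S (py f)"
    using f by (auto simp: numeral_2_eq_2)
  obtain r where r: "r > 0" "ball z r \<subseteq> S" using S z open_contains_ball by blast
  define d where "d = r / 2"
  define x0 y0 where "x0 = Re z" and "y0 = Im z"
  have d: "d > 0" using r by (simp add: d_def)
  have inS: "Complex x y \<in> S" if "\<bar>x - x0\<bar> < d" "\<bar>y - y0\<bar> < d" for x y
  proof -
    have "norm (Complex x y - z) \<le> \<bar>Re (Complex x y - z)\<bar> + \<bar>Im (Complex x y - z)\<bar>" by (rule cmod_le)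
    also have "\<dots> < r" using that by (simp add: d_def x0_def y0_def)
    finally show ?thesis using r by (auto simp: dist_norm norm_minus_commute)
  qed
  define U where "U = {x0 - d <..< x0 + d}"
  define c where "c = y0 - d / 2"
  have dx: "((\<lambda>x. g (Complex x y)) has_vector_derivative px g (Complex x y)) (at x within A)"
    if "g differentiable (at (Complex x y))" for g x y A
  proof -
    have 1: "((\<lambda>x. Complex x y) has_derivative (\<lambda>h. of_real h)) (at x within A)"
    proof -
      have "((\<lambda>x. of_real x + \<i> * of_real y) has_derivative (\<lambda>h. of_real h)) (at x within A)"
        by (auto intro!: derivative_eq_intros)
      then show ?thesis by (simp add: Complex_eq)
    qed
    from has_derivative_compose[OF this has_derivative_px_py[OF that]]
    show ?thesis by (simp add: has_vector_derivative_def scaleR_conv_of_real)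
  qed
  have dy: "((\<lambda>y. g (Complex x y)) has_vector_derivative py g (Complex x y)) (at y within A)"
    if "g differentiable (at (Complex x y))" for g x y A
  proof -
    have 1: "((\<lambda>y. Complex x y) has_derivative (\<lambda>h. \<i> * of_real h)) (at y within A)"
    proof -
      have "((\<lambda>y. of_real x + \<i> * of_real y) has_derivative (\<lambda>h. \<i> * of_real h)) (at y within A)"
        by (auto intro!: derivative_eq_intros)
      then show ?thesis by (simp add: Complex_eq)
    qed
    from has_derivative_compose[OF this has_derivative_px_py[OF that]]
    show ?thesis by (simp add: has_vector_derivative_def scaleR_conv_of_real)
  qed
  \<comment> \<open>Both sides are the derivative in \<open>x\<close> of \<open>f (x, y) - f (x, c)\<close>.\<close>
  have key: "integral {c..y} (\<lambda>t. px (py f) (Complex x0 t)) = px f (Complex x0 y) - px f (Complex x0 c)"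
    if y: "y \<in> {c..<y0 + d}" for y
  proof -
    have c1: "continuous_on (U \<times> cbox c y) (\<lambda>(x, t). px (py f) (Complex x t))"
    proof -
      have 1: "continuous_on S (px (py f))" using f2(3) by auto
      have "continuous_on (U \<times> cbox c y) (\<lambda>p. px (py f) (of_real (fst p) + \<i> * of_real (snd p)))"
        using y d by (intro continuous_on_compose2[OF 1])
          (auto intro!: continuous_intros inS simp: Complex_eq[symmetric] U_def c_def abs_less_iff)
      then show ?thesis by (simp add: Complex_eq case_prod_beta)
    qed
    have FTC: "((\<lambda>t. py f (Complex x t)) has_integral f (Complex x y) - f (Complex x c)) {c..y}" if "x \<in> U" for x
      using y d that by (intro fundamental_theorem_of_calculus dy) (auto intro!: f2(1)[rule_format] inS simp: U_def c_def abs_less_iff)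
    have "((\<lambda>x. integral (cbox c y) (\<lambda>t. py f (Complex x t))) has_vector_derivative integral (cbox c y) (\<lambda>t. px (py f) (Complex x0 t))) (at x0 within U)"
    proof (rule leibniz_rule_vector_derivative[OF _ _ c1])
      show "((\<lambda>x. py f (Complex x t)) has_vector_derivative px (py f) (Complex x t)) (at x within U)"
        if "x \<in> U" "t \<in> cbox c y" for x t
        using that y d f2(3) by (intro dx) (auto intro!: inS simp: U_def c_def abs_less_iff)
      show "(\<lambda>t. py f (Complex x t)) integrable_on cbox c y" if "x \<in> U" for x
        using FTC[OF that] by auto
    qed (use d in \<open>auto simp: U_def\<close>)
    moreover have "\<And>x. x \<in> U \<Longrightarrow> integral (cbox c y) (\<lambda>t. py f (Complex x t)) = f (Complex x y) - f (Complex x c)"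
      using FTC by (auto intro!: integral_unique)
    moreover have x0U: "x0 \<in> U" using d by (simp add: U_def)
    ultimately have A: "((\<lambda>x. f (Complex x y) - f (Complex x c)) has_vector_derivative integral (cbox c y) (\<lambda>t. px (py f) (Complex x0 t))) (at x0 within U)"
      by (metis (no_types, lifting) has_vector_derivative_transform)
    have B: "((\<lambda>x. f (Complex x y) - f (Complex x c)) has_vector_derivative px f (Complex x0 y) - px f (Complex x0 c)) (at x0 within U)"
      using y d by (intro has_vector_derivative_diff dx) (auto intro!: f2(1)[rule_format] inS simp: U_def c_def abs_less_iff)
    have oU: "open U" by (simp add: U_def)
    show ?thesis using vector_derivative_unique_at[of _ _ x0] A B at_within_open[OF x0U oU] by (metis interval_cbox)
  qed
  define b where "b = y0 + d / 2"
  have y0: "y0 \<in> {c<..<b}" "{c..b} \<subseteq> {c..<y0 + d}" using d by (auto simp: c_def b_def)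
  have "continuous_on {c..b} (\<lambda>t. px (py f) (Complex x0 t))"
  proof -
    have 1: "continuous_on S (px (py f))" using f2(3) by auto
    have "continuous_on {c..b} (\<lambda>t. px (py f) (of_real x0 + \<i> * of_real t))"
      using d by (intro continuous_on_compose2[OF 1])
        (auto intro!: continuous_intros inS simp: Complex_eq[symmetric] b_def c_def abs_less_iff)
    then show ?thesis by (simp add: Complex_eq)
  qed
  from integral_has_vector_derivative[OF this, of y0]
  have "((\<lambda>y. integral {c..y} (\<lambda>t. px (py f) (Complex x0 t))) has_vector_derivative px (py f) (Complex x0 y0)) (at y0 within {c..b})"
    using y0 by auto
  then have A: "((\<lambda>y. px f (Complex x0 y) - px f (Complex x0 c)) has_vector_derivative px (py f) (Complex x0 y0)) (at y0 within {c..b})"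
    by (rule has_vector_derivative_transform[rotated 2]) (use y0 in \<open>simp_all add: key subset_iff\<close>)
  have B: "((\<lambda>y. px f (Complex x0 y) - px f (Complex x0 c)) has_vector_derivative py (px f) (Complex x0 y0)) (at y0 within {c..b})"
  proof -
    have "px f differentiable at (Complex x0 y0)" using f2(2) d inS[of x0 y0] by auto
    from has_vector_derivative_diff[OF dy[OF this] has_vector_derivative_const] show ?thesis by simp
  qed
  have "px (py f) (Complex x0 y0) = py (px f) (Complex x0 y0)"
    by (rule vector_derivative_unique_within_closed_interval[unfolded box_real, OF _ _ A B]) (use y0 in auto)
  then show ?thesis by (simp add: x0_def y0_def)
qed

lemma smooth_on_imp_Ck:
  assumes S: "open S" and f: "smooth_on S f"
  shows "Ck k S f"
proof -
  obtain F where F0: "\<And>z. z \<in> S \<Longrightarrow> F 0 0 z = f z"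
    and F: "\<And>m n z. z \<in> S \<Longrightarrow> (F m n has_derivative
        (\<lambda>h. of_real (Re h) * F (Suc m) n z + of_real (Im h) * F m (Suc n) z)) (at z)"
    using f unfolding smooth_on_def by blast
  have "Ck k S (F m n)" for m n
  proof (induction k arbitrary: m n)
    case 0
    have "isCont (F m n) z" if "z \<in> S" for z
      using has_derivative_continuous[OF F[OF that]] .
    then show ?case by (simp add: continuous_at_imp_continuous_on)
  next
    case (Suc k)
    show ?case by (rule Ck_SucI[OF S Suc.IH Suc.IH F])
  qed
  from this[of 0 0] show ?thesis by (rule Ck_cong[OF S]) (simp add: F0)
qed

text \<open>
  The family of partial derivatives required by the definition is \<open>\<partial>\<^sub>x\<^sup>m \<partial>\<^sub>y\<^sup>n f\<close>; symmetry of the second derivatives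
  moves a further \<open>\<partial>\<^sub>y\<close> past the \<open>\<partial>\<^sub>x\<^sup>m\<close>.
\<close>

lemma Ck_imp_smooth_on:
  assumes S: "open S" and f: "\<And>k. Ck k S f"
  shows "smooth_on S f"
proof -
  define F where "F m n = (px ^^ m) ((py ^^ n) f)" for m n
  have 1: "Ck k S ((py ^^ n) f)" for k n
  proof (induction n arbitrary: k)
    case (Suc n)
    from Suc[of "Suc k"] show ?case by simp
  qed (simp add: f)
  have 2: "Ck k S (F m n)" for k m n
    unfolding F_def
  proof (induction m arbitrary: k)
    case (Suc m)
    from Suc[of "Suc k"] show ?case by simp
  qed (simp add: 1)
  have 3: "py (F m n) z = F m (Suc n) z" if "z \<in> S" for m n z
    using that
  proof (induction m arbitrary: z)
    case (Suc m)
    have d: "F m n differentiable (at w)" "py (F m n) differentiable (at w)" if "w \<in> S" for w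
      using 2[of "Suc (Suc 0)" m n] that by auto
    have "py (px (F m n)) z = px (py (F m n)) z"
      using px_py_commute[OF S 2 Suc.prems] by simp
    also have "\<dots> = px (F m (Suc n)) z"
      using px_py_cong(2)[OF S Suc.prems Suc.IH d(2)[OF Suc.prems]] by simp
    finally show ?case by (simp add: F_def)
  qed (simp add: F_def)
  have "(F m n has_derivative
        (\<lambda>h. of_real (Re h) * F (Suc m) n z + of_real (Im h) * F m (Suc n) z)) (at z)" if "z \<in> S" for m n z
  proof -
    have "F m n differentiable (at z)" using 2[of "Suc 0" m n] that by auto
    from has_derivative_px_py[OF this] show ?thesis by (simp add: 3[OF that]) (simp add: F_def)
  qed
  then show ?thesis unfolding smooth_on_def
    by (intro exI[of _ F]) (simp add: F_def)
qed

lemma Ck_const: "Ck k S (\<lambda>_. c)"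
proof -
  have "Ck k UNIV (\<lambda>_. c)" by (intro Ck_holomorphic) auto
  then show ?thesis by (rule Ck_subset) simp
qed

lemma Ck_cmult: "open S \<Longrightarrow> Ck k S f \<Longrightarrow> Ck k S (\<lambda>z. c * f z)"
  by (intro Ck_mult Ck_const)

lemma Ck_diff:
  assumes "open S" "Ck k S f" "Ck k S g"
  shows "Ck k S (\<lambda>z. f z - g z)"
proof -
  have "Ck k S (\<lambda>z. f z + (- 1) * g z)" using assms by (intro Ck_add Ck_cmult)
  then show ?thesis by simp
qed

lemma px_py_diff:
  assumes "f differentiable (at z)" "g differentiable (at z)"
  shows "px (\<lambda>w. f w - g w) z = px f z - px g z"
    "py (\<lambda>w. f w - g w) z = py f z - py g z"
    "(\<lambda>w. f w - g w) differentiable (at z)"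
  using px_py_eqI[OF has_derivative_diff[OF assms[THEN has_derivative_px_py]]]
  by (auto intro: differentiable_diff assms)

lemma px_py_const: "px (\<lambda>_. c) z = 0" "py (\<lambda>_. c) z = 0"
  using px_py_field[OF DERIV_const[of c "at z"]] by auto

text \<open>
  The Cauchy-Riemann equation at a point makes the real derivative there complex linear.
\<close>

lemma complex_linear_imp_field_derivative:
  assumes "f differentiable (at z)" "py f z = \<i> * px f z"
  shows "(f has_field_derivative px f z) (at z)"
proof -
  have "(\<lambda>h. of_real (Re h) * px f z + of_real (Im h) * py f z) = (*) (px f z)"
  proof
    fix h
    have "px f z * h = px f z * (of_real (Re h) + \<i> * of_real (Im h))" by (simp only: complex_eq[symmetric])
    then show "of_real (Re h) * px f z + of_real (Im h) * py f z = px f z * h"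
      by (simp add: assms(2) algebra_simps)
  qed
  with has_derivative_px_py[OF assms(1)] show ?thesis by (simp add: has_field_derivative_def)
qed

section \<open>A radial bump function\<close>

text \<open>
  With \<open>t = 1/x\<close>, one has \<open>d/dx (q(t) e\<^sup>-\<^sup>t) = t\<^sup>2 (q(t) - q'(t)) e\<^sup>-\<^sup>t\<close>; so \<open>flat n\<close> below is the derivative of order \<open>n\<close>
  of the function that is \<open>exp (-1/x)\<close> for positive \<open>x\<close> and \<open>0\<close> otherwise.
\<close>

primrec flat_poly :: "nat \<Rightarrow> real poly" where
  "flat_poly 0 = 1"
| "flat_poly (Suc n) = monom 1 2 * (flat_poly n - pderiv (flat_poly n))"

definition flat :: "nat \<Rightarrow> real \<Rightarrow> real" where
  "flat n x = (if x \<le> 0 then 0 else poly (flat_poly n) (1 / x) * exp (- 1 / x))"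

lemma poly_exp_tendsto_0:
  fixes p :: "real poly"
  shows "((\<lambda>t. poly p t * exp (- t)) \<longlongrightarrow> 0) at_top"
proof -
  have "((\<lambda>t. \<Sum>i\<le>degree p. coeff p i * (t ^ i / exp t)) \<longlongrightarrow> (\<Sum>i\<le>degree p. coeff p i * 0)) at_top"
    by (intro tendsto_intros tendsto_power_div_exp_0)
  then show ?thesis
    by (simp add: poly_altdef sum_distrib_right exp_minus divide_inverse mult.assoc)
qed

lemma flat_has_derivative: "(flat n has_real_derivative flat (Suc n) x) (at x)"
proof (cases x "0 :: real" rule: linorder_cases)
  case less
  have "((\<lambda>_. 0) has_real_derivative 0) (at x)" by simp
  then have "(flat n has_real_derivative 0) (at x)"
    by (rule has_field_derivative_transform_within_open[of _ _ _ "{..<0}"]) (use less in \<open>auto simp: flat_def\<close>)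
  then show ?thesis using less by (simp add: flat_def)
next
  case greater
  have "((\<lambda>x. poly (flat_poly n) (1 / x) * exp (- 1 / x)) has_real_derivative flat (Suc n) x) (at x)"
    using greater by (auto intro!: derivative_eq_intros poly_DERIV[THEN DERIV_chain2] simp: flat_def poly_monom field_simps power2_eq_square)
  then show ?thesis
    by (rule has_field_derivative_transform_within_open[of _ _ _ "{0<..}"]) (use greater in \<open>auto simp: flat_def\<close>)
next
  \<comment> \<open>At \<open>0\<close> the difference quotient is \<open>t q(t) exp (-t)\<close> with \<open>t = 1/x\<close>, which tends to \<open>0\<close>.\<close>
  case equal
  have inv: "filterlim (\<lambda>x. 1 / x) at_top (at_right (0::real))"
    using filterlim_inverse_at_top_right by (simp add: inverse_eq_divide)
  have "((\<lambda>x. poly (pCons 0 (flat_poly n)) (1 / x) * exp (- (1 / x))) \<longlongrightarrow> 0) (at_right 0)"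
    by (rule filterlim_compose[OF poly_exp_tendsto_0 inv])
  then have "((\<lambda>h. flat n h / h) \<longlongrightarrow> 0) (at_right 0)"
    by (rule Lim_transform_eventually) (auto simp: eventually_at_right_field flat_def intro!: exI[of _ 1])
  moreover have "((\<lambda>h. flat n h / h) \<longlongrightarrow> 0) (at_left 0)"
    by (rule Lim_transform_eventually[OF tendsto_const]) (auto simp: eventually_at_left_field flat_def intro!: exI[of _ "-1"])
  ultimately have "((\<lambda>h. flat n h / h) \<longlongrightarrow> 0) (at 0)"
    by (simp add: filterlim_split_at)
  then show ?thesis using equal by (simp add: DERIV_def flat_def)
qed

text \<open>
  Let \<open>g = flat 0\<close>. As \<open>g (x - 1)\<close> increases from \<open>0\<close> to a limit larger than \<open>1/2\<close>, the composite
  \<open>g (1/2 - g (x - 1))\<close> is constant up to \<open>1\<close> and vanishes from some point on. Composing \<open>g\<close> with itself in this way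
  avoids a quotient of two functions and keeps the chain rule simple.
\<close>

definition step_fun :: "real \<Rightarrow> real" where
  "step_fun x = flat 0 (1/2 - flat 0 (x - 1)) / flat 0 (1/2)"

lemma flat_0: "flat 0 x = (if x \<le> 0 then 0 else exp (- 1 / x))" by (simp add: flat_def)

lemma step_fun_left: "x \<le> 1 \<Longrightarrow> step_fun x = 1" by (simp add: step_fun_def flat_0)

lemma step_fun_right:
  assumes "x \<ge> 3"
  shows "step_fun x = 0"
proof -
  have "exp (ln 2) = (2::real)" by simp
  \<comment> \<open>Here \<open>exp (-1/2) \<ge> 1/2\<close>, so the argument of the outer \<open>flat 0\<close> is not positive.\<close>
  have "- (1 / (x - 1)) \<ge> - (1 / 2)" using assms by (simp add: field_simps)
  moreover have "ln (1/2) \<le> - (1/2 :: real)" using ln_le_minus_one[of "1/2::real"] by simp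
  ultimately have "ln (1/2) \<le> - (1 / (x - 1))" by linarith
  then have "exp (ln (1/2)) \<le> exp (- (1 / (x - 1)))" by (subst exp_le_cancel_iff)
  then show ?thesis using assms by (simp add: step_fun_def flat_0)
qed

definition step_deriv :: "real \<Rightarrow> real" where
  "step_deriv x = - flat (Suc 0) (1/2 - flat 0 (x - 1)) * flat (Suc 0) (x - 1) / flat 0 (1/2)"

lemma step_fun_deriv: "(step_fun has_real_derivative step_deriv x) (at x)"
proof -
  have "flat 0 (1/2) \<noteq> 0" by (simp add: flat_0)
  then show ?thesis
    unfolding step_fun_def[abs_def] step_deriv_def
    by (auto intro!: derivative_eq_intros DERIV_chain2[OF flat_has_derivative])
qed

lemma step_deriv_continuous: "continuous_on A step_deriv"
proof -
  have "continuous_on UNIV (flat n)" for n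
    using flat_has_derivative DERIV_isCont by (intro continuous_at_imp_continuous_on) blast
  then have *: "continuous_on B (\<lambda>x. flat n (g x))" if "continuous_on B g" for B n and g :: "real \<Rightarrow> real"
    using that continuous_on_compose2 by blast
  show ?thesis unfolding step_deriv_def
    by (intro continuous_intros *) (simp_all add: flat_0)
qed

definition bump :: "real \<Rightarrow> complex \<Rightarrow> complex" where
  "bump s z = of_real (step_fun ((cmod z)\<^sup>2 / s\<^sup>2))"

lemma Ck_cmod2: "Ck k UNIV (\<lambda>z. of_real ((cmod z)\<^sup>2))"
proof -
  have k0: "Ck k UNIV (\<lambda>z. c)" for k c by (intro Ck_holomorphic) auto
  have "Ck (Suc k) UNIV (\<lambda>z. of_real (Re z))" for k
    by (rule Ck_SucI[OF open_UNIV k0[of _ 1] k0[of _ 0]]) (auto intro!: derivative_eq_intros)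
  moreover have "Ck (Suc k) UNIV (\<lambda>z. of_real (Im z))" for k
    by (rule Ck_SucI[OF open_UNIV k0[of _ 0] k0[of _ 1]]) (auto intro!: derivative_eq_intros)
  ultimately have "Ck k UNIV (\<lambda>z. of_real (Re z) * of_real (Re z) + of_real (Im z) * of_real (Im z))"
    using Ck_SucD by (intro Ck_add Ck_mult) blast+
  then show ?thesis by (rule Ck_cong[OF open_UNIV]) (simp only: cmod_power2, simp add: power2_eq_square)
qed

lemma Ck_bump: "Ck k UNIV (bump s)"
proof -
  have k0: "Ck k UNIV (\<lambda>z. c)" for k c by (intro Ck_holomorphic) auto
  have u1: "Ck k UNIV (\<lambda>z. of_real ((cmod z)\<^sup>2 / s\<^sup>2 - 1))" for k
  proof -
    have "Ck k UNIV (\<lambda>z. of_real ((cmod z)\<^sup>2) * (1 / of_real (s\<^sup>2)) + (- 1))"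
      by (intro Ck_add Ck_mult Ck_cmod2 k0) auto
    then show ?thesis by simp
  qed
  have f1: "Ck k UNIV (\<lambda>z. of_real (flat 0 ((cmod z)\<^sup>2 / s\<^sup>2 - 1)))" for k
    using Ck_compose_real[of UNIV flat, OF open_UNIV flat_has_derivative u1] .
  have u2: "Ck k UNIV (\<lambda>z. of_real (1/2 - flat 0 ((cmod z)\<^sup>2 / s\<^sup>2 - 1)))" for k
  proof -
    have "Ck k UNIV (\<lambda>z. (1/2) + (- 1) * of_real (flat 0 ((cmod z)\<^sup>2 / s\<^sup>2 - 1)))"
      by (intro Ck_add Ck_mult f1 k0) auto
    then show ?thesis by simp
  qed
  have "Ck k UNIV (\<lambda>z. of_real (flat 0 (1/2 - flat 0 ((cmod z)\<^sup>2 / s\<^sup>2 - 1))) * (1 / of_real (flat 0 (1/2))))"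
    by (intro Ck_mult k0 Ck_compose_real[of UNIV flat, OF open_UNIV flat_has_derivative u2]) auto
  then show ?thesis by (simp add: bump_def[abs_def] step_fun_def)
qed

lemma bump_eq_1: "s > 0 \<Longrightarrow> cmod z \<le> s \<Longrightarrow> bump s z = 1"
  unfolding bump_def by (subst step_fun_left) (auto simp: field_simps power_mono)

lemma bump_eq_0:
  assumes "s > 0" "cmod z \<ge> 2 * s"
  shows "bump s z = 0"
proof -
  have "(2 * s)\<^sup>2 \<le> (cmod z)\<^sup>2" using assms by (intro power_mono) auto
  then have "(cmod z)\<^sup>2 / s\<^sup>2 \<ge> 4" using assms by (simp add: field_simps)
  then show ?thesis by (simp add: bump_def step_fun_right)
qed

text \<open>
  For functions of \<open>|z|\<^sup>2\<close> the operator \<open>\<i> \<partial>\<^sub>x - \<partial>\<^sub>y\<close>, which is \<open>2\<i>\<close> times the Cauchy-Riemann operator, produces a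
  factor \<open>z\<close>. This factor cancels the pole of \<open>R/z\<close> when the residue is extracted.
\<close>

lemma bump_px_py:
  "\<i> * px (bump s) z - py (bump s) z = 2 * \<i> * z * of_real (step_deriv ((cmod z)\<^sup>2 / s\<^sup>2) / s\<^sup>2)"
proof -
  have 1: "((\<lambda>z. (cmod z)\<^sup>2 / s\<^sup>2) has_derivative (\<lambda>h. 2 * (Re z * Re h + Im z * Im h) / s\<^sup>2)) (at z)"
  proof -
    have "((\<lambda>z. ((Re z)\<^sup>2 + (Im z)\<^sup>2) * inverse (s\<^sup>2)) has_derivative (\<lambda>h. 2 * (Re z * Re h + Im z * Im h) * inverse (s\<^sup>2))) (at z)"
      by (auto intro!: derivative_eq_intros simp: algebra_simps)
    then show ?thesis by (simp only: cmod_power2 divide_inverse)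
  qed
  have "(step_fun has_derivative (\<lambda>x. step_deriv ((cmod z)\<^sup>2 / s\<^sup>2) * x)) (at ((cmod z)\<^sup>2 / s\<^sup>2))"
    using step_fun_deriv by (simp add: has_field_derivative_def)
  from has_derivative_compose[OF 1 this]
  have "(bump s has_derivative (\<lambda>h. complex_of_real (step_deriv ((cmod z)\<^sup>2 / s\<^sup>2) * (2 * (Re z * Re h + Im z * Im h) / s\<^sup>2)))) (at z)"
    unfolding bump_def[abs_def] by (rule has_derivative_of_real)
  from px_py_eqI[OF this] show ?thesis
    by (simp add: complex_eq_iff)
qed

section \<open>Area integrals on the torus\<close>

lemma distr_Complex_lborel:
  "distr (lborel \<Otimes>\<^sub>M lborel) borel (\<lambda>(x, y). Complex x y) = (lborel :: complex measure)"
proof (rule lborel_eqI[symmetric])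
  have m: "(\<lambda>(x, y). Complex x y) \<in> borel_measurable (lborel \<Otimes>\<^sub>M lborel)"
  proof -
    have "(\<lambda>p::real \<times> real. of_real (fst p) + \<i> * of_real (snd p)) \<in> borel_measurable (lborel \<Otimes>\<^sub>M lborel)"
      by measurable
    then show ?thesis by (simp add: Complex_eq case_prod_beta)
  qed
  fix l u :: complex assume lu: "\<And>b. b \<in> Basis \<Longrightarrow> l \<bullet> b \<le> u \<bullet> b"
  have "(\<lambda>(x, y). Complex x y) -` box l u = {Re l<..<Re u} \<times> {Im l<..<Im u}"
    by (auto simp: in_box_complex_iff)
  then have "emeasure (distr (lborel \<Otimes>\<^sub>M lborel) borel (\<lambda>(x, y). Complex x y)) (box l u)
    = emeasure (lborel \<Otimes>\<^sub>M lborel) ({Re l<..<Re u} \<times> {Im l<..<Im u})"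
    using m by (subst emeasure_distr) (auto simp: space_pair_measure)
  also have "\<dots> = emeasure lborel {Re l<..<Re u} * emeasure lborel {Im l<..<Im u}"
    by (rule lborel.emeasure_pair_measure_Times) auto
  also have "\<dots> = ennreal ((Re u - Re l) * (Im u - Im l))"
    using lu[of 1] lu[of \<i>] by (simp add: Basis_complex_def ennreal_mult)
  finally show "emeasure (distr (lborel \<Otimes>\<^sub>M lborel) borel (\<lambda>(x, y). Complex x y)) (box l u)
      = ennreal (\<Prod>b\<in>Basis. (u - l) \<bullet> b)"
    by (simp add: Basis_complex_def)
qed simp

text \<open>
  For fixed \<open>t\<close> the substitution \<open>x = s + t Re \<tau>\<close> is a translation, so Fubini's theorem together with the scaling
  \<open>y = t Im \<tau>\<close> replaces a two-dimensional change of variables.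
\<close>

lemma integral_skew_coordinates:
  fixes H :: "complex \<Rightarrow> complex"
  assumes H: "integrable lborel H" and \<tau>: "Im \<tau> > 0"
  shows "(\<integral>u. H u \<partial>lborel) = Im \<tau> *\<^sub>R (\<integral>t. (\<integral>s. H (of_real s + of_real t * \<tau>) \<partial>lborel) \<partial>lborel)"
proof -
  have m: "(\<lambda>(x, y). Complex x y) \<in> borel_measurable (lborel \<Otimes>\<^sub>M lborel)"
  proof -
    have "(\<lambda>p::real \<times> real. of_real (fst p) + \<i> * of_real (snd p)) \<in> borel_measurable (lborel \<Otimes>\<^sub>M lborel)"
      by measurable
    then show ?thesis by (simp add: Complex_eq case_prod_beta)
  qed
  have Hm: "H \<in> borel_measurable borel" using borel_measurable_integrable[OF H] by simp
  have i: "integrable (lborel \<Otimes>\<^sub>M lborel) (\<lambda>(x, y). H (Complex x y))"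
  proof -
    have "integrable (distr (lborel \<Otimes>\<^sub>M lborel) borel (\<lambda>(x, y). Complex x y)) H"
      using H by (simp add: distr_Complex_lborel)
    then show ?thesis by (subst (asm) integrable_distr_eq[OF m Hm]) (simp add: case_prod_unfold)
  qed
  have "(\<integral>u. H u \<partial>lborel) = (\<integral>u. H u \<partial>(distr (lborel \<Otimes>\<^sub>M lborel) borel (\<lambda>(x, y). Complex x y)))"
    by (simp add: distr_Complex_lborel)
  also have "\<dots> = (\<integral>p. (case p of (x, y) \<Rightarrow> H (Complex x y)) \<partial>(lborel \<Otimes>\<^sub>M lborel))"
    by (subst integral_distr[OF m Hm]) (simp add: case_prod_unfold)
  also have "\<dots> = (\<integral>y. (\<integral>x. H (Complex x y) \<partial>lborel) \<partial>lborel)"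
    by (rule lborel_pair.integral_snd[OF i, symmetric])
  also have "\<dots> = Im \<tau> *\<^sub>R (\<integral>t. (\<integral>x. H (Complex x (Im \<tau> * t)) \<partial>lborel) \<partial>lborel)"
    using \<tau> by (subst lborel_integral_real_affine[where c = "Im \<tau>" and t = 0]) auto
  also have "(\<lambda>t. \<integral>x. H (Complex x (Im \<tau> * t)) \<partial>lborel) = (\<lambda>t. \<integral>s. H (of_real s + of_real t * \<tau>) \<partial>lborel)"
  proof
    fix t
    show "(\<integral>x. H (Complex x (Im \<tau> * t)) \<partial>lborel) = (\<integral>s. H (of_real s + of_real t * \<tau>) \<partial>lborel)"
    proof -
      have *: "Complex (t * Re \<tau> + x) (Im \<tau> * t) = of_real x + of_real t * \<tau>" for x
        by (simp add: complex_eq_iff)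
      show ?thesis
      by (subst lborel_integral_real_affine[where c = 1 and t = "t * Re \<tau>"])
        (simp_all add: *)
    qed
  qed
  finally show ?thesis .
qed

text \<open>
  The real coordinates of \<open>z = s + t \<tau>\<close>.
\<close>

definition coord_t :: "complex \<Rightarrow> complex \<Rightarrow> real" where "coord_t \<tau> z = Im z / Im \<tau>"
definition coord_s :: "complex \<Rightarrow> complex \<Rightarrow> real" where "coord_s \<tau> z = Re z - Im z / Im \<tau> * Re \<tau>"

definition cell :: "complex \<Rightarrow> real \<Rightarrow> real \<Rightarrow> complex set" where
  "cell \<tau> a b = {z. a \<le> coord_s \<tau> z \<and> coord_s \<tau> z < a + 1 \<and> b \<le> coord_t \<tau> z \<and> coord_t \<tau> z < b + 1}"

text \<open>
  The area integral over a cell in the coordinates \<open>s + t \<tau>\<close>, without the Jacobian \<open>Im \<tau>\<close>; see \<open>set_integral_cell\<close>.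
\<close>

definition cell_int :: "complex \<Rightarrow> real \<Rightarrow> real \<Rightarrow> (complex \<Rightarrow> complex) \<Rightarrow> complex" where
  "cell_int \<tau> a b F = integral {b..b+1} (\<lambda>t. integral {a..a+1} (\<lambda>s. F (of_real s + of_real t * \<tau>)))"

lemma coord_simps:
  assumes "Im \<tau> > 0"
  shows "coord_s \<tau> (of_real s + of_real t * \<tau>) = s" "coord_t \<tau> (of_real s + of_real t * \<tau>) = t"
    "of_real (coord_s \<tau> z) + of_real (coord_t \<tau> z) * \<tau> = z"
  using assms by (auto simp: coord_s_def coord_t_def complex_eq_iff)

lemma coord_add:
  "coord_s \<tau> (z + w) = coord_s \<tau> z + coord_s \<tau> w" "coord_t \<tau> (z + w) = coord_t \<tau> z + coord_t \<tau> w"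
  "coord_s \<tau> (z - w) = coord_s \<tau> z - coord_s \<tau> w" "coord_t \<tau> (z - w) = coord_t \<tau> z - coord_t \<tau> w"
  by (simp_all add: coord_s_def coord_t_def algebra_simps add_divide_distrib diff_divide_distrib)

lemma fund_parallelogram_cell:
  assumes "Im \<tau> > 0"
  shows "fund_parallelogram \<tau> = cell \<tau> 0 0"
proof (intro set_eqI iffI)
  fix z assume "z \<in> cell \<tau> 0 0"
  then show "z \<in> fund_parallelogram \<tau>"
    unfolding fund_parallelogram_def cell_def
    using coord_simps(3)[OF assms, of z] by (intro CollectI exI[of _ "coord_s \<tau> z"] exI[of _ "coord_t \<tau> z"]) auto
next
  fix z assume "z \<in> fund_parallelogram \<tau>"
  then show "z \<in> cell \<tau> 0 0"
    unfolding fund_parallelogram_def cell_def by (auto simp: coord_simps[OF assms])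
qed

lemma cell_borel [measurable]: "cell \<tau> a b \<in> sets borel"
proof -
  have [measurable]: "coord_s \<tau> \<in> borel_measurable borel" "coord_t \<tau> \<in> borel_measurable borel"
    unfolding coord_s_def[abs_def] coord_t_def[abs_def] by measurable
  show ?thesis unfolding cell_def by measurable
qed

lemma compact_closed_cell:
  assumes "Im \<tau> > 0"
  shows "compact {z. a \<le> coord_s \<tau> z \<and> coord_s \<tau> z \<le> a + 1 \<and> b \<le> coord_t \<tau> z \<and> coord_t \<tau> z \<le> b + 1}" (is "compact ?K")
proof -
  have "?K = (\<lambda>p. of_real (fst p) + of_real (snd p) * \<tau>) ` ({a..a+1} \<times> {b..b+1})"
  proof (intro set_eqI iffI)
    fix z assume "z \<in> ?K"
    then show "z \<in> (\<lambda>p. of_real (fst p) + of_real (snd p) * \<tau>) ` ({a..a+1} \<times> {b..b+1})"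
      using coord_simps(3)[OF assms, of z] by (intro image_eqI[of _ _ "(coord_s \<tau> z, coord_t \<tau> z)"]) auto
  qed (auto simp: coord_simps[OF assms])
  moreover have "compact ((\<lambda>p. of_real (fst p) + of_real (snd p) * \<tau>) ` ({a..a+1} \<times> {b..b+1}))"
    by (intro compact_continuous_image compact_Times continuous_intros) auto
  ultimately show ?thesis by simp
qed

lemma set_integrable_cell:
  fixes F :: "complex \<Rightarrow> complex"
  assumes "Im \<tau> > 0" "continuous_on UNIV F"
  shows "set_integrable lborel (cell \<tau> a b) F"
proof -
  let ?K = "{z. a \<le> coord_s \<tau> z \<and> coord_s \<tau> z \<le> a + 1 \<and> b \<le> coord_t \<tau> z \<and> coord_t \<tau> z \<le> b + 1}"
  have "set_integrable lborel ?K F"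
    unfolding set_integrable_def
    using compact_closed_cell[OF assms(1)] continuous_on_subset[OF assms(2)]
    by (intro borel_integrable_compact) auto
  then show ?thesis
    by (rule set_integrable_subset) (auto simp: cell_def[symmetric], auto simp: cell_def)
qed

lemma set_integral_Ico_eq_integral:
  fixes f :: "real \<Rightarrow> complex"
  assumes "continuous_on {a..b} f"
  shows "(LINT x:{a..<b}|lborel. f x) = integral {a..b} f"
proof -
  have "set_integrable lborel {a..b} f" by (rule borel_integrable_atLeastAtMost'[OF assms])
  then have "(LINT x:{a..<b}|lborel. f x) = integral {a..<b} f"
    by (intro set_borel_integral_eq_integral(2) set_integrable_subset[of lborel "{a..b}" f "{a..<b}"]) auto
  also have "\<dots> = integral {a..b} f"
  proof (rule integral_spike_set)
    show "negligible {x \<in> {a..<b} - {a..b}. f x \<noteq> 0}" by (rule negligible_subset[of "{}"]) auto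
    show "negligible {x \<in> {a..b} - {a..<b}. f x \<noteq> 0}" by (rule negligible_subset[of "{b}"]) auto
  qed
  finally show ?thesis .
qed

lemma continuous_inner_integral:
  fixes F :: "complex \<Rightarrow> complex"
  assumes "continuous_on UNIV F"
  shows "continuous_on A (\<lambda>t. integral {a..b} (\<lambda>s. F (of_real s + of_real t * \<tau>)))"
proof -
  have "continuous_on (A \<times> cbox a b) (\<lambda>(t, s). F (of_real s + of_real t * \<tau>))"
    unfolding case_prod_beta by (intro continuous_on_compose2[OF assms] continuous_intros) auto
  from integral_continuous_on_param[OF this] show ?thesis by simp
qed

lemma set_integral_cell:
  fixes F :: "complex \<Rightarrow> complex"
  assumes \<tau>: "Im \<tau> > 0" and F: "continuous_on UNIV F"
  shows "(LINT u:cell \<tau> a b|lborel. F u) = Im \<tau> * cell_int \<tau> a b F"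
proof -
  have "(LINT u:cell \<tau> a b|lborel. F u)
      = Im \<tau> *\<^sub>R (\<integral>t. (\<integral>s. indicator (cell \<tau> a b) (of_real s + of_real t * \<tau>) *\<^sub>R F (of_real s + of_real t * \<tau>) \<partial>lborel) \<partial>lborel)"
    unfolding set_lebesgue_integral_def
    by (rule integral_skew_coordinates[OF set_integrable_cell[OF assms, unfolded set_integrable_def] \<tau>])
  also have "(\<lambda>t. \<integral>s. indicator (cell \<tau> a b) (of_real s + of_real t * \<tau>) *\<^sub>R F (of_real s + of_real t * \<tau>) \<partial>lborel)
    = (\<lambda>t. indicator {b..<b+1} t *\<^sub>R integral {a..a+1} (\<lambda>s. F (of_real s + of_real t * \<tau>)))"
  proof
    fix t
    have "(\<integral>s. indicator (cell \<tau> a b) (of_real s + of_real t * \<tau>) *\<^sub>R F (of_real s + of_real t * \<tau>) \<partial>lborel)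
      = (\<integral>s. indicator {b..<b+1} t *\<^sub>R (indicator {a..<a+1} s *\<^sub>R F (of_real s + of_real t * \<tau>)) \<partial>lborel)"
      by (rule Bochner_Integration.integral_cong) (auto simp: cell_def coord_simps[OF \<tau>] indicator_def)
    also have "\<dots> = indicator {b..<b+1} t *\<^sub>R (LINT s:{a..<a+1}|lborel. F (of_real s + of_real t * \<tau>))"
      unfolding set_lebesgue_integral_def by (cases "t \<in> {b..<b+1}") simp_all
    also have "(LINT s:{a..<a+1}|lborel. F (of_real s + of_real t * \<tau>)) = integral {a..a+1} (\<lambda>s. F (of_real s + of_real t * \<tau>))"
      by (intro set_integral_Ico_eq_integral continuous_on_compose2[OF F] continuous_intros) auto
    finally show "(\<integral>s. indicator (cell \<tau> a b) (of_real s + of_real t * \<tau>) *\<^sub>R F (of_real s + of_real t * \<tau>) \<partial>lborel) =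
      indicator {b..<b+1} t *\<^sub>R integral {a..a+1} (\<lambda>s. F (of_real s + of_real t * \<tau>))" .
  qed
  also have "(\<integral>t. indicator {b..<b+1} t *\<^sub>R integral {a..a+1} (\<lambda>s. F (of_real s + of_real t * \<tau>)) \<partial>lborel) = cell_int \<tau> a b F"
    using set_integral_Ico_eq_integral[OF continuous_inner_integral[OF F]]
    unfolding cell_int_def set_lebesgue_integral_def by blast
  finally show ?thesis by (simp add: scaleR_conv_of_real)
qed

text \<open>
  The derivative of \<open>\<integral>\<^bsub>x\<^esub>\<^bsup>x+1\<^esup> f\<close> with respect to \<open>x\<close> is \<open>f (x + 1) - f x = 0\<close>.
\<close>

lemma integral_period_shift:
  fixes f :: "real \<Rightarrow> complex"
  assumes c: "continuous_on UNIV f" and p: "\<And>x. f (x + 1) = f x"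
  shows "integral {a..a+1} f = integral {0..1} f"
proof -
  define K where "K = \<bar>a\<bar> + 3"
  define \<Phi> where "\<Phi> x = integral {-K..x} f" for x
  have i: "f integrable_on {x..y}" for x y
    by (intro integrable_continuous_interval continuous_on_subset[OF c]) auto
  have \<Phi>: "(\<Phi> has_vector_derivative f x) (at x)" if "x \<in> {-K<..<K}" for x
  proof -
    have "(\<Phi> has_vector_derivative f x) (at x within {-K..K})"
      unfolding \<Phi>_def using that by (intro integral_has_vector_derivative continuous_on_subset[OF c]) auto
    then show ?thesis using that by (simp add: at_within_Icc_at)
  qed
  define S where "S = {-K<..<K-1}"
  have "((\<lambda>x. \<Phi> (x + 1) - \<Phi> x) has_derivative (\<lambda>h. 0)) (at x within S)" if "x \<in> S" for x
  proof -
    have "((\<lambda>x. \<Phi> (x + 1)) has_vector_derivative f (x + 1)) (at x)"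
    proof -
      have "((\<lambda>x. x + 1) has_vector_derivative 1) (at x)"
        by (auto intro!: derivative_eq_intros)
      from vector_diff_chain_at[OF this, of \<Phi> "f (x + 1)"] \<Phi>[of "x + 1"] that show ?thesis
        by (simp add: o_def S_def)
    qed
    then have "((\<lambda>x. \<Phi> (x + 1) - \<Phi> x) has_vector_derivative f (x + 1) - f x) (at x)"
      using \<Phi>[of x] that by (intro has_vector_derivative_diff) (auto simp: S_def)
    then show ?thesis by (simp add: p has_vector_derivative_def has_derivative_at_withinI)
  qed
  then obtain k where k: "\<And>x. x \<in> S \<Longrightarrow> \<Phi> (x + 1) - \<Phi> x = k"
    using has_derivative_zero_constant[of S "\<lambda>x. \<Phi> (x + 1) - \<Phi> x"] by (auto simp: S_def)
  have "integral {x..x+1} f = \<Phi> (x + 1) - \<Phi> x" if "x \<in> S" for x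
    using Henstock_Kurzweil_Integration.integral_combine[of "-K" x "x+1" f] i that by (simp add: \<Phi>_def S_def algebra_simps)
  then have "integral {x..x+1} f = k" if "x \<in> S" for x using k that by simp
  moreover have "a \<in> S" "0 \<in> S" by (auto simp: S_def K_def abs_if)
  ultimately show ?thesis by force
qed

text \<open>
  This freedom is used to choose a fundamental cell whose boundary avoids the half lattice.
\<close>

lemma cell_int_shift:
  assumes F: "continuous_on UNIV F" and p: "\<And>u. F (u + 1) = F u" "\<And>u. F (u + \<tau>) = F u"
  shows "cell_int \<tau> a b F = cell_int \<tau> 0 0 F"
proof -
  have c: "continuous_on UNIV (\<lambda>s. F (of_real s + of_real t * \<tau>))" for t
    by (intro continuous_on_compose2[OF F] continuous_intros) auto
  have "integral {a..a+1} (\<lambda>s. F (of_real s + of_real t * \<tau>)) = integral {0..1} (\<lambda>s. F (of_real s + of_real t * \<tau>))" for t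
    using p(1)[of "of_real _ + of_real t * \<tau>"]
    by (intro integral_period_shift c) (simp add: add_ac)
  moreover have "integral {b..b+1} (\<lambda>t. integral {0..1} (\<lambda>s. F (of_real s + of_real t * \<tau>)))
    = integral {0..1} (\<lambda>t. integral {0..1} (\<lambda>s. F (of_real s + of_real t * \<tau>)))"
    using p(2)[of "of_real _ + of_real _ * \<tau>"]
    by (intro integral_period_shift continuous_inner_integral F) (simp add: algebra_simps)
  ultimately show ?thesis by (simp add: cell_int_def)
qed

text \<open>
  In the directions \<open>1\<close> and \<open>\<tau>\<close> of the periods the derivative of \<open>F\<close> integrates to zero over a period; the derivative
  \<open>py F\<close> is a linear combination of these two directional derivatives.
\<close>

lemma Stokes_torus:
  assumes \<tau>: "Im \<tau> > 0" and F: "Ck 1 UNIV F" and p: "\<And>u. F (u + 1) = F u" "\<And>u. F (u + \<tau>) = F u"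
  shows "cell_int \<tau> 0 0 (px F) = 0" "cell_int \<tau> 0 0 (py F) = 0"
proof -
  have d: "(F has_derivative (\<lambda>h. of_real (Re h) * px F u + of_real (Im h) * py F u)) (at u)" for u
    using F by (intro has_derivative_px_py) auto
  have c: "continuous_on UNIV (px F)" "continuous_on UNIV (py F)" using F by auto
  have 1: "integral {0..1} (\<lambda>s. px F (of_real s + of_real t * \<tau>)) = 0" for t
  proof -
    have "((\<lambda>s. F (of_real s + of_real t * \<tau>)) has_vector_derivative px F (of_real s + of_real t * \<tau>)) (at s within {0..1})" for s
    proof -
      have "((\<lambda>s. of_real s + of_real t * \<tau>) has_derivative (\<lambda>h. of_real h)) (at s within {0..1})"
        by (auto intro!: derivative_eq_intros)
      from has_derivative_compose[OF this d] show ?thesis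
        by (simp add: has_vector_derivative_def scaleR_conv_of_real)
    qed
    from fundamental_theorem_of_calculus[OF _ this]
    have "((\<lambda>s. px F (of_real s + of_real t * \<tau>)) has_integral 0) {0..1}"
      using p(1)[of "of_real t * \<tau>"] by (force simp: add.commute)
    then show ?thesis by (rule integral_unique)
  qed
  then show px0: "cell_int \<tau> 0 0 (px F) = 0" by (simp add: cell_int_def)
  define G where "G u = of_real (Re \<tau>) * px F u + of_real (Im \<tau>) * py F u" for u
  have cG: "continuous_on UNIV G" unfolding G_def by (intro continuous_intros c)
  have 2: "integral {0..1} (\<lambda>t. G (of_real s + of_real t * \<tau>)) = 0" for s
  proof -
    have "((\<lambda>t. F (of_real s + of_real t * \<tau>)) has_vector_derivative G (of_real s + of_real t * \<tau>)) (at t within {0..1})" for t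
    proof -
      have "((\<lambda>t. of_real s + of_real t * \<tau>) has_derivative (\<lambda>h. of_real h * \<tau>)) (at t within {0..1})"
        by (auto intro!: derivative_eq_intros)
      from has_derivative_compose[OF this d] show ?thesis
        by (simp add: has_vector_derivative_def scaleR_conv_of_real G_def algebra_simps)
    qed
    from fundamental_theorem_of_calculus[OF _ this]
    have "((\<lambda>t. G (of_real s + of_real t * \<tau>)) has_integral 0) {0..1}"
      using p(2)[of "of_real s"] by force
    then show ?thesis by (rule integral_unique)
  qed
  have "cell_int \<tau> 0 0 G = integral {0..1} (\<lambda>s. integral {0..1} (\<lambda>t. G (of_real s + of_real t * \<tau>)))"
  proof -
    have "continuous_on (cbox (0::real, 0::real) (1, 1)) (\<lambda>(t, s). G (of_real s + of_real t * \<tau>))"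
      unfolding case_prod_beta by (intro continuous_on_compose2[OF cG] continuous_intros) auto
    from integral_swap_continuous[OF this] show ?thesis by (simp add: cell_int_def)
  qed
  then have "cell_int \<tau> 0 0 G = 0" by (simp add: 2)
  moreover have "cell_int \<tau> 0 0 G = of_real (Re \<tau>) * cell_int \<tau> 0 0 (px F) + of_real (Im \<tau>) * cell_int \<tau> 0 0 (py F)"
  proof -
    have "(LINT u:cell \<tau> 0 0|lborel. G u) = of_real (Re \<tau>) * (LINT u:cell \<tau> 0 0|lborel. px F u) + of_real (Im \<tau>) * (LINT u:cell \<tau> 0 0|lborel. py F u)"
      unfolding G_def using set_integrable_cell[OF \<tau> c(1)] set_integrable_cell[OF \<tau> c(2)]
      by (subst set_integral_add) (auto intro!: set_integrable_mult_right)
    then have "of_real (Im \<tau>) * cell_int \<tau> 0 0 G = of_real (Im \<tau>) * (of_real (Re \<tau>) * cell_int \<tau> 0 0 (px F) + of_real (Im \<tau>) * cell_int \<tau> 0 0 (py F))"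
      by (simp add: set_integral_cell[OF \<tau>] cG c algebra_simps)
    then show ?thesis using \<tau> by simp
  qed
  ultimately show "cell_int \<tau> 0 0 (py F) = 0" using \<tau> px0 by simp
qed

section \<open>The half lattice and periodised functions\<close>

text \<open>
  The preimage of \<open>D\<close>, which by \<open>mem_half_lattice_iff\<close> consists of the halves of lattice vectors.
\<close>

definition half_lattice :: "complex \<Rightarrow> complex set" where "half_lattice \<tau> = - M\<^sub>C \<tau>"

lemma mem_half_lattice_iff: "p \<in> half_lattice \<tau> \<longleftrightarrow> (\<exists>m n :: int. p = of_int m / 2 + of_int n / 2 * \<tau>)"
proof
  assume "p \<in> half_lattice \<tau>"
  then obtain d m n where d: "d \<in> {0, 1/2, (1 + \<tau>)/2, \<tau>/2}" and p: "p = d + (of_int m + of_int n * \<tau>)"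
    unfolding half_lattice_def M\<^sub>C_def lattice_def by auto
  from d consider "d = 0" | "d = 1/2" | "d = (1+\<tau>)/2" | "d = \<tau>/2" by blast
  then show "\<exists>m n :: int. p = of_int m / 2 + of_int n / 2 * \<tau>"
  proof cases
    case 1 show ?thesis unfolding p 1 by (rule exI[of _ "2 * m"], rule exI[of _ "2 * n"]) (simp add: field_simps)
  next
    case 2 show ?thesis unfolding p 2 by (rule exI[of _ "2 * m + 1"], rule exI[of _ "2 * n"]) (simp add: field_simps)
  next
    case 3 show ?thesis unfolding p 3 by (rule exI[of _ "2 * m + 1"], rule exI[of _ "2 * n + 1"]) (simp add: field_simps)
  next
    case 4 show ?thesis unfolding p 4 by (rule exI[of _ "2 * m"], rule exI[of _ "2 * n + 1"]) (simp add: field_simps)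
  qed
next
  assume "\<exists>m n :: int. p = of_int m / 2 + of_int n / 2 * \<tau>"
  then obtain m n :: int where p: "p = of_int m / 2 + of_int n / 2 * \<tau>" by blast
  have e: "p = (of_int (m mod 2) / 2 + of_int (n mod 2) / 2 * \<tau>) + (of_int (m div 2) + of_int (n div 2) * \<tau>)"
  proof -
    have "(of_int m :: complex) = of_int (2 * (m div 2) + m mod 2)" "(of_int n :: complex) = of_int (2 * (n div 2) + n mod 2)"
      by simp_all
    then have "(of_int m :: complex) = 2 * of_int (m div 2) + of_int (m mod 2)"
      "(of_int n :: complex) = 2 * of_int (n div 2) + of_int (n mod 2)"
      by (simp_all only: of_int_add of_int_mult of_int_numeral)
    then show ?thesis unfolding p by (simp only:) (simp add: field_simps)
  qed
  have "m mod 2 = 0 \<or> m mod 2 = 1" "n mod 2 = 0 \<or> n mod 2 = 1" by presburger+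
  then have "of_int (m mod 2) / 2 + of_int (n mod 2) / 2 * \<tau> \<in> {0, 1/2, (1 + \<tau>)/2, \<tau>/2}"
    by (auto simp: add_divide_distrib)
  then show "p \<in> half_lattice \<tau>" unfolding half_lattice_def M\<^sub>C_def lattice_def using e by blast
qed

lemma half_lattice_add: "l \<in> lattice \<tau> \<Longrightarrow> u + l \<in> half_lattice \<tau> \<longleftrightarrow> u \<in> half_lattice \<tau>"
proof -
  have *: "u + l \<in> half_lattice \<tau>" if "u \<in> half_lattice \<tau>" "l \<in> lattice \<tau>" for u l
  proof -
    obtain m n :: int where u: "u = of_int m / 2 + of_int n / 2 * \<tau>" using \<open>u \<in> half_lattice \<tau>\<close> mem_half_lattice_iff by blast
    obtain a b :: int where l: "l = of_int a + of_int b * \<tau>" using \<open>l \<in> lattice \<tau>\<close> lattice_def by auto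
    show ?thesis unfolding mem_half_lattice_iff u l
      by (intro exI[of _ "m + 2 * a"] exI[of _ "n + 2 * b"]) (simp add: field_simps)
  qed
  assume l: "l \<in> lattice \<tau>"
  have "- l \<in> lattice \<tau>"
  proof -
    obtain a b :: int where "l = of_int a + of_int b * \<tau>" using l lattice_def by auto
    then show ?thesis unfolding lattice_def by (intro CollectI exI[of _ "-a"] exI[of _ "-b"]) simp
  qed
  then show "u + l \<in> half_lattice \<tau> \<longleftrightarrow> u \<in> half_lattice \<tau>" using *[OF _ l, of u] *[of "u + l" "-l"] by auto
qed

lemma one_tau_lattice: "1 \<in> lattice \<tau>" "\<tau> \<in> lattice \<tau>" "0 \<in> lattice \<tau>"
proof -
  show "1 \<in> lattice \<tau>" unfolding lattice_def by (intro CollectI exI[of _ 1] exI[of _ 0]) simp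
  show "\<tau> \<in> lattice \<tau>" unfolding lattice_def by (intro CollectI exI[of _ 0] exI[of _ 1]) simp
  show "0 \<in> lattice \<tau>" unfolding lattice_def by (intro CollectI exI[of _ 0] exI[of _ 0]) simp
qed

lemma M_iff: "u \<in> M\<^sub>C \<tau> \<longleftrightarrow> u \<notin> half_lattice \<tau>" by (simp add: half_lattice_def)

text \<open>
  A number that forces both coordinates of every shorter vector to be less than \<open>1/8\<close>, while different
  half-lattice points differ by at least \<open>1/2\<close> in one of them. So discs of this radius around half-lattice points are disjoint and stay away from
  the boundary of the cell that is shifted by \<open>-1/4\<close>.
\<close>

definition sep_radius :: "complex \<Rightarrow> real" where "sep_radius \<tau> = Im \<tau> / (8 * (1 + Im \<tau> + \<bar>Re \<tau>\<bar>))"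

lemma sep_radius_pos: "Im \<tau> > 0 \<Longrightarrow> sep_radius \<tau> > 0" by (simp add: sep_radius_def)

lemma small_coordinates:
  assumes \<tau>: "Im \<tau> > 0" and z: "cmod z < sep_radius \<tau>"
  shows "\<bar>coord_s \<tau> z\<bar> < 1/8" "\<bar>coord_t \<tau> z\<bar> < 1/8"
proof -
  let ?d = "1 + Im \<tau> + \<bar>Re \<tau>\<bar>"
  have im: "\<bar>Im z\<bar> < sep_radius \<tau>" and re: "\<bar>Re z\<bar> < sep_radius \<tau>"
    using z abs_Im_le_cmod[of z] abs_Re_le_cmod[of z] by linarith+
  have "\<bar>coord_t \<tau> z\<bar> < sep_radius \<tau> / Im \<tau>"
    using im \<tau> by (simp add: coord_t_def abs_divide divide_strict_right_mono)
  also have "\<dots> = 1 / (8 * ?d)" using \<tau> by (simp add: sep_radius_def)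
  finally have t: "\<bar>coord_t \<tau> z\<bar> < 1 / (8 * ?d)" .
  have "1 / (8 * ?d) \<le> 1 / 8" using \<tau> by (intro divide_left_mono) auto
  with t show "\<bar>coord_t \<tau> z\<bar> < 1/8" by linarith
  have "\<bar>coord_s \<tau> z\<bar> \<le> \<bar>Re z\<bar> + \<bar>coord_t \<tau> z\<bar> * \<bar>Re \<tau>\<bar>"
    unfolding coord_s_def coord_t_def by (metis abs_mult abs_triangle_ineq4)
  also have "\<dots> < Im \<tau> / (8 * ?d) + 1 / (8 * ?d) * \<bar>Re \<tau>\<bar>"
    using re t by (intro add_less_le_mono mult_right_mono) (auto simp: sep_radius_def)
  also have "\<dots> = (Im \<tau> + \<bar>Re \<tau>\<bar>) / (8 * ?d)" using \<tau> by (simp add: add_divide_distrib)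
  also have "\<dots> \<le> 1 / 8" using \<tau> by (simp add: field_simps)
  finally show "\<bar>coord_s \<tau> z\<bar> < 1/8" .
qed

lemma half_lattice_coordinates:
  assumes "Im \<tau> > 0" "p \<in> half_lattice \<tau>"
  obtains m n :: int where "coord_s \<tau> p = of_int m / 2" "coord_t \<tau> p = of_int n / 2"
proof -
  obtain m n :: int where p: "p = of_int m / 2 + of_int n / 2 * \<tau>" using assms mem_half_lattice_iff by blast
  have "p = of_real (of_int m / 2) + of_real (of_int n / 2) * \<tau>" by (simp add: p)
  then show ?thesis using that[of m n] coord_simps[OF assms(1)] by metis
qed

lemma half_lattice_separated:
  assumes \<tau>: "Im \<tau> > 0" and p: "p \<in> half_lattice \<tau>" "q \<in> half_lattice \<tau>" and u: "cmod (u - p) < sep_radius \<tau>" "cmod (u - q) < sep_radius \<tau>"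
  shows "p = q"
proof -
  obtain m n where m: "coord_s \<tau> p = of_int m / 2" "coord_t \<tau> p = of_int n / 2" using half_lattice_coordinates[OF \<tau> p(1)] .
  obtain m' n' where m': "coord_s \<tau> q = of_int m' / 2" "coord_t \<tau> q = of_int n' / 2" using half_lattice_coordinates[OF \<tau> p(2)] .
  note small_coordinates[OF \<tau> u(1)] small_coordinates[OF \<tau> u(2)]
  then have "\<bar>coord_s \<tau> p - coord_s \<tau> q\<bar> < 1/2" "\<bar>coord_t \<tau> p - coord_t \<tau> q\<bar> < 1/2" unfolding coord_add by linarith+
  then have "\<bar>of_int (m - m') :: real\<bar> < 1" "\<bar>of_int (n - n') :: real\<bar> < 1" unfolding m m' of_int_diff by linarith+
  then have "m = m'" "n = n'" by linarith+
  then show "p = q" using coord_simps(3)[OF \<tau>, of p] coord_simps(3)[OF \<tau>, of q] m m' by simp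
qed

lemma open_M:
  assumes "Im \<tau> > 0"
  shows "open (M\<^sub>C \<tau>)"
proof -
  have "closed (half_lattice \<tau>)"
  proof (rule discrete_imp_closed[of "sep_radius \<tau>"])
    show "\<forall>x\<in>half_lattice \<tau>. \<forall>y\<in>half_lattice \<tau>. dist y x < sep_radius \<tau> \<longrightarrow> y = x"
      using half_lattice_separated[OF assms] sep_radius_pos[OF assms] by (metis dist_norm norm_zero right_minus_eq)
  qed (rule sep_radius_pos[OF assms])
  then show ?thesis by (simp add: half_lattice_def closed_def)
qed

lemma countable_half_lattice: "countable (half_lattice \<tau>)"
proof -
  have "half_lattice \<tau> = (\<lambda>(m, n). of_int m / 2 + of_int n / 2 * \<tau>) ` (UNIV :: (int \<times> int) set)"
    by (force simp: mem_half_lattice_iff)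
  then show ?thesis by simp
qed

text \<open>
  The function that equals \<open>z \<mapsto> G p z\<close>, in the local coordinate \<open>z = u - p\<close>, on the disc around each half-lattice point \<open>p\<close>, and
  vanishes outside these discs. All globally defined auxiliary functions and forms arise in this way from local data.
\<close>

definition periodise :: "complex \<Rightarrow> (complex \<Rightarrow> complex \<Rightarrow> complex) \<Rightarrow> complex \<Rightarrow> complex" where
  "periodise \<tau> G u = (if \<exists>p\<in>half_lattice \<tau>. cmod (u - p) < sep_radius \<tau>
     then let p = (THE p. p \<in> half_lattice \<tau> \<and> cmod (u - p) < sep_radius \<tau>) in G p (u - p) else 0)"

lemma periodise_near:
  assumes "Im \<tau> > 0" "p \<in> half_lattice \<tau>" "cmod (u - p) < sep_radius \<tau>"
  shows "periodise \<tau> G u = G p (u - p)"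
proof -
  have "(THE p. p \<in> half_lattice \<tau> \<and> cmod (u - p) < sep_radius \<tau>) = p"
    using assms half_lattice_separated by (intro the_equality) blast+
  then show ?thesis using assms unfolding periodise_def by (auto simp: Let_def)
qed

lemma periodise_far:
  assumes "Im \<tau> > 0" and "\<And>p z. p \<in> half_lattice \<tau> \<Longrightarrow> cmod z \<ge> \<rho> \<Longrightarrow> G p z = 0"
    and "\<And>p. p \<in> half_lattice \<tau> \<Longrightarrow> cmod (u - p) \<ge> \<rho>"
  shows "periodise \<tau> G u = 0"
proof (cases "\<exists>p\<in>half_lattice \<tau>. cmod (u - p) < sep_radius \<tau>")
  case True
  then obtain p where p: "p \<in> half_lattice \<tau>" "cmod (u - p) < sep_radius \<tau>" by blast
  then show ?thesis using periodise_near[OF assms(1) p] assms(2)[OF p(1)] assms(3)[OF p(1)] by simp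
qed (simp add: periodise_def)

lemma periodise_periodic:
  assumes \<tau>: "Im \<tau> > 0" and G: "\<And>p. p \<in> half_lattice \<tau> \<Longrightarrow> G (p + l) = G p" and l: "l \<in> lattice \<tau>"
  shows "periodise \<tau> G (u + l) = periodise \<tau> G u"
proof (cases "\<exists>p\<in>half_lattice \<tau>. cmod (u - p) < sep_radius \<tau>")
  case True
  then obtain p where p: "p \<in> half_lattice \<tau>" "cmod (u - p) < sep_radius \<tau>" by blast
  have "p + l \<in> half_lattice \<tau>" using p l half_lattice_add by blast
  from periodise_near[OF \<tau> this, of "u + l" G] periodise_near[OF \<tau> p, of G] show ?thesis using p G by simp
next
  case False
  then have "\<not> (\<exists>p\<in>half_lattice \<tau>. cmod (u + l - p) < sep_radius \<tau>)"
  proof (rule contrapos_nn)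
    assume "\<exists>p\<in>half_lattice \<tau>. cmod (u + l - p) < sep_radius \<tau>"
    then obtain p where p: "p \<in> half_lattice \<tau>" "cmod (u + l - p) < sep_radius \<tau>" by blast
    have "p - l \<in> half_lattice \<tau>" using p half_lattice_add[OF l, of "p - l"] by simp
    then show "\<exists>p\<in>half_lattice \<tau>. cmod (u - p) < sep_radius \<tau>" using p by (intro bexI[of _ "p - l"]) (simp_all add: algebra_simps)
  qed
  with False show ?thesis by (simp add: periodise_def)
qed

text \<open>
  Gluing by zero is smooth because \<open>G p\<close> already vanishes before the boundary of the disc, from radius \<open>\<rho>\<close> on.
\<close>

lemma periodise_Ck:
  assumes \<tau>: "Im \<tau> > 0" and \<rho>: "\<rho> < sep_radius \<tau>"
    and G0: "\<And>p z. p \<in> half_lattice \<tau> \<Longrightarrow> cmod z \<ge> \<rho> \<Longrightarrow> G p z = 0"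
    and S: "open S"
    and G: "\<And>p. p \<in> half_lattice \<tau> \<Longrightarrow> Ck k {z. cmod z < sep_radius \<tau> \<and> p + z \<in> S} (G p)"
  shows "Ck k S (periodise \<tau> G)"
proof (rule Ck_local)
  fix u assume u: "u \<in> S"
  show "\<exists>U. open U \<and> u \<in> U \<and> Ck k U (periodise \<tau> G)"
  proof (cases "\<exists>p\<in>half_lattice \<tau>. cmod (u - p) < sep_radius \<tau>")
    case True
    then obtain p where p: "p \<in> half_lattice \<tau>" "cmod (u - p) < sep_radius \<tau>" by blast
    let ?U = "ball p (sep_radius \<tau>) \<inter> S"
    have o: "open ?U" using S by auto
    have "Ck k ?U (\<lambda>z. G p (z + (- p)))"
      by (rule Ck_shift[OF G[OF p(1)]]) (auto simp: dist_norm norm_minus_commute)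
    then have "Ck k ?U (periodise \<tau> G)"
      by (rule Ck_cong[OF o]) (use periodise_near[OF \<tau> p(1)] in \<open>auto simp: dist_norm norm_minus_commute\<close>)
    then show ?thesis using o p u by (intro exI[of _ ?U]) (auto simp: dist_norm norm_minus_commute)
  next
    case False
    have "periodise \<tau> G w = 0" if "w \<in> ball u (sep_radius \<tau> - \<rho>)" for w
    proof (rule periodise_far[OF \<tau> G0])
      fix p assume "p \<in> half_lattice \<tau>"
      then have "sep_radius \<tau> \<le> cmod (u - p)" using False by force
      also have "\<dots> \<le> cmod (u - w) + cmod (w - p)" using norm_triangle_ineq[of "u - w" "w - p"] by simp
      finally show "\<rho> \<le> cmod (w - p)" using that by (simp add: dist_norm)
    qed auto
    moreover have "Ck k (ball u (sep_radius \<tau> - \<rho>)) (\<lambda>_. 0)" by (intro Ck_holomorphic) auto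
    ultimately have "Ck k (ball u (sep_radius \<tau> - \<rho>)) (periodise \<tau> G)" by (metis (no_types, lifting) Ck_cong open_ball)
    then show ?thesis using \<rho> by (intro exI[of _ "ball u (sep_radius \<tau> - \<rho>)"]) auto
  qed
qed

lemma periodise_Ck_M:
  assumes \<tau>: "Im \<tau> > 0" and \<rho>: "\<rho> < sep_radius \<tau>"
    and G0: "\<And>p z. p \<in> half_lattice \<tau> \<Longrightarrow> cmod z \<ge> \<rho> \<Longrightarrow> G p z = 0"
    and G: "\<And>p. p \<in> half_lattice \<tau> \<Longrightarrow> Ck k (ball 0 (sep_radius \<tau>) - {0}) (G p)"
  shows "Ck k (M\<^sub>C \<tau>) (periodise \<tau> G)"
proof (rule periodise_Ck[OF \<tau> \<rho> G0 open_M[OF \<tau>]])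
  fix p assume p: "p \<in> half_lattice \<tau>"
  show "Ck k {z. cmod z < sep_radius \<tau> \<and> p + z \<in> M\<^sub>C \<tau>} (G p)"
    by (rule Ck_subset[OF G[OF p]]) (use p in \<open>auto simp: M_iff\<close>)
qed auto

section \<open>Stokes' theorem on the punctured torus\<close>

text \<open>
  The half lattice is a null set, so functions on \<open>M\<close> with a continuous extension are integrated over the whole cell.
\<close>

lemma integral_M_continuous:
  assumes \<tau>: "Im \<tau> > 0" and F: "continuous_on UNIV F" and FG: "\<And>u. u \<in> M\<^sub>C \<tau> \<Longrightarrow> F u = G u"
  shows "integral_M \<tau> G = Im \<tau> * cell_int \<tau> 0 0 F" "integral_M \<tau> G = (LINT u:cell \<tau> 0 0|lborel. F u)"
proof -
  have "integral_M \<tau> G = (LINT u:fund_parallelogram \<tau> \<inter> M\<^sub>C \<tau>|lborel. F u)"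
    unfolding integral_M_def set_lebesgue_integral_def
    by (intro Bochner_Integration.integral_cong) (auto simp: indicator_def FG)
  also have "\<dots> = (LINT u:cell \<tau> 0 0|lborel. F u)"
    unfolding set_lebesgue_integral_def fund_parallelogram_cell[OF \<tau>]
  proof (rule integral_cong_AE)
    have Fm: "F \<in> borel_measurable borel" using F by (rule borel_measurable_continuous_onI)
    have Mm: "M\<^sub>C \<tau> \<in> sets borel" using open_M[OF \<tau>] by simp
    note [measurable] = Fm Mm
    show "(\<lambda>u. indicator (cell \<tau> 0 0 \<inter> M\<^sub>C \<tau>) u *\<^sub>R F u) \<in> borel_measurable lborel" by measurable
    show "(\<lambda>u. indicator (cell \<tau> 0 0) u *\<^sub>R F u) \<in> borel_measurable lborel" by measurable
    have "AE u in lborel. u \<notin> half_lattice \<tau>"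
      by (rule AE_not_in) (intro countable_imp_null_set_lborel countable_half_lattice)
    then show "AE u in lborel. indicator (cell \<tau> 0 0 \<inter> M\<^sub>C \<tau>) u *\<^sub>R F u = indicator (cell \<tau> 0 0) u *\<^sub>R F u"
      by eventually_elim (auto simp: M_iff indicator_def)
  qed
  finally show "integral_M \<tau> G = (LINT u:cell \<tau> 0 0|lborel. F u)" .
  then show "integral_M \<tau> G = Im \<tau> * cell_int \<tau> 0 0 F" using set_integral_cell[OF \<tau> F] by simp
qed

definition vanishes_near_half :: "complex \<Rightarrow> (complex \<Rightarrow> complex) \<Rightarrow> bool" where
  "vanishes_near_half \<tau> F \<longleftrightarrow> (\<exists>\<delta>>0. \<forall>p\<in>half_lattice \<tau>. \<forall>u\<in>M\<^sub>C \<tau>. cmod (u - p) < \<delta> \<longrightarrow> F u = 0)"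

definition zero_ext :: "complex \<Rightarrow> (complex \<Rightarrow> complex) \<Rightarrow> complex \<Rightarrow> complex" where
  "zero_ext \<tau> F u = (if u \<in> M\<^sub>C \<tau> then F u else 0)"

lemma Ck_zero_ext:
  assumes \<tau>: "Im \<tau> > 0" and F: "Ck k (M\<^sub>C \<tau>) F" and v: "vanishes_near_half \<tau> F"
  shows "Ck k UNIV (zero_ext \<tau> F)"
proof (rule Ck_local)
  fix z
  obtain \<delta> where \<delta>: "\<delta> > 0" "\<And>p u. p \<in> half_lattice \<tau> \<Longrightarrow> u \<in> M\<^sub>C \<tau> \<Longrightarrow> cmod (u - p) < \<delta> \<Longrightarrow> F u = 0"
    using v unfolding vanishes_near_half_def by blast
  show "\<exists>U. open U \<and> z \<in> U \<and> Ck k U (zero_ext \<tau> F)"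
  proof (cases "z \<in> M\<^sub>C \<tau>")
    case True
    have "Ck k (M\<^sub>C \<tau>) (zero_ext \<tau> F)"
      by (rule Ck_cong[OF open_M[OF \<tau>] F]) (simp add: zero_ext_def)
    then show ?thesis using True open_M[OF \<tau>] by blast
  next
    case False
    have "Ck k (ball z \<delta>) (\<lambda>_. 0)" by (intro Ck_holomorphic) auto
    then have "Ck k (ball z \<delta>) (zero_ext \<tau> F)"
      by (rule Ck_cong[OF open_ball]) (use False \<delta>(2)[of z] in \<open>auto simp: zero_ext_def M_iff dist_norm norm_minus_commute\<close>)
    then show ?thesis using \<delta> by (intro exI[of _ "ball z \<delta>"]) auto
  qed
qed

text \<open>
  Both components vanish near the half lattice, so they extend by zero to continuously differentiable functions on the torus, to which
  \<open>Stokes_torus\<close> applies. The term \<open>P\<close> is what is left over in applications and need only extend continuously.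
\<close>

lemma Stokes_M:
  assumes \<tau>: "Im \<tau> > 0"
    and A: "Ck 1 (M\<^sub>C \<tau>) A" "periodic_on_M \<tau> A" "vanishes_near_half \<tau> A"
    and B: "Ck 1 (M\<^sub>C \<tau>) B" "periodic_on_M \<tau> B" "vanishes_near_half \<tau> B"
    and P: "continuous_on UNIV P"
    and F: "\<And>u. u \<in> M\<^sub>C \<tau> \<Longrightarrow> F u = px B u - py A u + P u"
  shows "integral_M \<tau> F = integral_M \<tau> P"
proof -
  let ?A = "zero_ext \<tau> A" and ?B = "zero_ext \<tau> B"
  have c: "Ck 1 UNIV ?A" "Ck 1 UNIV ?B" using Ck_zero_ext \<tau> A B by blast+
  have p: "zero_ext \<tau> G (u + l) = zero_ext \<tau> G u" if "periodic_on_M \<tau> G" "l \<in> lattice \<tau>" for G u l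
    using that half_lattice_add[OF that(2), of u] by (auto simp: zero_ext_def M_iff periodic_on_M_def)
  have z: "cell_int \<tau> 0 0 (py ?A) = 0" "cell_int \<tau> 0 0 (px ?B) = 0"
    using Stokes_torus(2)[OF \<tau> c(1)] Stokes_torus(1)[OF \<tau> c(2)] p A(2) B(2) one_tau_lattice by blast+
  have cc: "continuous_on UNIV (px ?B)" "continuous_on UNIV (py ?A)" using c by auto
  have "integral_M \<tau> F = (LINT u:cell \<tau> 0 0|lborel. px ?B u - py ?A u + P u)"
  proof (rule integral_M_continuous(2)[OF \<tau>])
    show "continuous_on UNIV (\<lambda>u. px ?B u - py ?A u + P u)" by (intro continuous_intros cc P)
    fix u assume u: "u \<in> M\<^sub>C \<tau>"
    have "px ?B u = px B u" "py ?A u = py A u"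
      using px_py_cong(2)[OF open_M[OF \<tau>] u, of B ?B] px_py_cong(3)[OF open_M[OF \<tau>] u, of A ?A] A(1) B(1) u
      by (auto simp: zero_ext_def)
    then show "px ?B u - py ?A u + P u = F u" using F[OF u] by simp
  qed
  also have "\<dots> = (LINT u:cell \<tau> 0 0|lborel. px ?B u - py ?A u) + (LINT u:cell \<tau> 0 0|lborel. P u)"
    by (intro set_integral_add set_integrable_cell \<tau> continuous_intros cc P)
  also have "(LINT u:cell \<tau> 0 0|lborel. px ?B u - py ?A u) = (LINT u:cell \<tau> 0 0|lborel. px ?B u) - (LINT u:cell \<tau> 0 0|lborel. py ?A u)"
    by (intro set_integral_diff set_integrable_cell \<tau> cc)
  also have "\<dots> = 0" by (simp add: set_integral_cell[OF \<tau>] cc z)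
  also have "(LINT u:cell \<tau> 0 0|lborel. P u) = integral_M \<tau> P" by (rule integral_M_continuous(2)[OF \<tau> P, symmetric]) simp
  finally show ?thesis by simp
qed

section \<open>Localised integrals\<close>

text \<open>
  Representatives of \<open>D\<close>; they are exactly the half-lattice points in the cell that is shifted by \<open>-1/4\<close>.
\<close>

definition Dpts :: "complex \<Rightarrow> complex set" where "Dpts \<tau> = {0, 1/2, (1 + \<tau>)/2, \<tau>/2}"

lemma Dpts_half: "p \<in> Dpts \<tau> \<Longrightarrow> p \<in> half_lattice \<tau>"
  unfolding half_lattice_def M\<^sub>C_def Dpts_def using one_tau_lattice(3)[of \<tau>] by force

text \<open>
  In the cell shifted by \<open>-1/4\<close> in both coordinates, the discs around the four points of \<open>Dpts \<tau>\<close> are entirely inside and all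
  other discs are entirely outside. Hence the integral splits into four integrals over the plane.
\<close>

lemma integral_periodise:
  fixes G :: "complex \<Rightarrow> complex \<Rightarrow> complex"
  assumes \<tau>: "Im \<tau> > 0" and \<rho>: "\<rho> < sep_radius \<tau>"
    and G0: "\<And>p z. p \<in> half_lattice \<tau> \<Longrightarrow> cmod z \<ge> \<rho> \<Longrightarrow> G p z = 0"
    and G: "\<And>p. p \<in> half_lattice \<tau> \<Longrightarrow> continuous_on UNIV (G p)"
    and periodise: "\<And>p l. p \<in> half_lattice \<tau> \<Longrightarrow> l \<in> lattice \<tau> \<Longrightarrow> G (p + l) = G p"
    and F: "\<And>u. u \<in> M\<^sub>C \<tau> \<Longrightarrow> F u = periodise \<tau> G u"
  shows "integral_M \<tau> F = (\<Sum>p\<in>Dpts \<tau>. (\<integral>z. G p z \<partial>lborel))"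
proof -
  have c: "continuous_on UNIV (periodise \<tau> G)"
    using periodise_Ck[OF \<tau> \<rho> G0 open_UNIV, where k = 0] G by (force intro: continuous_on_subset)
  have p: "periodise \<tau> G (u + 1) = periodise \<tau> G u" "periodise \<tau> G (u + \<tau>) = periodise \<tau> G u" for u
    using periodise_periodic[OF \<tau>, of G] periodise one_tau_lattice by blast+
  let ?P = "cell \<tau> (-1/4) (-1/4)"
  have i: "integrable lborel (G p)" if "p \<in> half_lattice \<tau>" for p
  proof -
    have "integrable lborel (\<lambda>x. indicator (cball 0 \<rho>) x *\<^sub>R G p x)"
      by (intro borel_integrable_compact continuous_on_subset[OF G[OF that]]) auto
    also have "(\<lambda>x. indicator (cball 0 \<rho>) x *\<^sub>R G p x) = G p"
      using G0[OF that] by (force simp: indicator_def)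
    finally show ?thesis .
  qed
  have tr: "integrable lborel (\<lambda>u. G p (u - p))" "(\<integral>u. G p (u - p) \<partial>lborel) = (\<integral>u. G p u \<partial>lborel)" if "p \<in> half_lattice \<tau>" for p
  proof -
    have m: "G p \<in> borel_measurable borel" using G[OF that] by (rule borel_measurable_continuous_onI)
    have "integrable (distr lborel borel ((+) (- p))) (G p)" using i[OF that] by (simp only: lborel_distr_plus)
    then show "integrable lborel (\<lambda>u. G p (u - p))" by (subst (asm) integrable_distr_eq) (use m in auto)
    have "(\<integral>u. G p u \<partial>lborel) = (\<integral>u. G p u \<partial>(distr lborel borel ((+) (- p))))" by (simp only: lborel_distr_plus)
    also have "\<dots> = (\<integral>u. G p (u - p) \<partial>lborel)" by (subst integral_distr) (use m in auto)
    finally show "(\<integral>u. G p (u - p) \<partial>lborel) = (\<integral>u. G p u \<partial>lborel)" by simp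
  qed
  \<comment> \<open>The disc around \<open>q\<close> meets the shifted cell only if \<open>q\<close> is one of the four points.\<close>
  have key: "indicator ?P u *\<^sub>R periodise \<tau> G u = (\<Sum>p\<in>Dpts \<tau>. G p (u - p))" for u
  proof (cases "\<exists>q\<in>half_lattice \<tau>. cmod (u - q) < sep_radius \<tau>")
    case False
    have "G p (u - p) = 0" if "p \<in> half_lattice \<tau>" for p using G0[OF that, of "u - p"] False that \<rho> by force
    then show ?thesis using False Dpts_half by (auto simp: periodise_def)
  next
    case True
    then obtain q where q: "q \<in> half_lattice \<tau>" "cmod (u - q) < sep_radius \<tau>" by blast
    have pq: "G p (u - p) = (if p = q then periodise \<tau> G u else 0)" if "p \<in> Dpts \<tau>" for p
      using half_lattice_separated[OF \<tau> Dpts_half[OF that] q(1) _ q(2)] periodise_near[OF \<tau> q] G0[OF Dpts_half[OF that], of "u - p"] \<rho>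
      by (cases "cmod (u - p) < sep_radius \<tau>") auto
    have "(\<Sum>p\<in>Dpts \<tau>. G p (u - p)) = (\<Sum>p\<in>Dpts \<tau>. if p = q then periodise \<tau> G u else 0)"
      using pq by (intro sum.cong) auto
    also have "\<dots> = (if q \<in> Dpts \<tau> then periodise \<tau> G u else 0)"
      by (rule sum.delta) (simp add: Dpts_def)
    finally have "(\<Sum>p\<in>Dpts \<tau>. G p (u - p)) = (if q \<in> Dpts \<tau> then periodise \<tau> G u else 0)" .
    moreover have "u \<in> ?P \<longleftrightarrow> q \<in> Dpts \<tau>"
    proof -
      obtain m n where m: "coord_s \<tau> q = of_int m / 2" "coord_t \<tau> q = of_int n / 2" using half_lattice_coordinates[OF \<tau> q(1)] .
      have d: "\<bar>coord_s \<tau> u - of_int m / 2\<bar> < 1/8" "\<bar>coord_t \<tau> u - of_int n / 2\<bar> < 1/8"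
        using small_coordinates[OF \<tau> q(2)] unfolding coord_add m .
      have "u \<in> ?P \<longleftrightarrow> (m = 0 \<or> m = 1) \<and> (n = 0 \<or> n = 1)"
      proof -
        have *: "- 1/4 \<le> x \<and> x < -1/4 + 1 \<longleftrightarrow> k = 0 \<or> k = 1" if "\<bar>x - of_int k / 2\<bar> < 1/8" for x :: real and k :: int
        proof -
          consider "k \<le> -1" | "k = 0" | "k = 1" | "k \<ge> 2" by linarith
          then show ?thesis
          proof cases
            case 1 then have "(of_int k :: real) \<le> -1" by linarith
            then have "x < - 1/4" using that by linarith
            then show ?thesis using 1 by simp
          next
            case 4 then have "(of_int k :: real) \<ge> 2" by linarith
            then have "x > 3/4" using that by linarith
            then show ?thesis using 4 by simp
          next
            case 2
            then have "\<bar>x\<bar> < 1/8" using that by simp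
            then have "- 1/4 \<le> x" "x < 3/4" by linarith+
            then show ?thesis using 2 by simp
          next
            case 3
            then have "\<bar>x - 1/2\<bar> < 1/8" using that by simp
            then have "- 1/4 \<le> x" "x < 3/4" by linarith+
            then show ?thesis using 3 by simp
          qed
        qed
        show ?thesis unfolding cell_def using *[OF d(1)] *[OF d(2)] by auto
      qed
      also have "\<dots> \<longleftrightarrow> q \<in> Dpts \<tau>"
      proof
        have q': "q = of_int m / 2 + of_int n / 2 * \<tau>" using coord_simps(3)[OF \<tau>, of q] m by simp
        assume "(m = 0 \<or> m = 1) \<and> (n = 0 \<or> n = 1)"
        then show "q \<in> Dpts \<tau>" unfolding q' by (auto simp: Dpts_def add_divide_distrib)
      next
        assume "q \<in> Dpts \<tau>"
        then consider "q = 0" | "q = 1/2" | "q = (1+\<tau>)/2" | "q = \<tau>/2" by (auto simp: Dpts_def)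
        then show "(m = 0 \<or> m = 1) \<and> (n = 0 \<or> n = 1)"
          using m \<tau> by cases (auto simp: coord_s_def coord_t_def field_simps)
      qed
      finally show ?thesis .
    qed
    ultimately show ?thesis by (simp add: indicator_def)
  qed
  have "integral_M \<tau> F = Im \<tau> * cell_int \<tau> 0 0 (periodise \<tau> G)"
    using F by (intro integral_M_continuous(1)[OF \<tau> c]) simp
  also have "\<dots> = (LINT u:?P|lborel. periodise \<tau> G u)"
    unfolding set_integral_cell[OF \<tau> c] cell_int_shift[OF c p, of "-1/4" "-1/4"] ..
  also have "\<dots> = (\<integral>u. (\<Sum>p\<in>Dpts \<tau>. G p (u - p)) \<partial>lborel)"
    unfolding set_lebesgue_integral_def key ..
  also have "\<dots> = (\<Sum>p\<in>Dpts \<tau>. (\<integral>u. G p (u - p) \<partial>lborel))"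
    by (rule Bochner_Integration.integral_sum) (use tr Dpts_half in blast)
  also have "\<dots> = (\<Sum>p\<in>Dpts \<tau>. (\<integral>u. G p u \<partial>lborel))"
    by (rule sum.cong) (use tr Dpts_half in blast)+
  finally show ?thesis .
qed

text \<open>
  The disc of radius \<open>\<surd>x\<close> has area \<open>\<pi> x\<close>, so \<open>|z|\<^sup>2\<close> is distributed like \<open>\<pi> dx\<close> on the positive half line. This takes the place of
  polar coordinates for radial integrands.
\<close>

lemma distr_cmod2:
  "distr lborel borel (\<lambda>z::complex. (cmod z)\<^sup>2) = density lborel (\<lambda>x. ennreal (pi * indicator {0..} x))" (is "?M = ?N")
proof (rule measure_eqI_generator_eq[where E = "range (\<lambda>a. {..a::real})" and \<Omega> = UNIV and A = "\<lambda>n. {..real n}"])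
  show "Int_stable (range (\<lambda>a. {..a::real}))"
    by (auto simp: Int_stable_def)
  have s: "sets borel = sigma_sets UNIV (range (\<lambda>a. {..a::real}))"
    by (subst borel_eq_atMost) simp
  show "sets ?M = sigma_sets UNIV (range (\<lambda>a. {..a::real}))" "sets ?N = sigma_sets UNIV (range (\<lambda>a. {..a::real}))"
    using s by simp_all
  have 1: "emeasure ?M {..x} = ennreal (if x \<ge> 0 then pi * x else 0)" for x
  proof -
    have "emeasure ?M {..x} = emeasure lborel ((\<lambda>z::complex. (cmod z)\<^sup>2) -` {..x})"
      by (subst emeasure_distr) auto
    also have "(\<lambda>z::complex. (cmod z)\<^sup>2) -` {..x} = (if x \<ge> 0 then cball 0 (sqrt x) else {})"
    proof (cases "x \<ge> 0")
      case True
      have "(cmod z)\<^sup>2 \<le> x \<longleftrightarrow> cmod z \<le> sqrt x" for z :: complex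
        using real_le_rsqrt sqrt_ge_absD[of "cmod z" x] by auto
      then show ?thesis using True by auto
    next
      case False then have "\<not> (cmod z)\<^sup>2 \<le> x" for z :: complex using zero_le_power2[of "cmod z"] by linarith
      then show ?thesis using False by auto
    qed
    also have "emeasure lborel \<dots> = ennreal (if x \<ge> 0 then pi * x else 0)"
      by (auto simp: emeasure_cball unit_ball_vol_2 numeral_2_eq_2[symmetric])
    finally show ?thesis .
  qed
  have 2: "emeasure ?N {..x} = ennreal (if x \<ge> 0 then pi * x else 0)" for x
  proof -
    have "emeasure ?N {..x} = (\<integral>\<^sup>+y. ennreal (pi * indicator {0..} y) * indicator {..x} y \<partial>lborel)"
      by (subst emeasure_density) auto
    also have "\<dots> = (\<integral>\<^sup>+y. ennreal pi * indicator {0..x} y \<partial>lborel)"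
      by (intro nn_integral_cong) (auto simp: indicator_def)
    also have "\<dots> = ennreal pi * emeasure lborel {0..x}" by (rule nn_integral_cmult_indicator) simp
    also have "\<dots> = ennreal (if x \<ge> 0 then pi * x else 0)" by (auto simp: ennreal_mult)
    finally show ?thesis .
  qed
  show "emeasure ?M X = emeasure ?N X" if "X \<in> range (\<lambda>a. {..a::real})" for X
    using that 1 2 by auto
  show "emeasure ?M {..real i} \<noteq> \<infinity>" for i using 1 by simp
  show "(\<Union>i. {..real i}) = UNIV" using real_arch_simple by auto
qed auto

lemma step_deriv_0:
  assumes "x > 3"
  shows "step_deriv x = 0"
proof -
  have "(step_fun has_real_derivative 0) (at x)"
    by (rule has_field_derivative_transform_within_open[of "\<lambda>_. 0" _ _ "{3<..}"])
      (use assms in \<open>auto simp: step_fun_right\<close>)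
  then show ?thesis using DERIV_unique[OF step_fun_deriv] by blast
qed

text \<open>
  By \<open>distr_cmod2\<close> this is \<open>\<pi>\<close> times the total change of \<open>step_fun\<close>, which decreases from \<open>1\<close> to \<open>0\<close>. The value does not depend on \<open>s\<close>.
\<close>

lemma integral_bump:
  assumes s: "s > 0"
  shows "(\<integral>z. complex_of_real (step_deriv ((cmod z)\<^sup>2 / s\<^sup>2) / s\<^sup>2) \<partial>lborel) = - pi"
proof -
  define \<psi> where "\<psi> x = step_deriv (x / s\<^sup>2) / s\<^sup>2" for x
  have \<psi>c: "continuous_on A \<psi>" for A
    unfolding \<psi>_def using s by (intro continuous_intros continuous_on_compose2[OF step_deriv_continuous[of UNIV]]) auto
  have \<psi>d: "((\<lambda>x. step_fun (x / s\<^sup>2)) has_real_derivative \<psi> x) (at x within A)" for x A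
    unfolding \<psi>_def using DERIV_chain2[OF step_fun_deriv DERIV_cdivide[OF DERIV_ident], of "s\<^sup>2" x A] by simp
  have \<psi>0: "\<psi> x = 0" if "x \<ge> 4 * s\<^sup>2" for x
  proof -
    have "x / s\<^sup>2 \<ge> 4" using that s by (simp add: field_simps)
    then show ?thesis by (simp add: \<psi>_def step_deriv_0)
  qed
  have m: "\<psi> \<in> borel_measurable borel" using \<psi>c[of UNIV] by (rule borel_measurable_continuous_onI)
  have "(\<integral>z. \<psi> ((cmod z)\<^sup>2) \<partial>lborel) = (\<integral>x. \<psi> x \<partial>(distr lborel borel (\<lambda>z::complex. (cmod z)\<^sup>2)))"
    by (subst integral_distr) (use m in auto)
  also have "\<dots> = (\<integral>x. (pi * indicator {0..} x) *\<^sub>R \<psi> x \<partial>lborel)"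
    unfolding distr_cmod2 by (subst integral_density) (use m in auto)
  also have "\<dots> = pi * (LINT x:{0..4 * s\<^sup>2}|lborel. \<psi> x)"
    unfolding set_lebesgue_integral_def
    by (subst integral_mult_right_zero[symmetric]) (intro Bochner_Integration.integral_cong, auto simp: indicator_def \<psi>0)
  also have "(LINT x:{0..4 * s\<^sup>2}|lborel. \<psi> x) = step_fun (4 * s\<^sup>2 / s\<^sup>2) - step_fun (0 / s\<^sup>2)"
  proof -
    have "(LINT x:{0..4 * s\<^sup>2}|lborel. \<psi> x) = integral {0..4 * s\<^sup>2} \<psi>"
      by (intro set_borel_integral_eq_integral(2) borel_integrable_atLeastAtMost' \<psi>c)
    also have "\<dots> = step_fun (4 * s\<^sup>2 / s\<^sup>2) - step_fun (0 / s\<^sup>2)"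
      by (intro integral_unique fundamental_theorem_of_calculus)
        (use \<psi>d in \<open>auto simp: has_real_derivative_iff_has_vector_derivative\<close>)
    finally show ?thesis .
  qed
  also have "\<dots> = - 1" using s by (simp add: step_fun_left step_fun_right)
  finally have "(\<integral>z. \<psi> ((cmod (z::complex))\<^sup>2) \<partial>lborel) = - pi" by simp
  then show ?thesis by (simp only: \<psi>_def integral_complex_of_real)
qed

section \<open>Theta series\<close>

lemma ee_add: "ee (x + y) = ee x * ee y" by (simp add: ee_def exp_add[symmetric] algebra_simps)
lemma ee_0 [simp]: "ee 0 = 1" by (simp add: ee_def)
lemma ee_nonzero [simp]: "ee x \<noteq> 0" by (simp add: ee_def)
lemma ee_minus: "ee (- x) = inverse (ee x)" by (simp add: ee_def exp_minus)
lemma ee_diff: "ee (x - y) = ee x / ee y" using ee_add[of x "-y"] by (simp add: ee_minus field_simps)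
lemma norm_ee: "norm (ee x) = exp (- 2 * pi * Im x)" by (simp add: ee_def)
lemma ee_eq_1_iff: "ee x = 1 \<longleftrightarrow> (\<exists>n::int. x = of_int n)"
  unfolding ee_def exp_eq_1 by (auto simp: complex_eq_iff)
lemma ee_of_int [simp]: "ee (of_int n) = 1" using ee_eq_1_iff by blast
lemma ee_1 [simp]: "ee 1 = 1" using ee_of_int[of 1] by simp
lemma ee_half: "ee (1/2) = - 1" by (simp add: ee_def exp_pi_i)
lemma ee_quarter: "ee (1/4) = \<i>"
proof -
  have "2 * of_real pi * \<i> * (1/4) = \<i> * of_real (pi / 2)" by (simp add: field_simps)
  then show ?thesis unfolding ee_def by (simp only: cis_conv_exp[symmetric]) (simp add: complex_eq_iff)
qed
lemma holomorphic_ee [holomorphic_intros]: "f holomorphic_on S \<Longrightarrow> (\<lambda>z. ee (f z)) holomorphic_on S"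
  unfolding ee_def by (intro holomorphic_intros)
lemma ee_deriv: "(ee has_field_derivative 2 * of_real pi * \<i> * ee x) (at x)"
  unfolding ee_def[abs_def] by (auto intro!: derivative_eq_intros)
lemma ee_chain [derivative_intros]:
  "(f has_field_derivative f') (at x within s) \<Longrightarrow>
    ((\<lambda>x. ee (f x)) has_field_derivative 2 * of_real pi * \<i> * ee (f x) * f') (at x within s)"
  by (rule DERIV_chain2[OF ee_deriv])

definition th_term :: "complex \<Rightarrow> int \<Rightarrow> complex \<Rightarrow> complex" where
  "th_term \<tau> m u = ee (1/2 * (of_int m)\<^sup>2 * \<tau> + of_int m * u)"

lemma theta3_th_term: "theta3 \<tau> u = (\<Sum>\<^sub>\<infinity>m. th_term \<tau> m u)"
  by (simp add: theta3_def th_term_def)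

lemma norm_th_term: "norm (th_term \<tau> m u) = exp (- pi * (of_int m)\<^sup>2 * Im \<tau> - 2 * pi * of_int m * Im u)"
  by (simp add: th_term_def norm_ee power2_eq_square algebra_simps)

lemma summable_exp_abs_int: "(\<lambda>m::int. exp (- \<bar>of_int m :: real\<bar>)) summable_on UNIV"
proof -
  have "summable (\<lambda>n. exp (- 1 :: real) ^ n)" by (intro summable_geometric) simp
  then have "summable (\<lambda>n. exp (- real n))" by (simp add: exp_of_nat_mult[symmetric])
  then have n: "(\<lambda>n. exp (- real n)) summable_on (UNIV :: nat set)"
    by (subst summable_on_UNIV_nonneg_real_iff) auto
  have "(\<lambda>m::int. exp (- \<bar>of_int m :: real\<bar>)) summable_on {0..}"
    using n by (subst summable_on_reindex_bij_witness[of _ int nat UNIV "\<lambda>n. exp (- real n)"]) auto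
  moreover have "(\<lambda>m::int. exp (- \<bar>of_int m :: real\<bar>)) summable_on {..0}"
    using n by (subst summable_on_reindex_bij_witness[of _ "\<lambda>n. - int n" "\<lambda>m. nat (- m)" UNIV "\<lambda>n. exp (- real n)"]) auto
  ultimately have "(\<lambda>m::int. exp (- \<bar>of_int m :: real\<bar>)) summable_on ({0..} \<union> {..0})"
    by (rule summable_on_union)
  also have "{0..} \<union> {..0} = (UNIV :: int set)" by auto
  finally show ?thesis .
qed

text \<open>
  A summable majorant of the terms, uniform for \<open>|Im u| \<le> R\<close> and \<open>Im \<tau> \<ge> y\<close>. The second uniformity is needed for the limit of large
  \<open>Im \<tau>\<close>.
\<close>

definition th_bound :: "real \<Rightarrow> real \<Rightarrow> int \<Rightarrow> real" where
  "th_bound y R m = exp (- pi * (of_int m)\<^sup>2 * y + 2 * pi * R * \<bar>of_int m\<bar>)"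

lemma th_bound_summable:
  assumes "y > 0"
  shows "th_bound y R summable_on UNIV"
proof -
  define b where "b = 2 * pi * R + 1"
  have le: "th_bound y R m \<le> exp (b\<^sup>2 / (4 * pi * y)) * exp (- \<bar>of_int m :: real\<bar>)" for m
  proof -
    let ?x = "\<bar>of_int m :: real\<bar>"
    have "0 \<le> (2 * pi * y * ?x - b)\<^sup>2" by simp
    also have "\<dots> = 4 * pi * y * (pi * y * ?x\<^sup>2 - b * ?x) + b\<^sup>2" by (simp add: power2_eq_square algebra_simps)
    finally have "4 * pi * y * (b * ?x - pi * y * ?x\<^sup>2) \<le> b\<^sup>2" by (simp add: algebra_simps)
    then have "b * ?x - pi * y * ?x\<^sup>2 \<le> b\<^sup>2 / (4 * pi * y)" using assms by (simp add: field_simps)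
    then show ?thesis by (simp add: th_bound_def exp_add[symmetric] b_def algebra_simps)
  qed
  have "(\<lambda>m. norm (th_bound y R m)) summable_on UNIV"
    by (rule Infinite_Sum.abs_summable_on_comparison_test'[OF summable_on_cmult_right[OF summable_exp_abs_int]])
      (use le in \<open>simp add: th_bound_def\<close>)
  then show ?thesis by (simp add: th_bound_def[abs_def])
qed

lemma th_term_le:
  assumes "\<bar>Im u\<bar> \<le> R" "y \<le> Im \<tau>"
  shows "norm (th_term \<tau> m u) \<le> th_bound y R m"
proof -
  have "- (of_int m * Im u) \<le> \<bar>of_int m\<bar> * R"
    using assms by (metis abs_ge_minus_self abs_ge_zero abs_mult mult_left_mono order_trans)
  moreover have "(of_int m)\<^sup>2 * y \<le> (of_int m)\<^sup>2 * Im \<tau>" by (intro mult_left_mono assms) auto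
  ultimately have *: "pi * ((of_int m)\<^sup>2 * y) \<le> pi * ((of_int m)\<^sup>2 * Im \<tau>)" "2 * pi * (- (of_int m * Im u)) \<le> 2 * pi * (\<bar>of_int m\<bar> * R)"
    by (simp_all only: mult_le_cancel_left_pos pi_gt_zero mult_pos_pos zero_less_numeral)
  have "- pi * (of_int m)\<^sup>2 * Im \<tau> - 2 * pi * of_int m * Im u = - (pi * ((of_int m)\<^sup>2 * Im \<tau>)) + 2 * pi * (- (of_int m * Im u))"
    by simp
  also have "\<dots> \<le> - (pi * ((of_int m)\<^sup>2 * y)) + 2 * pi * (\<bar>of_int m\<bar> * R)" using * by linarith
  also have "\<dots> = - pi * (of_int m)\<^sup>2 * y + 2 * pi * R * \<bar>of_int m\<bar>" by simp
  finally show ?thesis unfolding norm_th_term th_bound_def exp_le_cancel_iff .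
qed

lemma th_term_summable:
  assumes "Im \<tau> > 0"
  shows "(\<lambda>m. norm (th_term \<tau> m u)) summable_on UNIV" "(\<lambda>m. th_term \<tau> m u) summable_on UNIV"
proof -
  show "(\<lambda>m. norm (th_term \<tau> m u)) summable_on UNIV"
    by (rule Infinite_Sum.abs_summable_on_comparison_test'[OF th_bound_summable[OF assms, of "\<bar>Im u\<bar>"]]) (rule th_term_le; simp)
  then show "(\<lambda>m. th_term \<tau> m u) summable_on UNIV" by (rule abs_summable_summable)
qed

lemma theta3_uniform:
  assumes "Im \<tau> > 0"
  shows "uniform_limit (cball c r) (\<lambda>X u. \<Sum>m\<in>X. th_term \<tau> m u) (theta3 \<tau>) (finite_subsets_at_top UNIV)"
  unfolding theta3_th_term[abs_def]
proof (rule Weierstrass_m_test_general)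
  show "th_bound (Im \<tau>) (\<bar>Im c\<bar> + r) summable_on UNIV" by (rule th_bound_summable[OF assms])
  fix m u assume "u \<in> cball c r"
  then have "\<bar>Im (u - c)\<bar> \<le> r" using abs_Im_le_cmod[of "u - c"] by (simp add: dist_norm norm_minus_commute)
  then show "norm (th_term \<tau> m u) \<le> th_bound (Im \<tau>) (\<bar>Im c\<bar> + r) m" by (intro th_term_le) auto
qed

lemma theta3_holomorphic:
  assumes "Im \<tau> > 0"
  shows "theta3 \<tau> holomorphic_on S"
proof -
  have "theta3 \<tau> holomorphic_on ball c 1" for c
  proof (rule holomorphic_uniform_limit[OF _ theta3_uniform[OF assms]])
    show "\<forall>\<^sub>F X in finite_subsets_at_top UNIV. continuous_on (cball c 1) (\<lambda>u. \<Sum>m\<in>X. th_term \<tau> m u) \<and> (\<lambda>u. \<Sum>m\<in>X. th_term \<tau> m u) holomorphic_on ball c 1"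
      by (intro always_eventually allI conjI holomorphic_on_imp_continuous_on) (auto simp: th_term_def intro!: holomorphic_intros)
  qed auto
  then have "theta3 \<tau> field_differentiable (at u)" for u
    by (meson centre_in_ball holomorphic_on_imp_differentiable_at open_ball zero_less_one)
  then show ?thesis
    by (auto simp: holomorphic_on_def field_differentiable_at_within)
qed

lemma theta3_plus_1: "theta3 \<tau> (u + 1) = theta3 \<tau> u"
proof -
  have "th_term \<tau> m (u + 1) = th_term \<tau> m u" for m
    by (simp add: th_term_def ee_add distrib_left)
  then show ?thesis by (simp add: theta3_th_term)
qed

text \<open>
  Completing the square: the shift \<open>u \<mapsto> u + \<tau>\<close> amounts to the shift \<open>m \<mapsto> m + 1\<close> of the summation index.
\<close>

lemma theta3_plus_tau: "theta3 \<tau> (u + \<tau>) = ee (- \<tau>/2 - u) * theta3 \<tau> u"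
proof -
  have "th_term \<tau> m (u + \<tau>) = ee (- \<tau>/2 - u) * th_term \<tau> (m + 1) u" for m
    unfolding th_term_def ee_add[symmetric] by (rule arg_cong[of _ _ ee]) (simp add: power2_eq_square field_simps)
  then have "theta3 \<tau> (u + \<tau>) = ee (- \<tau>/2 - u) * (\<Sum>\<^sub>\<infinity>m. th_term \<tau> (m + 1) u)"
    by (simp add: theta3_th_term infsum_cmult_right')
  also have "(\<Sum>\<^sub>\<infinity>m. th_term \<tau> (m + 1) u) = (\<Sum>\<^sub>\<infinity>m. th_term \<tau> m u)"
    by (rule infsum_reindex_bij_witness[of _ "\<lambda>m. m - 1" "\<lambda>m. m + 1"]) auto
  finally show ?thesis by (simp add: theta3_th_term)
qed

lemma theta3_minus: "theta3 \<tau> (- u) = theta3 \<tau> u"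
proof -
  have "(\<Sum>\<^sub>\<infinity>m. th_term \<tau> m (- u)) = (\<Sum>\<^sub>\<infinity>m. th_term \<tau> m u)"
    by (rule infsum_reindex_bij_witness[of _ "\<lambda>m. - m" "\<lambda>m. - m"]) (auto simp: th_term_def)
  then show ?thesis by (simp add: theta3_th_term)
qed

lemma theta4_theta3: "theta4 \<tau> u = theta3 \<tau> (u + 1/2)"
  by (simp add: theta4_def theta3_def)

lemma theta2_theta3: "theta2 \<tau> u = ee (\<tau>/8 + u/2) * theta3 \<tau> (u + \<tau>/2)"
proof -
  have "ee (1/2 * (of_int m + 1/2)\<^sup>2 * \<tau> + (of_int m + 1/2) * u) = ee (\<tau>/8 + u/2) * th_term \<tau> m (u + \<tau>/2)" for m :: int
    unfolding th_term_def ee_add[symmetric] by (rule arg_cong[of _ _ ee]) (simp add: power2_eq_square field_simps)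
  then show ?thesis by (simp add: theta2_def theta3_th_term infsum_cmult_right')
qed

lemma theta1_theta2: "theta1 \<tau> u = - theta2 \<tau> (u + 1/2)"
  by (simp add: theta1_def theta2_def)

lemma theta3_plus_half: "theta3 \<tau> (u + 1/2) = theta4 \<tau> u" by (simp add: theta4_theta3)
lemma theta4_plus_half: "theta4 \<tau> (u + 1/2) = theta3 \<tau> u"
  using theta3_plus_1[of \<tau> u] by (simp add: theta4_theta3 add.assoc)

lemma theta2_plus_1: "theta2 \<tau> (u + 1) = - theta2 \<tau> u"
proof -
  have "theta3 \<tau> (u + 1 + \<tau>/2) = theta3 \<tau> (u + \<tau>/2)" using theta3_plus_1[of \<tau> "u + \<tau>/2"] by (simp add: add_ac)
  moreover have "ee (\<tau>/8 + (u + 1)/2) = - ee (\<tau>/8 + u/2)"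
    using ee_add[of "\<tau>/8 + u/2" "1/2"] by (simp add: ee_half add_divide_distrib add_ac)
  ultimately show ?thesis by (simp add: theta2_theta3)
qed

lemma theta1_plus_half: "theta1 \<tau> (u + 1/2) = theta2 \<tau> u"
  using theta2_plus_1[of \<tau> u] by (simp add: theta1_theta2 add.assoc)
lemma theta2_plus_half: "theta2 \<tau> (u + 1/2) = - theta1 \<tau> u" by (simp add: theta1_theta2)

lemma theta1_plus_1: "theta1 \<tau> (u + 1) = - theta1 \<tau> u"
  using theta2_plus_1[of \<tau> "u + 1/2"] by (simp add: theta1_theta2 add_ac)
lemma theta4_plus_1: "theta4 \<tau> (u + 1) = theta4 \<tau> u"
  using theta3_plus_1[of \<tau> "u + 1/2"] by (simp add: theta4_theta3 add_ac)

text \<open>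
  The common factor by which the four functions are permuted under \<open>u \<mapsto> u + \<tau>/2\<close>; its product with its translate,
  \<open>tau_mult\<close> below, is the factor for \<open>u \<mapsto> u + \<tau>\<close>.
\<close>

definition half_tau_mult :: "complex \<Rightarrow> complex \<Rightarrow> complex" where "half_tau_mult \<tau> u = ee (- \<tau>/8 - u/2)"

lemma half_tau_mult_nonzero [simp]: "half_tau_mult \<tau> u \<noteq> 0" by (simp add: half_tau_mult_def)

lemma half_tau_mult_plus_half: "half_tau_mult \<tau> (u + 1/2) = - \<i> * half_tau_mult \<tau> u"
proof -
  have "half_tau_mult \<tau> (u + 1/2) = ee (- \<tau>/8 - u/2) * ee (- (1/4))"
    unfolding half_tau_mult_def ee_add[symmetric] by (rule arg_cong[of _ _ ee]) (simp add: field_simps)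
  then show ?thesis by (simp add: half_tau_mult_def ee_minus ee_quarter)
qed

lemma theta3_plus_htau: "theta3 \<tau> (u + \<tau>/2) = half_tau_mult \<tau> u * theta2 \<tau> u"
proof -
  have "half_tau_mult \<tau> u * ee (\<tau>/8 + u/2) = 1" by (simp add: half_tau_mult_def ee_add[symmetric])
  then show ?thesis by (simp add: theta2_theta3 mult.assoc[symmetric])
qed

lemma theta2_plus_htau: "theta2 \<tau> (u + \<tau>/2) = half_tau_mult \<tau> u * theta3 \<tau> u"
proof -
  have "theta2 \<tau> (u + \<tau>/2) = ee (\<tau>/8 + (u + \<tau>/2)/2) * theta3 \<tau> (u + \<tau>)"
    by (simp add: theta2_theta3 add.assoc)
  also have "\<dots> = (ee (\<tau>/8 + (u + \<tau>/2)/2) * ee (- \<tau>/2 - u)) * theta3 \<tau> u"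
    by (simp add: theta3_plus_tau)
  also have "ee (\<tau>/8 + (u + \<tau>/2)/2) * ee (- \<tau>/2 - u) = half_tau_mult \<tau> u"
    unfolding half_tau_mult_def ee_add[symmetric] by (rule arg_cong[of _ _ ee]) (simp add: field_simps)
  finally show ?thesis .
qed

lemma theta4_plus_htau: "theta4 \<tau> (u + \<tau>/2) = \<i> * half_tau_mult \<tau> u * theta1 \<tau> u"
  using theta3_plus_htau[of \<tau> "u + 1/2"] by (simp add: theta4_theta3 theta1_theta2 half_tau_mult_plus_half add_ac)

lemma theta1_plus_htau: "theta1 \<tau> (u + \<tau>/2) = \<i> * half_tau_mult \<tau> u * theta4 \<tau> u"
  using theta2_plus_htau[of \<tau> "u + 1/2"] by (simp add: theta4_theta3 theta1_theta2 half_tau_mult_plus_half add_ac)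

definition tau_mult :: "complex \<Rightarrow> complex \<Rightarrow> complex" where "tau_mult \<tau> u = ee (- \<tau>/2 - u)"

lemma tau_mult_nonzero [simp]: "tau_mult \<tau> u \<noteq> 0" by (simp add: tau_mult_def)

lemma half_tau_mult_mult: "half_tau_mult \<tau> (u + \<tau>/2) * half_tau_mult \<tau> u = tau_mult \<tau> u"
  unfolding half_tau_mult_def tau_mult_def ee_add[symmetric] by (rule arg_cong[of _ _ ee]) (simp add: field_simps)

lemma theta_plus_tau:
  "theta1 \<tau> (u + \<tau>) = - tau_mult \<tau> u * theta1 \<tau> u"
  "theta2 \<tau> (u + \<tau>) = tau_mult \<tau> u * theta2 \<tau> u"
  "theta3 \<tau> (u + \<tau>) = tau_mult \<tau> u * theta3 \<tau> u"
  "theta4 \<tau> (u + \<tau>) = - tau_mult \<tau> u * theta4 \<tau> u"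
proof -
  have e: "u + \<tau> = (u + \<tau>/2) + \<tau>/2" by simp
  have i: "\<i> * a * (\<i> * b * c) = - (a * b) * c" for a b c :: complex by (simp add: algebra_simps)
  show "theta1 \<tau> (u + \<tau>) = - tau_mult \<tau> u * theta1 \<tau> u"
    unfolding e by (simp only: theta1_plus_htau theta4_plus_htau i half_tau_mult_mult)
  show "theta4 \<tau> (u + \<tau>) = - tau_mult \<tau> u * theta4 \<tau> u"
    unfolding e by (simp only: theta1_plus_htau theta4_plus_htau i half_tau_mult_mult)
  show "theta2 \<tau> (u + \<tau>) = tau_mult \<tau> u * theta2 \<tau> u"
    unfolding e by (simp only: theta2_plus_htau theta3_plus_htau mult.assoc[symmetric] half_tau_mult_mult)
  show "theta3 \<tau> (u + \<tau>) = tau_mult \<tau> u * theta3 \<tau> u"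
    unfolding e by (simp only: theta2_plus_htau theta3_plus_htau mult.assoc[symmetric] half_tau_mult_mult)
qed

lemmas theta_plus_1 = theta1_plus_1 theta2_plus_1 theta3_plus_1 theta4_plus_1
lemmas theta_plus_half = theta1_plus_half theta2_plus_half theta3_plus_half theta4_plus_half
lemmas theta_plus_htau = theta1_plus_htau theta2_plus_htau theta3_plus_htau theta4_plus_htau

lemma theta_minus:
  "theta1 \<tau> (- u) = - theta1 \<tau> u" "theta2 \<tau> (- u) = theta2 \<tau> u" "theta4 \<tau> (- u) = theta4 \<tau> u"
proof -
  have t2: "theta2 \<tau> (- u) = theta2 \<tau> u" for u
  proof -
    have "theta2 \<tau> (- u) = ee (\<tau>/8 - u/2) * theta3 \<tau> (- (u - \<tau>/2))" by (simp add: theta2_theta3)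
    also have "\<dots> = ee (\<tau>/8 - u/2) * theta3 \<tau> (u - \<tau>/2)" by (simp only: theta3_minus)
    also have "\<dots> = ee (\<tau>/8 - u/2) * half_tau_mult \<tau> (u - \<tau>) * theta2 \<tau> (u - \<tau>)"
      using theta3_plus_htau[of \<tau> "u - \<tau>"] by (simp add: algebra_simps)
    also have "\<dots> = (ee (\<tau>/8 - u/2) * half_tau_mult \<tau> (u - \<tau>) / tau_mult \<tau> (u - \<tau>)) * theta2 \<tau> u"
      using theta_plus_tau(2)[of \<tau> "u - \<tau>"] by (simp add: field_simps)
    also have "ee (\<tau>/8 - u/2) * half_tau_mult \<tau> (u - \<tau>) / tau_mult \<tau> (u - \<tau>) = 1"
      unfolding half_tau_mult_def tau_mult_def ee_add[symmetric] ee_diff[symmetric] by (simp add: field_simps)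
    finally show ?thesis by simp
  qed
  show "theta2 \<tau> (- u) = theta2 \<tau> u" by (rule t2)
  show "theta4 \<tau> (- u) = theta4 \<tau> u"
    using theta3_minus[of \<tau> "u - 1/2"] theta4_plus_half[of \<tau> "u - 1/2"] theta3_plus_1[of \<tau> "u - 1/2"]
    by (simp add: theta4_theta3)
  show "theta1 \<tau> (- u) = - theta1 \<tau> u"
    using t2[of "u - 1/2"] theta2_plus_1[of \<tau> "u - 1/2"] by (simp add: theta1_theta2 add.commute)
qed

lemma theta_holomorphic:
  assumes "Im \<tau> > 0"
  shows "theta1 \<tau> holomorphic_on S" "theta2 \<tau> holomorphic_on S" "theta4 \<tau> holomorphic_on S"
proof -
  have 3: "(\<lambda>u. theta3 \<tau> (f u)) holomorphic_on T" if "f holomorphic_on T" for f T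
    using holomorphic_on_compose[OF that theta3_holomorphic[OF assms]] by (simp add: o_def)
  show "theta4 \<tau> holomorphic_on S" unfolding theta4_theta3[abs_def] by (intro 3 holomorphic_intros)
  have 2: "(\<lambda>u. theta2 \<tau> (f u)) holomorphic_on T" if "f holomorphic_on T" for f T
    unfolding theta2_theta3 by (intro 3 holomorphic_intros that) auto
  show "theta2 \<tau> holomorphic_on S" by (intro 2 holomorphic_intros)
  show "theta1 \<tau> holomorphic_on S" unfolding theta1_theta2[abs_def] by (intro 2 holomorphic_intros)
qed

section \<open>Quotients of quasi-periodic functions\<close>

lemma lattice_subset_half: "lattice \<tau> \<subseteq> half_lattice \<tau>"
proof
  fix l assume "l \<in> lattice \<tau>"
  moreover have "0 \<in> half_lattice \<tau>" using Dpts_half[of 0 \<tau>] by (simp add: Dpts_def)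
  ultimately show "l \<in> half_lattice \<tau>" using half_lattice_add[of l \<tau> 0] by simp
qed

lemma lattice_closed_ops:
  assumes "a \<in> lattice \<tau>" "b \<in> lattice \<tau>"
  shows "a + b \<in> lattice \<tau>" "a - b \<in> lattice \<tau>" "- a \<in> lattice \<tau>"
proof -
  obtain m n where a: "a = of_int m + of_int n * \<tau>" using assms lattice_def by auto
  obtain m' n' where b: "b = of_int m' + of_int n' * \<tau>" using assms lattice_def by auto
  show "a + b \<in> lattice \<tau>" unfolding lattice_def a b by (rule CollectI, rule exI[of _ "m + m'"], rule exI[of _ "n + n'"]) (simp add: algebra_simps)
  show "a - b \<in> lattice \<tau>" unfolding lattice_def a b by (rule CollectI, rule exI[of _ "m - m'"], rule exI[of _ "n - n'"]) (simp add: algebra_simps)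
  show "- a \<in> lattice \<tau>" unfolding lattice_def a by (rule CollectI, rule exI[of _ "- m"], rule exI[of _ "- n"]) (simp add: algebra_simps)
qed

lemma periodic_imp_lattice_periodic:
  assumes "\<And>u. f (u + 1) = f u" "\<And>u. f (u + \<tau>) = f u" "l \<in> lattice \<tau>"
  shows "f (u + l) = f u"
proof -
  have nat: "f (u + of_nat n * w) = f u" if "\<And>u. f (u + w) = f u" for n u w
    using that by (induction n arbitrary: u) (simp_all add: algebra_simps, metis add.assoc add.commute)
  have int: "f (u + of_int m * w) = f u" if "\<And>u. f (u + w) = f u" for m :: int and u w
  proof (cases "m \<ge> 0")
    case True
    then show ?thesis using nat[OF that, of u "nat m"] by simp
  next
    case False
    then have "of_nat (nat (- m)) = (- of_int m :: complex)" by (simp add: of_nat_nat)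
    then show ?thesis using nat[OF that, of "u + of_int m * w" "nat (- m)"] by simp
  qed
  obtain m n :: int where l: "l = of_int m + of_int n * \<tau>" using assms(3) lattice_def by auto
  show ?thesis using int[OF assms(1), of u m] int[OF assms(2), of "u + of_int m" n] by (simp add: l add.assoc)
qed

text \<open>
  The quotient \<open>N/S\<close> is doubly periodic, and its only possible singularities are at the points of \<open>p0\<close> plus the lattice, where the
  factorisation \<open>N = S H\<close> removes them. It is therefore bounded and entire, hence constant by Liouville's theorem.
\<close>

lemma quasi_periodic_quotient_constant:
  assumes \<tau>: "Im \<tau> > 0"
    and N: "N holomorphic_on UNIV" and S: "S holomorphic_on UNIV"
    and p1: "\<And>u. N (u + 1) * S u = N u * S (u + 1)" and pt: "\<And>u. N (u + \<tau>) * S u = N u * S (u + \<tau>)"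
    and z: "\<And>u. S u = 0 \<Longrightarrow> u - p0 \<in> lattice \<tau>"
    and r: "r > 0" and H: "H holomorphic_on ball p0 r" "\<And>u. u \<in> ball p0 r \<Longrightarrow> N u = S u * H u"
  obtains k where "\<And>u. N u = k * S u"
proof -
  define Q where "Q u = (if u - p0 \<in> lattice \<tau> then H p0 else N u / S u)" for u
  have add_l: "u + l - p0 \<in> lattice \<tau> \<longleftrightarrow> u - p0 \<in> lattice \<tau>" if "l \<in> lattice \<tau>" for u l
    using lattice_closed_ops[of "u - p0" \<tau> l] lattice_closed_ops[of "u + l - p0" \<tau> l] that by (auto simp: algebra_simps)
  have periodise: "Q (u + l) = Q u" if l: "l \<in> {1, \<tau>}" for u l
  proof (cases "u - p0 \<in> lattice \<tau>")
    case True
    then show ?thesis using add_l[of l u] l one_tau_lattice by (auto simp: Q_def)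
  next
    case False
    then have "u + l - p0 \<notin> lattice \<tau>" using add_l[of l u] l one_tau_lattice by auto
    with False have "S u \<noteq> 0" "S (u + l) \<noteq> 0" using z by blast+
    then show ?thesis using \<open>u + l - p0 \<notin> lattice \<tau>\<close> False l p1[of u] pt[of u] by (auto simp: Q_def field_simps)
  qed
  define e where "e = min r (sep_radius \<tau>)"
  have e: "e > 0" "e \<le> r" "e \<le> sep_radius \<tau>" using r sep_radius_pos[OF \<tau>] by (auto simp: e_def)
  have lat0: "u = p0" if "u - p0 \<in> lattice \<tau>" "u \<in> ball p0 e" for u
  proof -
    have "u - p0 \<in> half_lattice \<tau>" "0 \<in> half_lattice \<tau>" using that lattice_subset_half one_tau_lattice(3) by blast+
    then have "u - p0 = 0"
      by (rule half_lattice_separated[OF \<tau>, of _ _ "u - p0"]) (use that e sep_radius_pos[OF \<tau>] in \<open>auto simp: dist_norm norm_minus_commute\<close>)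
    then show ?thesis by simp
  qed
  have QH: "Q u = H u" if "u \<in> ball p0 e" for u
  proof (cases "u - p0 \<in> lattice \<tau>")
    case True then show ?thesis using lat0[OF True that] by (simp add: Q_def)
  next
    case False
    then have "S u \<noteq> 0" using z by blast
    then show ?thesis using False H(2)[of u] that e by (auto simp: Q_def)
  qed
  have Q0: "Q field_differentiable (at u)" if "u \<in> ball p0 e" for u
  proof -
    have "Q holomorphic_on ball p0 e"
      by (rule holomorphic_transform[of H]) (use H(1) e QH holomorphic_on_subset in \<open>auto intro: holomorphic_on_subset\<close>)
    then show ?thesis using that holomorphic_on_imp_differentiable_at by blast
  qed
  have perl: "Q (u + l) = Q u" if "l \<in> lattice \<tau>" for u l
    using periodic_imp_lattice_periodic[of Q \<tau> l u] periodise that by simp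
  have Q: "Q field_differentiable (at u)" for u
  proof (cases "u - p0 \<in> lattice \<tau>")
    case True
    have "(\<lambda>v. Q (v + (p0 - u))) = Q"
      using perl[of "p0 - u"] lattice_closed_ops(3)[OF True True] by auto
    moreover have "(\<lambda>v. Q (v + (p0 - u))) field_differentiable (at u)"
    proof -
      have "(\<lambda>v. v + (p0 - u)) field_differentiable (at u)" by (intro derivative_intros)
      moreover have "Q field_differentiable (at (u + (p0 - u)))" using Q0[of p0] e by simp
      ultimately have "Q \<circ> (\<lambda>v. v + (p0 - u)) field_differentiable (at u)" by (rule field_differentiable_compose)
      then show ?thesis by (simp add: o_def)
    qed
    ultimately show ?thesis by simp
  next
    case False
    let ?V = "{v. v - p0 \<notin> lattice \<tau>}"
    have o: "open ?V"
    proof -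
      have "closed (lattice \<tau>)"
        by (rule discrete_imp_closed[OF sep_radius_pos[OF \<tau>]])
          (use half_lattice_separated[OF \<tau>] lattice_subset_half sep_radius_pos[OF \<tau>] in \<open>metis dist_norm norm_zero right_minus_eq subsetD\<close>)
      then have "open ((\<lambda>v. v - p0) -` (- lattice \<tau>))" by (intro open_vimage continuous_intros) auto
      moreover have "(\<lambda>v. v - p0) -` (- lattice \<tau>) = ?V" by auto
      ultimately show ?thesis by simp
    qed
    have "(\<lambda>v. N v / S v) holomorphic_on ?V"
      by (intro holomorphic_intros holomorphic_on_subset[OF N] holomorphic_on_subset[OF S]) (use z in auto)
    then have "Q holomorphic_on ?V" by (rule holomorphic_transform) (auto simp: Q_def)
    then show ?thesis using o False holomorphic_on_imp_differentiable_at by blast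
  qed
  then have hQ: "Q holomorphic_on UNIV" by (simp add: holomorphic_on_def)
  have "bounded (range Q)"
  proof -
    let ?K = "{z. 0 \<le> coord_s \<tau> z \<and> coord_s \<tau> z \<le> 0 + 1 \<and> 0 \<le> coord_t \<tau> z \<and> coord_t \<tau> z \<le> 0 + 1}"
    have "bounded (Q ` ?K)"
      using compact_closed_cell[OF \<tau>, of 0 0] holomorphic_on_imp_continuous_on[OF hQ]
      by (intro compact_imp_bounded compact_continuous_image) (auto intro: continuous_on_subset)
    moreover have "range Q \<subseteq> Q ` ?K"
    proof
      fix w assume "w \<in> range Q"
      then obtain u where u: "w = Q u" by blast
      define l where "l = of_int (- \<lfloor>coord_s \<tau> u\<rfloor>) + of_int (- \<lfloor>coord_t \<tau> u\<rfloor>) * \<tau>"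
      have "l \<in> lattice \<tau>" unfolding l_def lattice_def by blast
      then have "Q (u + l) = w" using perl u by simp
      moreover have "coord_s \<tau> l = - of_int \<lfloor>coord_s \<tau> u\<rfloor>" "coord_t \<tau> l = - of_int \<lfloor>coord_t \<tau> u\<rfloor>"
        using \<tau> by (simp_all add: l_def coord_s_def coord_t_def)
      then have "u + l \<in> ?K" by (simp add: coord_add) linarith
      ultimately show "w \<in> Q ` ?K" by blast
    qed
    ultimately show ?thesis by (rule bounded_subset)
  qed
  from Liouville_theorem[OF hQ this] obtain k where k: "\<And>u. Q u = k" by (auto simp: constant_on_def)
  have "N u = k * S u" for u
  proof (rule analytic_continuation_open[of "ball p0 e" UNIV N "\<lambda>u. k * S u" u])
    show "N z = k * S z" if "z \<in> ball p0 e" for z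
      using H(2)[of z] QH[OF that] k[of z] that e by simp
  qed (use e N S in \<open>auto intro!: holomorphic_intros connected_UNIV\<close>)
  then show thesis by (rule that)
qed

text \<open>
  The difference quotient at \<open>a\<close>, holomorphic wherever \<open>f\<close> is. It splits off a zero of \<open>f\<close>, or separates the value at \<open>a\<close> from
  the rest of a power series.
\<close>

definition dquot :: "(complex \<Rightarrow> complex) \<Rightarrow> complex \<Rightarrow> complex \<Rightarrow> complex" where
  "dquot f a z = (if z = a then deriv f a else (f z - f a) / (z - a))"

lemma dquot_holomorphic: "f holomorphic_on S \<Longrightarrow> open S \<Longrightarrow> a \<in> S \<Longrightarrow> dquot f a holomorphic_on S"
  unfolding dquot_def[abs_def] by (rule pole_lemma) (simp_all add: interior_open)

lemma dquot_mult: "f z = f a + (z - a) * dquot f a z" by (simp add: dquot_def)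
lemma dquot_at [simp]: "dquot f a a = deriv f a" by (simp add: dquot_def)

text \<open>
  This supplies the local factorisation that \<open>quasi_periodic_quotient_constant\<close> asks for; the value of \<open>H\<close> at the centre allows
  the lemma to be applied twice when the denominator is a square.
\<close>

lemma simple_zero_quotient:
  assumes N: "N holomorphic_on ball a r" and S: "S holomorphic_on ball a r" and r: "r > 0"
    and 0: "N a = 0" "S a = 0" "deriv S a \<noteq> 0"
  obtains r' H where "r' > 0" "r' \<le> r" "H holomorphic_on ball a r'" "\<And>u. u \<in> ball a r' \<Longrightarrow> N u = S u * H u"
    "H a = deriv N a / deriv S a"
proof -
  have hN: "dquot N a holomorphic_on ball a r" and hS: "dquot S a holomorphic_on ball a r"
    using N S r by (auto intro!: dquot_holomorphic)
  have "continuous (at a) (dquot S a)"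
    using holomorphic_on_imp_continuous_on[OF hS] r by (simp add: continuous_on_eq_continuous_at)
  then obtain d where d: "d > 0" "\<And>u. dist u a < d \<Longrightarrow> dquot S a u \<noteq> 0"
    using continuous_at_avoid[of a "dquot S a" 0] 0 by (auto simp: dist_commute)
  define r' where "r' = min r d"
  have r': "r' > 0" "r' \<le> r" "r' \<le> d" using r d by (auto simp: r'_def)
  show thesis
  proof (rule that[of r' "\<lambda>u. dquot N a u / dquot S a u"])
    show "(\<lambda>u. dquot N a u / dquot S a u) holomorphic_on ball a r'"
      by (intro holomorphic_intros holomorphic_on_subset[OF hN] holomorphic_on_subset[OF hS])
        (use r' d(2) in \<open>auto simp: dist_commute\<close>)
    fix u assume "u \<in> ball a r'"
    then have "dquot S a u \<noteq> 0" using d(2)[of u] r' by (auto simp: dist_commute)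
    then show "N u = S u * (dquot N a u / dquot S a u)"
      using dquot_mult[of N u a] dquot_mult[of S u a] 0 by simp
  qed (use r' in auto)
qed

section \<open>The zeros of the theta functions\<close>

text \<open>
  The \<open>q\<close>-Pochhammer symbol \<open>(-z; q)\<close> of infinite length.
\<close>

definition q_prod :: "complex \<Rightarrow> complex \<Rightarrow> complex" where
  "q_prod q z = (\<Prod>n. 1 + q ^ n * z)"

lemma q_prod_convergent:
  fixes q z :: complex
  assumes "norm q < 1"
  shows "convergent_prod (\<lambda>n. 1 + q ^ n * z)"
proof (rule abs_convergent_prod_imp_convergent_prod)
  show "abs_convergent_prod (\<lambda>n. 1 + q ^ n * z)"
    unfolding abs_convergent_prod_conv_summable
    using assms by (auto simp: norm_mult norm_power intro!: summable_mult2 summable_geometric)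
qed

lemma q_prod_eq_0_iff:
  assumes "norm q < 1"
  shows "q_prod q z = 0 \<longleftrightarrow> (\<exists>n. q ^ n * z = - 1)"
proof -
  have "q_prod q z = 0 \<longleftrightarrow> 0 \<in> range (\<lambda>n. 1 + q ^ n * z)"
    unfolding q_prod_def by (rule has_prod_eq_0_iff) (rule convergent_prod_has_prod[OF q_prod_convergent[OF assms]])
  also have "\<dots> \<longleftrightarrow> (\<exists>n. q ^ n * z = - 1)" by (metis (no_types, lifting) add_eq_0_iff rangeE rangeI)
  finally show ?thesis .
qed

lemma q_prod_split:
  assumes "norm q < 1"
  shows "q_prod q z = (1 + z) * q_prod q (q * z)"
proof (cases "1 + z = 0")
  case True
  then have "q ^ 0 * z = - 1" by (simp add: add_eq_0_iff)
  then have "q_prod q z = 0" unfolding q_prod_eq_0_iff[OF assms] by blast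
  with True show ?thesis by simp
next
  case False
  have "(\<Prod>n. 1 + q ^ Suc n * z) = q_prod q z / (1 + z)"
    unfolding q_prod_def using prodinf_split_head[OF q_prod_convergent[OF assms, of z]] False by simp
  moreover have "(\<Prod>n. 1 + q ^ Suc n * z) = q_prod q (q * z)" by (simp add: q_prod_def mult_ac)
  ultimately show ?thesis using False by (simp add: divide_eq_eq mult.commute)
qed

lemma q_prod_holomorphic:
  assumes q: "norm q < 1"
  shows "q_prod q holomorphic_on S"
proof -
  have lim: "(\<lambda>N. \<Prod>n<N. 1 + q ^ n * z) \<longlonglongrightarrow> q_prod q z" for z
    unfolding q_prod_def using convergent_prod_LIMSEQ[OF q_prod_convergent[OF q, of z]] by (simp add: LIMSEQ_lessThan_iff_atMost)
  have "q_prod q holomorphic_on UNIV"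
  proof (rule holomorphic_uniform_sequence[OF open_UNIV])
    show "(\<lambda>z. \<Prod>n<N. 1 + q ^ n * z) holomorphic_on UNIV" for N by (intro holomorphic_intros)
    fix c :: complex
    have "uniformly_convergent_on (cball c 1) (\<lambda>N z. \<Prod>n<N. 1 + q ^ n * z)"
    proof (rule Infinite_Products.uniformly_convergent_on_prod')
      show "uniformly_convergent_on (cball c 1) (\<lambda>N z. \<Sum>n<N. norm (1 + q ^ n * z - 1))"
      proof (rule Weierstrass_m_test'[where M = "\<lambda>n. norm q ^ n * (norm c + 1)"])
        fix n z assume "z \<in> cball c 1"
        then have "norm z \<le> norm c + 1" using norm_triangle_sub[of z c] by (auto simp: dist_norm norm_minus_commute)
        then show "norm (norm (1 + q ^ n * z - 1)) \<le> norm q ^ n * (norm c + 1)"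
          by (simp add: norm_mult norm_power mult_left_mono)
      qed (use q in \<open>auto intro!: summable_mult2 summable_geometric\<close>)
    qed (auto intro!: continuous_intros)
    then obtain g where g: "uniform_limit (cball c 1) (\<lambda>N z. \<Prod>n<N. 1 + q ^ n * z) g sequentially"
      by (auto simp: uniformly_convergent_on_def)
    have "g z = q_prod q z" if "z \<in> cball c 1" for z
      by (rule LIMSEQ_unique[OF tendsto_uniform_limitI[OF g that] lim])
    then have "uniform_limit (cball c 1) (\<lambda>N z. \<Prod>n<N. 1 + q ^ n * z) g sequentially \<longleftrightarrow>
        uniform_limit (cball c 1) (\<lambda>N z. \<Prod>n<N. 1 + q ^ n * z) (q_prod q) sequentially"
      by (intro uniform_limit_cong') auto
    with g have "uniform_limit (cball c 1) (\<lambda>N z. \<Prod>n<N. 1 + q ^ n * z) (q_prod q) sequentially" by blast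
    then show "\<exists>d>0. cball c d \<subseteq> UNIV \<and> uniform_limit (cball c d) (\<lambda>N z. \<Prod>n<N. 1 + q ^ n * z) (q_prod q) sequentially"
      by (intro exI[of _ 1]) auto
  qed
  then show ?thesis using holomorphic_on_subset by blast
qed

text \<open>
  The product in Jacobi's triple product formula without its constant factor. Its zeros are visible, and it has the same
  quasi-periods as \<open>\<vartheta>\<^sub>3\<close>.
\<close>

definition theta_prod :: "complex \<Rightarrow> complex \<Rightarrow> complex" where
  "theta_prod \<tau> u = q_prod (ee \<tau>) (ee (\<tau>/2 + u)) * q_prod (ee \<tau>) (ee (\<tau>/2 - u))"

lemma norm_ee_less_1: "Im \<tau> > 0 \<Longrightarrow> norm (ee \<tau>) < 1" by (simp add: norm_ee)

lemma ee_power: "ee \<tau> ^ n = ee (of_nat n * \<tau>)"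
  by (induction n) (simp_all add: ee_add distrib_right)

lemma ee_eq_minus_1: "ee x = - 1 \<longleftrightarrow> (\<exists>n::int. x = of_int n + 1/2)"
proof -
  have "ee (x - 1/2) = - ee x" by (simp add: ee_diff ee_half)
  then have "ee x = - 1 \<longleftrightarrow> ee (x - 1/2) = 1" by (metis minus_minus)
  then show ?thesis by (simp add: ee_eq_1_iff algebra_simps)
qed

lemma theta_prod_zero:
  assumes \<tau>: "Im \<tau> > 0" and 0: "theta_prod \<tau> u = 0"
  shows "u - (1 + \<tau>)/2 \<in> lattice \<tau>"
proof -
  note q = norm_ee_less_1[OF \<tau>]
  have *: "\<exists>(n::nat) (m::int). of_nat n * \<tau> + (\<tau>/2 + v) = of_int m + 1/2" if "q_prod (ee \<tau>) (ee (\<tau>/2 + v)) = 0" for v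
    using that unfolding q_prod_eq_0_iff[OF q] ee_power ee_add[symmetric] ee_eq_minus_1 by blast
  from 0 have "q_prod (ee \<tau>) (ee (\<tau>/2 + u)) = 0 \<or> q_prod (ee \<tau>) (ee (\<tau>/2 + (- u))) = 0" by (simp add: theta_prod_def)
  then show ?thesis
  proof
    assume "q_prod (ee \<tau>) (ee (\<tau>/2 + u)) = 0"
    from *[OF this] obtain n m where h: "of_nat n * \<tau> + (\<tau>/2 + u) = of_int m + 1/2" by blast
    have "u = of_nat n * \<tau> + (\<tau>/2 + u) - of_nat n * \<tau> - \<tau>/2" by simp
    then have h: "u = of_int m + 1/2 - of_nat n * \<tau> - \<tau>/2" unfolding h .
    have "u - (1 + \<tau>)/2 = of_int m + of_int (- int n - 1) * \<tau>" by (subst h) (simp add: field_simps)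
    then show ?thesis unfolding lattice_def by blast
  next
    assume "q_prod (ee \<tau>) (ee (\<tau>/2 + (- u))) = 0"
    from *[OF this] obtain n m where h: "of_nat n * \<tau> + (\<tau>/2 + (- u)) = of_int m + 1/2" by blast
    have "u = of_nat n * \<tau> + \<tau>/2 - (of_nat n * \<tau> + (\<tau>/2 + (- u)))" by simp
    then have h: "u = of_nat n * \<tau> + \<tau>/2 - (of_int m + 1/2)" unfolding h .
    have "u - (1 + \<tau>)/2 = of_int (- m - 1) + of_int (int n) * \<tau>" by (subst h) (simp add: field_simps)
    then show ?thesis unfolding lattice_def by blast
  qed
qed

lemma theta_prod_plus_1: "theta_prod \<tau> (u + 1) = theta_prod \<tau> u"
proof -
  have "ee (\<tau>/2 + (u + 1)) = ee (\<tau>/2 + u)" "ee (\<tau>/2 - (u + 1)) = ee (\<tau>/2 - u)"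
    by (simp_all add: ee_add ee_diff)
  then show ?thesis by (simp add: theta_prod_def)
qed

lemma theta_prod_plus_tau:
  assumes \<tau>: "Im \<tau> > 0"
  shows "theta_prod \<tau> (u + \<tau>) = tau_mult \<tau> u * theta_prod \<tau> u"
proof -
  note q = norm_ee_less_1[OF \<tau>]
  let ?x = "ee (\<tau>/2 + u)"
  have 1: "q_prod (ee \<tau>) ?x = (1 + ?x) * q_prod (ee \<tau>) (ee (\<tau>/2 + (u + \<tau>)))"
    by (subst q_prod_split[OF q]) (simp add: ee_add[symmetric] algebra_simps)
  have 2: "q_prod (ee \<tau>) (ee (\<tau>/2 - (u + \<tau>))) = (1 + 1 / ?x) * q_prod (ee \<tau>) (ee (\<tau>/2 - u))"
  proof -
    have e: "\<tau>/2 - (u + \<tau>) = - (\<tau>/2 + u)" by (simp add: field_simps)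
    have "ee \<tau> * ee (\<tau>/2 - (u + \<tau>)) = ee (\<tau>/2 - u)"
      unfolding ee_add[symmetric] by (simp add: algebra_simps)
    moreover have "ee (\<tau>/2 - (u + \<tau>)) = 1 / ?x" unfolding e ee_minus inverse_eq_divide ..
    ultimately show ?thesis by (subst q_prod_split[OF q]) simp
  qed
  have e: "- \<tau>/2 - u = - (\<tau>/2 + u)" by simp
  have k: "tau_mult \<tau> u = 1 / ?x" unfolding tau_mult_def e ee_minus inverse_eq_divide ..
  have nz: "?x \<noteq> 0" by simp
  show ?thesis unfolding theta_prod_def 1 2 k using nz by (simp add: field_simps)
qed

lemma theta_prod_holomorphic:
  assumes "Im \<tau> > 0"
  shows "theta_prod \<tau> holomorphic_on S"
proof -
  have *: "(\<lambda>u. q_prod (ee \<tau>) (f u)) holomorphic_on S" if "f holomorphic_on S" for f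
    using holomorphic_on_compose[OF that q_prod_holomorphic[OF norm_ee_less_1[OF assms]]] by (simp add: o_def)
  show ?thesis unfolding theta_prod_def[abs_def] by (intro holomorphic_intros *) auto
qed

lemma theta_prod_simple_zero:
  assumes \<tau>: "Im \<tau> > 0"
  defines "p0 \<equiv> (1 + \<tau>)/2"
  shows "theta_prod \<tau> p0 = 0" "deriv (theta_prod \<tau>) p0 \<noteq> 0"
proof -
  note q = norm_ee_less_1[OF \<tau>]
  \<comment> \<open>Only the factor \<open>1 + ee (\<tau>/2 - u)\<close> of the product vanishes at \<open>p0\<close>; \<open>S1\<close> collects all the others.\<close>
  define S1 where "S1 u = q_prod (ee \<tau>) (ee (\<tau>/2 + u)) * q_prod (ee \<tau>) (ee \<tau> * ee (\<tau>/2 - u))" for u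
  have e1: "ee (\<tau>/2 + p0) = - ee \<tau>" and e2: "ee (\<tau>/2 - p0) = - 1"
  proof -
    have 1: "\<tau>/2 + p0 = \<tau> + 1/2" and 2: "\<tau>/2 - p0 = - (1/2)" by (simp_all add: p0_def field_simps)
    show "ee (\<tau>/2 + p0) = - ee \<tau>" unfolding 1 by (simp only: ee_add ee_half) simp
    show "ee (\<tau>/2 - p0) = - 1" unfolding 2 by (simp only: ee_minus ee_half) simp
  qed
  have F: "theta_prod \<tau> u = (1 + ee (\<tau>/2 - u)) * S1 u" for u
    unfolding theta_prod_def S1_def using q_prod_split[OF q, of "ee (\<tau>/2 - u)"] by simp
  show "theta_prod \<tau> p0 = 0" unfolding F e2 by simp
  have n0: "q_prod (ee \<tau>) (- ee \<tau>) \<noteq> 0"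
  proof
    assume "q_prod (ee \<tau>) (- ee \<tau>) = 0"
    then obtain n where "ee \<tau> ^ n * ee \<tau> = 1" unfolding q_prod_eq_0_iff[OF q] by auto
    then have "ee \<tau> ^ Suc n = 1" by (simp add: mult.commute)
    then have "norm (ee \<tau>) ^ Suc n = 1" by (metis norm_one norm_power)
    moreover have "norm (ee \<tau>) ^ Suc n < 1" using q by (intro power_Suc_less_one) auto
    ultimately show False by simp
  qed
  have S1: "S1 p0 \<noteq> 0" unfolding S1_def e1 e2 using n0 by simp
  have hS1: "S1 holomorphic_on UNIV"
  proof -
    have *: "(\<lambda>u. q_prod (ee \<tau>) (f u)) holomorphic_on UNIV" if "f holomorphic_on UNIV" for f
      using holomorphic_on_compose[OF that q_prod_holomorphic[OF q]] by (simp add: o_def)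
    show ?thesis unfolding S1_def[abs_def] by (intro holomorphic_intros *) auto
  qed
  then have dS: "(S1 has_field_derivative deriv S1 p0) (at p0)" using holomorphic_derivI open_UNIV by blast
  have "((\<lambda>u. ee (\<tau>/2 - u)) has_field_derivative 2 * of_real pi * \<i>) (at p0)"
    using e2 by (auto intro!: derivative_eq_intros)
  then have "((\<lambda>u. (1 + ee (\<tau>/2 - u)) * S1 u) has_field_derivative 2 * of_real pi * \<i> * S1 p0) (at p0)"
    using dS e2 by (auto intro!: derivative_eq_intros)
  then have "(theta_prod \<tau> has_field_derivative 2 * of_real pi * \<i> * S1 p0) (at p0)"
    unfolding F[abs_def, symmetric] .
  then show "deriv (theta_prod \<tau>) p0 \<noteq> 0" using S1 by (simp add: DERIV_imp_deriv)
qed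

text \<open>
  By evenness and \<open>\<vartheta>\<^sub>2 (u + 1) = - \<vartheta>\<^sub>2 u\<close>, the function \<open>\<vartheta>\<^sub>2\<close> vanishes at \<open>1/2\<close>; the translation by \<open>\<tau>/2\<close> moves this zero to
  \<open>(1 + \<tau>)/2\<close>.
\<close>

lemma theta3_zero_p0:
  shows "theta3 \<tau> ((1 + \<tau>)/2) = 0"
proof -
  have "theta3 \<tau> ((1 + \<tau>)/2) = half_tau_mult \<tau> (1/2) * theta2 \<tau> (1/2)"
    using theta3_plus_htau[of \<tau> "1/2"] by (simp add: add_divide_distrib)
  moreover have "theta2 \<tau> (1/2) = 0"
    using theta2_plus_1[of \<tau> "- (1/2)"] theta_minus(2)[of \<tau> "1/2"] by simp
  ultimately show ?thesis by simp
qed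

text \<open>
  The constant Fourier coefficient of \<open>\<vartheta>\<^sub>3\<close> on the real axis is \<open>1\<close>.
\<close>

lemma theta3_not_identically_0:
  assumes "Im \<tau> > 0"
  shows "\<exists>u. theta3 \<tau> u \<noteq> 0"
proof (rule ccontr)
  assume "\<nexists>u. theta3 \<tau> u \<noteq> 0"
  then have 0: "theta3 \<tau> u = 0" for u by blast
  have coeff: "((\<lambda>t::real. th_term \<tau> m (of_real t)) has_integral (if m = 0 then 1 else 0)) {0..1}" for m
  proof (cases "m = 0")
    case True
    then show ?thesis using has_integral_const_real[of "1::complex" 0 1] by (simp add: th_term_def)
  next
    case False
    define F where "F t = th_term \<tau> m (of_real t) / (2 * of_real pi * \<i> * of_int m)" for t
    have "(F has_vector_derivative th_term \<tau> m (of_real t)) (at t within {0..1})" for t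
    proof -
      have "((\<lambda>u. th_term \<tau> m u) has_field_derivative 2 * of_real pi * \<i> * th_term \<tau> m (of_real t) * of_int m) (at (of_real t))"
        unfolding th_term_def by (auto intro!: derivative_eq_intros)
      then have "((\<lambda>u. th_term \<tau> m u / (2 * of_real pi * \<i> * of_int m)) has_field_derivative th_term \<tau> m (of_real t)) (at (of_real t))"
        using False by (auto intro!: derivative_eq_intros)
      from has_vector_derivative_real_field[OF this] show ?thesis
        unfolding F_def by (simp add: has_vector_derivative_at_within)
    qed
    from fundamental_theorem_of_calculus[OF _ this]
    have "((\<lambda>t. th_term \<tau> m (of_real t)) has_integral F 1 - F 0) {0..1}" by simp
    moreover have "F 1 = F 0" by (simp add: F_def th_term_def ee_add)
    ultimately show ?thesis using False by simp
  qed
  have "uniform_limit {0..1::real} (\<lambda>X t. \<Sum>m\<in>X. th_term \<tau> m (of_real t)) (\<lambda>t. theta3 \<tau> (of_real t)) (finite_subsets_at_top UNIV)"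
    by (rule uniform_limit_compose'[OF theta3_uniform[OF assms, of 0 1]]) auto
  then obtain I J where IJ: "\<And>X. ((\<lambda>t. \<Sum>m\<in>X. th_term \<tau> m (of_real t)) has_integral I X) {0..1::real}"
     "((\<lambda>t. theta3 \<tau> (of_real t)) has_integral J) {0..1::real}" "(I \<longlongrightarrow> J) (finite_subsets_at_top UNIV)"
    by (rule uniform_limit_integral) (auto simp: th_term_def ee_def intro!: continuous_intros)
  have "J = 0" using IJ(2) by (simp add: 0 has_integral_0_eq)
  have "\<forall>\<^sub>F X in finite_subsets_at_top (UNIV :: int set). I X = 1"
    unfolding eventually_finite_subsets_at_top
  proof (intro exI[of _ "{0}"] conjI allI impI)
    fix Y :: "int set" assume Y: "finite Y \<and> {0} \<subseteq> Y \<and> Y \<subseteq> UNIV"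
    have "((\<lambda>t. \<Sum>m\<in>Y. th_term \<tau> m (of_real t)) has_integral (\<Sum>m\<in>Y. if m = 0 then 1 else 0)) {0..1::real}"
      using Y by (intro has_integral_sum coeff) auto
    then show "I Y = 1" using has_integral_unique[OF IJ(1)] Y by (simp add: sum.delta)
  qed auto
  then have "(I \<longlongrightarrow> 1) (finite_subsets_at_top UNIV)" by (rule tendsto_eventually)
  then have "J = 1" using IJ(3) tendsto_unique finite_subsets_at_top_neq_bot by blast
  with \<open>J = 0\<close> show False by simp
qed

text \<open>
  The known zero of \<open>\<vartheta>\<^sub>3\<close> at \<open>(1 + \<tau>)/2\<close> makes \<open>\<vartheta>\<^sub>3\<close> divisible by \<open>theta_prod\<close> there, hence a constant multiple of it.
\<close>

lemma theta3_zeros: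
  assumes \<tau>: "Im \<tau> > 0"
  shows "theta3 \<tau> u = 0 \<longleftrightarrow> u - (1 + \<tau>)/2 \<in> lattice \<tau>" "deriv (theta3 \<tau>) ((1 + \<tau>)/2) \<noteq> 0"
proof -
  let ?p = "(1 + \<tau>)/2"
  obtain r H where r: "r > 0" "H holomorphic_on ball ?p r" "\<And>u. u \<in> ball ?p r \<Longrightarrow> theta3 \<tau> u = theta_prod \<tau> u * H u"
    using simple_zero_quotient[of "theta3 \<tau>" ?p 1 "theta_prod \<tau>"] theta3_holomorphic[OF \<tau>] theta_prod_holomorphic[OF \<tau>]
      theta3_zero_p0 theta_prod_simple_zero[OF \<tau>] by (metis zero_less_one)
  obtain k where k: "\<And>u. theta3 \<tau> u = k * theta_prod \<tau> u"
  proof (rule quasi_periodic_quotient_constant[OF \<tau> theta3_holomorphic[OF \<tau>] theta_prod_holomorphic[OF \<tau>] _ _ theta_prod_zero[OF \<tau>] r])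
    show "theta3 \<tau> (u + \<tau>) * theta_prod \<tau> u = theta3 \<tau> u * theta_prod \<tau> (u + \<tau>)" for u
      by (simp add: theta_plus_tau theta_prod_plus_tau[OF \<tau>])
  qed (auto simp: theta3_plus_1 theta_prod_plus_1)
  have k0: "k \<noteq> 0" using theta3_not_identically_0[OF \<tau>] k by auto
  have zl: "theta3 \<tau> (?p + l) = 0" if "l \<in> lattice \<tau>" for l
  proof -
    have "(theta3 \<tau> (u + 1) = 0) = (theta3 \<tau> u = 0)" "(theta3 \<tau> (u + \<tau>) = 0) = (theta3 \<tau> u = 0)" for u
      by (simp_all add: theta3_plus_1 theta_plus_tau)
    from periodic_imp_lattice_periodic[of "\<lambda>u. theta3 \<tau> u = 0", OF this that] theta3_zero_p0 show ?thesis by simp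
  qed
  show "theta3 \<tau> u = 0 \<longleftrightarrow> u - ?p \<in> lattice \<tau>"
    using theta_prod_zero[OF \<tau>, of u] k k0 zl[of "u - ?p"] by auto
  have "deriv (theta3 \<tau>) ?p = k * deriv (theta_prod \<tau>) ?p"
  proof -
    have "(theta_prod \<tau> has_field_derivative deriv (theta_prod \<tau>) ?p) (at ?p)"
      using holomorphic_derivI[OF theta_prod_holomorphic[OF \<tau>, of UNIV]] by simp
    then have "((\<lambda>u. k * theta_prod \<tau> u) has_field_derivative k * deriv (theta_prod \<tau>) ?p) (at ?p)" by (rule DERIV_cmult)
    then show ?thesis unfolding k[symmetric] by (rule DERIV_imp_deriv)
  qed
  then show "deriv (theta3 \<tau>) ?p \<noteq> 0" using k0 theta_prod_simple_zero[OF \<tau>] by simp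
qed

lemma theta_zeros:
  assumes \<tau>: "Im \<tau> > 0"
  shows "theta1 \<tau> u = 0 \<longleftrightarrow> u \<in> lattice \<tau>" "theta2 \<tau> u = 0 \<longleftrightarrow> u - 1/2 \<in> lattice \<tau>"
    "theta4 \<tau> u = 0 \<longleftrightarrow> u - \<tau>/2 \<in> lattice \<tau>"
proof -
  show 4: "theta4 \<tau> u = 0 \<longleftrightarrow> u - \<tau>/2 \<in> lattice \<tau>" for u
    using theta3_zeros(1)[OF \<tau>, of "u + 1/2"] by (simp add: theta4_theta3 add_divide_distrib)
  have e: "u + \<tau>/2 - (1 + \<tau>)/2 = u - 1/2" by (simp add: field_simps)
  show "theta2 \<tau> u = 0 \<longleftrightarrow> u - 1/2 \<in> lattice \<tau>"
    using theta3_zeros(1)[OF \<tau>, of "u + \<tau>/2"] unfolding theta3_plus_htau e by simp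
  show "theta1 \<tau> u = 0 \<longleftrightarrow> u \<in> lattice \<tau>"
    using 4[of "u + \<tau>/2"] unfolding theta4_plus_htau by simp
qed

section \<open>Identities between theta functions\<close>

lemma even_deriv_0:
  fixes f :: "complex \<Rightarrow> complex"
  assumes "f holomorphic_on UNIV" "\<And>u. f (- u) = f u"
  shows "deriv f 0 = 0"
proof -
  have d: "(f has_field_derivative deriv f 0) (at 0)" using assms(1) holomorphic_derivI by blast
  have "((\<lambda>u. f (- u)) has_field_derivative deriv f 0 * (- 1)) (at 0)"
    by (rule DERIV_chain2[where g = uminus]) (use d in \<open>auto intro!: derivative_eq_intros\<close>)
  then have "(f has_field_derivative deriv f 0 * (- 1)) (at 0)" using assms(2) by simp
  from DERIV_unique[OF d this] show ?thesis by simp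
qed

lemma deriv_parity:
  fixes f :: "complex \<Rightarrow> complex"
  assumes "f holomorphic_on UNIV" "\<And>u. f (- u) = c * f u"
  shows "deriv f (- u) = - c * deriv f u"
proof -
  have d: "(f has_field_derivative deriv f v) (at v)" for v using assms(1) holomorphic_derivI by blast
  have "((\<lambda>u. f (- u)) has_field_derivative deriv f (- u) * (- 1)) (at u)"
    by (rule DERIV_chain2[OF d]) (auto intro!: derivative_eq_intros)
  moreover have "((\<lambda>u. f (- u)) has_field_derivative c * deriv f u) (at u)"
    unfolding assms(2) by (rule DERIV_cmult[OF d])
  ultimately have "deriv f (- u) * (- 1) = c * deriv f u" by (rule DERIV_unique)
  then show ?thesis by (metis minus_minus mult_minus1_right mult_minus_left)
qed

lemma holo_UNIV_deriv:
  fixes f :: "complex \<Rightarrow> complex"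
  assumes "f holomorphic_on UNIV"
  shows "(f has_field_derivative deriv f u) (at u)" "deriv f holomorphic_on UNIV"
  using assms holomorphic_derivI holomorphic_deriv by blast+

lemma deriv2_mult:
  fixes f g :: "complex \<Rightarrow> complex"
  assumes "f holomorphic_on UNIV" "g holomorphic_on UNIV"
  shows "deriv (\<lambda>u. f u * g u) u = deriv f u * g u + f u * deriv g u"
    "deriv (deriv (\<lambda>u. f u * g u)) u = deriv (deriv f) u * g u + 2 * deriv f u * deriv g u + f u * deriv (deriv g) u"
proof -
  note d = holo_UNIV_deriv[OF assms(1)] holo_UNIV_deriv[OF assms(2)]
  have 1: "deriv (\<lambda>u. f u * g u) = (\<lambda>u. deriv f u * g u + f u * deriv g u)"
    using DERIV_mult[OF d(1,3)] by (auto intro!: DERIV_imp_deriv simp: mult.commute add.commute)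
  then show "deriv (\<lambda>u. f u * g u) u = deriv f u * g u + f u * deriv g u" by simp
  have "((\<lambda>u. deriv f u * g u + f u * deriv g u) has_field_derivative
    deriv (deriv f) u * g u + 2 * deriv f u * deriv g u + f u * deriv (deriv g) u) (at u)"
    using holo_UNIV_deriv(1)[OF d(2)] holo_UNIV_deriv(1)[OF d(4)] d(1,3)
    by (auto intro!: derivative_eq_intros)
  then show "deriv (deriv (\<lambda>u. f u * g u)) u = deriv (deriv f) u * g u + 2 * deriv f u * deriv g u + f u * deriv (deriv g) u"
    unfolding 1 by (rule DERIV_imp_deriv)
qed

text \<open>
  The expression \<open>- f\<^sup>2 (log f)''\<close>, which is defined also at the zeros of \<open>f\<close>. For \<open>f = \<vartheta>\<^sub>1\<close> it is \<open>\<vartheta>\<^sub>1\<^sup>2\<close> times the Weierstrass function,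
  up to an additive multiple of \<open>\<vartheta>\<^sub>1\<^sup>2\<close>.
\<close>

definition hirota :: "(complex \<Rightarrow> complex) \<Rightarrow> complex \<Rightarrow> complex" where
  "hirota f u = (deriv f u)\<^sup>2 - f u * deriv (deriv f) u"

text \<open>
  The logarithm of the factor \<open>E\<close> is linear, so it does not contribute to the second logarithmic derivative.
\<close>

lemma hirota_shift:
  assumes f: "f holomorphic_on UNIV" and g: "g holomorphic_on UNIV"
    and E: "\<And>u. (E has_field_derivative b * E u) (at u)" and fg: "\<And>u. f (u + s) = E u * g u"
  shows "hirota f (u + s) = (E u)\<^sup>2 * hirota g u"
proof -
  note df = holo_UNIV_deriv[OF f] note dg = holo_UNIV_deriv[OF g]
  have sh: "((\<lambda>u. h (u + s)) has_field_derivative deriv h (u + s)) (at u)" if "h holomorphic_on UNIV" for h u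
    using holo_UNIV_deriv(1)[OF that] DERIV_shift by blast
  have 1: "deriv f (u + s) = E u * (b * g u + deriv g u)" for u
  proof -
    have "((\<lambda>u. E u * g u) has_field_derivative E u * (b * g u + deriv g u)) (at u)"
      using E[of u] dg(1)[of u] by (auto intro!: derivative_eq_intros simp: algebra_simps)
    then show ?thesis using sh[OF f, of u] unfolding fg by (blast intro: DERIV_unique)
  qed
  have 2: "deriv (deriv f) (u + s) = E u * (b\<^sup>2 * g u + 2 * b * deriv g u + deriv (deriv g) u)"
  proof -
    have "((\<lambda>u. E u * (b * g u + deriv g u)) has_field_derivative E u * (b\<^sup>2 * g u + 2 * b * deriv g u + deriv (deriv g) u)) (at u)"
      using E[of u] dg(1)[of u] holo_UNIV_deriv(1)[OF dg(2), of u]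
      by (auto intro!: derivative_eq_intros simp: algebra_simps power2_eq_square)
    then show ?thesis using sh[OF df(2), of u] unfolding 1 by (blast intro: DERIV_unique)
  qed
  show ?thesis unfolding hirota_def 1 2 fg by (simp add: power2_eq_square algebra_simps)
qed

lemma hirota_holomorphic: "f holomorphic_on UNIV \<Longrightarrow> hirota f holomorphic_on UNIV"
  unfolding hirota_def[abs_def] by (intro holomorphic_intros) auto

text \<open>
  For even \<open>f\<close> this is the second logarithmic derivative at \<open>0\<close>.
\<close>

definition second_ratio :: "(complex \<Rightarrow> complex) \<Rightarrow> complex" where "second_ratio f = deriv (deriv f) 0 / f 0"

locale theta_tau =
  fixes \<tau> :: complex
  assumes \<tau>: "Im \<tau> > 0"
begin

abbreviation "T1 \<equiv> theta1 \<tau>" abbreviation "T2 \<equiv> theta2 \<tau>"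
abbreviation "T3 \<equiv> theta3 \<tau>" abbreviation "T4 \<equiv> theta4 \<tau>"

lemmas hol = theta_holomorphic(1)[OF \<tau>] theta_holomorphic(2)[OF \<tau>] theta3_holomorphic[OF \<tau>] theta_holomorphic(3)[OF \<tau>]

lemma half_lattice_notin:
  "1/2 \<notin> lattice \<tau>" "\<tau>/2 \<notin> lattice \<tau>" "(1 + \<tau>)/2 \<notin> lattice \<tau>"
proof -
  have *: "\<exists>m n::int. coord_s \<tau> l = of_int m \<and> coord_t \<tau> l = of_int n" if h: "l \<in> lattice \<tau>" for l
  proof -
    obtain m n :: int where l: "l = of_int m + of_int n * \<tau>" using h lattice_def by auto
    then show ?thesis using \<tau> by (intro exI[of _ m] exI[of _ n]) (auto simp: coord_s_def coord_t_def)
  qed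
  have n: "1/2 \<noteq> real_of_int m" for m
  proof
    assume "1/2 = real_of_int m"
    then have "1 = 2 * m" by linarith
    then show False by presburger
  qed
  have "coord_s \<tau> (1/2) = 1/2" "coord_t \<tau> (\<tau>/2) = 1/2" "coord_t \<tau> ((1 + \<tau>)/2) = 1/2" using \<tau> by (auto simp: coord_s_def coord_t_def)
  then show "1/2 \<notin> lattice \<tau>" "\<tau>/2 \<notin> lattice \<tau>" "(1 + \<tau>)/2 \<notin> lattice \<tau>" using * n by metis+
qed

lemma nz: "T2 0 \<noteq> 0" "T3 0 \<noteq> 0" "T4 0 \<noteq> 0"
  using half_lattice_notin lattice_closed_ops(3)[of _ \<tau>] theta_zeros[OF \<tau>, of 0] theta3_zeros(1)[OF \<tau>, of 0] by fastforce+

lemma T1_0: "T1 0 = 0" using theta_zeros(1)[OF \<tau>] one_tau_lattice by blast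

lemma T1_deriv_nz: "deriv T1 0 \<noteq> 0"
proof -
  define E where "E u = - ee (\<tau>/8 + u/2 + 1/4)" for u
  have T1E: "T1 = (\<lambda>u. E u * T3 (u + (1 + \<tau>)/2))"
  proof
    fix u
    have "T1 u = - ee (\<tau>/8 + (u + 1/2)/2) * T3 (u + 1/2 + \<tau>/2)" by (simp add: theta1_theta2 theta2_theta3)
    then show "T1 u = E u * T3 (u + (1 + \<tau>)/2)" by (simp add: E_def add_divide_distrib add.assoc)
  qed
  have "((\<lambda>u. E u * T3 (u + (1 + \<tau>)/2)) has_field_derivative E 0 * deriv T3 ((1 + \<tau>)/2)) (at 0)"
  proof -
    have "((\<lambda>u. T3 (u + (1 + \<tau>)/2)) has_field_derivative deriv T3 (0 + (1 + \<tau>)/2)) (at 0)"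
      using holo_UNIV_deriv(1)[OF hol(3)] DERIV_shift by blast
    moreover have "(E has_field_derivative - (of_real pi * \<i> * ee (\<tau>/8 + 1/4))) (at 0)"
      unfolding E_def[abs_def] by (auto intro!: derivative_eq_intros)
    ultimately show ?thesis using theta3_zero_p0[of \<tau>] by (auto intro!: derivative_eq_intros)
  qed
  then have "deriv T1 0 = E 0 * deriv T3 ((1 + \<tau>)/2)" unfolding T1E by (rule DERIV_imp_deriv)
  then show ?thesis using theta3_zeros(2)[OF \<tau>] by (simp add: E_def)
qed

lemma deriv_even_0: "deriv T2 0 = 0" "deriv T3 0 = 0" "deriv T4 0 = 0" "deriv (deriv T1) 0 = 0"
  using even_deriv_0[OF hol(2) theta_minus(2)] even_deriv_0[OF hol(3) theta3_minus] even_deriv_0[OF hol(4) theta_minus(3)]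
    even_deriv_0[OF holo_UNIV_deriv(2)[OF hol(1)]] deriv_parity[OF hol(1), of "-1"] theta_minus(1) by auto

text \<open>
  The coefficient of \<open>\<vartheta>\<^sub>4\<^sup>2\<close> in \<open>hirota_theta1\<close>, forced by comparison at \<open>0\<close>. By Jacobi's formula it equals \<open>\<pi>\<^sup>2 \<vartheta>\<^sub>2(0)\<^sup>2 \<vartheta>\<^sub>3(0)\<^sup>2\<close>, see
  \<open>wp_coeff_eq\<close>.
\<close>

definition wp_coeff :: complex where "wp_coeff = (deriv T1 0)\<^sup>2 / (T4 0)\<^sup>2"

lemma half_tau_mult_deriv: "(half_tau_mult \<tau> has_field_derivative (- of_real pi * \<i>) * half_tau_mult \<tau> u) (at u)"
  unfolding half_tau_mult_def[abs_def] by (auto intro!: derivative_eq_intros)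
lemma tau_mult_deriv: "(tau_mult \<tau> has_field_derivative (- 2 * of_real pi * \<i>) * tau_mult \<tau> u) (at u)"
  unfolding tau_mult_def[abs_def] by (auto intro!: derivative_eq_intros)

text \<open>
  Divided by \<open>\<vartheta>\<^sub>1\<^sup>2\<close>, this says that \<open>\<wp>(u) - \<wp>(\<tau>/2)\<close> is a multiple of \<open>\<vartheta>\<^sub>4\<^sup>2/\<vartheta>\<^sub>1\<^sup>2\<close>. The choice of
  \<open>wp_coeff\<close> makes \<open>hirota \<vartheta>\<^sub>1 - wp_coeff \<vartheta>\<^sub>4\<^sup>2\<close> vanish at \<open>0\<close>, by evenness at least doubly, so the difference is a constant multiple of
  \<open>\<vartheta>\<^sub>1\<^sup>2\<close>; the constant is found at \<open>u = \<tau>/2\<close>, where \<open>\<vartheta>\<^sub>4\<close> vanishes.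
\<close>

lemma hirota_theta1: "hirota T1 u = wp_coeff * (T4 u)\<^sup>2 - second_ratio T4 * (T1 u)\<^sup>2"
proof -
  define N where "N u = hirota T1 u - wp_coeff * (T4 u)\<^sup>2" for u
  define S where "S u = (T1 u)\<^sup>2" for u
  have N: "N holomorphic_on UNIV" and S: "S holomorphic_on UNIV"
    unfolding N_def[abs_def] S_def[abs_def] by (intro holomorphic_intros hirota_holomorphic hol)+
  have N1: "N (u + 1) = N u" for u
    unfolding N_def using hirota_shift[OF hol(1) hol(1), of "\<lambda>_. -1" 0 1 u] by (simp add: theta_plus_1)
  have S1: "S (u + 1) = S u" for u by (simp add: S_def theta_plus_1)
  have Wt: "hirota T1 (u + \<tau>) = (tau_mult \<tau> u)\<^sup>2 * hirota T1 u" for u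
    using hirota_shift[OF hol(1) hol(1), of "\<lambda>u. - tau_mult \<tau> u" "- 2 * of_real pi * \<i>" \<tau> u] DERIV_minus[OF tau_mult_deriv]
    by (simp add: theta_plus_tau)
  have Nt: "N (u + \<tau>) = (tau_mult \<tau> u)\<^sup>2 * N u" for u
    unfolding N_def Wt theta_plus_tau by (simp add: power_mult_distrib algebra_simps)
  have St: "S (u + \<tau>) = (tau_mult \<tau> u)\<^sup>2 * S u" for u by (simp add: S_def theta_plus_tau power_mult_distrib)
  have N0: "N 0 = 0" using nz by (simp add: N_def hirota_def T1_0 wp_coeff_def)
  have Wm: "hirota T1 (- u) = hirota T1 u" for u
  proof -
    have "deriv T1 (- u) = deriv T1 u" for u using deriv_parity[OF hol(1), of "-1" u] theta_minus(1) by simp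
    moreover from this have "deriv (deriv T1) (- u) = - deriv (deriv T1) u"
      using deriv_parity[OF holo_UNIV_deriv(2)[OF hol(1)], of 1 u] by simp
    ultimately show ?thesis by (simp add: hirota_def theta_minus)
  qed
  have dN0: "deriv N 0 = 0"
    by (rule even_deriv_0[OF N]) (simp add: N_def Wm theta_minus)
  \<comment> \<open>\<open>N\<close> has a zero of order at least two at \<open>0\<close>, so it can be divided by \<open>\<vartheta>\<^sub>1\<close> twice.\<close>
  obtain r H where r: "r > 0" "r \<le> 1" "H holomorphic_on ball 0 r" "\<And>u. u \<in> ball 0 r \<Longrightarrow> N u = T1 u * H u"
    "H 0 = deriv N 0 / deriv T1 0"
    using simple_zero_quotient[OF holomorphic_on_subset[OF N] hol(1) zero_less_one N0 T1_0 T1_deriv_nz] by auto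
  obtain r' H' where r': "r' > 0" "r' \<le> r" "H' holomorphic_on ball 0 r'" "\<And>u. u \<in> ball 0 r' \<Longrightarrow> H u = T1 u * H' u"
    by (rule simple_zero_quotient[OF r(3) hol(1) r(1) _ T1_0 T1_deriv_nz]) (use r(5) dN0 in auto)
  obtain K where K: "\<And>u. N u = K * S u"
  proof (rule quasi_periodic_quotient_constant[OF \<tau> N S _ _ _ r'(1) r'(3)])
    show "u - 0 \<in> lattice \<tau>" if "S u = 0" for u using that theta_zeros(1)[OF \<tau>, of u] by (simp add: S_def)
    show "N u = S u * H' u" if "u \<in> ball 0 r'" for u
      using r(4)[of u] r'(4)[OF that] that r' by (auto simp: S_def power2_eq_square)
  qed (auto simp: N1 S1 Nt St)
  have "K = - second_ratio T4"
  proof -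
    have W: "hirota T1 (0 + \<tau>/2) = (\<i> * half_tau_mult \<tau> 0)\<^sup>2 * hirota T4 0"
    proof (rule hirota_shift[OF hol(1) hol(4)])
      show "((\<lambda>u. \<i> * half_tau_mult \<tau> u) has_field_derivative (- of_real pi * \<i>) * (\<i> * half_tau_mult \<tau> u)) (at u)" for u
        using DERIV_cmult[OF half_tau_mult_deriv, of \<i> u] by (simp add: mult_ac)
    qed (simp add: theta1_plus_htau)
    have "N (0 + \<tau>/2) = (\<i> * half_tau_mult \<tau> 0)\<^sup>2 * hirota T4 0"
      unfolding N_def W theta4_plus_htau T1_0 by simp
    moreover have "hirota T4 0 = - (second_ratio T4 * (T4 0)\<^sup>2)"
      unfolding hirota_def second_ratio_def deriv_even_0 using nz by (simp add: power2_eq_square)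
    moreover have "S (0 + \<tau>/2) = (\<i> * half_tau_mult \<tau> 0)\<^sup>2 * (T4 0)\<^sup>2"
      unfolding S_def theta1_plus_htau by (simp add: power_mult_distrib)
    ultimately have "(\<i> * half_tau_mult \<tau> 0)\<^sup>2 * (- (second_ratio T4 * (T4 0)\<^sup>2)) = K * ((\<i> * half_tau_mult \<tau> 0)\<^sup>2 * (T4 0)\<^sup>2)"
      using K[of "0 + \<tau>/2"] by simp
    then have "((\<i> * half_tau_mult \<tau> 0)\<^sup>2 * (T4 0)\<^sup>2) * (K + second_ratio T4) = 0" by (simp add: algebra_simps)
    then show ?thesis using nz by (simp add: eq_neg_iff_add_eq_0)
  qed
  then show ?thesis using K[of u] by (simp add: N_def S_def algebra_simps)
qed

text \<open>
  Evaluate \<open>hirota_theta1\<close> at the two remaining half periods, where \<open>\<vartheta>\<^sub>1\<close> and \<open>\<vartheta>\<^sub>4\<close> turn into other theta functions at \<open>0\<close>.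
\<close>

lemma second_ratio_differences:
  "second_ratio T4 - second_ratio T2 = wp_coeff * (T3 0)\<^sup>2 / (T2 0)\<^sup>2" "second_ratio T4 - second_ratio T3 = wp_coeff * (T2 0)\<^sup>2 / (T3 0)\<^sup>2"
proof -
  have W2: "hirota T1 (0 + 1/2) = 1\<^sup>2 * hirota T2 0"
    by (rule hirota_shift[OF hol(1) hol(2), of _ 0]) (auto simp: theta1_plus_half)
  have "hirota T2 0 = - (second_ratio T2 * (T2 0)\<^sup>2)"
    unfolding hirota_def second_ratio_def deriv_even_0 using nz by (simp add: power2_eq_square)
  with hirota_theta1[of "0 + 1/2"] W2 have "- (second_ratio T2 * (T2 0)\<^sup>2) = wp_coeff * (T3 0)\<^sup>2 - second_ratio T4 * (T2 0)\<^sup>2"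
    unfolding theta4_plus_half theta1_plus_half by simp
  then show "second_ratio T4 - second_ratio T2 = wp_coeff * (T3 0)\<^sup>2 / (T2 0)\<^sup>2" using nz by (simp add: field_simps)
  have e1: "T1 (u + (\<tau>/2 + 1/2)) = half_tau_mult \<tau> u * T3 u" "T4 (u + (\<tau>/2 + 1/2)) = half_tau_mult \<tau> u * T2 u" for u
    using theta1_plus_half[of \<tau> "u + \<tau>/2"] theta4_plus_half[of \<tau> "u + \<tau>/2"]
    by (simp_all add: add.assoc theta2_plus_htau theta3_plus_htau)
  have W3: "hirota T1 (0 + (\<tau>/2 + 1/2)) = (half_tau_mult \<tau> 0)\<^sup>2 * hirota T3 0"
    by (rule hirota_shift[OF hol(1) hol(3) half_tau_mult_deriv e1(1)])
  have "hirota T3 0 = - (second_ratio T3 * (T3 0)\<^sup>2)"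
    unfolding hirota_def second_ratio_def deriv_even_0 using nz by (simp add: power2_eq_square)
  with hirota_theta1[of "0 + (\<tau>/2 + 1/2)"] W3
  have "(half_tau_mult \<tau> 0)\<^sup>2 * (- (second_ratio T3 * (T3 0)\<^sup>2)) = (half_tau_mult \<tau> 0)\<^sup>2 * (wp_coeff * (T2 0)\<^sup>2 - second_ratio T4 * (T3 0)\<^sup>2)"
    unfolding e1 by (simp add: power_mult_distrib algebra_simps)
  then have "- (second_ratio T3 * (T3 0)\<^sup>2) = wp_coeff * (T2 0)\<^sup>2 - second_ratio T4 * (T3 0)\<^sup>2"
    by (simp only: mult_cancel_left) simp
  then show "second_ratio T4 - second_ratio T3 = wp_coeff * (T2 0)\<^sup>2 / (T3 0)\<^sup>2" using nz by (simp add: field_simps)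
qed

text \<open>
  The function \<open>\<vartheta>\<^sub>1(u)/u\<close>. It is even, and its second logarithmic derivative at \<open>0\<close> is a third of \<open>\<vartheta>\<^sub>1'''(0)/\<vartheta>\<^sub>1'(0)\<close>.
\<close>

definition theta1_over_u :: "complex \<Rightarrow> complex" where "theta1_over_u = dquot T1 0"

lemma theta1_over_u: "theta1_over_u holomorphic_on UNIV" "T1 u = u * theta1_over_u u" "theta1_over_u 0 = deriv T1 0" "theta1_over_u (- u) = theta1_over_u u"
proof -
  show "theta1_over_u holomorphic_on UNIV" unfolding theta1_over_u_def by (intro dquot_holomorphic hol) auto
  show m: "T1 u = u * theta1_over_u u" "theta1_over_u 0 = deriv T1 0" for u
    using dquot_mult[of T1 u 0] T1_0 by (simp_all add: theta1_over_u_def)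
  show "theta1_over_u (- u) = theta1_over_u u"
    by (cases "u = 0") (simp_all add: theta1_over_u_def dquot_def T1_0 theta_minus)
qed

lemma theta1_over_u_deriv_0: "deriv theta1_over_u 0 = 0" by (rule even_deriv_0[OF theta1_over_u(1,4)])

lemma theta1_deriv3: "deriv (deriv (deriv T1)) 0 = 3 * deriv (deriv theta1_over_u) 0"
proof -
  have T: "T1 = (\<lambda>u. u * theta1_over_u u)" using theta1_over_u(2) by blast
  note d = holo_UNIV_deriv[OF theta1_over_u(1)]
  have i: "(\<lambda>u::complex. u) holomorphic_on UNIV" by (rule holomorphic_on_ident)
  have 2: "deriv (deriv T1) = (\<lambda>u. 2 * deriv theta1_over_u u + u * deriv (deriv theta1_over_u) u)"
    unfolding T using deriv2_mult(2)[OF i theta1_over_u(1)] by (simp add: fun_eq_iff)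
  have "((\<lambda>u. 2 * deriv theta1_over_u u + u * deriv (deriv theta1_over_u) u) has_field_derivative 3 * deriv (deriv theta1_over_u) 0) (at 0)"
    using holo_UNIV_deriv[OF d(2)] holo_UNIV_deriv(1)[OF holo_UNIV_deriv(2)[OF d(2)]]
    by (auto intro!: derivative_eq_intros)
  then show ?thesis unfolding 2 by (rule DERIV_imp_deriv)
qed

text \<open>
  Substituting \<open>v = 2u\<close>, the zeros of \<open>\<vartheta>\<^sub>1(2u)\<close> are the half-lattice points, at each of which exactly one of the four factors on the
  right has a simple zero; both sides have the same quasi-periods.
\<close>

lemma theta_duplication:
  obtains k where "\<And>v. T1 v = k * (T1 (v/2) * (T2 (v/2) * T3 (v/2) * T4 (v/2)))"
proof -
  define S where "S v = T1 (v/2) * (T2 (v/2) * T3 (v/2) * T4 (v/2))" for v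
  have c: "(\<lambda>v. f (v/2)) holomorphic_on UNIV" if "f holomorphic_on UNIV" for f
    using holomorphic_on_compose[of "\<lambda>v. v/2" UNIV f] that holomorphic_on_subset[OF that] by (simp add: o_def holomorphic_intros)
  have S: "S holomorphic_on UNIV" unfolding S_def[abs_def] by (intro holomorphic_intros c hol)
  have a1: "(v + 1)/2 = v/2 + 1/2" and a2: "(v + \<tau>)/2 = v/2 + \<tau>/2" for v :: complex by (simp_all add: add_divide_distrib)
  have S1: "S (v + 1) = - S v" for v unfolding S_def a1 theta_plus_half by simp
  have n4: "half_tau_mult \<tau> (v/2) ^ 4 = tau_mult \<tau> v" for v
  proof -
    have "half_tau_mult \<tau> (v/2) ^ 4 = ee (of_nat 4 * (- \<tau>/8 - v/2/2))" unfolding half_tau_mult_def by (rule ee_power)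
    also have "of_nat 4 * (- \<tau>/8 - v/2/2) = - \<tau>/2 - v" by (simp add: field_simps)
    finally show ?thesis by (simp add: tau_mult_def)
  qed
  have St: "S (v + \<tau>) = - tau_mult \<tau> v * S v" for v
    unfolding S_def a2 theta_plus_htau n4[symmetric] by (simp add: power4_eq_xxxx algebra_simps)
  have zero: "v - 0 \<in> lattice \<tau>" if "S v = 0" for v
  proof -
    have dbl: "2 * l \<in> lattice \<tau>" if "l \<in> lattice \<tau>" for l
      unfolding mult_2 by (rule lattice_closed_ops(1)[OF that that])
    have *: "v \<in> lattice \<tau>" if "v/2 - d \<in> lattice \<tau>" "2 * d \<in> lattice \<tau>" for d
    proof -
      have "v = 2 * (v/2 - d) + 2 * d" by (simp add: algebra_simps)
      then show ?thesis using lattice_closed_ops(1)[OF dbl[OF that(1)] that(2)] by simp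
    qed
    have "v/2 - 0 \<in> lattice \<tau> \<or> v/2 - 1/2 \<in> lattice \<tau> \<or> v/2 - (1 + \<tau>)/2 \<in> lattice \<tau> \<or> v/2 - \<tau>/2 \<in> lattice \<tau>"
      using that theta_zeros[OF \<tau>, of "v/2"] theta3_zeros(1)[OF \<tau>, of "v/2"] by (auto simp: S_def)
    moreover have dbl_half: "2 * ((1 + \<tau>)/2) = 1 + \<tau>" by (simp add: field_simps)
    ultimately show ?thesis
      using *[of 0] *[of "1/2"] *[of "(1 + \<tau>)/2", unfolded dbl_half] *[of "\<tau>/2"] one_tau_lattice[of \<tau>] lattice_closed_ops(1)[of 1 \<tau> \<tau>] by auto
  qed
  have S0: "S 0 = 0" by (simp add: S_def T1_0)
  have dS: "deriv S 0 \<noteq> 0"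
  proof -
    have "((\<lambda>v. T1 (v/2)) has_field_derivative deriv T1 0 * (1/2)) (at 0)"
      by (rule DERIV_chain2) (use holo_UNIV_deriv(1)[OF hol(1), of 0] in \<open>auto intro!: derivative_eq_intros\<close>)
    moreover have "((\<lambda>v. T2 (v/2) * T3 (v/2) * T4 (v/2)) has_field_derivative deriv (\<lambda>v. T2 (v/2) * T3 (v/2) * T4 (v/2)) 0) (at 0)"
      by (rule holo_UNIV_deriv(1)) (intro holomorphic_intros c hol)
    ultimately have "(S has_field_derivative deriv T1 0 * (1/2) * (T2 0 * T3 0 * T4 0)) (at 0)"
      unfolding S_def[abs_def] by (rule DERIV_cong[OF DERIV_mult]) (simp add: T1_0)
    then show ?thesis using nz T1_deriv_nz by (simp add: DERIV_imp_deriv)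
  qed
  obtain r H where r: "r > 0" "r \<le> 1" "H holomorphic_on ball 0 r" "\<And>u. u \<in> ball 0 r \<Longrightarrow> T1 u = S u * H u"
      "H 0 = deriv T1 0 / deriv S 0"
    by (rule simple_zero_quotient[OF hol(1) holomorphic_on_subset[OF S subset_UNIV] zero_less_one T1_0 S0 dS]) (rule that)
  show thesis
  proof (rule quasi_periodic_quotient_constant[OF \<tau> hol(1) S _ _ zero r(1,3,4)])
    fix k assume "\<And>u. T1 u = k * S u"
    then show thesis using that unfolding S_def by blast
  qed (auto simp: S1 St theta_plus_1 theta_plus_tau)
qed

text \<open>
  After division by \<open>u\<close>, the duplication formula reads \<open>2 \<mu>(2u) = k \<mu>(u) \<vartheta>\<^sub>2(u) \<vartheta>\<^sub>3(u) \<vartheta>\<^sub>4(u)\<close> with \<open>\<mu>(u) = \<vartheta>\<^sub>1(u)/u\<close>. Second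
  logarithmic derivatives at \<open>0\<close> give \<open>4 L = L + \<Sigma>\<close>, where \<open>L\<close> belongs to \<open>\<mu>\<close> and \<open>\<Sigma>\<close> is the sum of the three others.
\<close>

lemma third_ratio_sum: "deriv (deriv (deriv T1)) 0 / deriv T1 0 = second_ratio T2 + second_ratio T3 + second_ratio T4"
proof -
  define P where "P u = T2 u * T3 u * T4 u" for u
  have h23: "(\<lambda>u. T2 u * T3 u) holomorphic_on UNIV" by (intro holomorphic_intros hol)
  have hP: "P holomorphic_on UNIV" unfolding P_def[abs_def] by (intro holomorphic_intros hol)
  obtain k where k: "\<And>v. T1 v = k * (T1 (v/2) * P (v/2))"
    using theta_duplication unfolding P_def by blast
  have hk: "(\<lambda>u. theta1_over_u u * P u) holomorphic_on UNIV" by (intro holomorphic_intros theta1_over_u hP)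
  \<comment> \<open>First derivatives of the duplication formula at \<open>0\<close> give the constant.\<close>
  have kP: "k * P 0 = 2"
  proof -
    have "((\<lambda>v. k * (T1 (v/2) * P (v/2))) has_field_derivative k * (deriv T1 0 * (1/2) * P 0)) (at 0)"
    proof -
      have "((\<lambda>v. T1 (v/2)) has_field_derivative deriv T1 0 * (1/2)) (at 0)"
        by (rule DERIV_chain2) (use holo_UNIV_deriv(1)[OF hol(1), of 0] in \<open>auto intro!: derivative_eq_intros\<close>)
      moreover have "((\<lambda>v. P (v/2)) has_field_derivative deriv P 0 * (1/2)) (at 0)"
        by (rule DERIV_chain2) (use holo_UNIV_deriv(1)[OF hP, of 0] in \<open>auto intro!: derivative_eq_intros\<close>)
      ultimately show ?thesis using T1_0 by (auto intro!: derivative_eq_intros)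
    qed
    then have "deriv T1 0 = k * (deriv T1 0 * (1/2) * P 0)"
      unfolding k[symmetric] by (rule DERIV_imp_deriv)
    then show ?thesis using T1_deriv_nz by (simp add: field_simps)
  qed
  have e: "2 * theta1_over_u (2 * u) = k * (theta1_over_u u * P u)" for u
  proof (cases "u = 0")
    case True
    have "k * (theta1_over_u 0 * P 0) = theta1_over_u 0 * (k * P 0)" by simp
    then show ?thesis using True by (simp only: kP) simp
  next
    case False
    have "u * (2 * theta1_over_u (2 * u)) = u * (k * (theta1_over_u u * P u))"
      using k[of "2 * u"] theta1_over_u(2)[of "2 * u"] theta1_over_u(2)[of u] by simp
    then show ?thesis using False by simp
  qed
  note dm = holo_UNIV_deriv[OF theta1_over_u(1)]
  have "deriv (deriv (\<lambda>u. 2 * theta1_over_u (2 * u))) 0 = 8 * deriv (deriv theta1_over_u) 0"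
  proof -
    have "((\<lambda>u. 2 * theta1_over_u (2 * u)) has_field_derivative 4 * deriv theta1_over_u (2 * u)) (at u)" for u
    proof -
      have "((\<lambda>u. theta1_over_u (2 * u)) has_field_derivative deriv theta1_over_u (2 * u) * 2) (at u)"
        by (rule DERIV_chain2[OF dm(1)]) (auto intro!: derivative_eq_intros)
      then show ?thesis by (auto intro!: derivative_eq_intros)
    qed
    then have 1: "deriv (\<lambda>u. 2 * theta1_over_u (2 * u)) = (\<lambda>u. 4 * deriv theta1_over_u (2 * u))" by (auto intro: DERIV_imp_deriv)
    have "((\<lambda>u. 4 * deriv theta1_over_u (2 * u)) has_field_derivative 8 * deriv (deriv theta1_over_u) 0) (at 0)"
    proof -
      have "((\<lambda>u. deriv theta1_over_u (2 * u)) has_field_derivative deriv (deriv theta1_over_u) (2 * 0) * 2) (at 0)"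
        by (rule DERIV_chain2[OF holo_UNIV_deriv(1)[OF dm(2)]]) (auto intro!: derivative_eq_intros)
      then show ?thesis by (auto intro!: derivative_eq_intros)
    qed
    then show ?thesis unfolding 1 by (rule DERIV_imp_deriv)
  qed
  moreover have "deriv (deriv (\<lambda>u. k * (theta1_over_u u * P u))) 0 = k * (deriv (deriv theta1_over_u) 0 * P 0 + theta1_over_u 0 * deriv (deriv P) 0)"
  proof -
    have c: "(\<lambda>_. k) holomorphic_on UNIV" by (rule holomorphic_on_const)
    show ?thesis
      unfolding deriv2_mult(2)[OF c hk] deriv2_mult(2)[OF theta1_over_u(1) hP] by (simp add: theta1_over_u_deriv_0)
  qed
  ultimately have A: "8 * deriv (deriv theta1_over_u) 0 = (k * P 0) * deriv (deriv theta1_over_u) 0 + k * theta1_over_u 0 * deriv (deriv P) 0"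
    unfolding e by (simp add: algebra_simps)
  define \<Sigma> where "\<Sigma> = second_ratio T2 + second_ratio T3 + second_ratio T4"
  have "deriv (deriv P) 0 = P 0 * \<Sigma>"
    unfolding P_def[abs_def] deriv2_mult[OF h23 hol(4)] deriv2_mult[OF hol(2) hol(3)] second_ratio_def \<Sigma>_def
    using nz by (simp add: deriv_even_0 field_simps)
  then have "k * theta1_over_u 0 * deriv (deriv P) 0 = (k * P 0) * (theta1_over_u 0 * \<Sigma>)" by (simp only: mult_ac)
  with A have "8 * deriv (deriv theta1_over_u) 0 = 2 * deriv (deriv theta1_over_u) 0 + 2 * (theta1_over_u 0 * \<Sigma>)" unfolding kP by simp
  then have "3 * deriv (deriv theta1_over_u) 0 = theta1_over_u 0 * (second_ratio T2 + second_ratio T3 + second_ratio T4)" unfolding \<Sigma>_def by simp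
  then show ?thesis unfolding theta1_deriv3 using T1_deriv_nz by (simp add: theta1_over_u(3))
qed

end

section \<open>Jacobi's derivative formula\<close>

lemma has_sum_product_int:
  fixes f g :: "int \<Rightarrow> complex"
  assumes f: "(\<lambda>m. norm (f m)) summable_on UNIV" and g: "(\<lambda>m. norm (g m)) summable_on UNIV"
  shows "((\<lambda>(m, n). f m * g n) has_sum (infsum f UNIV * infsum g UNIV)) UNIV"
proof -
  have "((\<lambda>(m, n). f m * g n) has_sum (infsum f UNIV * infsum g UNIV)) (Sigma UNIV (\<lambda>_. UNIV))"
  proof (rule has_sum_SigmaI)
    show "((\<lambda>n. case (m, n) of (m, n) \<Rightarrow> f m * g n) has_sum f m * infsum g UNIV) UNIV" for m
      using has_sum_cmult_right[OF has_sum_infsum[OF abs_summable_summable[OF g]], of "f m"] by simp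
    show "((\<lambda>m. f m * infsum g UNIV) has_sum infsum f UNIV * infsum g UNIV) UNIV"
      by (rule has_sum_cmult_left[OF has_sum_infsum[OF abs_summable_summable[OF f]]])
    show "(\<lambda>(m, n). f m * g n) summable_on Sigma UNIV (\<lambda>_. UNIV)"
    proof (rule abs_summable_summable)
      have "(\<lambda>(m, n). norm (f m) * norm (g n)) summable_on Sigma UNIV (\<lambda>_. UNIV)"
      proof (rule summable_on_SigmaI)
        show "((\<lambda>n. case (m, n) of (m, n) \<Rightarrow> norm (f m) * norm (g n)) has_sum norm (f m) * infsum (\<lambda>n. norm (g n)) UNIV) UNIV" for m
          using has_sum_cmult_right[OF has_sum_infsum[OF g], of "norm (f m)"] by simp
        show "(\<lambda>m. norm (f m) * infsum (\<lambda>n. norm (g n)) UNIV) summable_on UNIV"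
          by (rule summable_on_cmult_left[OF f])
      qed auto
      then show "(\<lambda>p. norm (case p of (m, n) \<Rightarrow> f m * g n)) summable_on Sigma UNIV (\<lambda>_. UNIV)"
        by (simp add: case_prod_unfold norm_mult)
    qed
  qed
  then show ?thesis by simp
qed

lemma theta2_th_term: "theta2 \<tau> u = infsum (\<lambda>m. ee (\<tau>/8 + u/2) * th_term \<tau> m (u + \<tau>/2)) UNIV"
  by (simp add: theta2_theta3 theta3_th_term infsum_cmult_right')

text \<open>
  Put \<open>m = k + l\<close>, \<open>n = k - l\<close> in the double series, so that \<open>m\<^sup>2 + n\<^sup>2 = 2 (k\<^sup>2 + l\<^sup>2)\<close>. The pairs with \<open>m + n\<close> even give integers
  \<open>k, l\<close> and the first product, those with \<open>m + n\<close> odd give half-integers and the second.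
\<close>

lemma theta3_mult_theta3:
  assumes \<tau>: "Im \<tau> > 0"
  shows "theta3 \<tau> x * theta3 \<tau> y = theta3 (2 * \<tau>) (x + y) * theta3 (2 * \<tau>) (x - y)
    + theta2 (2 * \<tau>) (x + y) * theta2 (2 * \<tau>) (x - y)"
proof -
  define h where "h = (\<lambda>(m, n). th_term \<tau> m x * th_term \<tau> n y)"
  have \<tau>2: "Im (2 * \<tau>) > 0" using \<tau> by simp
  have h: "(h has_sum theta3 \<tau> x * theta3 \<tau> y) UNIV"
    unfolding h_def theta3_th_term by (rule has_sum_product_int; rule th_term_summable[OF \<tau>])
  define A B where "A = {(m, n :: int). even (m + n)}" and "B = {(m, n :: int). odd (m + n)}"
  have "((\<lambda>(k, l). th_term (2 * \<tau>) k (x + y) * th_term (2 * \<tau>) l (x - y)) has_sum theta3 (2 * \<tau>) (x + y) * theta3 (2 * \<tau>) (x - y)) UNIV"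
    unfolding theta3_th_term by (rule has_sum_product_int; rule th_term_summable[OF \<tau>2])
  then have hA: "(h has_sum theta3 (2 * \<tau>) (x + y) * theta3 (2 * \<tau>) (x - y)) A"
  proof (subst (asm) has_sum_reindex_bij_witness[of _ "\<lambda>(m, n). ((m + n) div 2, (m - n) div 2)" "\<lambda>(k, l). (k + l, k - l)" A h _ _ "theta3 (2 * \<tau>) (x + y) * theta3 (2 * \<tau>) (x - y)"])
    fix p :: "int \<times> int"
    obtain k l where p: "p = (k, l)" by fastforce
    show "h (case p of (k, l) \<Rightarrow> (k + l, k - l)) = (case p of (k, l) \<Rightarrow> th_term (2 * \<tau>) k (x + y) * th_term (2 * \<tau>) l (x - y))"
      unfolding p h_def prod.case th_term_def ee_add[symmetric]
      by (rule arg_cong[of _ _ ee]) (simp add: power2_eq_square algebra_simps)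
  qed (auto simp: A_def, presburger+)
  have m2: "(\<lambda>m. norm (ee (2 * \<tau>/8 + u/2) * th_term (2 * \<tau>) m (u + 2 * \<tau>/2))) summable_on UNIV" for u
    unfolding norm_mult by (rule summable_on_cmult_right[OF th_term_summable(1)[OF \<tau>2]])
  have "((\<lambda>(k, l). (ee (2 * \<tau>/8 + (x + y)/2) * th_term (2 * \<tau>) k (x + y + 2 * \<tau>/2)) * (ee (2 * \<tau>/8 + (x - y)/2) * th_term (2 * \<tau>) l (x - y + 2 * \<tau>/2)))
      has_sum theta2 (2 * \<tau>) (x + y) * theta2 (2 * \<tau>) (x - y)) UNIV"
    unfolding theta2_th_term by (rule has_sum_product_int; rule m2)
  then have hB: "(h has_sum theta2 (2 * \<tau>) (x + y) * theta2 (2 * \<tau>) (x - y)) B"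
  proof (subst (asm) has_sum_reindex_bij_witness[of _ "\<lambda>(m, n). ((m + n) div 2, (m - n) div 2)" "\<lambda>(k, l). (k + l + 1, k - l)" B h _ _ "theta2 (2 * \<tau>) (x + y) * theta2 (2 * \<tau>) (x - y)"])
    fix p :: "int \<times> int"
    obtain k l where p: "p = (k, l)" by fastforce
    show "h (case p of (k, l) \<Rightarrow> (k + l + 1, k - l)) = (case p of (k, l) \<Rightarrow> (ee (2 * \<tau>/8 + (x + y)/2) * th_term (2 * \<tau>) k (x + y + 2 * \<tau>/2)) * (ee (2 * \<tau>/8 + (x - y)/2) * th_term (2 * \<tau>) l (x - y + 2 * \<tau>/2)))"
      unfolding p h_def prod.case th_term_def ee_add[symmetric]
      by (rule arg_cong[of _ _ ee]) (simp add: power2_eq_square field_simps)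
    show "(case case p of (k, l) \<Rightarrow> (k + l + 1, k - l) of (m, n) \<Rightarrow> ((m + n) div 2, (m - n) div 2)) = p"
      unfolding p by simp
  next
    fix p :: "int \<times> int"
    assume "p \<in> B"
    then obtain m n where p: "p = (m, n)" "odd (m + n)" by (auto simp: B_def)
    then show "(case case p of (m, n) \<Rightarrow> ((m + n) div 2, (m - n) div 2) of (k, l) \<Rightarrow> (k + l + 1, k - l)) = p"
      by simp presburger
  qed (auto simp: B_def)
  have "(h has_sum (theta3 (2 * \<tau>) (x + y) * theta3 (2 * \<tau>) (x - y) + theta2 (2 * \<tau>) (x + y) * theta2 (2 * \<tau>) (x - y))) (A \<union> B)"
    by (rule has_sum_Un_disjoint[OF hA hB]) (auto simp: A_def B_def)
  also have "A \<union> B = UNIV" by (auto simp: A_def B_def)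
  finally show ?thesis using h has_sum_unique by blast
qed

definition jacobi_ratio :: "complex \<Rightarrow> complex" where
  "jacobi_ratio \<tau> = deriv (theta1 \<tau>) 0 / (theta2 \<tau> 0 * theta3 \<tau> 0 * theta4 \<tau> 0)"

text \<open>
  Special values of \<open>theta3_mult_theta3\<close> are Landen's identities, in which all right-hand sides are taken at \<open>2\<tau>\<close>:
  \<open>\<vartheta>\<^sub>3(0) \<vartheta>\<^sub>4(0) = \<vartheta>\<^sub>4(0)\<^sup>2\<close>, \<open>\<vartheta>\<^sub>2(0)\<^sup>2 = 2 \<vartheta>\<^sub>2(0) \<vartheta>\<^sub>3(0)\<close> and \<open>\<vartheta>\<^sub>1(u) \<vartheta>\<^sub>2(u) = \<vartheta>\<^sub>1(2u) \<vartheta>\<^sub>4(0)\<close>. The derivative of the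
  last one at \<open>0\<close>, divided by the product of the first two, is the assertion.
\<close>

lemma jacobi_ratio_double:
  assumes \<tau>: "Im \<tau> > 0"
  shows "jacobi_ratio \<tau> = jacobi_ratio (2 * \<tau>)"
proof -
  have \<tau>2: "Im (2 * \<tau>) > 0" using \<tau> by simp
  interpret a: theta_tau \<tau> using \<tau> by unfold_locales
  interpret b: theta_tau "2 * \<tau>" using \<tau>2 by unfold_locales
  have half0: "theta2 (2 * \<tau>) (1/2) = 0" "theta3 (2 * \<tau>) (1/2) = theta4 (2 * \<tau>) 0"
    using theta2_plus_half[of "2 * \<tau>" 0] theta3_plus_half[of "2 * \<tau>" 0] b.T1_0 by simp_all
  have i34: "theta3 \<tau> 0 * theta4 \<tau> 0 = (theta4 (2 * \<tau>) 0)\<^sup>2"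
  proof -
    have "theta3 \<tau> 0 * theta4 \<tau> 0 = theta3 \<tau> 0 * theta3 \<tau> (1/2)" using theta3_plus_half[of \<tau> 0] by simp
    also have "\<dots> = theta3 (2 * \<tau>) (1/2) * theta3 (2 * \<tau>) (- (1/2)) + theta2 (2 * \<tau>) (1/2) * theta2 (2 * \<tau>) (- (1/2))"
      using theta3_mult_theta3[OF \<tau>, of 0 "1/2"] by simp
    finally show ?thesis by (simp only: theta3_minus half0) (simp add: power2_eq_square)
  qed
  have n2: "half_tau_mult (2 * \<tau>) 0 = half_tau_mult \<tau> 0 * half_tau_mult \<tau> 0"
    unfolding half_tau_mult_def ee_add[symmetric] by (rule arg_cong[of _ _ ee]) simp
  have i22: "(theta2 \<tau> 0)\<^sup>2 = 2 * theta2 (2 * \<tau>) 0 * theta3 (2 * \<tau>) 0"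
  proof -
    have "theta3 \<tau> (0 + \<tau>/2) * theta3 \<tau> (0 + \<tau>/2) = theta3 (2 * \<tau>) (0 + (2 * \<tau>)/2) * theta3 (2 * \<tau>) 0 + theta2 (2 * \<tau>) (0 + (2 * \<tau>)/2) * theta2 (2 * \<tau>) 0"
      using theta3_mult_theta3[OF \<tau>, of "\<tau>/2" "\<tau>/2"] by simp
    then have "(half_tau_mult \<tau> 0 * half_tau_mult \<tau> 0) * (theta2 \<tau> 0)\<^sup>2 = (half_tau_mult \<tau> 0 * half_tau_mult \<tau> 0) * (2 * theta2 (2 * \<tau>) 0 * theta3 (2 * \<tau>) 0)"
      unfolding theta_plus_htau n2 by (simp add: algebra_simps power2_eq_square)
    then show ?thesis by simp
  qed
  have i12: "theta1 \<tau> u * theta2 \<tau> u = theta1 (2 * \<tau>) (2 * u) * theta4 (2 * \<tau>) 0" for u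
  proof -
    have 1: "theta3 \<tau> ((u + 1/2) + \<tau>/2) = \<i> * half_tau_mult \<tau> u * theta1 \<tau> u"
      unfolding theta3_plus_htau theta2_plus_half half_tau_mult_plus_half by simp
    have 2: "theta3 (2 * \<tau>) ((2 * u + 1/2) + (2 * \<tau>)/2) = \<i> * half_tau_mult (2 * \<tau>) (2 * u) * theta1 (2 * \<tau>) (2 * u)"
      unfolding theta3_plus_htau theta2_plus_half half_tau_mult_plus_half by simp
    have 3: "half_tau_mult (2 * \<tau>) (2 * u) = half_tau_mult \<tau> u * half_tau_mult \<tau> u"
      unfolding half_tau_mult_def ee_add[symmetric] by (rule arg_cong[of _ _ ee]) simp
    have e: "((u + 1/2) + \<tau>/2) + (u + \<tau>/2) = (2 * u + 1/2) + (2 * \<tau>)/2" "((u + 1/2) + \<tau>/2) - (u + \<tau>/2) = 1/2"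
      by simp_all
    have "theta3 \<tau> ((u + 1/2) + \<tau>/2) * theta3 \<tau> (u + \<tau>/2) = theta3 (2 * \<tau>) ((2 * u + 1/2) + (2 * \<tau>)/2) * theta4 (2 * \<tau>) 0"
      using theta3_mult_theta3[OF \<tau>, of "(u + 1/2) + \<tau>/2" "u + \<tau>/2"] unfolding e half0 by simp
    then have "(\<i> * half_tau_mult \<tau> u * half_tau_mult \<tau> u) * (theta1 \<tau> u * theta2 \<tau> u) = (\<i> * half_tau_mult \<tau> u * half_tau_mult \<tau> u) * (theta1 (2 * \<tau>) (2 * u) * theta4 (2 * \<tau>) 0)"
      unfolding 1 2 3 theta3_plus_htau[of \<tau> u] by (simp add: mult_ac)
    then show ?thesis by simp
  qed
  have d: "deriv (theta1 \<tau>) 0 * theta2 \<tau> 0 = 2 * deriv (theta1 (2 * \<tau>)) 0 * theta4 (2 * \<tau>) 0"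
  proof -
    have "((\<lambda>u. theta1 \<tau> u * theta2 \<tau> u) has_field_derivative deriv (theta1 \<tau>) 0 * theta2 \<tau> 0) (at 0)"
      using DERIV_mult[OF holo_UNIV_deriv(1)[OF a.hol(1)] holo_UNIV_deriv(1)[OF a.hol(2)], of 0] a.T1_0 by simp
    moreover have "((\<lambda>u. theta1 (2 * \<tau>) (2 * u) * theta4 (2 * \<tau>) 0) has_field_derivative 2 * deriv (theta1 (2 * \<tau>)) 0 * theta4 (2 * \<tau>) 0) (at 0)"
    proof -
      have "((\<lambda>u. theta1 (2 * \<tau>) (2 * u)) has_field_derivative deriv (theta1 (2 * \<tau>)) 0 * 2) (at 0)"
        by (rule DERIV_chain2) (use holo_UNIV_deriv(1)[OF b.hol(1), of 0] in \<open>auto intro!: derivative_eq_intros\<close>)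
      then show ?thesis by (auto intro!: derivative_eq_intros)
    qed
    ultimately show ?thesis unfolding i12 by (rule DERIV_unique)
  qed
  have "jacobi_ratio \<tau> = (deriv (theta1 \<tau>) 0 * theta2 \<tau> 0) / ((theta2 \<tau> 0)\<^sup>2 * (theta3 \<tau> 0 * theta4 \<tau> 0))"
    using a.nz by (simp add: jacobi_ratio_def power2_eq_square)
  also have "\<dots> = jacobi_ratio (2 * \<tau>)"
    unfolding d i22 i34 using b.nz by (simp add: jacobi_ratio_def power2_eq_square)
  finally show ?thesis .
qed

lemma infsum_tail_bound:
  fixes f :: "int \<Rightarrow> complex" and b :: "int \<Rightarrow> real"
  assumes f: "f summable_on UNIV" and B: "finite B" and b: "b summable_on UNIV" "\<And>m. b m \<ge> 0" and c: "c \<ge> 0"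
    and le: "\<And>m. m \<notin> B \<Longrightarrow> norm (f m) \<le> c * b m"
  shows "norm (infsum f UNIV - sum f B) \<le> c * infsum b UNIV"
proof -
  have fs: "f summable_on - B" and bs: "b summable_on - B" using f b(1) summable_on_subset_banach by blast+
  have "infsum f (B \<union> - B) = infsum f B + infsum f (- B)"
    using fs B by (intro infsum_Un_disjoint) auto
  then have "infsum f UNIV - sum f B = infsum f (- B)" using B by simp
  also have "norm \<dots> \<le> c * infsum b (- B)"
    by (rule norm_infsum_le[OF has_sum_infsum[OF fs] has_sum_cmult_right[OF has_sum_infsum[OF bs]]]) (use le in auto)
  also have "\<dots> \<le> c * infsum b UNIV"
    by (intro mult_left_mono c infsum_mono_neutral bs b) (use b in auto)
  finally show ?thesis .
qed

lemma theta3_limit_bound: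
  assumes y: "Im \<tau> \<ge> 1" and u: "Im u = 0"
  shows "norm (theta3 \<tau> u - 1) \<le> exp (- pi * (Im \<tau> - 1)) * infsum (th_bound 1 0) UNIV"
proof -
  have \<tau>: "Im \<tau> > 0" using y by simp
  have "norm (infsum (\<lambda>m. th_term \<tau> m u) UNIV - sum (\<lambda>m. th_term \<tau> m u) {0}) \<le> exp (- pi * (Im \<tau> - 1)) * infsum (th_bound 1 0) UNIV"
  proof (rule infsum_tail_bound[OF th_term_summable(2)[OF \<tau>] _ th_bound_summable])
    fix m :: int assume "m \<notin> {0}"
    then have "\<bar>m\<bar> \<ge> 1" by auto
    then have "1 \<le> m\<^sup>2" using abs_le_square_iff[of 1 m] by simp
    then have "1 \<le> (of_int m :: real)\<^sup>2" by (metis of_int_1_le_iff of_int_power)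
    then have "1 * (Im \<tau> - 1) \<le> (of_int m)\<^sup>2 * (Im \<tau> - 1)" using y by (intro mult_right_mono) auto
    then have "pi * (Im \<tau> - 1) \<le> pi * ((of_int m)\<^sup>2 * (Im \<tau> - 1))" by simp
    then show "norm (th_term \<tau> m u) \<le> exp (- pi * (Im \<tau> - 1)) * th_bound 1 0 m"
      unfolding norm_th_term th_bound_def exp_add[symmetric] exp_le_cancel_iff using u by (simp add: algebra_simps)
  qed (auto simp: th_bound_def)
  then show ?thesis by (simp add: theta3_th_term th_term_def)
qed

text \<open>
  After multiplication by \<open>ee (-\<tau>/8)\<close> the term of index \<open>m\<close> has size about \<open>exp (- \<pi> m (m + 1) Im \<tau>)\<close>, so the terms with \<open>m = 0\<close> and
  \<open>m = -1\<close> dominate.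
\<close>

lemma theta2_limit_bound:
  assumes y: "Im \<tau> \<ge> 1" and u: "\<bar>Im u\<bar> \<le> R"
  shows "norm (ee (- \<tau>/8) * theta2 \<tau> u - (ee (u/2) + ee (- u/2))) \<le> exp (- 2 * pi * (Im \<tau> - 1)) * (exp (pi * R) * infsum (th_bound 1 (R + 1/2)) UNIV)"
proof -
  have \<tau>: "Im \<tau> > 0" using y by simp
  define f where "f m = ee (u/2) * th_term \<tau> m (u + \<tau>/2)" for m
  have f: "ee (- \<tau>/8) * theta2 \<tau> u = infsum f UNIV"
  proof -
    have "ee (- \<tau>/8) * ee (\<tau>/8 + u/2) = ee (u/2)" unfolding ee_add[symmetric] by simp
    then show ?thesis
      unfolding f_def theta2_theta3 theta3_th_term infsum_cmult_right' by (simp add: mult.assoc[symmetric])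
  qed
  have nf: "norm (f m) = exp (- pi * (of_int (m * (m + 1))) * Im \<tau> - 2 * pi * of_int m * Im u - pi * Im u)" for m
    unfolding f_def norm_mult norm_ee norm_th_term exp_add[symmetric] by (simp add: power2_eq_square algebra_simps)
  have s: "infsum (\<lambda>m. exp (pi * R) * th_bound 1 (R + 1/2) m) UNIV = exp (pi * R) * infsum (th_bound 1 (R + 1/2)) UNIV"
    by (rule infsum_cmult_right')
  have "norm (infsum f UNIV - sum f {0, - 1}) \<le> exp (- 2 * pi * (Im \<tau> - 1)) * infsum (\<lambda>m. exp (pi * R) * th_bound 1 (R + 1/2) m) UNIV"
  proof (rule infsum_tail_bound)
    show "f summable_on UNIV" unfolding f_def by (rule summable_on_cmult_right[OF th_term_summable(2)[OF \<tau>]])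
    show "(\<lambda>m. exp (pi * R) * th_bound 1 (R + 1/2) m) summable_on UNIV"
      by (rule summable_on_cmult_right[OF th_bound_summable]) simp
    fix m :: int assume m: "m \<notin> {0, - 1}"
    have "2 \<le> m * (m + 1)"
    proof (cases "m \<ge> 1")
      case True
      then have "1 * 2 \<le> m * (m + 1)" by (intro mult_mono) auto
      then show ?thesis by simp
    next
      case False
      with m have "m \<le> -2" by auto
      then have "2 * 1 \<le> (- m) * (- (m + 1))" by (intro mult_mono) auto
      then show ?thesis by (simp add: algebra_simps)
    qed
    then have "2 \<le> (of_int (m * (m + 1)) :: real)" by linarith
    then have "2 * (Im \<tau> - 1) \<le> of_int (m * (m + 1)) * (Im \<tau> - 1)" using y by (intro mult_right_mono) auto
    then have 1: "2 * pi * (Im \<tau> - 1) \<le> pi * (of_int (m * (m + 1)) * (Im \<tau> - 1))"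
      using mult_left_mono[of "2 * (Im \<tau> - 1)" _ pi] by (simp add: mult_ac)
    have "- (of_int m * Im u) \<le> \<bar>of_int m\<bar> * R"
      using u by (metis abs_ge_minus_self abs_ge_zero abs_mult mult_left_mono order_trans)
    then have 2: "2 * pi * (- (of_int m * Im u)) \<le> 2 * pi * (\<bar>of_int m\<bar> * R)" by (intro mult_left_mono) auto
    have "pi * (- Im u) \<le> pi * R" "pi * (- of_int m) \<le> pi * \<bar>of_int m\<bar>"
      using u by (intro mult_left_mono; simp)+
    then have 3: "- (pi * Im u) \<le> pi * R" and 4: "- (pi * of_int m) \<le> pi * \<bar>of_int m\<bar>" by simp_all
    have "- pi * (of_int (m * (m + 1))) * Im \<tau> - 2 * pi * of_int m * Im u - pi * Im u
      = - (pi * (of_int (m * (m + 1)) * (Im \<tau> - 1))) - pi * (of_int m)\<^sup>2 + - (pi * of_int m) + 2 * pi * (- (of_int m * Im u)) + - (pi * Im u)"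
      by (simp add: power2_eq_square algebra_simps)
    also have "\<dots> \<le> - (2 * pi * (Im \<tau> - 1)) - pi * (of_int m)\<^sup>2 + pi * \<bar>of_int m\<bar> + 2 * pi * (\<bar>of_int m\<bar> * R) + pi * R"
      using 1 2 3 4 by linarith
    also have "\<dots> = - 2 * pi * (Im \<tau> - 1) + (pi * R + (- pi * (of_int m)\<^sup>2 * 1 + 2 * pi * (R + 1/2) * \<bar>of_int m\<bar>))"
      by (simp add: algebra_simps)
    finally show "norm (f m) \<le> exp (- 2 * pi * (Im \<tau> - 1)) * (exp (pi * R) * th_bound 1 (R + 1/2) m)"
      unfolding nf th_bound_def exp_add[symmetric] exp_le_cancel_iff .
  qed (auto simp: th_bound_def)
  moreover have "sum f {0, -1} = ee (u/2) + ee (- u/2)"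
  proof -
    have "ee (u/2) * ee (\<tau>/2 - (u + \<tau>/2)) = ee (- u/2)"
      unfolding ee_add[symmetric] by (rule arg_cong[of _ _ ee]) simp
    then show ?thesis by (simp add: f_def th_term_def)
  qed
  ultimately show ?thesis unfolding f s by simp
qed

text \<open>
  The ratio is the same at all \<open>2\<^sup>n \<tau>\<close>. As \<open>n\<close> grows, \<open>\<vartheta>\<^sub>3(0)\<close> and \<open>\<vartheta>\<^sub>4(0)\<close> tend to \<open>1\<close>, and after rescaling by a common factor
  \<open>\<vartheta>\<^sub>2(u)\<close> tends to \<open>2 cos (\<pi>u)\<close> locally uniformly, hence with its derivative.
\<close>

lemma jacobi_ratio_eq_pi:
  assumes \<tau>: "Im \<tau> > 0"
  shows "jacobi_ratio \<tau> = of_real pi"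
proof -
  define t where "t n = 2 ^ n * \<tau>" for n
  have It: "Im (t n) = 2 ^ n * Im \<tau>" for n
  proof -
    have "t n = of_real (2 ^ n) * \<tau>" by (simp add: t_def)
    moreover have "Im (of_real r * \<tau>) = r * Im \<tau>" for r by simp
    ultimately show ?thesis by metis
  qed
  have tpos: "Im (t n) > 0" for n using \<tau> by (simp add: It)
  have jt: "jacobi_ratio (t n) = jacobi_ratio \<tau>" for n
  proof (induction n)
    case (Suc n)
    have "t (Suc n) = 2 * t n" by (simp add: t_def)
    then show ?case using Suc jacobi_ratio_double[OF tpos[of n]] by simp
  qed (simp add: t_def)
  have top: "filterlim (\<lambda>n. Im (t n)) at_top sequentially"
    unfolding It using \<tau> by real_asymp
  have ev: "\<forall>\<^sub>F n in sequentially. Im (t n) \<ge> 1" using top by (simp add: filterlim_at_top)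
  have e0: "(\<lambda>n. exp (- c * (Im (t n) - 1)) * K) \<longlonglongrightarrow> 0" if "c > 0" for c K :: real
  proof -
    have "filterlim (\<lambda>n. c * (Im (t n) - 1)) at_top sequentially"
    proof (rule filterlim_tendsto_pos_mult_at_top[OF tendsto_const that])
      have "filterlim (\<lambda>n. - 1 + Im (t n)) at_top sequentially"
        by (rule filterlim_tendsto_add_at_top[OF tendsto_const top])
      then show "filterlim (\<lambda>n. Im (t n) - 1) at_top sequentially" by simp
    qed
    then have "(\<lambda>n. exp (- (c * (Im (t n) - 1)))) \<longlonglongrightarrow> 0"
      by (intro filterlim_compose[OF exp_at_bot] filterlim_compose[OF filterlim_uminus_at_bot_at_top])
    from tendsto_mult_left_zero[OF this, of K] show ?thesis by simp
  qed
  have l3: "(\<lambda>n. theta3 (t n) u) \<longlonglongrightarrow> 1" if u: "Im u = 0" for u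
  proof -
    have "(\<lambda>n. theta3 (t n) u - 1) \<longlonglongrightarrow> 0"
    proof (rule Lim_null_comparison[OF _ e0[of pi "infsum (th_bound 1 0) UNIV"]])
      show "\<forall>\<^sub>F n in sequentially. norm (theta3 (t n) u - 1) \<le> exp (- pi * (Im (t n) - 1)) * infsum (th_bound 1 0) UNIV"
        using ev by eventually_elim (rule theta3_limit_bound[OF _ u])
    qed simp
    then show ?thesis by (simp add: LIM_zero_iff)
  qed
  define G where "G u = ee (u/2) + ee (- u/2)" for u
  \<comment> \<open>By \<open>\<vartheta>\<^sub>1(u) = - \<vartheta>\<^sub>2(u + 1/2)\<close> the derivative of \<open>\<vartheta>\<^sub>1\<close> at \<open>0\<close> is minus that of \<open>\<vartheta>\<^sub>2\<close> at \<open>1/2\<close>.\<close>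
  have ul: "uniform_limit (cball x 1) (\<lambda>n u. ee (- t n/8) * theta2 (t n) u) G sequentially" for x
  proof (rule uniform_limitI)
    fix e :: real assume e: "e > 0"
    define R where "R = \<bar>Im x\<bar> + 1"
    define K where "K = exp (pi * R) * infsum (th_bound 1 (R + 1/2)) UNIV"
    have "\<forall>\<^sub>F n in sequentially. exp (- (2 * pi) * (Im (t n) - 1)) * K < e"
      using order_tendstoD(2)[OF e0[of "2 * pi" K] e] by simp
    with ev show "\<forall>\<^sub>F n in sequentially. \<forall>u\<in>cball x 1. dist (ee (- t n/8) * theta2 (t n) u) (G u) < e"
    proof eventually_elim
      case (elim n)
      show ?case
      proof
        fix u assume "u \<in> cball x 1"
        then have "\<bar>Im (u - x)\<bar> \<le> 1" using abs_Im_le_cmod[of "u - x"] by (simp add: dist_norm norm_minus_commute)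
        then have "\<bar>Im u\<bar> \<le> R" by (auto simp: R_def)
        from theta2_limit_bound[OF elim(1) this] elim(2) show "dist (ee (- t n/8) * theta2 (t n) u) (G u) < e"
          by (simp add: dist_norm G_def K_def)
      qed
    qed
  qed
  have l2: "(\<lambda>n. ee (- t n/8) * theta2 (t n) 0) \<longlonglongrightarrow> 2"
    using tendsto_uniform_limitI[OF ul[of 0], of 0] by (simp add: G_def)
  have h2: "(\<lambda>u. theta2 (t n) u) holomorphic_on UNIV" for n using theta_holomorphic(2)[OF tpos] by simp
  have "\<exists>G'. \<forall>x\<in>UNIV. (G has_field_derivative G' x) (at x) \<and> (\<lambda>n. ee (- t n/8) * deriv (theta2 (t n)) x) \<longlonglongrightarrow> G' x"
  proof (rule has_complex_derivative_uniform_sequence[OF open_UNIV])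
    show "((\<lambda>u. ee (- t n/8) * theta2 (t n) u) has_field_derivative ee (- t n/8) * deriv (theta2 (t n)) x) (at x)" for n x
      by (rule DERIV_cmult[OF holo_UNIV_deriv(1)[OF h2]])
    show "\<exists>d>0. cball x d \<subseteq> UNIV \<and> uniform_limit (cball x d) (\<lambda>n u. ee (- t n/8) * theta2 (t n) u) G sequentially" for x
      using ul by (intro exI[of _ 1]) auto
  qed
  then obtain G' where G': "\<And>x. (G has_field_derivative G' x) (at x)" "\<And>x. (\<lambda>n. ee (- t n/8) * deriv (theta2 (t n)) x) \<longlonglongrightarrow> G' x"
    by blast
  have "(G has_field_derivative - 2 * of_real pi) (at (1/2))"
  proof -
    have "(G has_field_derivative of_real pi * \<i> * (ee (1/2/2) - ee (- (1/2)/2))) (at (1/2))"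
      unfolding G_def[abs_def] by (auto intro!: derivative_eq_intros simp: algebra_simps)
    also have "ee (1/2/2) - ee (- (1/2)/2) = 2 * \<i>"
      using ee_quarter ee_minus[of "1/4"] by simp
    finally show ?thesis by (simp add: mult_ac)
  qed
  then have G'h: "G' (1/2) = - 2 * of_real pi" using G'(1) DERIV_unique by blast
  have l1: "(\<lambda>n. ee (- t n/8) * deriv (theta1 (t n)) 0) \<longlonglongrightarrow> 2 * of_real pi"
  proof -
    have "deriv (theta1 (t n)) 0 = - deriv (theta2 (t n)) (1/2)" for n
    proof -
      have "((\<lambda>u. theta2 (t n) (u + 1/2)) has_field_derivative deriv (theta2 (t n)) (0 + 1/2)) (at 0)"
        using holo_UNIV_deriv(1)[OF h2] DERIV_shift by blast
      then have "((\<lambda>u. - theta2 (t n) (u + 1/2)) has_field_derivative - deriv (theta2 (t n)) (1/2)) (at 0)"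
        by (auto intro: DERIV_minus)
      then show ?thesis unfolding theta1_theta2[symmetric] by (rule DERIV_imp_deriv)
    qed
    then show ?thesis using tendsto_minus[OF G'(2)[of "1/2"]] G'h by simp
  qed
  have l4: "(\<lambda>n. theta4 (t n) 0) \<longlonglongrightarrow> 1" using l3[of "1/2"] by (simp add: theta4_theta3)
  have "(\<lambda>n. (ee (- t n/8) * deriv (theta1 (t n)) 0) / ((ee (- t n/8) * theta2 (t n) 0) * theta3 (t n) 0 * theta4 (t n) 0)) \<longlonglongrightarrow> 2 * of_real pi / (2 * 1 * 1)"
    by (intro tendsto_intros l1 l2 l3 l4) auto
  moreover have "(ee (- t n/8) * deriv (theta1 (t n)) 0) / ((ee (- t n/8) * theta2 (t n) 0) * theta3 (t n) 0 * theta4 (t n) 0) = jacobi_ratio \<tau>" for n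
    using jt[of n] by (simp add: jacobi_ratio_def mult.assoc)
  ultimately have "(\<lambda>n. jacobi_ratio \<tau>) \<longlonglongrightarrow> of_real pi" by simp
  then show ?thesis by (simp add: LIMSEQ_const_iff)
qed

lemma (in theta_tau) Jacobi_derivative: "deriv T1 0 = of_real pi * T2 0 * T3 0 * T4 0"
  using jacobi_ratio_eq_pi[OF \<tau>] nz by (simp add: jacobi_ratio_def field_simps)

section \<open>Local solutions of the connection equation\<close>

text \<open>
  Comparing coefficients, \<open>Y\<close> has the coefficients of \<open>H\<close> divided by \<open>n + \<kappa>\<close>. These denominators are bounded away from \<open>0\<close>, so the
  radius of convergence does not shrink.
\<close>

lemma frobenius_regular:
  fixes \<kappa> :: complex
  assumes \<kappa>: "\<And>n::nat. of_nat n + \<kappa> \<noteq> 0" and H: "H holomorphic_on ball 0 r"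
  obtains Y where "Y holomorphic_on ball 0 r" "\<And>z. z \<in> ball 0 r \<Longrightarrow> z * deriv Y z + \<kappa> * Y z = H z"
proof -
  define h where "h n = (deriv ^^ n) H 0 / fact n" for n
  have Hs: "(\<lambda>n. h n * z ^ n) sums H z" if "z \<in> ball 0 r" for z
    using holomorphic_power_series[OF H that] by (simp add: h_def)
  define y where "y n = h n / (of_nat n + \<kappa>)" for n
  obtain \<delta> where \<delta>: "\<delta> > 0" "\<And>n. norm (of_nat n + \<kappa>) \<ge> \<delta>"
  proof -
    obtain N where N: "real N \<ge> norm \<kappa> + 1" using real_arch_simple by blast
    define \<delta> where "\<delta> = Min (insert 1 ((\<lambda>n. norm (of_nat n + \<kappa>)) ` {..<N}))"
    have "\<delta> > 0" unfolding \<delta>_def using \<kappa> by (subst Min_gr_iff) auto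
    moreover have "norm (of_nat n + \<kappa>) \<ge> \<delta>" for n
    proof (cases "n < N")
      case True then show ?thesis unfolding \<delta>_def by (intro Min_le) auto
    next
      case False
      have "real n = norm (of_nat n + \<kappa> - \<kappa>)" by simp
      also have "\<dots> \<le> norm (of_nat n + \<kappa>) + norm \<kappa>" by (rule norm_triangle_ineq4)
      finally have "norm (of_nat n + \<kappa>) \<ge> 1" using N False by linarith
      moreover have "\<delta> \<le> 1" unfolding \<delta>_def by (intro Min_le) auto
      ultimately show ?thesis by linarith
    qed
    ultimately show thesis using that by blast
  qed
  define Y where "Y z = (\<Sum>n. y n * z ^ n)" for z
  have key: "(Y has_field_derivative deriv Y z) (at z) \<and> z * deriv Y z + \<kappa> * Y z = H z" if z: "z \<in> ball 0 r" for z
  proof -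
    define w where "w = (norm z + r) / 2"
    have w: "0 < w" "norm z < w" "w < r" using z norm_ge_zero[of z] by (auto simp: w_def simp del: norm_ge_zero)
    have sw: "summable (\<lambda>n. norm (h n * of_real w ^ n))"
    proof -
      define w' where "w' = (w + r) / 2"
      have w': "w < w'" "w' < r" using w by (auto simp: w'_def)
      have "summable (\<lambda>n. h n * of_real w' ^ n)"
        using Hs[of "of_real w'"] w w' by (auto simp: sums_iff)
      then show ?thesis by (rule powser_insidea) (use w w' in auto)
    qed
    have "summable (\<lambda>n. norm (y n * of_real w ^ n))"
    proof (rule summable_comparison_test')
      show "summable (\<lambda>n. norm (h n * of_real w ^ n) / \<delta>)" using sw by (rule summable_divide)
      show "norm (norm (y n * of_real w ^ n)) \<le> norm (h n * of_real w ^ n) / \<delta>" if "n \<ge> 0" for n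
      proof -
        have "norm (y n) \<le> norm (h n) / \<delta>"
          unfolding y_def norm_divide using \<delta> by (intro frac_le) auto
        then have "norm (y n) * norm (of_real w ^ n :: complex) \<le> norm (h n) / \<delta> * norm (of_real w ^ n :: complex)"
          by (rule mult_right_mono) simp
        then show ?thesis by (simp add: norm_mult)
      qed
    qed
    then have "summable (\<lambda>n. y n * of_real w ^ n)" by (rule summable_norm_cancel)
    then have "summable (\<lambda>n. y n * of_real (w ^ n))" by simp
    from power_series_and_derivative_0[OF this]
    obtain g g' where g: "\<And>z. cmod z < w \<Longrightarrow> (\<lambda>n. y n * z ^ n) sums g z \<and>
        (\<lambda>n. of_nat n * y n * z ^ (n - 1)) sums g' z \<and> (g has_field_derivative g' z) (at z)" by blast
    have Yg: "Y u = g u" if "cmod u < w" for u unfolding Y_def using g[OF that] sums_unique by metis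
    have d: "(Y has_field_derivative g' z) (at z)"
      by (rule has_field_derivative_transform_within_open[of g _ _ "ball 0 w"]) (use g w Yg in auto)
    have "(\<lambda>n. z * (of_nat n * y n * z ^ (n - 1)) + \<kappa> * (y n * z ^ n)) sums (z * g' z + \<kappa> * g z)"
      using g[OF w(2)] by (intro sums_add sums_mult) auto
    moreover have "z * (of_nat n * y n * z ^ (n - 1)) + \<kappa> * (y n * z ^ n) = h n * z ^ n" for n
    proof -
      have "z * (of_nat n * y n * z ^ (n - 1)) + \<kappa> * (y n * z ^ n) = (of_nat n + \<kappa>) * y n * z ^ n"
        by (cases n) (simp_all add: algebra_simps)
      then show ?thesis using \<kappa>[of n] by (simp add: y_def)
    qed
    ultimately have "(\<lambda>n. h n * z ^ n) sums (z * g' z + \<kappa> * g z)" by simp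
    then have "z * g' z + \<kappa> * g z = H z" using Hs[OF z] sums_unique2 by blast
    then show ?thesis using d Yg[OF w(2)] DERIV_imp_deriv by metis
  qed
  have "Y holomorphic_on ball 0 r" unfolding holomorphic_on_open[OF open_ball] using key by blast
  then show thesis by (rule that) (use key in blast)
qed

text \<open>
  The germ \<open>f = a/z + b + d z + z\<^sup>2 y\<close> with \<open>f' + f (c/z + v) = A/z\<^sup>2 + B/z + e\<close>. The coefficients of \<open>z\<^sup>-\<^sup>2\<close>, \<open>z\<^sup>-\<^sup>1\<close> and \<open>1\<close>
  determine \<open>a\<close>, \<open>b\<close> and \<open>d\<close>; the remaining equation for \<open>y\<close> is regular. Three explicit coefficients are enough to
  read off the residue of \<open>f\<close> times a form with at most a double pole.
\<close>

lemma local_solution: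
  fixes c A B :: complex
  assumes c: "c \<notin> \<int>" and r: "r > 0"
    and v: "v holomorphic_on ball 0 r" and e: "e holomorphic_on ball 0 r"
  defines "a \<equiv> A / (c - 1)"
  defines "b \<equiv> (B - a * v 0) / c"
  defines "d \<equiv> (e 0 - a * deriv v 0 - b * v 0) / (c + 1)"
  obtains y where "y holomorphic_on ball 0 r"
    "\<And>z. z \<in> ball 0 r \<Longrightarrow> z \<noteq> 0 \<Longrightarrow>
      ((\<lambda>z. a / z + b + d * z + z\<^sup>2 * y z) has_field_derivative
        A / z\<^sup>2 + B / z + e z - (a / z + b + d * z + z\<^sup>2 * y z) * (c / z + v z)) (at z)"
proof -
  have cn: "c - 1 \<noteq> 0" "c \<noteq> 0" "c + 1 \<noteq> 0" "of_nat n + (c + 2) \<noteq> 0" for n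
  proof -
    show "c - 1 \<noteq> 0" "c \<noteq> 0" using c by auto
    have c': "c \<noteq> of_int m" for m using c by auto
    show "c + 1 \<noteq> 0" using c'[of "- 1"] by (auto simp: add_eq_0_iff2)
    show "of_nat n + (c + 2) \<noteq> 0"
    proof
      assume h: "of_nat n + (c + 2) = 0"
      have "c = of_nat n + (c + 2) - of_nat n - 2" by simp
      then have "c = of_int (- int n - 2)" unfolding h by simp
      with c' show False by blast
    qed
  qed
  have 0: "0 \<in> ball 0 r" using r by simp
  obtain V where V: "\<And>z. z \<in> ball 0 r \<Longrightarrow> (V has_field_derivative v z) (at z within ball 0 r)"
    using holomorphic_convex_primitive'[OF convex_ball open_ball v] by metis
  have V': "(V has_field_derivative v z) (at z)" if "z \<in> ball 0 r" for z
    using V[OF that] that at_within_open[of z "ball 0 r"] by auto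
  have hV: "V holomorphic_on ball 0 r" unfolding holomorphic_on_open[OF open_ball] using V' by blast
  define v1 where "v1 = dquot v 0"
  have v1: "v1 holomorphic_on ball 0 r" "v z = v 0 + z * v1 z" "v1 0 = deriv v 0" for z
    using dquot_holomorphic[OF v open_ball 0] dquot_mult[of v z 0] by (simp_all add: v1_def)
  \<comment> \<open>The factor \<open>exp V\<close> removes \<open>v\<close> from the equation for \<open>y\<close>, where \<open>V\<close> is a primitive of \<open>v\<close>; what remains has the
    exponent \<open>\<kappa> = c + 2\<close>. The choice of \<open>d\<close> makes the right-hand side \<open>E\<close> divisible by \<open>z\<close>.\<close>
  define E where "E z = e z - d * (1 + c) - a * v1 z - b * v z - d * z * v z" for z
  have E: "E holomorphic_on ball 0 r" unfolding E_def[abs_def] by (intro holomorphic_intros v e v1)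
  have "d * (1 + c) = e 0 - a * deriv v 0 - b * v 0" using cn by (simp add: d_def add.commute)
  then have E0: "E 0 = 0" by (simp add: E_def v1(3))
  define E1 where "E1 = dquot E 0"
  have E1: "E1 holomorphic_on ball 0 r" "E z = z * E1 z" for z
    using dquot_holomorphic[OF E open_ball 0] dquot_mult[of E z 0] E0 by (simp_all add: E1_def)
  have hE: "(\<lambda>z. E1 z * exp (V z)) holomorphic_on ball 0 r" by (intro holomorphic_intros E1 hV)
  obtain Y where Y: "Y holomorphic_on ball 0 r" "\<And>z. z \<in> ball 0 r \<Longrightarrow> z * deriv Y z + (c + 2) * Y z = E1 z * exp (V z)"
    using frobenius_regular[OF cn(4) hE] by blast
  define y where "y z = Y z * exp (- V z)" for z
  have hy: "y holomorphic_on ball 0 r" unfolding y_def[abs_def] by (intro holomorphic_intros Y hV)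
  show thesis
  proof (rule that[OF hy])
    fix z :: complex assume z: "z \<in> ball 0 r" "z \<noteq> 0"
    have dY: "(Y has_field_derivative deriv Y z) (at z)" using Y(1) z holomorphic_derivI by blast
    define y' where "y' = deriv Y z * exp (- V z) - v z * y z"
    have dy: "(y has_field_derivative y') (at z)"
      unfolding y_def[abs_def] y'_def using dY V'[OF z(1)] by (auto intro!: derivative_eq_intros simp: y_def)
    have eq: "z * y' + (c + 2) * y z + z * v z * y z = E1 z"
    proof -
      have "z * y' + (c + 2) * y z + z * v z * y z = (z * deriv Y z + (c + 2) * Y z) * exp (- V z)"
        by (simp add: y'_def y_def algebra_simps)
      also have "\<dots> = E1 z" using Y(2)[OF z(1)] by (simp add: exp_minus)
      finally show ?thesis .
    qed
    have "((\<lambda>z. a / z + b + d * z + z\<^sup>2 * y z) has_field_derivative (- a / z\<^sup>2 + d + 2 * z * y z + z\<^sup>2 * y')) (at z)"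
      using dy z by (auto intro!: derivative_eq_intros simp: power2_eq_square)
    moreover have "- a / z\<^sup>2 + d + 2 * z * y z + z\<^sup>2 * y' = A / z\<^sup>2 + B / z + e z - (a / z + b + d * z + z\<^sup>2 * y z) * (c / z + v z)"
    proof -
      have 1: "A = a * (c - 1)" "B = b * c + a * v 0" using cn by (simp_all add: a_def b_def)
      have "z * E1 z = e z - d * (1 + c) - a * v1 z - b * v z - d * z * v z" using E1(2)[of z] by (simp add: E_def)
      then have e': "e z = z * (z * y' + (c + 2) * y z + z * v z * y z) + d * (1 + c) + a * v1 z + b * v z + d * z * v z"
        unfolding eq by simp
      show ?thesis unfolding e' 1 using z(2) v1(2)[of z] by (simp add: field_simps power2_eq_square)
    qed
    ultimately show "((\<lambda>z. a / z + b + d * z + z\<^sup>2 * y z) has_field_derivative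
        A / z\<^sup>2 + B / z + e z - (a / z + b + d * z + z\<^sup>2 * y z) * (c / z + v z)) (at z)" by simp
  qed
qed

text \<open>
  The residue of the product is \<open>a e(0) + b B + d A\<close>; once \<open>z\<^sup>-\<^sup>1\<close> is removed, every Laurent term has a primitive.
\<close>

lemma local_residue_primitive:
  fixes a b d A B :: complex
  assumes r: "r > 0" and y: "y holomorphic_on ball 0 r" and e: "e holomorphic_on ball 0 r"
  obtains G where "\<And>z. z \<in> ball 0 r \<Longrightarrow> z \<noteq> 0 \<Longrightarrow> (G has_field_derivative
    (a / z + b + d * z + z\<^sup>2 * y z) * (A / z\<^sup>2 + B / z + e z) - (a * e 0 + b * B + d * A) / z) (at z)"
proof -
  have 0: "0 \<in> ball 0 r" using r by simp
  define e1 where "e1 = dquot e 0"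
  have e1: "e1 holomorphic_on ball 0 r" "e z = e 0 + z * e1 z" for z
    using dquot_holomorphic[OF e open_ball 0] dquot_mult[of e z 0] by (simp_all add: e1_def)
  define Q where "Q z = a * e1 z + b * e z + d * B + y z * A + d * z * e z + z * y z * B + z\<^sup>2 * y z * e z" for z
  have Q: "Q holomorphic_on ball 0 r" unfolding Q_def[abs_def] by (intro holomorphic_intros y e e1)
  obtain P where P: "\<And>z. z \<in> ball 0 r \<Longrightarrow> (P has_field_derivative Q z) (at z within ball 0 r)"
    using holomorphic_convex_primitive'[OF convex_ball open_ball Q] by metis
  have P': "(P has_field_derivative Q z) (at z)" if "z \<in> ball 0 r" for z
    using P[OF that] that at_within_open[of z "ball 0 r"] by auto
  show thesis
  proof (rule that[of "\<lambda>z. - (a * A / 2) / z\<^sup>2 - (a * B + b * A) / z + P z"])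
    fix z :: complex assume z: "z \<in> ball 0 r" "z \<noteq> 0"
    have "((\<lambda>z. - (a * A / 2) / z\<^sup>2 - (a * B + b * A) / z + P z) has_field_derivative
      a * A / z ^ 3 + (a * B + b * A) / z\<^sup>2 + Q z) (at z)"
      using P'[OF z(1)] z(2) by (auto intro!: derivative_eq_intros simp: power2_eq_square power3_eq_cube field_simps)
    moreover have "a * A / z ^ 3 + (a * B + b * A) / z\<^sup>2 + Q z =
      (a / z + b + d * z + z\<^sup>2 * y z) * (A / z\<^sup>2 + B / z + e z) - (a * e 0 + b * B + d * A) / z"
      unfolding Q_def using z(2) e1(2)[of z] by (simp add: field_simps power2_eq_square power3_eq_cube)
    ultimately show "((\<lambda>z. - (a * A / 2) / z\<^sup>2 - (a * B + b * A) / z + P z) has_field_derivative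
      (a / z + b + d * z + z\<^sup>2 * y z) * (A / z\<^sup>2 + B / z + e z) - (a * e 0 + b * B + d * A) / z) (at z)" by simp
  qed
qed

text \<open>
  On the universal covering \<open>s \<mapsto> exp s\<close> of the punctured disc, \<open>k (exp s) exp (V (exp s) + c s)\<close> is constant, where \<open>V' = v\<close>. Under
  \<open>s \<mapsto> s + 2\<pi>\<i>\<close> it is multiplied by \<open>exp (2\<pi>\<i>c)\<close>, which differs from \<open>1\<close>; so it is zero.
\<close>

lemma local_homogeneous_solution_0:
  fixes c :: complex
  assumes c: "c \<notin> \<int>" and v: "v holomorphic_on ball 0 r"
    and k: "\<And>z. z \<in> ball 0 r \<Longrightarrow> z \<noteq> 0 \<Longrightarrow> (k has_field_derivative - k z * (c / z + v z)) (at z)"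
    and z: "z \<in> ball 0 r" "z \<noteq> 0"
  shows "k z = 0"
proof -
  obtain V where V: "\<And>z. z \<in> ball 0 r \<Longrightarrow> (V has_field_derivative v z) (at z within ball 0 r)"
    using holomorphic_convex_primitive'[OF convex_ball open_ball v] by metis
  have V': "(V has_field_derivative v z) (at z)" if "z \<in> ball 0 r" for z
    using V[OF that] that at_within_open[of z "ball 0 r"] by auto
  have r: "r > 0" using z norm_ge_zero[of z] by (auto simp del: norm_ge_zero)
  define S where "S = {s. Re s < ln r}"
  have S: "convex S" "open S" unfolding S_def by (rule convex_halfspace_Re_lt, rule open_halfspace_Re_lt)
  have eS: "exp s \<in> ball 0 r" "exp s \<noteq> 0" if "s \<in> S" for s
    using that r by (auto simp: S_def) (metis exp_less_mono exp_ln)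
  define G where "G s = k (exp s) * exp (V (exp s) + c * s)" for s
  have "(G has_field_derivative 0) (at s)" if s: "s \<in> S" for s
  proof -
    have "((\<lambda>s. k (exp s)) has_field_derivative - k (exp s) * (c / exp s + v (exp s)) * exp s) (at s)"
      by (rule DERIV_chain2[OF k[OF eS[OF s]] DERIV_exp])
    moreover have "((\<lambda>s. V (exp s)) has_field_derivative v (exp s) * exp s) (at s)"
      by (rule DERIV_chain2[OF V'[OF eS(1)[OF s]] DERIV_exp])
    ultimately show ?thesis unfolding G_def[abs_def]
      by (auto intro!: derivative_eq_intros simp: field_simps)
  qed
  then obtain K where K: "\<And>s. s \<in> S \<Longrightarrow> G s = K"
    using has_field_derivative_zero_constant[of S G] S by (meson has_field_derivative_at_within)
  define s where "s = Ln z"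
  have es: "exp s = z" using z by (simp add: s_def)
  have "s \<in> S"
  proof -
    have "Re s = ln (cmod z)" using z by (simp add: s_def)
    moreover have "ln (cmod z) < ln r" using z r by (subst ln_less_cancel_iff) auto
    ultimately show ?thesis by (simp add: S_def)
  qed
  moreover from this have "s + 2 * of_real pi * \<i> \<in> S" by (simp add: S_def)
  ultimately have "G (s + 2 * of_real pi * \<i>) = G s" using K by simp
  moreover have "G (s + 2 * of_real pi * \<i>) = exp (c * (2 * of_real pi * \<i>)) * G s"
  proof -
    have "exp (s + 2 * of_real pi * \<i>) = exp s" using exp_add[of s "2 * of_real pi * \<i>"] by (simp add: mult_ac)
    then show ?thesis by (simp add: G_def exp_add distrib_left mult_ac)
  qed
  moreover have "exp (c * (2 * of_real pi * \<i>)) \<noteq> 1"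
  proof -
    have "ee c \<noteq> 1" using c ee_eq_1_iff[of c] by auto
    then show ?thesis by (simp add: ee_def mult_ac)
  qed
  ultimately have "G s = 0" by (metis mult_cancel_right1)
  then show ?thesis by (simp add: G_def es)
qed

section \<open>Compactly supported representatives and residues\<close>

text \<open>
  Local data are given only at the four points of \<open>Dpts \<tau>\<close>; through this choice of a representative they are used at all
  half-lattice points in a periodic way.
\<close>

definition rep_pt :: "complex \<Rightarrow> complex \<Rightarrow> complex" where
  "rep_pt \<tau> p = (SOME d. d \<in> Dpts \<tau> \<and> p - d \<in> lattice \<tau>)"

lemma rep_pt:
  assumes "p \<in> half_lattice \<tau>"
  shows "rep_pt \<tau> p \<in> Dpts \<tau>" "p - rep_pt \<tau> p \<in> lattice \<tau>"
proof -
  from assms obtain d l where "d \<in> Dpts \<tau>" "l \<in> lattice \<tau>" "p = d + l"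
    unfolding half_lattice_def M\<^sub>C_def Dpts_def by blast
  then have "\<exists>d. d \<in> Dpts \<tau> \<and> p - d \<in> lattice \<tau>" by force
  from someI_ex[OF this] show "rep_pt \<tau> p \<in> Dpts \<tau>" "p - rep_pt \<tau> p \<in> lattice \<tau>"
    by (simp_all add: rep_pt_def)
qed

lemma rep_pt_add:
  assumes "l \<in> lattice \<tau>"
  shows "rep_pt \<tau> (p + l) = rep_pt \<tau> p"
proof -
  have "p + l - d \<in> lattice \<tau> \<longleftrightarrow> p - d \<in> lattice \<tau>" for d
    using lattice_closed_ops[of "p - d" \<tau> l] lattice_closed_ops[of "p + l - d" \<tau> l] assms by (auto simp: algebra_simps)
  then show ?thesis by (simp add: rep_pt_def)
qed

lemma Dpts_inequivalent:
  assumes \<tau>: "Im \<tau> > 0" and d: "d \<in> Dpts \<tau>" "d' \<in> Dpts \<tau>" and l: "d - d' \<in> lattice \<tau>"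
  shows "d = d'"
proof -
  obtain m n :: int where mn: "d - d' = of_int m + of_int n * \<tau>" using l lattice_def by auto
  have c: "coord_s \<tau> (d - d') = of_int m" "coord_t \<tau> (d - d') = of_int n" unfolding mn using \<tau> by (auto simp: coord_s_def coord_t_def)
  have *: "(coord_s \<tau> x = 0 \<or> coord_s \<tau> x = 1/2) \<and> (coord_t \<tau> x = 0 \<or> coord_t \<tau> x = 1/2)" if "x \<in> Dpts \<tau>" for x
  proof -
    have "\<forall>x\<in>Dpts \<tau>. (coord_s \<tau> x = 0 \<or> coord_s \<tau> x = 1/2) \<and> (coord_t \<tau> x = 0 \<or> coord_t \<tau> x = 1/2)"
      unfolding Dpts_def using \<tau> by (simp add: coord_s_def coord_t_def add_divide_distrib)
    with that show ?thesis by blast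
  qed
  have "\<bar>of_int m :: real\<bar> < 1" "\<bar>of_int n :: real\<bar> < 1"
    using *[OF d(1)] *[OF d(2)] c unfolding coord_add by auto
  then have "m = 0" "n = 0" by linarith+
  then show ?thesis using mn by simp
qed

lemma M_not_half: "u \<in> M\<^sub>C \<tau> \<Longrightarrow> p \<in> half_lattice \<tau> \<Longrightarrow> u - p \<noteq> 0"
  by (auto simp: M_iff)

lemma M_near_half:
  assumes "Im \<tau> > 0" "p \<in> half_lattice \<tau>" "z \<in> ball 0 (sep_radius \<tau>)" "z \<noteq> 0"
  shows "p + z \<in> M\<^sub>C \<tau>"
proof (rule ccontr)
  assume "p + z \<notin> M\<^sub>C \<tau>"
  then have "p + z \<in> half_lattice \<tau>" by (simp add: M_iff)
  from half_lattice_separated[OF assms(1,2) this, of "p + z"] show False using assms sep_radius_pos[OF assms(1)] by auto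
qed

text \<open>
  A doubly periodic connection form \<open>w du\<close> with simple poles at \<open>D\<close> and nonintegral exponents \<open>cf\<close>. These are the
  properties of \<open>\<omega>\<close> on which the passage from integrals to residues rests.
\<close>

locale torus_connection = theta_tau +
  fixes w :: "complex \<Rightarrow> complex" and cf :: "complex \<Rightarrow> complex"
  assumes w_hol: "w holomorphic_on M\<^sub>C \<tau>" and w_per: "periodic_on_M \<tau> w"
    and w_loc: "\<And>d. d \<in> Dpts \<tau> \<Longrightarrow> \<exists>v. v holomorphic_on ball 0 (sep_radius \<tau>) \<and>
      (\<forall>z. z \<in> ball 0 (sep_radius \<tau>) \<longrightarrow> z \<noteq> 0 \<longrightarrow> w (d + z) = cf d / z + v z)"
    and cf: "\<And>d. d \<in> Dpts \<tau> \<Longrightarrow> cf d \<notin> \<int>"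

text \<open>
  For two forms \<open>g1 du\<close> and \<open>g2 du\<close>: at each \<open>d\<close> in \<open>D\<close>, \<open>F d\<close> solves \<open>\<nabla>F = g1 du\<close>, and \<open>Rs d\<close> is the residue of \<open>F d g2\<close>, expressed by the
  existence of a primitive \<open>G d\<close> of \<open>F d g2 - Rs d / z\<close>.
\<close>

locale local_data = torus_connection +
  fixes g1 g2 :: "complex \<Rightarrow> complex" and F G :: "complex \<Rightarrow> complex \<Rightarrow> complex" and Rs :: "complex \<Rightarrow> complex"
  assumes g1: "g1 \<in> mero_functions \<tau>" and g2: "g2 \<in> mero_functions \<tau>"
    and F: "\<And>d z. d \<in> Dpts \<tau> \<Longrightarrow> z \<in> ball 0 (sep_radius \<tau>) \<Longrightarrow> z \<noteq> 0 \<Longrightarrow>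
       (F d has_field_derivative g1 (d + z) - F d z * w (d + z)) (at z)"
    and G: "\<And>d z. d \<in> Dpts \<tau> \<Longrightarrow> z \<in> ball 0 (sep_radius \<tau>) \<Longrightarrow> z \<noteq> 0 \<Longrightarrow>
       (G d has_field_derivative F d z * g2 (d + z) - Rs d / z) (at z)"
begin

abbreviation "M \<equiv> M\<^sub>C \<tau>"
abbreviation "R \<equiv> sep_radius \<tau>"

lemma oM: "open M" by (rule open_M[OF \<tau>])

definition s where "s = R / 8"
lemma s: "s > 0" "2 * s < R" using sep_radius_pos[OF \<tau>] by (auto simp: s_def)

definition local_sol where "local_sol p = F (rep_pt \<tau> p)"
definition local_prim where "local_prim p = G (rep_pt \<tau> p)"
definition local_res where "local_res p = Rs (rep_pt \<tau> p)"

lemma g_hol: "g1 holomorphic_on M" "g2 holomorphic_on M" and g_per: "periodic_on_M \<tau> g1" "periodic_on_M \<tau> g2"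
  using g1 g2 by (auto simp: mero_functions_def)

lemma shift_rep:
  assumes "periodic_on_M \<tau> g" "p \<in> half_lattice \<tau>" "z \<in> ball 0 R" "z \<noteq> 0"
  shows "g (p + z) = g (rep_pt \<tau> p + z)"
proof -
  have "rep_pt \<tau> p + z \<in> M" using M_near_half[OF \<tau> Dpts_half[OF rep_pt(1)[OF assms(2)]] assms(3,4)] .
  then have "g (rep_pt \<tau> p + z + (p - rep_pt \<tau> p)) = g (rep_pt \<tau> p + z)"
    using assms(1) rep_pt(2)[OF assms(2)] unfolding periodic_on_M_def by blast
  then show ?thesis by (simp add: algebra_simps)
qed

lemma local_sol:
  assumes "p \<in> half_lattice \<tau>" "z \<in> ball 0 R" "z \<noteq> 0"
  shows "(local_sol p has_field_derivative g1 (p + z) - local_sol p z * w (p + z)) (at z)"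
    "(local_prim p has_field_derivative local_sol p z * g2 (p + z) - local_res p / z) (at z)"
  using F[OF rep_pt(1)[OF assms(1)] assms(2,3)] G[OF rep_pt(1)[OF assms(1)] assms(2,3)]
  by (simp_all add: local_sol_def local_prim_def local_res_def shift_rep[OF g_per(1) assms] shift_rep[OF g_per(2) assms] shift_rep[OF w_per assms])

lemma local_sol_holomorphic: "p \<in> half_lattice \<tau> \<Longrightarrow> local_sol p holomorphic_on (ball 0 R - {0})" "p \<in> half_lattice \<tau> \<Longrightarrow> local_prim p holomorphic_on (ball 0 R - {0})"
proof -
  have o: "open (ball 0 R - {0 :: complex})" by (intro open_Diff) auto
  show "p \<in> half_lattice \<tau> \<Longrightarrow> local_sol p holomorphic_on (ball 0 R - {0})" "p \<in> half_lattice \<tau> \<Longrightarrow> local_prim p holomorphic_on (ball 0 R - {0})"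
    unfolding holomorphic_on_open[OF o] using local_sol by blast+
qed

lemma local_data_shift:
  assumes "l \<in> lattice \<tau>"
  shows "local_sol (p + l) = local_sol p" "local_prim (p + l) = local_prim p" "local_res (p + l) = local_res p"
  using rep_pt_add[OF assms] by (simp_all add: local_sol_def local_prim_def local_res_def)

text \<open>
  The equation says in particular that \<open>h\<close> satisfies the Cauchy-Riemann equations near \<open>p\<close>. So \<open>h + f_p\<close> is a holomorphic solution of
  the homogeneous equation on a punctured disc and vanishes by \<open>local_homogeneous_solution_0\<close>.
\<close>

lemma solution_unique:
  assumes h: "\<And>u. u \<in> M \<Longrightarrow> h differentiable (at u)" and p: "p \<in> half_lattice \<tau>" and \<delta>: "\<delta> > 0"
    and 0: "\<And>u v. u \<in> M \<Longrightarrow> cmod (u - p) < \<delta> \<Longrightarrow> g1 u * v + nabla0 (times_du w) h u v = 0"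
    and z: "z \<in> ball 0 (min \<delta> R)" "z \<noteq> 0"
  shows "h (p + z) = - local_sol p z"
proof -
  obtain v where v: "v holomorphic_on ball 0 R" "\<And>z. z \<in> ball 0 R \<Longrightarrow> z \<noteq> 0 \<Longrightarrow> w (p + z) = cf (rep_pt \<tau> p) / z + v z"
    using w_loc[OF rep_pt(1)[OF p]] shift_rep[OF w_per p] by metis
  define k where "k z = h (p + z) + local_sol p z" for z
  have "k z = 0"
  proof (rule local_homogeneous_solution_0[OF cf[OF rep_pt(1)[OF p]] _ _ z])
    show "v holomorphic_on ball 0 (min \<delta> R)" using v(1) holomorphic_on_subset by fastforce
    fix z :: complex assume z: "z \<in> ball 0 (min \<delta> R)" "z \<noteq> 0"
    then have zR: "z \<in> ball 0 R" and zd: "cmod z < \<delta>" by auto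
    have uM: "p + z \<in> M" by (rule M_near_half[OF \<tau> p zR z(2)])
    have *: "px h (p + z) = - (g1 (p + z) + h (p + z) * w (p + z))" "py h (p + z) = \<i> * (- (g1 (p + z) + h (p + z) * w (p + z)))"
      using 0[OF uM, of 1] 0[OF uM, of \<i>] zd
      by (simp_all add: nabla0_def d0_def times_du_def px_def py_def eq_neg_iff_add_eq_0 algebra_simps)
    have "(h has_field_derivative px h (p + z)) (at (p + z))"
      by (rule complex_linear_imp_field_derivative[OF h[OF uM]]) (simp add: *)
    then have "((\<lambda>z. h (p + z)) has_field_derivative - (g1 (p + z) + h (p + z) * w (p + z))) (at z)"
      unfolding * using DERIV_shift[of h _ z p] by (simp add: add.commute)
    from DERIV_add[OF this local_sol(1)[OF p zR z(2)]]
    have "(k has_field_derivative - k z * w (p + z)) (at z)"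
      unfolding k_def[abs_def] by (rule DERIV_cong) (simp add: algebra_simps)
    then show "(k has_field_derivative - k z * (cf (rep_pt \<tau> p) / z + v z)) (at z)" using v(2)[OF zR z(2)] by simp
  qed
  then show ?thesis by (simp add: k_def eq_neg_iff_add_eq_0)
qed

text \<open>
  A case distinction with the same \<open>p\<close> for all periodised functions, so that identities between them reduce to identities between
  their local expressions.
\<close>

lemma periodise_pointwise:
  assumes "u \<in> M"
  obtains p where "p \<in> half_lattice \<tau>" "u - p \<in> ball 0 R" "u - p \<noteq> 0" "\<And>K. periodise \<tau> K u = K p (u - p)"
    | "\<And>p. p \<in> half_lattice \<tau> \<Longrightarrow> cmod (u - p) \<ge> R" "\<And>K. periodise \<tau> K u = 0"
proof (cases "\<exists>p\<in>half_lattice \<tau>. cmod (u - p) < R")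
  case True
  then obtain p where p: "p \<in> half_lattice \<tau>" "cmod (u - p) < R" by blast
  show thesis by (rule that(1)[of p]) (use p M_not_half[OF assms] periodise_near[OF \<tau> p] in auto)
next
  case False
  show thesis by (rule that(2)) (use False in \<open>force simp: periodise_def\<close>)+
qed

lemma periodise_derivatives:
  assumes K0: "\<And>p z. p \<in> half_lattice \<tau> \<Longrightarrow> cmod z \<ge> 2 * s \<Longrightarrow> K p z = 0"
    and K: "\<And>p z. p \<in> half_lattice \<tau> \<Longrightarrow> z \<in> ball 0 R \<Longrightarrow> z \<noteq> 0 \<Longrightarrow> K p differentiable (at z)"
    and u: "u \<in> M"
  shows "px (periodise \<tau> K) u = periodise \<tau> (\<lambda>p. px (K p)) u" "py (periodise \<tau> K) u = periodise \<tau> (\<lambda>p. py (K p)) u"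
    "periodise \<tau> K differentiable (at u)"
proof -
  have *: "px (periodise \<tau> K) u = periodise \<tau> (\<lambda>p. px (K p)) u \<and> py (periodise \<tau> K) u = periodise \<tau> (\<lambda>p. py (K p)) u
    \<and> periodise \<tau> K differentiable (at u)"
  proof (cases rule: periodise_pointwise[OF u])
    case (1 p)
    have o: "open (ball p R)" "u \<in> ball p R" using 1 by (auto simp: dist_norm norm_minus_commute)
    have e: "K p (x + (- p)) = periodise \<tau> K x" if "x \<in> ball p R" for x
      using periodise_near[OF \<tau> 1(1), of x K] that by (simp add: dist_norm norm_minus_commute)
    have d: "(\<lambda>x. K p (x + (- p))) differentiable (at u)"
      unfolding px_py_shift(3) using K[OF 1(1)] 1 by simp
    from px_py_cong[OF o e d] show ?thesis unfolding 1(4) px_py_shift by simp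
  next
    case 2
    have o: "open (ball u (R - 2 * s))" "u \<in> ball u (R - 2 * s)" using s by auto
    have e: "0 = periodise \<tau> K x" if x: "x \<in> ball u (R - 2 * s)" for x
    proof (rule periodise_far[OF \<tau> K0, symmetric])
      fix p assume "p \<in> half_lattice \<tau>"
      then have "R \<le> cmod (u - p)" using 2 by blast
      also have "\<dots> \<le> cmod (u - x) + cmod (x - p)" using norm_triangle_ineq[of "u - x" "x - p"] by simp
      finally show "2 * s \<le> cmod (x - p)" using x by (simp add: dist_norm)
    qed auto
    have d: "(\<lambda>_::complex. 0::complex) differentiable (at u)" by simp
    show ?thesis using px_py_cong[OF o e d] px_py_field[OF DERIV_const[of "0::complex" "at u"]] 2(2) by simp
  qed
  then show "px (periodise \<tau> K) u = periodise \<tau> (\<lambda>p. px (K p)) u" "py (periodise \<tau> K) u = periodise \<tau> (\<lambda>p. py (K p)) u"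
    "periodise \<tau> K differentiable (at u)" by auto
qed

text \<open>
  The function that equals \<open>f_p\<close> near each half-lattice point \<open>p\<close> and is smoothly cut off further out.
\<close>

definition cutoff where "cutoff = periodise \<tau> (\<lambda>p z. bump s z * local_sol p z)"

lemma bump0: "cmod z \<ge> 2 * s \<Longrightarrow> bump s z = 0" using bump_eq_0[OF s(1)] .

lemma bump_deriv1:
  assumes "cmod z < s"
  shows "px (bump s) z = 0" "py (bump s) z = 0"
proof -
  have d: "(\<lambda>_::complex. 1::complex) differentiable (at z)" by simp
  have "\<And>w. w \<in> ball 0 s \<Longrightarrow> 1 = bump s w" using bump_eq_1[OF s(1)] by simp
  from px_py_cong[of "ball 0 s" z "\<lambda>_. 1" "bump s", OF open_ball _ this d] assms show "px (bump s) z = 0" "py (bump s) z = 0"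
    using px_py_field[OF DERIV_const[of "1::complex" "at z"]] by auto
qed

lemma bump_diff: "bump s differentiable (at z)" "px (bump s) differentiable (at z)" "py (bump s) differentiable (at z)"
  using Ck_bump[of 2 s] by (simp_all add: numeral_2_eq_2)

lemma local_sol_derivatives:
  assumes "p \<in> half_lattice \<tau>" "z \<in> ball 0 R" "z \<noteq> 0"
  shows "local_sol p differentiable (at z)" "local_prim p differentiable (at z)"
    "px (local_sol p) z = g1 (p + z) - local_sol p z * w (p + z)" "py (local_sol p) z = \<i> * (g1 (p + z) - local_sol p z * w (p + z))"
    "px (local_prim p) z = local_sol p z * g2 (p + z) - local_res p / z" "py (local_prim p) z = \<i> * (local_sol p z * g2 (p + z) - local_res p / z)"
  using px_py_field[OF local_sol(1)[OF assms]] px_py_field[OF local_sol(2)[OF assms]] by auto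

lemma punctured_open: "open (ball 0 R - {0 :: complex})" by (intro open_Diff) auto

lemma cutoff_Ck: "Ck k M cutoff"
  unfolding cutoff_def
proof (rule periodise_Ck_M[OF \<tau> s(2)])
  show "Ck k (ball 0 R - {0}) (\<lambda>z. bump s z * local_sol p z)" if "p \<in> half_lattice \<tau>" for p
    by (intro Ck_mult punctured_open Ck_holomorphic local_sol_holomorphic that Ck_subset[OF Ck_bump]) auto
qed (simp add: bump0)

lemma cutoff_per: "l \<in> lattice \<tau> \<Longrightarrow> cutoff (u + l) = cutoff u"
  unfolding cutoff_def by (rule periodise_periodic[OF \<tau>]) (simp_all add: local_data_shift)

lemma cutoff_near:
  assumes "p \<in> half_lattice \<tau>" "cmod (u - p) < s"
  shows "cutoff u = local_sol p (u - p)"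
proof -
  have "cmod (u - p) < R" using assms s by linarith
  from periodise_near[OF \<tau> assms(1) this] show ?thesis
    using bump_eq_1[OF s(1), of "u - p"] assms by (simp add: cutoff_def)
qed

text \<open>
  Near \<open>p\<close> the operator \<open>\<i> \<partial>\<^sub>x - \<partial>\<^sub>y\<close> annihilates the holomorphic factor \<open>f_p\<close> and differentiates only the bump function.
\<close>

lemma cutoff_Dbar:
  assumes u: "u \<in> M"
  shows "\<i> * px cutoff u - py cutoff u = periodise \<tau> (\<lambda>p z. (\<i> * px (bump s) z - py (bump s) z) * local_sol p z) u"
proof -
  have d: "px cutoff u = periodise \<tau> (\<lambda>p. px (\<lambda>z. bump s z * local_sol p z)) u" "py cutoff u = periodise \<tau> (\<lambda>p. py (\<lambda>z. bump s z * local_sol p z)) u"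
    unfolding cutoff_def by (rule periodise_derivatives[OF _ _ u]; simp add: bump0 px_py_mult bump_diff local_sol_derivatives)+
  show ?thesis
  proof (cases rule: periodise_pointwise[OF u])
    case (1 p)
    show ?thesis unfolding d 1(4)
      by (simp add: px_py_mult bump_diff local_sol_derivatives[OF 1(1-3)] algebra_simps)
  qed (simp add: d)
qed

text \<open>
  The components of the 1-form \<open>G_p d\<chi>\<close>, where \<open>\<chi>\<close> is the bump function. It vanishes near \<open>p\<close>, where \<open>\<chi>\<close> is constant, and outside a
  larger disc, so it is smooth even where \<open>G_p\<close> is singular.
\<close>

definition corrA where "corrA = periodise \<tau> (\<lambda>p z. px (bump s) z * local_prim p z)"
definition corrB where "corrB = periodise \<tau> (\<lambda>p z. py (bump s) z * local_prim p z)"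

text \<open>
  The circle \<open>|z| = 2s\<close> is included: there \<open>|z|\<^sup>2/s\<^sup>2 = 4\<close>, and \<open>step_fun\<close> is constant already from \<open>3\<close> on.
\<close>

lemma bump_deriv_far:
  assumes "cmod z \<ge> 2 * s"
  shows "px (bump s) z = 0" "py (bump s) z = 0"
proof -
  have 1: "(bump s has_derivative (\<lambda>h. of_real (Re h) * px (bump s) z + of_real (Im h) * py (bump s) z)) (at z)"
    by (rule has_derivative_px_py[OF bump_diff(1)])
  have "((\<lambda>z. (cmod z)\<^sup>2 / s\<^sup>2) has_derivative (\<lambda>h. 2 * (Re z * Re h + Im z * Im h) * inverse (s\<^sup>2))) (at z)"
  proof -
    have "((\<lambda>z. ((Re z)\<^sup>2 + (Im z)\<^sup>2) * inverse (s\<^sup>2)) has_derivative (\<lambda>h. 2 * (Re z * Re h + Im z * Im h) * inverse (s\<^sup>2))) (at z)"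
      by (auto intro!: derivative_eq_intros simp: algebra_simps)
    then show ?thesis by (simp only: cmod_power2 divide_inverse)
  qed
  moreover have "(step_fun has_derivative (\<lambda>x. 0)) (at ((cmod z)\<^sup>2 / s\<^sup>2))"
  proof -
    have "(2 * s)\<^sup>2 \<le> (cmod z)\<^sup>2" using assms s by (intro power_mono) auto
    then have "(cmod z)\<^sup>2 / s\<^sup>2 > 3" using s by (simp add: field_simps) (smt (verit) zero_less_power)
    then have "step_deriv ((cmod z)\<^sup>2 / s\<^sup>2) = 0" by (rule step_deriv_0)
    then show ?thesis using step_fun_deriv[of "(cmod z)\<^sup>2 / s\<^sup>2"] by (simp add: has_field_derivative_def lambda_zero)
  qed
  ultimately have "((\<lambda>z. step_fun ((cmod z)\<^sup>2 / s\<^sup>2)) has_derivative (\<lambda>h. 0)) (at z)" by (rule has_derivative_compose)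
  from has_derivative_of_real[OF this] have "(bump s has_derivative (\<lambda>h. 0)) (at z)"
    by (simp add: bump_def[abs_def])
  from px_py_eqI[OF this] show "px (bump s) z = 0" "py (bump s) z = 0" by auto
qed

lemma corr_Ck: "Ck k M corrA" "Ck k M corrB"
proof -
  have b: "Ck k UNIV (px (bump s))" "Ck k UNIV (py (bump s))" using Ck_bump[of "Suc k" s] by auto
  show "Ck k M corrA" unfolding corrA_def
  proof (rule periodise_Ck_M[OF \<tau> s(2)])
    show "Ck k (ball 0 R - {0}) (\<lambda>z. px (bump s) z * local_prim p z)" if "p \<in> half_lattice \<tau>" for p
      by (intro Ck_mult punctured_open Ck_holomorphic local_sol_holomorphic that Ck_subset[OF b(1)]) auto
  qed (simp add: bump_deriv_far)
  show "Ck k M corrB" unfolding corrB_def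
  proof (rule periodise_Ck_M[OF \<tau> s(2)])
    show "Ck k (ball 0 R - {0}) (\<lambda>z. py (bump s) z * local_prim p z)" if "p \<in> half_lattice \<tau>" for p
      by (intro Ck_mult punctured_open Ck_holomorphic local_sol_holomorphic that Ck_subset[OF b(2)]) auto
  qed (simp add: bump_deriv_far)
qed

lemma corr_per: "l \<in> lattice \<tau> \<Longrightarrow> corrA (u + l) = corrA u" "l \<in> lattice \<tau> \<Longrightarrow> corrB (u + l) = corrB u"
  unfolding corrA_def corrB_def by (rule periodise_periodic[OF \<tau>]; simp add: local_data_shift)+

lemma corr_near:
  assumes "p \<in> half_lattice \<tau>" "cmod (u - p) < s"
  shows "corrA u = 0" "corrB u = 0"
proof -
  have "cmod (u - p) < R" using assms s by linarith
  note n = periodise_near[OF \<tau> assms(1) this]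
  show "corrA u = 0" "corrB u = 0" using assms by (simp_all add: corrA_def corrB_def n bump_deriv1)
qed

text \<open>
  This is \<open>d(G_p d\<chi>) = dG_p \<and> d\<chi>\<close> with \<open>dG_p = (f_p g2 - R_p/z) dz\<close>.
\<close>

lemma corr_derivatives:
  assumes u: "u \<in> M"
  shows "px corrB u - py corrA u = - periodise \<tau> (\<lambda>p z. (\<i> * px (bump s) z - py (bump s) z) * (local_sol p z * g2 (p + z) - local_res p / z)) u"
proof -
  have A: "py corrA u = periodise \<tau> (\<lambda>p. py (\<lambda>z. px (bump s) z * local_prim p z)) u"
    unfolding corrA_def by (rule periodise_derivatives[OF _ _ u]; simp add: bump_deriv_far px_py_mult bump_diff local_sol_derivatives)
  have B: "px corrB u = periodise \<tau> (\<lambda>p. px (\<lambda>z. py (bump s) z * local_prim p z)) u"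
    unfolding corrB_def by (rule periodise_derivatives[OF _ _ u]; simp add: bump_deriv_far px_py_mult bump_diff local_sol_derivatives)
  have sym: "px (py (bump s)) z = py (px (bump s)) z" for z
    by (rule px_py_commute[OF open_UNIV Ck_bump]) simp
  show ?thesis
  proof (cases rule: periodise_pointwise[OF u])
    case (1 p)
    show ?thesis unfolding A B 1(4)
      by (simp add: px_py_mult bump_diff local_sol_derivatives[OF 1(1-3)] sym algebra_simps)
  qed (simp add: A B)
qed

text \<open>
  The coefficient of \<open>- R_p d\<chi> \<and> dz/z\<close>, the part of the wedge product that is not exact. The pole of \<open>1/z\<close> is cancelled by
  the factor \<open>z\<close> in \<open>bump_px_py\<close>, so the kernel is continuous everywhere.
\<close>

definition res_kernel where "res_kernel p z = - (2 * \<i> * local_res p * of_real (step_deriv ((cmod z)\<^sup>2 / s\<^sup>2) / s\<^sup>2))"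

lemma res_kernel_0:
  assumes "cmod z \<ge> 2 * s" shows "res_kernel p z = 0"
proof -
  have "(2 * s)\<^sup>2 \<le> (cmod z)\<^sup>2" using assms s by (intro power_mono) auto
  then have "(cmod z)\<^sup>2 / s\<^sup>2 > 3" using s by (simp add: field_simps) (smt (verit) zero_less_power)
  then show ?thesis by (simp add: res_kernel_def step_deriv_0)
qed

lemma res_kernel_cont: "continuous_on A (res_kernel p)"
proof -
  have "continuous_on A (\<lambda>z. step_deriv ((cmod z)\<^sup>2 / s\<^sup>2))"
    by (rule continuous_on_compose2[OF step_deriv_continuous[of UNIV]]) (use s in \<open>auto intro!: continuous_intros\<close>)
  then show ?thesis unfolding res_kernel_def[abs_def] using s by (intro continuous_intros) auto
qed

lemma periodise_res_kernel_cont: "continuous_on UNIV (periodise \<tau> res_kernel)"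
  using periodise_Ck[OF \<tau> s(2) res_kernel_0 open_UNIV, where k = 0] res_kernel_cont by simp

lemma integral_res_kernel: "integral_M \<tau> (periodise \<tau> res_kernel) = 2 * of_real pi * \<i> * (\<Sum>d\<in>Dpts \<tau>. Rs d)"
proof -
  have rep: "rep_pt \<tau> d = d" if "d \<in> Dpts \<tau>" for d
    using Dpts_inequivalent[OF \<tau> that rep_pt(1)[OF Dpts_half[OF that]] rep_pt(2)[OF Dpts_half[OF that]]] by simp
  have "integral_M \<tau> (periodise \<tau> res_kernel) = (\<Sum>p\<in>Dpts \<tau>. (\<integral>z. res_kernel p z \<partial>lborel))"
  proof (rule integral_periodise[OF \<tau> s(2) res_kernel_0])
    show "res_kernel (p + l) = res_kernel p" if "l \<in> lattice \<tau>" for p l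
      unfolding res_kernel_def[abs_def] local_data_shift(3)[OF that] ..
  qed (auto simp: res_kernel_cont)
  also have "\<dots> = (\<Sum>d\<in>Dpts \<tau>. 2 * of_real pi * \<i> * Rs d)"
  proof (rule sum.cong)
    fix d assume d: "d \<in> Dpts \<tau>"
    have "(\<integral>z. res_kernel d z \<partial>lborel) = - (2 * \<i> * local_res d) * (\<integral>z. complex_of_real (step_deriv ((cmod z)\<^sup>2 / s\<^sup>2) / s\<^sup>2) \<partial>lborel)"
      unfolding res_kernel_def by (subst integral_mult_right_zero[symmetric]) simp
    then show "(\<integral>z. res_kernel d z \<partial>lborel) = 2 * of_real pi * \<i> * Rs d"
      unfolding integral_bump[OF s(1)] by (simp add: local_res_def rep[OF d])
  qed simp
  finally show ?thesis by (simp add: sum_distrib_left)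
qed

text \<open>
  The compact set in the definition has a positive distance from the closed half lattice, and this distance is invariant
  under translation by lattice vectors.
\<close>

lemma compact_support_vanishes:
  assumes "compact_support_in_M \<tau> \<phi>"
  obtains \<delta> where "\<delta> > 0" "\<And>p u. p \<in> half_lattice \<tau> \<Longrightarrow> u \<in> M \<Longrightarrow> cmod (u - p) < \<delta> \<Longrightarrow> \<phi> u = (\<lambda>v. 0)"
proof -
  obtain K where K: "compact K" "K \<subseteq> M" "\<And>u. u \<in> M \<Longrightarrow> \<phi> u \<noteq> (\<lambda>v. 0) \<Longrightarrow> \<exists>l\<in>lattice \<tau>. u + l \<in> K"
    using assms unfolding compact_support_in_M_def by blast
  have "closed (half_lattice \<tau>)" using oM by (simp add: half_lattice_def open_closed)
  moreover have "K \<inter> half_lattice \<tau> = {}" using K(2) by (auto simp: half_lattice_def)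
  ultimately obtain \<delta> where \<delta>: "\<delta> > 0" "\<And>x y. x \<in> K \<Longrightarrow> y \<in> half_lattice \<tau> \<Longrightarrow> \<delta> \<le> dist x y"
    using separate_compact_closed[OF K(1)] by metis
  show thesis
  proof (rule that[OF \<delta>(1)])
    fix p u assume pu: "p \<in> half_lattice \<tau>" "u \<in> M" "cmod (u - p) < \<delta>"
    show "\<phi> u = (\<lambda>v. 0)"
    proof (rule ccontr)
      assume "\<phi> u \<noteq> (\<lambda>v. 0)"
      then obtain l where l: "l \<in> lattice \<tau>" "u + l \<in> K" using K(3) pu by blast
      then have "\<delta> \<le> dist (u + l) (p + l)" using \<delta>(2) half_lattice_add pu(1) by blast
      then show False using pu(3) by (simp add: dist_norm)
    qed
  qed
qed

lemma Ck_M_holomorphic: "f holomorphic_on M \<Longrightarrow> Ck k M f" by (rule Ck_holomorphic[OF oM])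

text \<open>
  For every admissible pair the wedge product is the coefficient of \<open>d(k g2 du + G_p d\<chi> - g \<phi>c)\<close> plus the residue kernel, with
  \<open>k = h + cutoff\<close>. The 1-form in brackets vanishes near the half lattice: \<open>k\<close> does because \<open>h = - f_p\<close> there, \<open>G_p d\<chi>\<close> because \<open>\<chi>\<close> is
  locally constant, and \<open>\<phi>c\<close> by its compact support.
\<close>

lemma integral_of_representative:
  assumes rep: "compact_rep \<tau> (times_du w) (times_du g1) \<phi>c"
    and g: "g \<in> mero_functions \<tau>"
    and \<psi>: "\<And>u v. u \<in> M \<Longrightarrow> \<psi> u v = times_du g2 u v + nabla0 (neg_form (times_du w)) g u v"
  shows "integral_M \<tau> (wedge \<phi>c \<psi>) = 2 * of_real pi * \<i> * (\<Sum>d\<in>Dpts \<tau>. Rs d)"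
proof -
  obtain h where sm: "\<phi>c \<in> smooth_forms \<tau>" and coord_s: "compact_support_in_M \<tau> \<phi>c"
    and cl: "\<And>u. u \<in> M \<Longrightarrow> nabla1 (times_du w) \<phi>c u = 0"
    and h: "h \<in> smooth_functions \<tau>" and \<phi>c: "\<And>u v. u \<in> M \<Longrightarrow> \<phi>c u v = times_du g1 u v + nabla0 (times_du w) h u v"
    using rep unfolding compact_rep_def by blast
  have hC: "Ck k M h" for k using h smooth_on_imp_Ck[OF oM] by (simp add: smooth_functions_def)
  have hp: "h (u + l) = h u" if "u \<in> M" "l \<in> lattice \<tau>" for u l
    using h that by (simp add: smooth_functions_def periodic_on_M_def)
  have hd: "h differentiable (at u)" if "u \<in> M" for u using hC[of 1] that by simp
  obtain \<delta> where \<delta>: "\<delta> > 0" "\<And>p u. p \<in> half_lattice \<tau> \<Longrightarrow> u \<in> M \<Longrightarrow> cmod (u - p) < \<delta> \<Longrightarrow> \<phi>c u = (\<lambda>v. 0)"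
    using compact_support_vanishes[OF coord_s] by blast
  have gh: "g holomorphic_on M" "periodic_on_M \<tau> g" using g by (auto simp: mero_functions_def)
  define a1 where "a1 = (\<lambda>u. \<phi>c u 1)"
  define a2 where "a2 = (\<lambda>u. \<phi>c u \<i>)"
  have aC: "Ck k M a1" "Ck k M a2" for k
    using sm smooth_on_imp_Ck[OF oM] by (simp_all add: smooth_forms_def a1_def a2_def)
  have ap: "a1 (u + l) = a1 u" "a2 (u + l) = a2 u" if "u \<in> M" "l \<in> lattice \<tau>" for u l
    using sm that by (simp_all add: smooth_forms_def periodic_on_M_def a1_def a2_def)
  define k where "k u = h u + cutoff u" for u
  have kC: "Ck n M k" for n unfolding k_def[abs_def] by (intro Ck_add oM hC cutoff_Ck)
  have k0: "k u = 0" if "p \<in> half_lattice \<tau>" "u \<in> M" "cmod (u - p) < min \<delta> s" for p u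
  proof -
    have z: "u - p \<in> ball 0 (min \<delta> R)" "u - p \<noteq> 0" using that s M_not_half by auto
    have "h (p + (u - p)) = - local_sol p (u - p)"
    proof (rule solution_unique[OF hd that(1) \<delta>(1) _ z])
      fix u v assume "u \<in> M" "cmod (u - p) < \<delta>"
      then show "g1 u * v + nabla0 (times_du w) h u v = 0"
        using \<delta>(2)[OF that(1), of u] \<phi>c[of u v] by (simp add: times_du_def)
    qed
    then show ?thesis using cutoff_near[OF that(1), of u] that(3) by (simp add: k_def)
  qed
  \<comment> \<open>The components in \<open>dx\<close> and \<open>dy\<close> of the 1-form whose differential is split off.\<close>
  define A where "A u = (k u * g2 u + corrA u) - g u * a1 u" for u
  define B where "B u = (\<i> * (k u * g2 u) + corrB u) - g u * a2 u" for u
  have "integral_M \<tau> (wedge \<phi>c \<psi>) = integral_M \<tau> (periodise \<tau> res_kernel)"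
  proof (rule Stokes_M[OF \<tau>])
    show "Ck 1 M A" "Ck 1 M B" unfolding A_def[abs_def] B_def[abs_def]
      by (intro Ck_diff Ck_add Ck_cmult Ck_mult oM kC corr_Ck aC Ck_M_holomorphic g_hol gh)+
    show "periodic_on_M \<tau> A" "periodic_on_M \<tau> B"
      using hp ap g_per(2) gh(2) cutoff_per corr_per unfolding periodic_on_M_def A_def B_def k_def by simp_all
    have "A u = 0 \<and> B u = 0" if "p \<in> half_lattice \<tau>" "u \<in> M" "cmod (u - p) < min \<delta> s" for p u
      using k0[OF that] corr_near[OF that(1), of u] \<delta>(2)[OF that(1,2)] that(3) by (simp add: A_def B_def a1_def a2_def)
    then show "vanishes_near_half \<tau> A" "vanishes_near_half \<tau> B"
      unfolding vanishes_near_half_def using \<delta>(1) s(1) by (intro exI[of _ "min \<delta> s"]; auto)+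
    show "continuous_on UNIV (periodise \<tau> res_kernel)" by (rule periodise_res_kernel_cont)
    fix u assume u: "u \<in> M"
    have g2d: "(g2 has_field_derivative deriv g2 u) (at u)" and gd: "(g has_field_derivative deriv g u) (at u)"
      using holomorphic_derivI[OF g_hol(2) oM u] holomorphic_derivI[OF gh(1) oM u] by blast+
    note dg2 = px_py_field[OF g2d] and dg = px_py_field[OF gd]
    have dk: "k differentiable (at u)" and dc: "corrA differentiable (at u)" "corrB differentiable (at u)" "cutoff differentiable (at u)"
      and da: "a1 differentiable (at u)" "a2 differentiable (at u)"
      using kC[of 1] corr_Ck[of 1] aC[of 1] cutoff_Ck[of 1] u by auto
    have pA: "py A u = (py k u * g2 u + k u * (\<i> * deriv g2 u) + py corrA u) - (\<i> * deriv g u * a1 u + g u * py a1 u)"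
      unfolding A_def[abs_def] by (simp add: px_py_diff px_py_add px_py_mult dk dg2 dc dg da)
    have pB: "px B u = (\<i> * (px k u * g2 u + k u * deriv g2 u) + px corrB u) - (deriv g u * a2 u + g u * px a2 u)"
      unfolding B_def[abs_def] by (simp add: px_py_diff px_py_add px_py_mult px_py_const dk dg2 dc dg da)
    have pk: "px k u = px h u + px cutoff u" "py k u = py h u + py cutoff u"
      unfolding k_def[abs_def] using px_py_add[OF hd[OF u] dc(3)] by auto
    have cl': "px a2 u - py a1 u = a1 u * (\<i> * w u) - a2 u * w u"
      using cl[OF u] by (simp add: nabla1_def d1_def wedge_def times_du_def px_def py_def a1_def a2_def algebra_simps)
    have \<phi>1: "a1 u = g1 u + px h u + h u * w u" "a2 u = \<i> * g1 u + py h u + \<i> * (h u * w u)"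
      using \<phi>c[OF u, of 1] \<phi>c[OF u, of \<i>] by (simp_all add: a1_def a2_def times_du_def nabla0_def d0_def px_def py_def algebra_simps)
    have \<psi>1: "\<psi> u 1 = g2 u + deriv g u - g u * w u" "\<psi> u \<i> = \<i> * (g2 u + deriv g u - g u * w u)"
      using \<psi>[OF u, of 1] \<psi>[OF u, of \<i>] dg
      by (simp_all add: times_du_def nabla0_def neg_form_def d0_def px_def py_def algebra_simps)
    have W: "wedge \<phi>c \<psi> u = (\<i> * a1 u - a2 u) * (g2 u + deriv g u - g u * w u)"
      unfolding wedge_def \<psi>1 by (simp add: a1_def a2_def algebra_simps)
    have D: "\<i> * a1 u - a2 u = \<i> * px h u - py h u" unfolding \<phi>1 by (simp add: algebra_simps)
    have res: "g2 u * (\<i> * px cutoff u - py cutoff u) + (px corrB u - py corrA u) = - periodise \<tau> res_kernel u"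
    proof (cases rule: periodise_pointwise[OF u])
      case (1 p)
      define D where "D = \<i> * px (bump s) (u - p) - py (bump s) (u - p)"
      have "D = 2 * \<i> * (u - p) * of_real (step_deriv ((cmod (u - p))\<^sup>2 / s\<^sup>2) / s\<^sup>2)"
        unfolding D_def by (rule bump_px_py)
      then have "D * (local_res p / (u - p)) = - res_kernel p (u - p)" using 1(3) by (simp add: res_kernel_def)
      then have "g2 u * (D * local_sol p (u - p)) - D * (local_sol p (u - p) * g2 u - local_res p / (u - p)) = - res_kernel p (u - p)"
        by (simp add: algebra_simps)
      then show ?thesis
        unfolding cutoff_Dbar[OF u] corr_derivatives[OF u] 1(4) D_def[symmetric] by simp
    next
      case 2
      then show ?thesis unfolding cutoff_Dbar[OF u] corr_derivatives[OF u] by simp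
    qed
    have "px B u - py A u = g2 u * (\<i> * px h u - py h u) + (g2 u * (\<i> * px cutoff u - py cutoff u) + (px corrB u - py corrA u))
      + deriv g u * (\<i> * a1 u - a2 u) - g u * (px a2 u - py a1 u)"
      unfolding pA pB pk by (simp add: algebra_simps)
    also have "\<dots> = (\<i> * a1 u - a2 u) * (g2 u + deriv g u - g u * w u) - periodise \<tau> res_kernel u"
      unfolding res cl' D[symmetric] by (simp add: algebra_simps)
    finally show "wedge \<phi>c \<psi> u = px B u - py A u + periodise \<tau> res_kernel u" unfolding W by simp
  qed
  then show ?thesis by (simp add: integral_res_kernel)
qed

text \<open>
  Take \<open>h = - cutoff\<close>: near \<open>p\<close> it equals \<open>- f_p\<close>, so \<open>\<nabla>h\<close> cancels \<open>g1 du\<close> there.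
\<close>

lemma exists_representative: "\<exists>\<phi>c. compact_rep \<tau> (times_du w) (times_du g1) \<phi>c"
proof -
  define h where "h u = - cutoff u" for u
  define \<phi>c where "\<phi>c u v = times_du g1 u v + nabla0 (times_du w) h u v" for u v
  have hC: "Ck k M h" for k
    using Ck_cmult[OF oM cutoff_Ck, of k "-1"] by (simp add: h_def[abs_def])
  have hd: "h differentiable (at u)" if "u \<in> M" for u using hC[of 1] that by simp
  have hp: "h (u + l) = h u" if "l \<in> lattice \<tau>" for u l using cutoff_per[OF that] by (simp add: h_def)
  have c1: "(\<lambda>u. \<phi>c u 1) = (\<lambda>u. g1 u + px h u + h u * w u)"
    by (simp add: \<phi>c_def times_du_def nabla0_def d0_def px_def fun_eq_iff)
  have c2: "(\<lambda>u. \<phi>c u \<i>) = (\<lambda>u. \<i> * g1 u + py h u + \<i> * (h u * w u))"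
    by (simp add: \<phi>c_def times_du_def nabla0_def d0_def py_def fun_eq_iff)
  have hpC: "Ck k M (px h)" "Ck k M (py h)" for k using hC[of "Suc k"] by auto
  have near: "\<phi>c u = (\<lambda>v. 0)" if u: "u \<in> M" and p: "p \<in> half_lattice \<tau>" and up: "cmod (u - p) < s" for u p
  proof
    fix v
    have z: "u - p \<in> ball 0 R" "u - p \<noteq> 0" using up s M_not_half[OF u p] by auto
    have "((\<lambda>u. local_sol p (u - p)) has_field_derivative g1 u - local_sol p (u - p) * w u) (at u)"
      using local_sol(1)[OF p z] DERIV_shift[of "local_sol p" _ u "- p"] by simp
    then have "((\<lambda>u. - local_sol p (u - p)) has_field_derivative - (g1 u - local_sol p (u - p) * w u)) (at u)"
      by (rule DERIV_minus)
    then have "(h has_field_derivative - (g1 u - local_sol p (u - p) * w u)) (at u)"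
      by (rule has_field_derivative_transform_within_open[of _ _ _ "ball p s"])
        (use up cutoff_near[OF p] in \<open>auto simp: h_def dist_norm norm_minus_commute\<close>)
    then have "frechet_derivative h (at u) = (*) (- (g1 u - local_sol p (u - p) * w u))"
      unfolding has_field_derivative_def by (rule frechet_derivative_at[symmetric])
    then show "\<phi>c u v = 0"
      using cutoff_near[OF p up] by (simp add: \<phi>c_def times_du_def nabla0_def d0_def h_def algebra_simps)
  qed
  have smooth: "\<phi>c \<in> smooth_forms \<tau>"
    unfolding smooth_forms_def
  proof (intro CollectI conjI ballI)
    show "periodic_on_M \<tau> \<phi>c"
      unfolding periodic_on_M_def
    proof (intro ballI ext)
      fix u l v assume u: "u \<in> M" and l: "l \<in> lattice \<tau>"
      have "frechet_derivative (\<lambda>x. h (x + l)) (at u) = frechet_derivative h (at (u + l))"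
        unfolding frechet_derivative_def has_derivative_shift_iff ..
      moreover have "(\<lambda>x. h (x + l)) = h" using hp[OF l] by auto
      ultimately have "d0 h (u + l) v = d0 h u v" by (simp add: d0_def)
      then show "\<phi>c (u + l) v = \<phi>c u v"
        using g_per(1) w_per u l hp[OF l] by (simp add: \<phi>c_def times_du_def nabla0_def periodic_on_M_def)
    qed
    show "linear (\<phi>c u)" if "u \<in> M" for u
    proof -
      have "linear (frechet_derivative h (at u))"
        using hd[OF that] frechet_derivative_works has_derivative_linear by blast
      then have "linear (\<lambda>v. g1 u * v + (frechet_derivative h (at u) v + h u * w u * v))"
        by (intro linear_compose_add bounded_linear.linear[OF bounded_linear_mult_right])
      then show ?thesis by (simp add: \<phi>c_def[abs_def] times_du_def nabla0_def d0_def mult.assoc)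
    qed
    show "smooth_on M (\<lambda>u. \<phi>c u 1)" unfolding c1
      by (intro Ck_imp_smooth_on oM Ck_add Ck_mult hpC hC Ck_M_holomorphic g_hol w_hol)
    show "smooth_on M (\<lambda>u. \<phi>c u \<i>)" unfolding c2
      by (intro Ck_imp_smooth_on oM Ck_add Ck_cmult Ck_mult hpC hC Ck_M_holomorphic g_hol w_hol)
  qed
  have supp: "compact_support_in_M \<tau> \<phi>c"
  proof -
    let ?C = "{z. 0 \<le> coord_s \<tau> z \<and> coord_s \<tau> z \<le> 0 + 1 \<and> 0 \<le> coord_t \<tau> z \<and> coord_t \<tau> z \<le> 0 + 1}"
    let ?F = "\<Inter>p\<in>half_lattice \<tau>. {u. s \<le> cmod (u - p)}"
    have "closed ?F" by (intro closed_INT ballI closed_Collect_le continuous_intros)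
    then have "compact (?C \<inter> ?F)" using compact_closed_cell[OF \<tau>, of 0 0] by (intro compact_Int_closed) auto
    moreover have "?C \<inter> ?F \<subseteq> M"
    proof
      fix u assume u: "u \<in> ?C \<inter> ?F"
      show "u \<in> M"
      proof (rule ccontr)
        assume "u \<notin> M"
        then have "u \<in> half_lattice \<tau>" by (simp add: M_iff)
        then have "s \<le> cmod (u - u)" using u by blast
        then show False using s(1) by simp
      qed
    qed
    moreover have "\<exists>l\<in>lattice \<tau>. u + l \<in> ?C \<inter> ?F" if u: "u \<in> M" and nz: "\<phi>c u \<noteq> (\<lambda>v. 0)" for u
    proof -
      define l where "l = of_int (- \<lfloor>coord_s \<tau> u\<rfloor>) + of_int (- \<lfloor>coord_t \<tau> u\<rfloor>) * \<tau>"
      have l: "l \<in> lattice \<tau>" unfolding l_def lattice_def by blast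
      have "coord_s \<tau> l = - of_int \<lfloor>coord_s \<tau> u\<rfloor>" "coord_t \<tau> l = - of_int \<lfloor>coord_t \<tau> u\<rfloor>"
        using \<tau> by (simp_all add: l_def coord_s_def coord_t_def)
      then have "u + l \<in> ?C" by (simp add: coord_add) linarith
      moreover have "s \<le> cmod (u + l - p)" if p: "p \<in> half_lattice \<tau>" for p
      proof (rule ccontr)
        assume "\<not> s \<le> cmod (u + l - p)"
        then have "cmod (u - (p - l)) < s" by (simp add: algebra_simps)
        moreover have "p - l \<in> half_lattice \<tau>" using half_lattice_add[OF l, of "p - l"] p by simp
        ultimately show False using near[OF u] nz by blast
      qed
      ultimately show ?thesis using l by blast
    qed
    ultimately show ?thesis unfolding compact_support_in_M_def by blast
  qed
  have closed: "nabla1 (times_du w) \<phi>c u = 0" if u: "u \<in> M" for u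
  proof -
    have gd: "(g1 has_field_derivative deriv g1 u) (at u)" and wd: "(w has_field_derivative deriv w u) (at u)"
      using holomorphic_derivI[OF g_hol(1) oM u] holomorphic_derivI[OF w_hol oM u] by blast+
    note dg = px_py_field[OF gd] and dw = px_py_field[OF wd]
    have dh: "h differentiable (at u)" "px h differentiable (at u)" "py h differentiable (at u)"
      using hC[of 2] u by (auto simp: numeral_2_eq_2)
    have 1: "py (\<lambda>u. \<phi>c u 1) u = \<i> * deriv g1 u + py (px h) u + (py h u * w u + h u * (\<i> * deriv w u))"
      unfolding c1 by (simp add: px_py_add px_py_mult dg dw dh)
    have 2: "px (\<lambda>u. \<phi>c u \<i>) u = \<i> * deriv g1 u + px (py h) u + \<i> * (px h u * w u + h u * deriv w u)"
      unfolding c2 by (simp add: px_py_add px_py_mult px_py_const dg dw dh)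
    have sym: "px (py h) u = py (px h) u" by (rule px_py_commute[OF oM hC u])
    have a: "\<phi>c u 1 = g1 u + px h u + h u * w u" "\<phi>c u \<i> = \<i> * g1 u + py h u + \<i> * (h u * w u)"
      using fun_cong[OF c1] fun_cong[OF c2] by auto
    have "nabla1 (times_du w) \<phi>c u = (px (\<lambda>u. \<phi>c u \<i>) u - py (\<lambda>u. \<phi>c u 1) u) + (w u * \<phi>c u \<i> - \<i> * w u * \<phi>c u 1)"
      by (simp add: nabla1_def d1_def wedge_def times_du_def px_def py_def mult_ac)
    also have "\<dots> = 0" unfolding 1 2 a sym by (simp add: algebra_simps)
    finally show ?thesis .
  qed
  have "h \<in> smooth_functions \<tau>"
    using Ck_imp_smooth_on[OF oM hC] hp by (simp add: smooth_functions_def periodic_on_M_def)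
  then have "compact_rep \<tau> (times_du w) (times_du g1) \<phi>c"
    unfolding compact_rep_def using smooth supp closed \<phi>c_def by blast
  then show ?thesis by blast
qed

lemma zero_mero: "(\<lambda>_. 0) \<in> mero_functions \<tau>"
  by (auto simp: mero_functions_def periodic_on_M_def intro!: meromorphic_intros)

lemma times_du_mero: "g \<in> mero_functions \<tau> \<Longrightarrow> times_du g \<in> mero_forms \<tau>"
  by (auto simp: mero_forms_def)

lemma self_in_coh_class:
  assumes "g \<in> mero_functions \<tau>"
  shows "times_du g \<in> coh_class \<tau> \<eta> (times_du g)"
proof -
  have "nabla0 \<eta> (\<lambda>_. 0) u v = 0" for u v by (simp add: nabla0_def d0_def)
  then show ?thesis
    unfolding coh_class_def cohomologous_def using times_du_mero[OF assms] zero_mero by auto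
qed

text \<open>
  A representative of another form in the class of \<open>g1 du\<close> is also a representative of \<open>g1 du\<close>, with the exact
  difference absorbed into \<open>h\<close>; the choice in the class of \<open>g2 du\<close> is covered by \<open>integral_of_representative\<close>. So all admissible
  integrals agree and the definite description is well defined.
\<close>

lemma intersection_ch_eq:
  "intersection_ch \<tau> (times_du w) (coh_class \<tau> (times_du w) (times_du g1)) (coh_class \<tau> (neg_form (times_du w)) (times_du g2))
    = 2 * of_real pi * \<i> * (\<Sum>d\<in>Dpts \<tau>. Rs d)"
  unfolding intersection_ch_def
proof (rule the_equality)
  obtain \<phi>c where r: "compact_rep \<tau> (times_du w) (times_du g1) \<phi>c" using exists_representative by blast
  have "integral_M \<tau> (wedge \<phi>c (times_du g2)) = 2 * of_real pi * \<i> * (\<Sum>d\<in>Dpts \<tau>. Rs d)"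
    by (rule integral_of_representative[OF r zero_mero]) (simp add: nabla0_def d0_def)
  then show "\<exists>\<phi>\<in>coh_class \<tau> (times_du w) (times_du g1). \<exists>\<psi>\<in>coh_class \<tau> (neg_form (times_du w)) (times_du g2). \<exists>\<phi>c.
      compact_rep \<tau> (times_du w) \<phi> \<phi>c \<and> 2 * of_real pi * \<i> * (\<Sum>d\<in>Dpts \<tau>. Rs d) = integral_M \<tau> (wedge \<phi>c \<psi>)"
    using self_in_coh_class[OF g1] self_in_coh_class[OF g2] r by metis
next
  fix S
  assume "\<exists>\<phi>\<in>coh_class \<tau> (times_du w) (times_du g1). \<exists>\<psi>\<in>coh_class \<tau> (neg_form (times_du w)) (times_du g2). \<exists>\<phi>c.
      compact_rep \<tau> (times_du w) \<phi> \<phi>c \<and> S = integral_M \<tau> (wedge \<phi>c \<psi>)"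
  then obtain \<phi> \<psi> \<phi>c where X: "\<phi> \<in> coh_class \<tau> (times_du w) (times_du g1)" and Y: "\<psi> \<in> coh_class \<tau> (neg_form (times_du w)) (times_du g2)"
    and r: "compact_rep \<tau> (times_du w) \<phi> \<phi>c" and S: "S = integral_M \<tau> (wedge \<phi>c \<psi>)" by blast
  obtain f where f: "f \<in> mero_functions \<tau>" "\<And>u v. u \<in> M \<Longrightarrow> \<phi> u v - times_du g1 u v = nabla0 (times_du w) f u v"
    using X unfolding coh_class_def cohomologous_def by blast
  obtain g where g: "g \<in> mero_functions \<tau>" "\<And>u v. u \<in> M \<Longrightarrow> \<psi> u v - times_du g2 u v = nabla0 (neg_form (times_du w)) g u v"
    using Y unfolding coh_class_def cohomologous_def by blast
  obtain h where h: "h \<in> smooth_functions \<tau>" "\<And>u v. u \<in> M \<Longrightarrow> \<phi>c u v = \<phi> u v + nabla0 (times_du w) h u v"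
    and rr: "\<phi>c \<in> smooth_forms \<tau>" "compact_support_in_M \<tau> \<phi>c" "\<And>u. u \<in> M \<Longrightarrow> nabla1 (times_du w) \<phi>c u = 0"
    using r unfolding compact_rep_def by blast
  have fh: "f holomorphic_on M" "periodic_on_M \<tau> f" using f(1) by (auto simp: mero_functions_def)
  have hC: "Ck k M h" for k using h(1) smooth_on_imp_Ck[OF oM] by (simp add: smooth_functions_def)
  have sf: "(\<lambda>u. f u + h u) \<in> smooth_functions \<tau>"
    using h(1) fh(2) Ck_imp_smooth_on[OF oM Ck_add[OF oM Ck_M_holomorphic[OF fh(1)] hC]]
    by (simp add: smooth_functions_def periodic_on_M_def)
  have nab: "nabla0 (times_du w) (\<lambda>u. f u + h u) u v = nabla0 (times_du w) f u v + nabla0 (times_du w) h u v" if u: "u \<in> M" for u v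
  proof -
    have d: "f differentiable (at u)" "h differentiable (at u)"
      using px_py_field(3)[OF holomorphic_derivI[OF fh(1) oM u]] hC[of 1] u by auto
    have "frechet_derivative (\<lambda>u. f u + h u) (at u) v = frechet_derivative f (at u) v + frechet_derivative h (at u) v"
    proof -
      have "((\<lambda>u. f u + h u) has_derivative (\<lambda>v. frechet_derivative f (at u) v + frechet_derivative h (at u) v)) (at u)"
        using d frechet_derivative_works by (intro has_derivative_add) blast+
      from frechet_derivative_at[OF this] show ?thesis by metis
    qed
    then show ?thesis by (simp add: nabla0_def d0_def distrib_right)
  qed
  have "compact_rep \<tau> (times_du w) (times_du g1) \<phi>c"
    unfolding compact_rep_def
  proof (intro conjI rr ballI bexI[OF _ sf] allI)
    fix u v assume "u \<in> M"
    then show "\<phi>c u v = times_du g1 u v + nabla0 (times_du w) (\<lambda>u. f u + h u) u v"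
      using h(2)[of u v] f(2)[of u v] nab[of u v] by (simp add: algebra_simps)
  qed
  then show "S = 2 * of_real pi * \<i> * (\<Sum>d\<in>Dpts \<tau>. Rs d)"
    unfolding S by (rule integral_of_representative[OF _ g(1)]) (use g(2) in \<open>simp add: algebra_simps\<close>)
qed

end

section \<open>From local expansions to intersection numbers\<close>

text \<open>
  The residue of \<open>f (A2/z\<^sup>2 + B2/z + e2 + \<dots>)\<close>, where \<open>f\<close> is the local solution for \<open>A1/z\<^sup>2 + B1/z + e1 + \<dots>\<close> and the connection form is
  \<open>c/z + v0 + v1 z + \<dots>\<close>.
\<close>

definition res_coeff :: "complex \<Rightarrow> complex \<Rightarrow> complex \<Rightarrow> complex \<Rightarrow> complex \<Rightarrow> complex \<Rightarrow> complex \<Rightarrow> complex \<Rightarrow> complex \<Rightarrow> complex" where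
  "res_coeff c v0 v1 A1 B1 e1 A2 B2 e2 =
     A1 / (c - 1) * e2 + (B1 - A1 / (c - 1) * v0) / c * B2
     + (e1 - A1 / (c - 1) * v1 - (B1 - A1 / (c - 1) * v0) / c * v0) / (c + 1) * A2"

lemma (in torus_connection) intersection_formula:
  fixes v e1 e2 :: "complex \<Rightarrow> complex \<Rightarrow> complex" and A1 A2 B1 B2 :: "complex \<Rightarrow> complex"
  assumes g: "g1 \<in> mero_functions \<tau>" "g2 \<in> mero_functions \<tau>"
    and v: "\<And>d. d \<in> Dpts \<tau> \<Longrightarrow> v d holomorphic_on ball 0 (sep_radius \<tau>)"
      "\<And>d z. d \<in> Dpts \<tau> \<Longrightarrow> z \<in> ball 0 (sep_radius \<tau>) \<Longrightarrow> z \<noteq> 0 \<Longrightarrow> w (d + z) = cf d / z + v d z"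
    and e1: "\<And>d. d \<in> Dpts \<tau> \<Longrightarrow> e1 d holomorphic_on ball 0 (sep_radius \<tau>)"
      "\<And>d z. d \<in> Dpts \<tau> \<Longrightarrow> z \<in> ball 0 (sep_radius \<tau>) \<Longrightarrow> z \<noteq> 0 \<Longrightarrow> g1 (d + z) = A1 d / z\<^sup>2 + B1 d / z + e1 d z"
    and e2: "\<And>d. d \<in> Dpts \<tau> \<Longrightarrow> e2 d holomorphic_on ball 0 (sep_radius \<tau>)"
      "\<And>d z. d \<in> Dpts \<tau> \<Longrightarrow> z \<in> ball 0 (sep_radius \<tau>) \<Longrightarrow> z \<noteq> 0 \<Longrightarrow> g2 (d + z) = A2 d / z\<^sup>2 + B2 d / z + e2 d z"
  shows "intersection_ch \<tau> (times_du w) (coh_class \<tau> (times_du w) (times_du g1)) (coh_class \<tau> (neg_form (times_du w)) (times_du g2))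
    = 2 * of_real pi * \<i> * (\<Sum>d\<in>Dpts \<tau>. res_coeff (cf d) (v d 0) (deriv (v d) 0) (A1 d) (B1 d) (e1 d 0) (A2 d) (B2 d) (e2 d 0))"
proof -
  define a where "a d = A1 d / (cf d - 1)" for d
  define b where "b d = (B1 d - a d * v d 0) / cf d" for d
  define k where "k d = (e1 d 0 - a d * deriv (v d) 0 - b d * v d 0) / (cf d + 1)" for d
  define Rs where "Rs d = a d * e2 d 0 + b d * B2 d + k d * A2 d" for d
  have ex: "\<exists>F G. \<forall>z. z \<in> ball 0 (sep_radius \<tau>) \<longrightarrow> z \<noteq> 0 \<longrightarrow>
      (F has_field_derivative g1 (d + z) - F z * w (d + z)) (at z) \<and>
      (G has_field_derivative F z * g2 (d + z) - Rs d / z) (at z)" if d: "d \<in> Dpts \<tau>" for d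
  proof -
    obtain y where y: "y holomorphic_on ball 0 (sep_radius \<tau>)"
      "\<And>z. z \<in> ball 0 (sep_radius \<tau>) \<Longrightarrow> z \<noteq> 0 \<Longrightarrow>
      ((\<lambda>z. a d / z + b d + k d * z + z\<^sup>2 * y z) has_field_derivative
        A1 d / z\<^sup>2 + B1 d / z + e1 d z - (a d / z + b d + k d * z + z\<^sup>2 * y z) * (cf d / z + v d z)) (at z)"
      by (rule local_solution[OF cf[OF d] sep_radius_pos[OF \<tau>] v(1)[OF d] e1(1)[OF d], of "A1 d" "B1 d",
            folded a_def, folded b_def, folded k_def]) (rule that)
    obtain G where G: "\<And>z. z \<in> ball 0 (sep_radius \<tau>) \<Longrightarrow> z \<noteq> 0 \<Longrightarrow> (G has_field_derivative
      (a d / z + b d + k d * z + z\<^sup>2 * y z) * (A2 d / z\<^sup>2 + B2 d / z + e2 d z) - Rs d / z) (at z)"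
      by (rule local_residue_primitive[OF sep_radius_pos[OF \<tau>] y(1) e2(1)[OF d], of "a d" "b d" "k d" "A2 d" "B2 d",
            folded Rs_def]) (rule that)
    show ?thesis
    proof (rule exI[of _ "\<lambda>z. a d / z + b d + k d * z + z\<^sup>2 * y z"], rule exI[of _ G], intro allI impI)
      fix z :: complex assume z: "z \<in> ball 0 (sep_radius \<tau>)" "z \<noteq> 0"
      show "((\<lambda>z. a d / z + b d + k d * z + z\<^sup>2 * y z) has_field_derivative
            g1 (d + z) - (a d / z + b d + k d * z + z\<^sup>2 * y z) * w (d + z)) (at z) \<and>
          (G has_field_derivative (a d / z + b d + k d * z + z\<^sup>2 * y z) * g2 (d + z) - Rs d / z) (at z)"
        unfolding v(2)[OF d z] e1(2)[OF d z] e2(2)[OF d z] using y(2)[OF z] G[OF z] by blast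
    qed
  qed
  then obtain F G where FG: "\<And>d z. d \<in> Dpts \<tau> \<Longrightarrow> z \<in> ball 0 (sep_radius \<tau>) \<Longrightarrow> z \<noteq> 0 \<Longrightarrow>
      (F d has_field_derivative g1 (d + z) - F d z * w (d + z)) (at z)"
     "\<And>d z. d \<in> Dpts \<tau> \<Longrightarrow> z \<in> ball 0 (sep_radius \<tau>) \<Longrightarrow> z \<noteq> 0 \<Longrightarrow>
      (G d has_field_derivative F d z * g2 (d + z) - Rs d / z) (at z)"
    by metis
  have loc: "local_data \<tau> w cf g1 g2 F G Rs"
    by unfold_locales (use g FG in auto)
  show ?thesis
    unfolding local_data.intersection_ch_eq[OF loc] by (simp add: Rs_def res_coeff_def a_def b_def k_def)
qed

section \<open>The connection form and the cocycles\<close>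

lemma periodic_on_MI:
  fixes f :: "complex \<Rightarrow> complex"
  assumes "\<And>u. u \<in> M\<^sub>C \<tau> \<Longrightarrow> f (u + 1) = f u" "\<And>u. u \<in> M\<^sub>C \<tau> \<Longrightarrow> f (u + \<tau>) = f u"
  shows "periodic_on_M \<tau> f"
proof -
  define f' where "f' u = (if u \<in> M\<^sub>C \<tau> then f u else 0)" for u
  have M: "u + l \<in> M\<^sub>C \<tau> \<longleftrightarrow> u \<in> M\<^sub>C \<tau>" if "l \<in> lattice \<tau>" for u l
    using half_lattice_add[OF that] by (simp add: M_iff)
  have "f' (u + 1) = f' u" "f' (u + \<tau>) = f' u" for u
    using M[of 1 u] M[of \<tau> u] one_tau_lattice[of \<tau>] assms[of u] by (auto simp: f'_def)
  then have "f' (u + l) = f' u" if "l \<in> lattice \<tau>" for u l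
    using periodic_imp_lattice_periodic[of f' \<tau> l u] that by blast
  then show ?thesis unfolding periodic_on_M_def using M by (metis f'_def)
qed

lemma log_derivative_simple_zero:
  assumes f: "f holomorphic_on UNIV" and r: "r > 0" and d: "f d = 0" "deriv f d \<noteq> 0"
    and nz: "\<And>z. z \<in> ball 0 r \<Longrightarrow> z \<noteq> 0 \<Longrightarrow> f (d + z) \<noteq> 0"
  obtains v where "v holomorphic_on ball 0 r"
    "\<And>z. z \<in> ball 0 r \<Longrightarrow> z \<noteq> 0 \<Longrightarrow> deriv f (d + z) / f (d + z) = 1 / z + v z"
proof -
  define m where "m z = dquot f d (d + z)" for z
  have hq: "dquot f d holomorphic_on UNIV" using f by (intro dquot_holomorphic) auto
  have "(\<lambda>z. d + z) holomorphic_on UNIV" by (intro holomorphic_intros)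
  from holomorphic_on_compose[OF this] have hm: "m holomorphic_on UNIV"
    unfolding m_def[abs_def] using hq by (metis comp_def holomorphic_cong holomorphic_on_subset subset_UNIV)
  have fm: "f (d + z) = z * m z" for z using dquot_mult[of f "d + z" d] d by (simp add: m_def)
  have m0: "m z \<noteq> 0" if "z \<in> ball 0 r" for z
  proof (cases "z = 0")
    case True then show ?thesis using d by (simp add: m_def)
  next
    case False then show ?thesis using nz[OF that False] fm[of z] by auto
  qed
  have df: "deriv f (d + z) = m z + z * deriv m z" for z
  proof -
    have "((\<lambda>z. f (d + z)) has_field_derivative deriv f (d + z)) (at z)"
      using holo_UNIV_deriv(1)[OF f, of "z + d"] DERIV_shift[of f _ z d] by (simp add: add.commute)
    moreover have "((\<lambda>z. z * m z) has_field_derivative m z + z * deriv m z) (at z)"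
      using holo_UNIV_deriv(1)[OF hm, of z] by (auto intro!: derivative_eq_intros)
    ultimately show ?thesis unfolding fm by (rule DERIV_unique)
  qed
  show thesis
  proof (rule that[of "\<lambda>z. deriv m z / m z"])
    show "(\<lambda>z. deriv m z / m z) holomorphic_on ball 0 r"
      using m0 holomorphic_on_subset[OF holo_UNIV_deriv(2)[OF hm]] holomorphic_on_subset[OF hm]
      by (intro holomorphic_intros) auto
    fix z :: complex assume z: "z \<in> ball 0 r" "z \<noteq> 0"
    show "deriv f (d + z) / f (d + z) = 1 / z + deriv m z / m z"
      unfolding fm df using m0[OF z(1)] z by (simp add: field_simps)
  qed
qed

context theta_tau
begin

abbreviation "Rd \<equiv> sep_radius \<tau>"
definition log_der :: "(complex \<Rightarrow> complex) \<Rightarrow> complex \<Rightarrow> complex" where "log_der f u = deriv f u / f u"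

lemma theta_nonzero_M:
  assumes "u \<in> M\<^sub>C \<tau>"
  shows "T1 u \<noteq> 0" "T2 u \<noteq> 0" "T3 u \<noteq> 0" "T4 u \<noteq> 0"
proof -
  have *: "u - d \<notin> lattice \<tau>" if "d \<in> Dpts \<tau>" for d
  proof
    assume "u - d \<in> lattice \<tau>"
    then have "d + (u - d) \<in> half_lattice \<tau>" using half_lattice_add Dpts_half[OF that] by blast
    then show False using assms by (simp add: M_iff)
  qed
  show "T1 u \<noteq> 0" "T2 u \<noteq> 0" "T3 u \<noteq> 0" "T4 u \<noteq> 0"
    using *[of 0] *[of "1/2"] *[of "(1 + \<tau>)/2"] *[of "\<tau>/2"] theta_zeros[OF \<tau>, of u] theta3_zeros(1)[OF \<tau>, of u]
    by (auto simp: Dpts_def)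
qed

lemma theta_nonzero_near:
  assumes "z \<in> ball 0 Rd" "z \<noteq> 0" "d \<in> Dpts \<tau>"
  shows "T1 (d + z) \<noteq> 0" "T2 (d + z) \<noteq> 0" "T3 (d + z) \<noteq> 0" "T4 (d + z) \<noteq> 0"
  using theta_nonzero_M[OF M_near_half[OF \<tau> Dpts_half[OF assms(3)] assms(1,2)]] by blast+

lemma theta_at_Dpts:
  "T1 0 = 0" "T2 (1/2) = 0" "T3 ((1 + \<tau>)/2) = 0" "T4 (\<tau>/2) = 0"
  "d \<in> Dpts \<tau> \<Longrightarrow> d \<noteq> 0 \<Longrightarrow> T1 d \<noteq> 0"
  "d \<in> Dpts \<tau> \<Longrightarrow> d \<noteq> 1/2 \<Longrightarrow> T2 d \<noteq> 0"
  "d \<in> Dpts \<tau> \<Longrightarrow> d \<noteq> (1 + \<tau>)/2 \<Longrightarrow> T3 d \<noteq> 0"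
  "d \<in> Dpts \<tau> \<Longrightarrow> d \<noteq> \<tau>/2 \<Longrightarrow> T4 d \<noteq> 0"
proof -
  have D: "0 \<in> Dpts \<tau>" "1/2 \<in> Dpts \<tau>" "(1 + \<tau>)/2 \<in> Dpts \<tau>" "\<tau>/2 \<in> Dpts \<tau>" by (auto simp: Dpts_def)
  note zs = theta_zeros[OF \<tau>] theta3_zeros(1)[OF \<tau>]
  show "T1 0 = 0" "T2 (1/2) = 0" "T3 ((1 + \<tau>)/2) = 0" "T4 (\<tau>/2) = 0"
    unfolding zs using one_tau_lattice(3)[of \<tau>] by simp_all
  show "d \<in> Dpts \<tau> \<Longrightarrow> d \<noteq> 0 \<Longrightarrow> T1 d \<noteq> 0" "d \<in> Dpts \<tau> \<Longrightarrow> d \<noteq> 1/2 \<Longrightarrow> T2 d \<noteq> 0"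
    "d \<in> Dpts \<tau> \<Longrightarrow> d \<noteq> (1 + \<tau>)/2 \<Longrightarrow> T3 d \<noteq> 0" "d \<in> Dpts \<tau> \<Longrightarrow> d \<noteq> \<tau>/2 \<Longrightarrow> T4 d \<noteq> 0"
    unfolding zs using Dpts_inequivalent[OF \<tau> _ D(1), of d] Dpts_inequivalent[OF \<tau> _ D(2), of d]
      Dpts_inequivalent[OF \<tau> _ D(3), of d] Dpts_inequivalent[OF \<tau> _ D(4), of d] by auto
qed

lemma theta_simple_zeros: "deriv T2 (1/2) \<noteq> 0" "deriv T4 (\<tau>/2) \<noteq> 0"
proof -
  have sh: "((\<lambda>u. h (u + a)) has_field_derivative deriv h (u + a)) (at u)" if "h holomorphic_on UNIV" for h a u
    using holo_UNIV_deriv(1)[OF that] DERIV_shift by blast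
  have "((\<lambda>u. T2 (u + 1/2)) has_field_derivative - deriv T1 0) (at 0)"
    unfolding theta2_plus_half by (rule DERIV_minus[OF holo_UNIV_deriv(1)[OF hol(1)]])
  with sh[OF hol(2), of "1/2" 0] have "deriv T2 (0 + 1/2) = - deriv T1 0" by (rule DERIV_unique)
  then show "deriv T2 (1/2) \<noteq> 0" using T1_deriv_nz by simp
  have "((\<lambda>u. T4 (u + \<tau>/2)) has_field_derivative \<i> * half_tau_mult \<tau> 0 * deriv T1 0) (at 0)"
    unfolding theta4_plus_htau using half_tau_mult_deriv[of 0] holo_UNIV_deriv(1)[OF hol(1), of 0] T1_0
    by (auto intro!: derivative_eq_intros)
  with sh[OF hol(4), of "\<tau>/2" 0] have "deriv T4 (0 + \<tau>/2) = \<i> * half_tau_mult \<tau> 0 * deriv T1 0" by (rule DERIV_unique)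
  then show "deriv T4 (\<tau>/2) \<noteq> 0" using T1_deriv_nz by simp
qed

lemma log_der_regular:
  assumes f: "f holomorphic_on UNIV" and nz: "\<And>z. z \<in> ball 0 Rd \<Longrightarrow> f (d + z) \<noteq> 0"
  shows "(\<lambda>z. log_der f (d + z)) holomorphic_on ball 0 Rd"
proof -
  have c: "(\<lambda>z. h (d + z)) holomorphic_on S" if "h holomorphic_on UNIV" for h S
  proof -
    have "(\<lambda>z. d + z) holomorphic_on S" by (intro holomorphic_intros)
    from holomorphic_on_compose[OF this, of h] show ?thesis using holomorphic_on_subset[OF that] by (simp add: o_def)
  qed
  show ?thesis unfolding log_der_def by (intro holomorphic_intros c f holo_UNIV_deriv(2)[OF f] nz)
qed

lemma log_der_local:
  assumes f: "f holomorphic_on UNIV" and near: "\<And>z. z \<in> ball 0 Rd \<Longrightarrow> z \<noteq> 0 \<Longrightarrow> f (d + z) \<noteq> 0"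
    and P: "P \<Longrightarrow> f d = 0 \<and> deriv f d \<noteq> 0" "\<not> P \<Longrightarrow> f d \<noteq> 0"
  shows "\<exists>v. v holomorphic_on ball 0 Rd \<and> (\<forall>z. z \<in> ball 0 Rd \<longrightarrow> z \<noteq> 0 \<longrightarrow> log_der f (d + z) = of_bool P / z + v z)"
proof (cases P)
  case True
  from log_derivative_simple_zero[OF f sep_radius_pos[OF \<tau>] _ _ near] P(1)[OF True]
  obtain v where "v holomorphic_on ball 0 Rd"
    "\<And>z. z \<in> ball 0 Rd \<Longrightarrow> z \<noteq> 0 \<Longrightarrow> deriv f (d + z) / f (d + z) = 1 / z + v z" by metis
  then show ?thesis using True by (auto simp: log_der_def of_bool_def)
next
  case False
  have "f (d + z) \<noteq> 0" if "z \<in> ball 0 Rd" for z using near[OF that] P(2)[OF False] by (cases "z = 0") auto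
  from log_der_regular[OF f this] show ?thesis using False by (intro exI[of _ "\<lambda>z. log_der f (d + z)"]) (auto simp: of_bool_def)
qed

end

locale theta_exponents = theta_tau +
  fixes \<alpha> \<beta> \<gamma> c1 c2 c3 c4 :: complex
  assumes c_def: "c1 = 2*\<alpha>" "c2 = 2*\<gamma> - 2*\<alpha>" "c3 = - 2*\<beta>" "c4 = 2*\<beta> - 2*\<gamma>"
    and c_nonint: "c1 \<notin> \<int>" "c2 \<notin> \<int>" "c3 \<notin> \<int>" "c4 \<notin> \<int>"
begin

definition omega_coeff :: "complex \<Rightarrow> complex" where
  "omega_coeff u = c1 * log_der T1 u + c2 * log_der T2 u + c3 * log_der T3 u + c4 * log_der T4 u"

lemma omega_eq: "omega \<tau> \<alpha> \<beta> \<gamma> = times_du omega_coeff"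
  unfolding omega_def omega_coeff_def[abs_def] log_der_def by (simp only: c_def)

definition exponent_at :: "complex \<Rightarrow> complex" where
  "exponent_at d = (if d = 0 then c1 else if d = 1/2 then c2 else if d = (1 + \<tau>)/2 then c3 else c4)"

lemma Dpts_distinct: "1/2 \<noteq> (1 + \<tau>)/2" "\<tau>/2 \<noteq> 0" "\<tau>/2 \<noteq> 1/2" "\<tau>/2 \<noteq> (1 + \<tau>)/2" "(1 + \<tau>)/2 \<noteq> 0"
  using \<tau> by (auto simp: complex_eq_iff add_divide_distrib)

lemma omega_coeff_holomorphic: "omega_coeff holomorphic_on M\<^sub>C \<tau>"
  unfolding omega_coeff_def[abs_def] log_der_def
  by (intro holomorphic_intros hol theta_nonzero_M holomorphic_on_subset[OF holo_UNIV_deriv(2)] subset_UNIV)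

lemma log_der_shift:
  assumes f: "f holomorphic_on UNIV" and E: "\<And>u. (E has_field_derivative b * E u) (at u)" "\<And>u. E u \<noteq> 0"
    and fE: "\<And>u. f (u + l) = E u * f u" and nz: "f u \<noteq> 0"
  shows "log_der f (u + l) = b + log_der f u"
proof -
  have "((\<lambda>u. f (u + l)) has_field_derivative deriv f (u + l)) (at u)"
    using holo_UNIV_deriv(1)[OF f] DERIV_shift by blast
  moreover have "((\<lambda>u. E u * f u) has_field_derivative b * E u * f u + deriv f u * E u) (at u)"
    using DERIV_mult[OF E(1)[of u] holo_UNIV_deriv(1)[OF f, of u]] by simp
  ultimately have "deriv f (u + l) = b * E u * f u + deriv f u * E u" unfolding fE by (rule DERIV_unique)
  then show ?thesis unfolding log_der_def fE using nz E(2)[of u] by (simp add: field_simps)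
qed

lemma omega_coeff_periodic: "periodic_on_M \<tau> omega_coeff"
proof (rule periodic_on_MI)
  fix u assume u: "u \<in> M\<^sub>C \<tau>"
  note n = theta_nonzero_M[OF u]
  have c0: "((\<lambda>_. c) has_field_derivative 0 * c) (at x)" for c x :: complex by simp
  have "log_der T1 (u + 1) = 0 + log_der T1 u" "log_der T2 (u + 1) = 0 + log_der T2 u"
    by (rule log_der_shift[of _ "\<lambda>_. -1"]; use hol n theta_plus_1 c0[of "-1"] in simp)+
  moreover have "log_der T3 (u + 1) = 0 + log_der T3 u" "log_der T4 (u + 1) = 0 + log_der T4 u"
    by (rule log_der_shift[of _ "\<lambda>_. 1"]; use hol n theta_plus_1 c0[of "1"] in simp)+
  ultimately show "omega_coeff (u + 1) = omega_coeff u" by (simp add: omega_coeff_def)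
  let ?b = "- 2 * of_real pi * \<i>"
  have km: "((\<lambda>u. - tau_mult \<tau> u) has_field_derivative ?b * (- tau_mult \<tau> u)) (at u)" for u
    using DERIV_minus[OF tau_mult_deriv[of u]] by simp
  have "log_der T1 (u + \<tau>) = ?b + log_der T1 u" "log_der T4 (u + \<tau>) = ?b + log_der T4 u"
    by (rule log_der_shift[of _ "\<lambda>u. - tau_mult \<tau> u", OF _ km]; use hol n theta_plus_tau in simp)+
  moreover have "log_der T2 (u + \<tau>) = ?b + log_der T2 u" "log_der T3 (u + \<tau>) = ?b + log_der T3 u"
    by (rule log_der_shift[of _ "tau_mult \<tau>", OF _ tau_mult_deriv]; use hol n theta_plus_tau in simp)+
  ultimately have "omega_coeff (u + \<tau>) = (c1 + c2 + c3 + c4) * ?b + omega_coeff u" by (simp only: omega_coeff_def) (simp add: algebra_simps)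
  moreover have "c1 + c2 + c3 + c4 = 0" by (simp add: c_def)
  ultimately show "omega_coeff (u + \<tau>) = omega_coeff u" by simp
qed

lemma omega_coeff_local:
  assumes d: "d \<in> Dpts \<tau>"
  shows "\<exists>v. v holomorphic_on ball 0 Rd \<and> (\<forall>z. z \<in> ball 0 Rd \<longrightarrow> z \<noteq> 0 \<longrightarrow> omega_coeff (d + z) = exponent_at d / z + v z)"
proof -
  note n = theta_nonzero_near[OF _ _ d]
  obtain v1 where v1: "v1 holomorphic_on ball 0 Rd" "\<And>z. z \<in> ball 0 Rd \<Longrightarrow> z \<noteq> 0 \<Longrightarrow> log_der T1 (d + z) = of_bool (d = 0) / z + v1 z"
    using log_der_local[OF hol(1) n(1), of "d = 0"] theta_at_Dpts d T1_deriv_nz by blast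
  obtain v2 where v2: "v2 holomorphic_on ball 0 Rd" "\<And>z. z \<in> ball 0 Rd \<Longrightarrow> z \<noteq> 0 \<Longrightarrow> log_der T2 (d + z) = of_bool (d = 1/2) / z + v2 z"
    using log_der_local[OF hol(2) n(2), of "d = 1/2"] theta_at_Dpts d theta_simple_zeros by blast
  obtain v3 where v3: "v3 holomorphic_on ball 0 Rd" "\<And>z. z \<in> ball 0 Rd \<Longrightarrow> z \<noteq> 0 \<Longrightarrow> log_der T3 (d + z) = of_bool (d = (1 + \<tau>)/2) / z + v3 z"
    using log_der_local[OF hol(3) n(3), of "d = (1 + \<tau>)/2"] theta_at_Dpts d theta3_zeros(2)[OF \<tau>] by blast
  obtain v4 where v4: "v4 holomorphic_on ball 0 Rd" "\<And>z. z \<in> ball 0 Rd \<Longrightarrow> z \<noteq> 0 \<Longrightarrow> log_der T4 (d + z) = of_bool (d = \<tau>/2) / z + v4 z"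
    using log_der_local[OF hol(4) n(4), of "d = \<tau>/2"] theta_at_Dpts d theta_simple_zeros by blast
  have cf: "exponent_at d = c1 * of_bool (d = 0) + c2 * of_bool (d = 1/2) + c3 * of_bool (d = (1 + \<tau>)/2) + c4 * of_bool (d = \<tau>/2)"
  proof -
    have "\<forall>d\<in>Dpts \<tau>. exponent_at d = c1 * of_bool (d = 0) + c2 * of_bool (d = 1/2) + c3 * of_bool (d = (1 + \<tau>)/2) + c4 * of_bool (d = \<tau>/2)"
      unfolding Dpts_def using Dpts_distinct Dpts_distinct[symmetric] by (simp add: exponent_at_def of_bool_def)
    with d show ?thesis by blast
  qed
  show ?thesis
  proof (intro exI[of _ "\<lambda>z. c1 * v1 z + c2 * v2 z + c3 * v3 z + c4 * v4 z"] conjI allI impI)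
    show "(\<lambda>z. c1 * v1 z + c2 * v2 z + c3 * v3 z + c4 * v4 z) holomorphic_on ball 0 Rd"
      by (intro holomorphic_intros v1 v2 v3 v4)
    fix z :: complex assume z: "z \<in> ball 0 Rd" "z \<noteq> 0"
    show "omega_coeff (d + z) = exponent_at d / z + (c1 * v1 z + c2 * v2 z + c3 * v3 z + c4 * v4 z)"
      unfolding omega_coeff_def cf v1(2)[OF z] v2(2)[OF z] v3(2)[OF z] v4(2)[OF z]
      by (simp only: add_divide_distrib distrib_left times_divide_eq_right) (simp only: ac_simps)
  qed
qed

sublocale torus_connection \<tau> omega_coeff exponent_at
proof unfold_locales
  show "omega_coeff holomorphic_on M\<^sub>C \<tau>" "periodic_on_M \<tau> omega_coeff" by (rule omega_coeff_holomorphic, rule omega_coeff_periodic)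
  show "exponent_at d \<notin> \<int>" if "d \<in> Dpts \<tau>" for d using c_nonint by (simp add: exponent_at_def)
qed (rule omega_coeff_local)

text \<open>
  The regular part of the coefficient of \<open>\<omega>\<close> at \<open>0\<close>. It is given explicitly because its slope at \<open>0\<close> enters the intersection numbers; at the
  other points the double-pole coefficients of the cocycles vanish, and with them the dependence on the regular part.
\<close>

definition omega_reg0 :: "complex \<Rightarrow> complex" where
  "omega_reg0 z = c1 * (deriv theta1_over_u z / theta1_over_u z) + c2 * log_der T2 z + c3 * log_der T3 z + c4 * log_der T4 z"

lemma theta1_over_u_nonzero: "z \<in> ball 0 Rd \<Longrightarrow> theta1_over_u z \<noteq> 0"
  using theta_nonzero_near(1)[of z 0] theta1_over_u(2)[of z] theta1_over_u(3) T1_deriv_nz by (cases "z = 0") (auto simp: Dpts_def)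

lemma log_der_theta1: "z \<noteq> 0 \<Longrightarrow> theta1_over_u z \<noteq> 0 \<Longrightarrow> log_der T1 z = 1 / z + deriv theta1_over_u z / theta1_over_u z"
proof -
  have T: "T1 = (\<lambda>u. u * theta1_over_u u)" using theta1_over_u(2) by blast
  have "deriv T1 z = theta1_over_u z + z * deriv theta1_over_u z"
    unfolding T using deriv2_mult(1)[OF holomorphic_on_ident theta1_over_u(1)] by simp
  then show "z \<noteq> 0 \<Longrightarrow> theta1_over_u z \<noteq> 0 \<Longrightarrow> log_der T1 z = 1 / z + deriv theta1_over_u z / theta1_over_u z"
    using theta1_over_u(2)[of z] by (simp add: log_der_def field_simps)
qed

lemma T_near_0:
  assumes "z \<in> ball 0 Rd"
  shows "T2 z \<noteq> 0" "T3 z \<noteq> 0" "T4 z \<noteq> 0"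
  using theta_nonzero_near[OF assms, of 0] nz by (cases "z = 0"; auto simp: Dpts_def)+

lemma deriv_quotient:
  fixes f :: "complex \<Rightarrow> complex"
  assumes f: "f holomorphic_on UNIV" and "f z \<noteq> 0"
  shows "((\<lambda>z. deriv f z / f z) has_field_derivative deriv (deriv f) z / f z - (deriv f z / f z)\<^sup>2) (at z)"
  using holo_UNIV_deriv(1)[OF f, of z] holo_UNIV_deriv(1)[OF holo_UNIV_deriv(2)[OF f], of z] assms(2)
  by (auto intro!: derivative_eq_intros simp: field_simps power2_eq_square)

definition third_ratio where "third_ratio = deriv (deriv (deriv T1)) 0 / deriv T1 0"

lemma omega_reg0:
  "omega_reg0 holomorphic_on ball 0 Rd" "z \<in> ball 0 Rd \<Longrightarrow> z \<noteq> 0 \<Longrightarrow> omega_coeff z = c1 / z + omega_reg0 z" "omega_reg0 0 = 0"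
  "deriv omega_reg0 0 = c1 * third_ratio / 3 + c2 * second_ratio T2 + c3 * second_ratio T3 + c4 * second_ratio T4"
proof -
  show "omega_reg0 holomorphic_on ball 0 Rd"
    unfolding omega_reg0_def[abs_def] log_der_def
    by (intro holomorphic_intros hol T_near_0 theta1_over_u_nonzero holomorphic_on_subset[OF holo_UNIV_deriv(2)] subset_UNIV
        holomorphic_on_subset[OF theta1_over_u(1)] theta1_over_u(1))
  show "z \<in> ball 0 Rd \<Longrightarrow> z \<noteq> 0 \<Longrightarrow> omega_coeff z = c1 / z + omega_reg0 z"
    using log_der_theta1[OF _ theta1_over_u_nonzero] by (simp add: omega_coeff_def omega_reg0_def distrib_left)
  show "omega_reg0 0 = 0" by (simp add: omega_reg0_def log_der_def theta1_over_u_deriv_0 deriv_even_0)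
  have m0: "theta1_over_u 0 \<noteq> 0" using theta1_over_u(3) T1_deriv_nz by simp
  have q: "((\<lambda>z. c * (deriv f z / f z)) has_field_derivative c * (deriv (deriv f) 0 / f 0)) (at 0)"
    if "f holomorphic_on UNIV" "f 0 \<noteq> 0" "deriv f 0 = 0" for f c
    using DERIV_cmult[OF deriv_quotient[OF that(1,2)], of c] that(3) by simp
  have "(omega_reg0 has_field_derivative c1 * (deriv (deriv theta1_over_u) 0 / theta1_over_u 0) + c2 * second_ratio T2 + c3 * second_ratio T3 + c4 * second_ratio T4) (at 0)"
    unfolding omega_reg0_def[abs_def] log_der_def second_ratio_def
    by (intro DERIV_add q hol theta1_over_u theta1_over_u_deriv_0 deriv_even_0 nz m0)
  then have "deriv omega_reg0 0 = c1 * (deriv (deriv theta1_over_u) 0 / theta1_over_u 0) + c2 * second_ratio T2 + c3 * second_ratio T3 + c4 * second_ratio T4"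
    by (rule DERIV_imp_deriv)
  moreover have "deriv (deriv theta1_over_u) 0 / theta1_over_u 0 = third_ratio / 3" by (simp add: third_ratio_def theta1_deriv3 theta1_over_u(3))
  ultimately show "deriv omega_reg0 0 = c1 * third_ratio / 3 + c2 * second_ratio T2 + c3 * second_ratio T3 + c4 * second_ratio T4" by simp
qed

definition phi_coeff :: "4 \<Rightarrow> complex \<Rightarrow> complex" where
  "phi_coeff j u = (if j = 1 then of_real pi * T3 0 ^ 2
     else if j = 2 then of_real pi * T2 0 ^ 2 * (T4 u ^ 2 / T1 u ^ 2)
     else if j = 3 then of_real pi * T2 0 ^ 2 * (T3 u * T4 u / (T1 u * T2 u))
     else of_real pi * T3 0 ^ 2 * (T2 u * T4 u / (T1 u * T3 u)))"

lemma phi_eq: "phi \<tau> j = times_du (phi_coeff j)"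
  unfolding phi_def phi_coeff_def[abs_def] ..

lemma phi_coeff_holomorphic: "phi_coeff j holomorphic_on M\<^sub>C \<tau>"
proof -
  have "(\<lambda>u. of_real pi * T3 0 ^ 2) holomorphic_on M\<^sub>C \<tau>" "(\<lambda>u. of_real pi * T2 0 ^ 2 * (T4 u ^ 2 / T1 u ^ 2)) holomorphic_on M\<^sub>C \<tau>"
    "(\<lambda>u. of_real pi * T2 0 ^ 2 * (T3 u * T4 u / (T1 u * T2 u))) holomorphic_on M\<^sub>C \<tau>"
    "(\<lambda>u. of_real pi * T3 0 ^ 2 * (T2 u * T4 u / (T1 u * T3 u))) holomorphic_on M\<^sub>C \<tau>"
    by (intro holomorphic_intros hol; simp add: theta_nonzero_M)+
  then show ?thesis unfolding phi_coeff_def[abs_def] by (cases "j = 1"; cases "j = 2"; cases "j = 3"; simp)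
qed

lemma phi_coeff_periodic: "phi_coeff j (u + 1) = phi_coeff j u" "phi_coeff j (u + \<tau>) = phi_coeff j u"
  unfolding phi_coeff_def theta_plus_1 theta_plus_tau by (auto simp: power_mult_distrib)

lemma phi_coeff_mero: "phi_coeff j \<in> mero_functions \<tau>"
proof -
  have T: "f meromorphic_on UNIV" if "f holomorphic_on UNIV" for f :: "complex \<Rightarrow> complex"
    using that by (intro analytic_on_imp_meromorphic_on) (simp add: analytic_on_open)
  note m = T[OF hol(1)] T[OF hol(2)] T[OF hol(3)] T[OF hol(4)]
  have "(\<lambda>u. of_real pi * T3 0 ^ 2) meromorphic_on UNIV" "(\<lambda>u. of_real pi * T2 0 ^ 2 * (T4 u ^ 2 / T1 u ^ 2)) meromorphic_on UNIV"
    "(\<lambda>u. of_real pi * T2 0 ^ 2 * (T3 u * T4 u / (T1 u * T2 u))) meromorphic_on UNIV"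
    "(\<lambda>u. of_real pi * T3 0 ^ 2 * (T2 u * T4 u / (T1 u * T3 u))) meromorphic_on UNIV"
    by (intro meromorphic_intros m)+
  then have "phi_coeff j meromorphic_on UNIV" unfolding phi_coeff_def[abs_def] by (cases "j = 1"; cases "j = 2"; cases "j = 3"; simp)
  then show ?thesis using phi_coeff_holomorphic periodic_on_MI[of \<tau> "phi_coeff j"] phi_coeff_periodic by (simp add: mero_functions_def)
qed

lemma wp_coeff_eq: "wp_coeff = of_real pi ^ 2 * (T2 0)\<^sup>2 * (T3 0)\<^sup>2"
  using nz by (simp add: wp_coeff_def Jacobi_derivative power_mult_distrib)

text \<open>
  The coefficient of \<open>z\<^sup>-\<^sup>2\<close> in the second cocycle.
\<close>

definition phi2_lead :: complex where "phi2_lead = 1 / (of_real pi * (T3 0)\<^sup>2)"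

text \<open>
  These translations by half periods determine the expansions of the third and fourth cocycles at their second poles from those
  at \<open>0\<close>.
\<close>

lemma phi_coeff_half_period: "phi_coeff 3 (1/2 + u) = - phi_coeff 3 u" "phi_coeff 4 ((1 + \<tau>)/2 + u) = - phi_coeff 4 u"
proof -
  have "phi_coeff 3 (u + 1/2) = - phi_coeff 3 u"
    unfolding phi_coeff_def theta_plus_half by (simp add: mult_ac)
  then show "phi_coeff 3 (1/2 + u) = - phi_coeff 3 u" by (simp add: add.commute)
  have "phi_coeff 4 ((u + \<tau>/2) + 1/2) = - phi_coeff 4 u"
    unfolding phi_coeff_def theta_plus_half theta_plus_htau by (simp add: mult_ac)
  moreover have "(u + \<tau>/2) + 1/2 = (1 + \<tau>)/2 + u" by (simp add: field_simps)
  ultimately show "phi_coeff 4 ((1 + \<tau>)/2 + u) = - phi_coeff 4 u" by simp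
qed

definition Q3 where "Q3 z = of_real pi * T2 0 ^ 2 * (T3 z * T4 z / (theta1_over_u z * T2 z))"
definition Q4 where "Q4 z = of_real pi * T3 0 ^ 2 * (T2 z * T4 z / (theta1_over_u z * T3 z))"

text \<open>
  The value \<open>1\<close> at \<open>0\<close> is Jacobi's formula; evenness makes the first derivative vanish, so the third and fourth cocycles have
  no constant term at \<open>0\<close>.
\<close>

lemma phi34_quotients:
  "Q3 holomorphic_on ball 0 Rd" "Q4 holomorphic_on ball 0 Rd" "Q3 0 = 1" "Q4 0 = 1"
  "deriv Q3 0 = 0" "deriv Q4 0 = 0" "z \<noteq> 0 \<Longrightarrow> phi_coeff 3 z = Q3 z / z" "z \<noteq> 0 \<Longrightarrow> phi_coeff 4 z = Q4 z / z"
proof -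
  have m: "theta1_over_u holomorphic_on S" for S using theta1_over_u(1) holomorphic_on_subset by blast
  show h: "Q3 holomorphic_on ball 0 Rd" "Q4 holomorphic_on ball 0 Rd"
    unfolding Q3_def[abs_def] Q4_def[abs_def] by (intro holomorphic_intros hol m; simp add: T_near_0 theta1_over_u_nonzero)+
  show "Q3 0 = 1" "Q4 0 = 1"
    using nz by (simp_all add: Q3_def Q4_def theta1_over_u(3) Jacobi_derivative power2_eq_square)
  have z: "deriv Q 0 = 0" if hQ: "Q holomorphic_on ball 0 Rd" and e: "\<And>z. Q (- z) = Q z" for Q
  proof -
    have d: "(Q has_field_derivative deriv Q 0) (at 0)"
      using holomorphic_derivI[OF hQ open_ball, of 0] sep_radius_pos[OF \<tau>] by simp
    have "((\<lambda>u. Q (- u)) has_field_derivative deriv Q 0 * (- 1)) (at 0)"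
      by (rule DERIV_chain2[where g = uminus]) (use d in \<open>auto intro!: derivative_eq_intros\<close>)
    then have "(Q has_field_derivative deriv Q 0 * (- 1)) (at 0)" unfolding e .
    from DERIV_unique[OF d this] show ?thesis by simp
  qed
  show "deriv Q3 0 = 0" by (rule z[OF h(1)]) (simp add: Q3_def theta_minus theta3_minus theta1_over_u(4))
  show "deriv Q4 0 = 0" by (rule z[OF h(2)]) (simp add: Q4_def theta_minus theta3_minus theta1_over_u(4))
  show "z \<noteq> 0 \<Longrightarrow> phi_coeff 3 z = Q3 z / z" "z \<noteq> 0 \<Longrightarrow> phi_coeff 4 z = Q4 z / z"
    by (simp_all add: phi_coeff_def Q3_def Q4_def theta1_over_u(2)[of z] mult_ac)
qed

definition Q2 where "Q2 z = phi2_lead * (second_ratio T4 - (deriv (deriv theta1_over_u) z / theta1_over_u z - (deriv theta1_over_u z / theta1_over_u z)\<^sup>2))"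

text \<open>
  This is \<open>hirota_theta1\<close> divided by \<open>\<vartheta>\<^sub>1\<^sup>2\<close> and written in terms of \<open>\<vartheta>\<^sub>1(z)/z\<close>.
\<close>

lemma Q2:
  "Q2 holomorphic_on ball 0 Rd" "Q2 0 = phi2_lead * (second_ratio T4 - third_ratio / 3)"
  "z \<in> ball 0 Rd \<Longrightarrow> z \<noteq> 0 \<Longrightarrow> phi_coeff 2 z = phi2_lead / z\<^sup>2 + Q2 z"
proof -
  note dm = holo_UNIV_deriv(2)[OF theta1_over_u(1)]
  have m: "theta1_over_u holomorphic_on S" "deriv theta1_over_u holomorphic_on S" "deriv (deriv theta1_over_u) holomorphic_on S" for S
    using theta1_over_u(1) dm holo_UNIV_deriv(2)[OF dm] holomorphic_on_subset by blast+
  show "Q2 holomorphic_on ball 0 Rd"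
    unfolding Q2_def[abs_def] by (intro holomorphic_intros m; simp add: theta1_over_u_nonzero)
  show "Q2 0 = phi2_lead * (second_ratio T4 - third_ratio / 3)"
    by (simp add: Q2_def theta1_over_u_deriv_0 third_ratio_def theta1_deriv3 theta1_over_u(3))
  assume z: "z \<in> ball 0 Rd" "z \<noteq> 0"
  have m0: "theta1_over_u z \<noteq> 0" by (rule theta1_over_u_nonzero[OF z(1)])
  have T: "T1 = (\<lambda>u. u * theta1_over_u u)" using theta1_over_u(2) by blast
  have d1: "deriv T1 z = theta1_over_u z + z * deriv theta1_over_u z" and d2: "deriv (deriv T1) z = 2 * deriv theta1_over_u z + z * deriv (deriv theta1_over_u) z"
    unfolding T using deriv2_mult[OF holomorphic_on_ident theta1_over_u(1), of z] by simp_all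
  have "wp_coeff * (T4 z)\<^sup>2 = hirota T1 z + second_ratio T4 * (T1 z)\<^sup>2" using hirota_theta1[of z] by simp
  then have "wp_coeff * (T4 z)\<^sup>2 / (T1 z)\<^sup>2 = hirota T1 z / (T1 z)\<^sup>2 + second_ratio T4" using m0 z by (simp add: theta1_over_u(2)[of z] field_simps)
  also have "hirota T1 z / (T1 z)\<^sup>2 = 1 / z\<^sup>2 - (deriv (deriv theta1_over_u) z / theta1_over_u z - (deriv theta1_over_u z / theta1_over_u z)\<^sup>2)"
    unfolding hirota_def d1 d2 theta1_over_u(2)[of z] using m0 z by (simp add: field_simps power2_eq_square)
  finally have e: "wp_coeff * (T4 z)\<^sup>2 / (T1 z)\<^sup>2 = 1 / z\<^sup>2 - (deriv (deriv theta1_over_u) z / theta1_over_u z - (deriv theta1_over_u z / theta1_over_u z)\<^sup>2) + second_ratio T4" .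
  have "phi2_lead * (wp_coeff * (T4 z)\<^sup>2 / (T1 z)\<^sup>2) = phi2_lead / z\<^sup>2 + Q2 z" unfolding e Q2_def by (simp add: algebra_simps)
  moreover have "phi2_lead * (wp_coeff * (T4 z)\<^sup>2 / (T1 z)\<^sup>2) = phi_coeff 2 z"
    unfolding wp_coeff_eq phi2_lead_def phi_coeff_def using nz by (simp add: power2_eq_square)
  ultimately show "phi_coeff 2 z = phi2_lead / z\<^sup>2 + Q2 z" by simp
qed

text \<open>
  At \<open>d\<close> in \<open>D\<close> the \<open>j\<close>-th cocycle has the coefficient \<open>polar2 j d / z\<^sup>2 + polar1 j d / z + reg_part j d z\<close>.
\<close>

definition polar2 :: "4 \<Rightarrow> complex \<Rightarrow> complex" where
  "polar2 j d = (if j = 2 \<and> d = 0 then phi2_lead else 0)"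
definition polar1 :: "4 \<Rightarrow> complex \<Rightarrow> complex" where
  "polar1 j d = (if j = 3 then (if d = 0 then 1 else if d = 1/2 then - 1 else 0)
    else if j = 4 then (if d = 0 then 1 else if d = (1 + \<tau>)/2 then - 1 else 0) else 0)"
definition reg_part :: "4 \<Rightarrow> complex \<Rightarrow> complex \<Rightarrow> complex" where
  "reg_part j d z = (if d = 0 \<and> j = 2 then Q2 z
    else if d = 0 \<and> j = 3 then dquot Q3 0 z else if d = 1/2 \<and> j = 3 then - dquot Q3 0 z
    else if d = 0 \<and> j = 4 then dquot Q4 0 z else if d = (1 + \<tau>)/2 \<and> j = 4 then - dquot Q4 0 z
    else phi_coeff j (d + z))"

lemma dquot_Q: "dquot Q3 0 holomorphic_on ball 0 Rd" "dquot Q4 0 holomorphic_on ball 0 Rd"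
  "z \<noteq> 0 \<Longrightarrow> phi_coeff 3 z = 1 / z + dquot Q3 0 z" "z \<noteq> 0 \<Longrightarrow> phi_coeff 4 z = 1 / z + dquot Q4 0 z"
proof -
  show "dquot Q3 0 holomorphic_on ball 0 Rd" "dquot Q4 0 holomorphic_on ball 0 Rd"
    using phi34_quotients(1,2) sep_radius_pos[OF \<tau>] by (auto intro!: dquot_holomorphic)
  show "z \<noteq> 0 \<Longrightarrow> phi_coeff 3 z = 1 / z + dquot Q3 0 z" "z \<noteq> 0 \<Longrightarrow> phi_coeff 4 z = 1 / z + dquot Q4 0 z"
    using phi34_quotients(7,8) dquot_mult[of Q3 z 0] dquot_mult[of Q4 z 0] phi34_quotients(3,4) by (simp_all add: field_simps)
qed

lemma reg_part_holomorphic: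
  assumes d: "d \<in> Dpts \<tau>"
  shows "reg_part j d holomorphic_on ball 0 Rd"
proof -
  have c: "(\<lambda>z. h (d + z)) holomorphic_on S" if "h holomorphic_on UNIV" for h S
  proof -
    have "(\<lambda>z. d + z) holomorphic_on S" by (intro holomorphic_intros)
    from holomorphic_on_compose[OF this, of h] show ?thesis using holomorphic_on_subset[OF that] by (simp add: o_def)
  qed
  have n: "T1 (d + z) \<noteq> 0" if "d \<noteq> 0" "z \<in> ball 0 Rd" for z
    using theta_nonzero_near(1)[OF that(2) _ d] theta_at_Dpts(5)[OF d that(1)] by (cases "z = 0") auto
  have n2: "T2 (d + z) \<noteq> 0" if "d \<noteq> 1/2" "z \<in> ball 0 Rd" for z
    using theta_nonzero_near(2)[OF that(2) _ d] theta_at_Dpts(6)[OF d that(1)] by (cases "z = 0") auto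
  have n3: "T3 (d + z) \<noteq> 0" if "d \<noteq> (1 + \<tau>)/2" "z \<in> ball 0 Rd" for z
    using theta_nonzero_near(3)[OF that(2) _ d] theta_at_Dpts(7)[OF d that(1)] by (cases "z = 0") auto
  have p2: "(\<lambda>z. phi_coeff 2 (d + z)) holomorphic_on ball 0 Rd" if "d \<noteq> 0"
    unfolding phi_coeff_def using n[OF that] by (simp, intro holomorphic_intros c hol) auto
  have p3: "(\<lambda>z. phi_coeff 3 (d + z)) holomorphic_on ball 0 Rd" if "d \<noteq> 0" "d \<noteq> 1/2"
    unfolding phi_coeff_def using n[OF that(1)] n2[OF that(2)] by (simp, intro holomorphic_intros c hol) auto
  have p4: "(\<lambda>z. phi_coeff 4 (d + z)) holomorphic_on ball 0 Rd" if "d \<noteq> 0" "d \<noteq> (1 + \<tau>)/2"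
    unfolding phi_coeff_def using n[OF that(1)] n3[OF that(2)] by (simp, intro holomorphic_intros c hol) auto
  have p1: "(\<lambda>z. phi_coeff 1 (d + z)) holomorphic_on ball 0 Rd" unfolding phi_coeff_def by simp
  have m: "(\<lambda>z. - dquot Q3 0 z) holomorphic_on ball 0 Rd" "(\<lambda>z. - dquot Q4 0 z) holomorphic_on ball 0 Rd"
    by (intro holomorphic_intros dquot_Q)+
  have q: "(\<lambda>z. dquot Q3 0 z) holomorphic_on ball 0 Rd" "(\<lambda>z. dquot Q4 0 z) holomorphic_on ball 0 Rd" "(\<lambda>z. Q2 z) holomorphic_on ball 0 Rd"
    using dquot_Q Q2(1) by simp_all
  consider "d = 0" "j = 2" | "d = 0" "j = 3" | "d = 1/2" "j = 3" | "d = 0" "j = 4" | "d = (1 + \<tau>)/2" "j = 4"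
    | "j = 1" | "j = 2" "d \<noteq> 0" | "j = 3" "d \<noteq> 0" "d \<noteq> 1/2" | "j = 4" "d \<noteq> 0" "d \<noteq> (1 + \<tau>)/2"
    using exhaust_4[of j] by blast
  then show ?thesis
  proof cases
    case 1 then have "reg_part j d = Q2" by (simp add: reg_part_def fun_eq_iff)
    then show ?thesis using q by simp
  next
    case 2 then have "reg_part j d = dquot Q3 0" by (simp add: reg_part_def fun_eq_iff)
    then show ?thesis using q by simp
  next
    case 3
    then have "d \<noteq> 0" by auto
    with 3 have "reg_part j d = (\<lambda>z. - dquot Q3 0 z)" by (simp add: reg_part_def fun_eq_iff)
    then show ?thesis using m by simp
  next
    case 4 then have "reg_part j d = dquot Q4 0" by (simp add: reg_part_def fun_eq_iff)
    then show ?thesis using q by simp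
  next
    case 5
    then have "d \<noteq> 0" using Dpts_distinct by auto
    with 5 have "reg_part j d = (\<lambda>z. - dquot Q4 0 z)" using Dpts_distinct by (simp add: reg_part_def fun_eq_iff)
    then show ?thesis using m by simp
  next
    case 6 then have "reg_part j d = (\<lambda>z. phi_coeff 1 (d + z))" by (simp add: reg_part_def fun_eq_iff)
    then show ?thesis using p1 by simp
  next
    case 7 then have "reg_part j d = (\<lambda>z. phi_coeff 2 (d + z))" by (simp add: reg_part_def fun_eq_iff)
    then show ?thesis using p2 7 by simp
  next
    case 8 then have "reg_part j d = (\<lambda>z. phi_coeff 3 (d + z))" by (simp add: reg_part_def fun_eq_iff)
    then show ?thesis using p3 8 by simp
  next
    case 9 then have "reg_part j d = (\<lambda>z. phi_coeff 4 (d + z))" by (simp add: reg_part_def fun_eq_iff)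
    then show ?thesis using p4 9 by simp
  qed
qed

lemma phi_expansion:
  assumes d: "d \<in> Dpts \<tau>" and z: "z \<in> ball 0 Rd" "z \<noteq> 0"
  shows "phi_coeff j (d + z) = polar2 j d / z\<^sup>2 + polar1 j d / z + reg_part j d z"
proof -
  have h: "phi_coeff 3 (1/2 + z) = - (1 / z) - dquot Q3 0 z" "phi_coeff 4 ((1 + \<tau>)/2 + z) = - (1 / z) - dquot Q4 0 z"
    unfolding phi_coeff_half_period dquot_Q(3)[OF z(2)] dquot_Q(4)[OF z(2)] by simp_all
  consider "j = 1" | "j = 2" | "j = 3" | "j = 4" using exhaust_4[of j] by blast
  then show ?thesis
  proof cases
    case 3
    show ?thesis
    proof (cases "d = 0"; cases "d = 1/2")
      assume "d \<noteq> 0" "d = 1/2"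
      then show ?thesis unfolding 3 \<open>d = 1/2\<close> h by (simp add: polar2_def polar1_def reg_part_def)
    qed (simp_all add: 3 polar2_def polar1_def reg_part_def dquot_Q(3)[OF z(2)])
  next
    case 4
    show ?thesis
    proof (cases "d = 0"; cases "d = (1 + \<tau>)/2")
      assume "d \<noteq> 0" "d = (1 + \<tau>)/2"
      then show ?thesis unfolding 4 \<open>d = (1 + \<tau>)/2\<close> h using Dpts_distinct by (simp add: polar2_def polar1_def reg_part_def)
    qed (use Dpts_distinct in \<open>simp_all add: 4 polar2_def polar1_def reg_part_def dquot_Q(4)[OF z(2)]\<close>)
  qed (auto simp: polar2_def polar1_def reg_part_def Q2(3)[OF z])
qed

definition omega_reg where "omega_reg d = (if d = 0 then omega_reg0 else (SOME v. v holomorphic_on ball 0 Rd \<and> (\<forall>z. z \<in> ball 0 Rd \<longrightarrow> z \<noteq> 0 \<longrightarrow> omega_coeff (d + z) = exponent_at d / z + v z)))"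

lemma omega_reg:
  assumes "d \<in> Dpts \<tau>"
  shows "omega_reg d holomorphic_on ball 0 Rd" "z \<in> ball 0 Rd \<Longrightarrow> z \<noteq> 0 \<Longrightarrow> omega_coeff (d + z) = exponent_at d / z + omega_reg d z"
proof -
  have "omega_reg d holomorphic_on ball 0 Rd \<and> (\<forall>z. z \<in> ball 0 Rd \<longrightarrow> z \<noteq> 0 \<longrightarrow> omega_coeff (d + z) = exponent_at d / z + omega_reg d z)"
  proof (cases "d = 0")
    case True
    then show ?thesis using omega_reg0(1,2) by (simp add: omega_reg_def exponent_at_def)
  next
    case False
    then have e: "omega_reg d = (SOME v. v holomorphic_on ball 0 Rd \<and> (\<forall>z. z \<in> ball 0 Rd \<longrightarrow> z \<noteq> 0 \<longrightarrow> omega_coeff (d + z) = exponent_at d / z + v z))"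
      by (simp only: omega_reg_def if_False)
    show ?thesis unfolding e by (rule someI_ex[OF omega_coeff_local[OF assms]])
  qed
  then show "omega_reg d holomorphic_on ball 0 Rd" "z \<in> ball 0 Rd \<Longrightarrow> z \<noteq> 0 \<Longrightarrow> omega_coeff (d + z) = exponent_at d / z + omega_reg d z" by blast+
qed

definition reg0_slope where "reg0_slope = c1 * third_ratio / 3 + c2 * second_ratio T2 + c3 * second_ratio T3 + c4 * second_ratio T4"

text \<open>
  Only \<open>0\<close> contributes through double poles; at the other points \<open>res_coeff\<close> reduces to the product of the residues divided by the
  exponent, and at \<open>\<tau>/2\<close> no cocycle has a pole.
\<close>

lemma intersection_number:
  "intersection_ch \<tau> (omega \<tau> \<alpha> \<beta> \<gamma>) (coh_class \<tau> (omega \<tau> \<alpha> \<beta> \<gamma>) (phi \<tau> i)) (coh_class \<tau> (neg_form (omega \<tau> \<alpha> \<beta> \<gamma>)) (phi \<tau> j))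
   = 2 * of_real pi * \<i> * (polar2 i 0 / (c1 - 1) * reg_part j 0 0 + polar1 i 0 * polar1 j 0 / c1 + (reg_part i 0 0 - polar2 i 0 / (c1 - 1) * reg0_slope) / (c1 + 1) * polar2 j 0
      + polar1 i (1/2) * polar1 j (1/2) / c2 + polar1 i ((1 + \<tau>)/2) * polar1 j ((1 + \<tau>)/2) / c3)"
proof -
  have r0: "res_coeff (exponent_at 0) (omega_reg 0 0) (deriv (omega_reg 0) 0) (polar2 i 0) (polar1 i 0) (reg_part i 0 0) (polar2 j 0) (polar1 j 0) (reg_part j 0 0)
    = polar2 i 0 / (c1 - 1) * reg_part j 0 0 + polar1 i 0 * polar1 j 0 / c1 + (reg_part i 0 0 - polar2 i 0 / (c1 - 1) * reg0_slope) / (c1 + 1) * polar2 j 0"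
    by (simp add: res_coeff_def omega_reg_def omega_reg0(3,4) reg0_slope_def exponent_at_def)
  have rd: "res_coeff (exponent_at d) v v' (polar2 i d) (polar1 i d) e (polar2 j d) (polar1 j d) e' = polar1 i d * polar1 j d / exponent_at d" if "d \<noteq> 0" for d v v' e e'
    using that by (simp add: res_coeff_def polar2_def)
  have b4: "polar1 i (\<tau>/2) = 0" for i using Dpts_distinct by (simp add: polar1_def)
  have s: "(\<Sum>d\<in>Dpts \<tau>. f d) = f 0 + f (1/2) + f ((1 + \<tau>)/2) + f (\<tau>/2)" for f :: "complex \<Rightarrow> complex"
    unfolding Dpts_def using Dpts_distinct Dpts_distinct[symmetric] by simp
  have c: "exponent_at (1/2) = c2" "exponent_at ((1 + \<tau>)/2) = c3" using Dpts_distinct Dpts_distinct[symmetric] by (simp_all add: exponent_at_def)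
  have h0: "(1/2 :: complex) \<noteq> 0" by simp
  have "intersection_ch \<tau> (times_du omega_coeff) (coh_class \<tau> (times_du omega_coeff) (times_du (phi_coeff i))) (coh_class \<tau> (neg_form (times_du omega_coeff)) (times_du (phi_coeff j)))
    = 2 * of_real pi * \<i> * (\<Sum>d\<in>Dpts \<tau>. res_coeff (exponent_at d) (omega_reg d 0) (deriv (omega_reg d) 0) (polar2 i d) (polar1 i d) (reg_part i d 0) (polar2 j d) (polar1 j d) (reg_part j d 0))"
    by (rule intersection_formula[OF phi_coeff_mero phi_coeff_mero omega_reg reg_part_holomorphic phi_expansion reg_part_holomorphic phi_expansion])
  then show ?thesis
    unfolding omega_eq phi_eq s r0 rd[OF h0] rd[OF Dpts_distinct(5)] rd[OF Dpts_distinct(2)]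
    unfolding c b4 by simp
qed

lemma reg_part_at_0: "reg_part 1 0 0 = of_real pi * (T3 0)\<^sup>2" "reg_part 2 0 0 = phi2_lead * (second_ratio T4 - third_ratio/3)" "reg_part 3 0 0 = 0" "reg_part 4 0 0 = 0"
  by (simp_all add: reg_part_def phi_coeff_def Q2(2) phi34_quotients(5,6))

lemma c1_nz: "c1 \<noteq> 0" "c1 - 1 \<noteq> 0" "c1 + 1 \<noteq> 0" "c2 \<noteq> 0" "c3 \<noteq> 0"
proof -
  have "c1 \<noteq> of_int m" for m using c_nonint by auto
  from this[of 0] this[of 1] this[of "-1"] show "c1 \<noteq> 0" "c1 - 1 \<noteq> 0" "c1 + 1 \<noteq> 0" by (auto simp: add_eq_0_iff2)
  show "c2 \<noteq> 0" "c3 \<noteq> 0" using c_nonint by auto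
qed

end

lemma vec4_component [simp]:
  fixes a b c d :: "'a::zero"
  shows "(vector [a, b, c, d] :: 'a ^ 4) $ 1 = a" "(vector [a, b, c, d] :: 'a ^ 4) $ 2 = b"
    "(vector [a, b, c, d] :: 'a ^ 4) $ 3 = c" "(vector [a, b, c, d] :: 'a ^ 4) $ 4 = d"
  unfolding vector_def by simp_all

theorem theorem3p1:
  fixes \<tau> \<alpha> \<beta> \<gamma> c1 c2 c3 c4 C22 :: complex
  assumes "Im \<tau> > 0"
    and "c1 = 2*\<alpha>" and "c2 = 2*\<gamma> - 2*\<alpha>" and "c3 = - 2*\<beta>" and "c4 = 2*\<beta> - 2*\<gamma>"
    and "c1 \<notin> \<int>" and "c2 \<notin> \<int>" and "c3 \<notin> \<int>" and "c4 \<notin> \<int>"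
    and "C22 = 1 / ((of_real pi)\<^sup>2 * theta3 \<tau> 0 ^ 4 * (c1 - 1) * (c1 + 1)) *
           (- c1 * ((deriv ^^ 3) (theta1 \<tau>) 0 / deriv (theta1 \<tau>) 0)
            - c2 * ((deriv ^^ 2) (theta2 \<tau>) 0 / theta2 \<tau> 0)
            - c3 * ((deriv ^^ 2) (theta3 \<tau>) 0 / theta3 \<tau> 0)
            + (2*c1 - c4) * ((deriv ^^ 2) (theta4 \<tau>) 0 / theta4 \<tau> 0))"
  shows "intersection_matrix \<tau> \<alpha> \<beta> \<gamma> =
           (\<chi> i j. 2 * of_real pi * \<i> *
              (vector [vector [0, 1 / (c1 + 1), 0, 0],
                       vector [1 / (c1 - 1), C22, 0, 0],
                       vector [0, 0, (c1 + c2) / (c1 * c2), 1 / c1],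
                       vector [0, 0, 1 / c1, (c1 + c3) / (c1 * c3)]] :: complex ^ 4 ^ 4) $ i $ j)
         \<and> (\<forall>a b c. \<alpha> = a + 1/2 \<and> \<beta> = b - 1/2 \<and> \<gamma> = c \<longrightarrow>
              C22 = ((a - b + 1) * modular_lambda \<tau> + c) / (2 * a * (a + 1)))"
proof -
  interpret theta_exponents \<tau> \<alpha> \<beta> \<gamma> c1 c2 c3 c4
    using assms(1-9) by unfold_locales
  have t3: "T3 0 \<noteq> 0" by (rule nz)
  define L where "L = - c1 * third_ratio - c2 * second_ratio T2 - c3 * second_ratio T3 + (2 * c1 - c4) * second_ratio T4"
  have C22: "C22 = L / ((of_real pi)\<^sup>2 * T3 0 ^ 4 * (c1 - 1) * (c1 + 1))"
    using assms(10) by (simp add: L_def third_ratio_def second_ratio_def numeral_2_eq_2 numeral_3_eq_3)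
  have kp2: "phi2_lead * phi2_lead = 1 / ((of_real pi)\<^sup>2 * T3 0 ^ 4)"
    by (simp add: phi2_lead_def power2_eq_square power4_eq_xxxx)
  have e22: "phi2_lead / (c1 - 1) * (phi2_lead * (second_ratio T4 - third_ratio/3)) + (phi2_lead * (second_ratio T4 - third_ratio/3) - phi2_lead / (c1 - 1) * reg0_slope) / (c1 + 1) * phi2_lead = C22"
  proof -
    define k x y where "k = second_ratio T4 - third_ratio/3" and "x = c1 - 1" and "y = c1 + 1"
    have xy: "x \<noteq> 0" "y \<noteq> 0" using c1_nz by (simp_all add: x_def y_def)
    have Lk: "L = k * x + k * y - reg0_slope" by (simp add: L_def reg0_slope_def k_def x_def y_def field_simps)
    have "phi2_lead / x * (phi2_lead * k) + (phi2_lead * k - phi2_lead / x * reg0_slope) / y * phi2_lead = phi2_lead * phi2_lead * (k * x + k * y - reg0_slope) / (x * y)"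
      using xy by (simp add: field_simps)
    also have "\<dots> = C22" unfolding C22 Lk kp2 x_def y_def by simp
    finally show ?thesis unfolding k_def x_def y_def .
  qed
  have kpi: "phi2_lead * (of_real pi * (T3 0)\<^sup>2) = 1" "of_real pi * (T3 0)\<^sup>2 * phi2_lead = 1" using t3 by (simp_all add: phi2_lead_def)
  have sums: "1 / c1 + 1 / c2 = (c1 + c2) / (c1 * c2)" "1 / c1 + 1 / c3 = (c1 + c3) / (c1 * c3)"
    using c1_nz by (simp_all add: field_simps)
  have "intersection_matrix \<tau> \<alpha> \<beta> \<gamma> =
           (\<chi> i j. 2 * of_real pi * \<i> *
              (vector [vector [0, 1 / (c1 + 1), 0, 0],
                       vector [1 / (c1 - 1), C22, 0, 0],
                       vector [0, 0, (c1 + c2) / (c1 * c2), 1 / c1],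
                       vector [0, 0, 1 / c1, (c1 + c3) / (c1 * c3)]] :: complex ^ 4 ^ 4) $ i $ j)"
    unfolding vec_eq_iff forall_4 intersection_matrix_def Let_def
    using e22 kpi sums t3 Dpts_distinct Dpts_distinct[symmetric]
    by (simp add: intersection_number reg_part_at_0 polar2_def polar1_def)
  moreover have "C22 = ((a - b + 1) * modular_lambda \<tau> + c) / (2 * a * (a + 1))"
    if abc: "\<alpha> = a + 1/2" "\<beta> = b - 1/2" "\<gamma> = c" for a b c
  proof -
    have c: "c1 = 2 * a + 1" "c2 = 2 * c - 2 * a - 1" "c3 = 1 - 2 * b" "c4 = 2 * b - 1 - 2 * c"
      using assms(2-5) abc by (simp_all add: algebra_simps)
    have s: "third_ratio = second_ratio T2 + second_ratio T3 + second_ratio T4" unfolding third_ratio_def by (rule third_ratio_sum)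
    have d2: "second_ratio T2 = second_ratio T4 - of_real pi ^ 2 * T3 0 ^ 4" and d3: "second_ratio T3 = second_ratio T4 - of_real pi ^ 2 * T2 0 ^ 4"
      using second_ratio_differences nz unfolding wp_coeff_eq by (simp_all add: field_simps power2_eq_square power4_eq_xxxx)
    have L: "L = 2 * of_real pi ^ 2 * (c * T3 0 ^ 4 + (a - b + 1) * T2 0 ^ 4)"
      unfolding L_def s c d2 d3 by (simp add: algebra_simps)
    have p: "c1 - 1 = 2 * a" "c1 + 1 = 2 * (a + 1)" unfolding c by simp_all
    have nza: "a \<noteq> 0" "a + 1 \<noteq> 0" using c1_nz(2,3) unfolding p by (auto simp only: mult_eq_0_iff de_Morgan_disj)
    define X where "X = c * T3 0 ^ 4 + (a - b + 1) * T2 0 ^ 4"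
    have "C22 = X / (T3 0 ^ 4 * (2 * a * (a + 1)))"
      unfolding C22 L p X_def[symmetric] by simp
    also have "X / (T3 0 ^ 4 * (2 * a * (a + 1))) = X / T3 0 ^ 4 / (2 * a * (a + 1))" by simp
    also have "X / T3 0 ^ 4 = (a - b + 1) * modular_lambda \<tau> + c"
      unfolding X_def modular_lambda_def using t3 by (simp add: field_simps)
    finally show ?thesis .
  qed
  ultimately show ?thesis by blast
qed

end
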